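(* Let $s>1/2$, let $\lambda\in\mathbb{R}$, and let $\varphi$ and $\gamma$ be smooth (complex-valued) functions on the one-dimensional torus $\mathbb{T}$, independent of $c$. Then there exist constants $T,c_0,C,h_0,\tau_0>0$ such that the following holds: for all $c>c_0$, $\tau<\tau_0$ and $h<h_0$, if $$z_0^{n,h}:=\tfrac12u_0^{n,h}e^{ic^2t_n}+\tfrac12\overline{v_0^{n,h}}e^{-ic^2t_n},\qquad t_n=n\tau,$$ where $(u_0^{n,h},v_0^{n,h})$ is the numerical approximation at time $t_n$ of the solution of the limit system $$i\partial_tu_0-\tfrac12\Delta u_0-\tfrac\lambda8(|u_0|^2+2|v_0|^2)u_0=0,\quad u_0(0)=\varphi-i\gamma,$$ $$i\partial_tv_0-\tfrac12\Delta v_0-\tfrac\lambda8(|v_0|^2+2|u_0|^2)v_0=0,\quad v_0(0)=\overline{\varphi+i\gamma},$$ obtained by the Strang splitting with Fourier pseudo-spectral discretization with mesh size $h$ described in the context, and if $z(t)$ is the exact solution of $$\frac1{c^2}\partial_{tt}z-\Delta z+c^2z=\lambda|z|^2z,\qquad z(0)=\varphi,\quad\partial_tz(0)=c^2\gamma$$ on $\mathbb{T}$, then $$\|z(t_n)-z_0^{n,h}\|_{L^2}\le C(\tau^2+h^s+c^{-2})\qquad\text{for all }t_n\le T.$$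
   Context: $\mathbb{T}=\mathbb{R}/2\pi\mathbb{Z}$ and $\Delta=\partial_{xx}$. Space discretization: $h=1/K$ with $K\in\mathbb{N}$, $K\ge1$, grid points $x_j=jh\pi$, $j=-K,\dots,K-1$. Grid functions are identified with trigonometric polynomials in $X_K=\mathrm{span}\{e^{iax}:-K\le a\le K-1\}$, and $I_h g\in X_K$ denotes the trigonometric interpolant of $g$ at the grid points $x_j$ (acting componentwise on pairs). Fully discrete Strang splitting with time step $\tau>0$: $(u_0^{0,h},v_0^{0,h})=I_h(u_0(0),v_0(0))$ and $$(u_0^{n+1,h},v_0^{n+1,h})=\Phi_P^{\tau/2}\circ\Phi_T^{\tau}\circ\Phi_P^{\tau/2}(u_0^{n,h},v_0^{n,h}).$$ Here $\Phi_T^t$ is the exact flow of the kinetic part $i\partial_tu=\frac12\Delta u$, $i\partial_tv=\frac12\Delta v$ (i.e. multiplication of the $a$-th Fourier coefficients by $e^{ita^2/2}$), and $\Phi_P^t$ is the exact flow, at the grid points, of the potential part $i\partial_tu=\frac\lambda8(|u|^2+2|v|^2)u$, $i\partial_tv=\frac\lambda8(|v|^2+2|u|^2)v$; since $|u|,|v|$ are conserved by the latter, $$\Phi_P^t(u,v)=I_h\big(e^{-it\frac\lambda8(|u|^2+2|v|^2)}u,\;e^{-it\frac\lambda8(|v|^2+2|u|^2)}v\big).$$ *)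

theory Defs
  imports "HOL-Analysis.Analysis"
begin

text \<open>Functions on the torus \<open>\<real>/2\<pi>\<int>\<close> are represented by \<open>2\<pi>\<close>-periodic functions on \<open>\<real>\<close>.\<close>

definition torus_periodic :: "(real \<Rightarrow> complex) \<Rightarrow> bool" where
  "torus_periodic f \<longleftrightarrow> (\<forall>x. f (x + 2 * pi) = f x)"

definition torus_smooth :: "(real \<Rightarrow> complex) \<Rightarrow> bool" where
  "torus_smooth f \<longleftrightarrow> torus_periodic f \<and>
     (\<forall>k. ((\<lambda>g x. vector_derivative g (at x)) ^^ k) f differentiable_on UNIV)"

definition torus_L2_norm :: "(real \<Rightarrow> complex) \<Rightarrow> real" where
  "torus_L2_norm f = sqrt (integral {-pi..pi} (\<lambda>x. (cmod (f x))\<^sup>2))"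

definition fourier_coeff :: "(real \<Rightarrow> complex) \<Rightarrow> int \<Rightarrow> complex" where
  "fourier_coeff f a =
     integral {-pi..pi} (\<lambda>x. f x * exp (- \<i> * of_int a * of_real x)) / of_real (2 * pi)"

text \<open>
  Classical solutions on \<open>[0,T]\<close> of
  \<open>c\<^sup>-\<^sup>2 z\<^sub>t\<^sub>t - z\<^sub>x\<^sub>x + c\<^sup>2 z = \<lambda> |z|\<^sup>2 z\<close>, \<open>z(0) = \<phi>\<close>, \<open>z\<^sub>t(0) = c\<^sup>2 \<gamma>\<close>;
  time derivatives are one-sided at \<open>t = 0\<close> and \<open>t = T\<close>. The unknown is curried, \<open>z t x\<close>, and
  its values at times outside \<open>[0,T]\<close> are irrelevant.
\<close>

definition klein_gordon_solution ::
  "real \<Rightarrow> real \<Rightarrow> (real \<Rightarrow> complex) \<Rightarrow> (real \<Rightarrow> complex) \<Rightarrow> real \<Rightarrow> (real \<Rightarrow> real \<Rightarrow> complex) \<Rightarrow> bool"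
where
  "klein_gordon_solution lam c \<phi> \<gamma> T z \<longleftrightarrow>
     (\<forall>t\<in>{0..T}. torus_periodic (z t)) \<and>
     (\<exists>zt ztt zx zxx.
        (\<forall>w\<in>{z, zt, ztt, zx, zxx}. continuous_on ({0..T} \<times> UNIV) (\<lambda>(t, x). w t x)) \<and>
        (\<forall>t\<in>{0..T}. \<forall>x.
           ((\<lambda>r. z r x) has_vector_derivative zt t x) (at t within {0..T}) \<and>
           ((\<lambda>r. zt r x) has_vector_derivative ztt t x) (at t within {0..T}) \<and>
           (z t has_vector_derivative zx t x) (at x) \<and>
           (zx t has_vector_derivative zxx t x) (at x) \<and>
           of_real (1 / c\<^sup>2) * ztt t x - zxx t x + of_real (c\<^sup>2) * z t x
             = of_real (lam * (cmod (z t x))\<^sup>2) * z t x) \<and>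
        (\<forall>x. z 0 x = \<phi> x \<and> zt 0 x = of_real (c\<^sup>2) * \<gamma> x))"

text \<open>The discretization is indexed by \<open>K \<ge> 1\<close>, with mesh size \<open>h = 1/K\<close>.\<close>

definition grid_point :: "nat \<Rightarrow> int \<Rightarrow> real" where
  "grid_point K j = of_int j * (1 / real K) * pi"

definition trig_space :: "nat \<Rightarrow> (real \<Rightarrow> complex) set" where
  "trig_space K =
     range (\<lambda>(coef :: int \<Rightarrow> complex) x.
       \<Sum>a\<in>{- int K..int K - 1}. coef a * exp (\<i> * of_int a * of_real x))"

definition trig_interp :: "nat \<Rightarrow> (real \<Rightarrow> complex) \<Rightarrow> real \<Rightarrow> complex" where
  "trig_interp K g =
     (THE p. p \<in> trig_space K \<and> (\<forall>j\<in>{- int K..int K - 1}. p (grid_point K j) = g (grid_point K j)))"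

text \<open>
  The flow of \<open>i p\<^sub>t = p\<^sub>x\<^sub>x / 2\<close> on \<open>trig_space K\<close>, whose members have no Fourier modes other than
  those summed here.
\<close>

definition kinetic_mult :: "nat \<Rightarrow> real \<Rightarrow> (real \<Rightarrow> complex) \<Rightarrow> real \<Rightarrow> complex" where
  "kinetic_mult K t p x =
     (\<Sum>a\<in>{- int K..int K - 1}.
        exp (\<i> * of_real (t * (of_int a)\<^sup>2 / 2)) * fourier_coeff p a * exp (\<i> * of_int a * of_real x))"

type_synonym state = "(real \<Rightarrow> complex) \<times> (real \<Rightarrow> complex)"

definition kinetic_flow :: "nat \<Rightarrow> real \<Rightarrow> state \<Rightarrow> state" where
  "kinetic_flow K t = (\<lambda>(u, v). (kinetic_mult K t u, kinetic_mult K t v))"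

text \<open>
  The flow of \<open>i u\<^sub>t = \<lambda>/8 (|u|\<^sup>2 + 2|v|\<^sup>2) u\<close>, \<open>i v\<^sub>t = \<lambda>/8 (|v|\<^sup>2 + 2|u|\<^sup>2) v\<close> at the grid points;
  \<open>|u|\<close> and \<open>|v|\<close> are conserved there.
\<close>

definition potential_flow :: "nat \<Rightarrow> real \<Rightarrow> real \<Rightarrow> state \<Rightarrow> state" where
  "potential_flow K lam t = (\<lambda>(u, v).
     (trig_interp K (\<lambda>x. exp (- \<i> * of_real (t * (lam / 8) * ((cmod (u x))\<^sup>2 + 2 * (cmod (v x))\<^sup>2))) * u x),
      trig_interp K (\<lambda>x. exp (- \<i> * of_real (t * (lam / 8) * ((cmod (v x))\<^sup>2 + 2 * (cmod (u x))\<^sup>2))) * v x)))"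

definition strang_step :: "nat \<Rightarrow> real \<Rightarrow> real \<Rightarrow> state \<Rightarrow> state" where
  "strang_step K lam \<tau> =
     potential_flow K lam (\<tau> / 2) \<circ> kinetic_flow K \<tau> \<circ> potential_flow K lam (\<tau> / 2)"

text \<open>
  \<open>n\<close> steps of the scheme for the limit system, started from its initial data
  \<open>u\<^sub>0(0) = \<phi> - i\<gamma>\<close>, \<open>v\<^sub>0(0) = cnj (\<phi> + i\<gamma>)\<close>.
\<close>

definition strang_approx ::
  "nat \<Rightarrow> real \<Rightarrow> real \<Rightarrow> (real \<Rightarrow> complex) \<Rightarrow> (real \<Rightarrow> complex) \<Rightarrow> nat \<Rightarrow> state"
where
  "strang_approx K lam \<tau> \<phi> \<gamma> n =
     (strang_step K lam \<tau> ^^ n)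
       (trig_interp K (\<lambda>x. \<phi> x - \<i> * \<gamma> x), trig_interp K (\<lambda>x. cnj (\<phi> x + \<i> * \<gamma> x)))"

definition z0_approx ::
  "nat \<Rightarrow> real \<Rightarrow> real \<Rightarrow> real \<Rightarrow> (real \<Rightarrow> complex) \<Rightarrow> (real \<Rightarrow> complex) \<Rightarrow> nat \<Rightarrow> real \<Rightarrow> complex"
where
  "z0_approx K lam \<tau> c \<phi> \<gamma> n x =
     (let (u, v) = strang_approx K lam \<tau> \<phi> \<gamma> n; t = real n * \<tau>
      in 1 / 2 * u x * exp (\<i> * of_real (c\<^sup>2 * t)) + 1 / 2 * cnj (v x) * exp (- \<i> * of_real (c\<^sup>2 * t)))"

text \<open>The interpolation problem defining \<open>trig_interp\<close> is uniquely solvable.\<close>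

lemma trig_grid_orthogonal:
  assumes K: "K \<ge> 1" and a: "a \<in> {- int K..int K - 1}" and b: "b \<in> {- int K..int K - 1}"
  shows "(\<Sum>j\<in>{- int K..int K - 1}.
            exp (\<i> * of_int a * of_real (grid_point K j)) * exp (- \<i> * of_int b * of_real (grid_point K j)))
         = (if a = b then of_nat (2 * K) else 0)"
proof -
  define w where "w = exp (\<i> * of_int (a - b) * of_real (pi / real K))"
  have summand: "exp (\<i> * of_int a * of_real (grid_point K j)) * exp (- \<i> * of_int b * of_real (grid_point K j))
      = w powi j" for j
  proof -
    have "exp (of_int j * (\<i> * of_int (a - b) * of_real (pi / real K))) = w powi j"
      unfolding w_def by (rule exp_power_int[symmetric])
    then show ?thesis
      by (simp add: exp_add[symmetric] grid_point_def algebra_simps)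
  qed
  have reindex: "(\<Sum>j\<in>{- int K..int K - 1}. w powi j) = w powi (- int K) * (\<Sum>m<2 * K. w ^ m)"
  proof -
    have w0: "w \<noteq> 0" by (simp add: w_def)
    have "(\<Sum>j\<in>{- int K..int K - 1}. w powi j) = (\<Sum>m<2 * K. w powi (int m - int K))"
      by (rule sum.reindex_bij_witness[of _ "\<lambda>m. int m - int K" "\<lambda>j. nat (j + int K)"]) auto
    also have "\<dots> = (\<Sum>m<2 * K. w powi (- int K) * w ^ m)"
      using w0 by (intro sum.cong refl) (simp add: power_int_diff power_int_minus field_simps)
    finally show ?thesis by (simp add: sum_distrib_left)
  qed
  show ?thesis
  proof (cases "a = b")
    case True
    then show ?thesis unfolding summand by (simp add: w_def)
  next
    case False
    have "w ^ (2 * K) = exp (of_nat (2 * K) * (\<i> * of_int (a - b) * of_real (pi / real K)))"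
      unfolding w_def by (rule exp_of_nat_mult[symmetric])
    also have "of_nat (2 * K) * (\<i> * of_int (a - b) * of_real (pi / real K))
        = \<i> * of_int (a - b) * (of_real pi * 2)"
      using K by (simp add: field_simps)
    also have "exp \<dots> = 1" 
      using exp_integer_2pi[of "of_int (a - b)"] by (simp add: algebra_simps)
    finally have w1: "w ^ (2 * K) = 1" .
    have "w \<noteq> 1"
    proof
      assume "w = 1"
      then obtain n :: int where "of_int (a - b) * (pi / real K) = of_int (2 * n) * pi"
        unfolding w_def exp_eq_1 by auto
      then have "pi * real_of_int (a - b) = pi * (of_int (2 * n) * real K)"
        using K by (simp add: field_simps)
      then have "real_of_int (a - b) = of_int (2 * n) * real K"
        using pi_gt_zero mult_left_cancel by (metis less_irrefl)
      then have "a - b = 2 * n * int K"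
        by (metis of_int_eq_iff of_int_mult of_int_of_nat_eq)
      moreover have "\<bar>a - b\<bar> < 2 * int K" using a b by auto
      ultimately have "\<bar>n\<bar> * (2 * int K) < 1 * (2 * int K)" by (simp add: abs_mult)
      then have "\<bar>n\<bar> < 1" by (metis mult_less_cancel_right_pos of_nat_0_less_iff K
            mult_pos_pos zero_less_numeral less_le_trans zero_less_one)
      then show False using \<open>a - b = 2 * n * int K\<close> False by simp
    qed
    then have "(\<Sum>m<2 * K. w ^ m) = 0" using w1 by (simp add: geometric_sum)
    then show ?thesis unfolding summand reindex using False by simp
  qed
qed

lemma trig_interp_ex1:
  assumes K: "K \<ge> 1"
  shows "\<exists>!p. p \<in> trig_space K \<and>
           (\<forall>j\<in>{- int K..int K - 1}. p (grid_point K j) = g (grid_point K j))"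
proof -
  let ?I = "{- int K..int K - 1}"
  let ?e = "\<lambda>(a::int) (j::int). exp (\<i> * of_int a * of_real (grid_point K j)) :: complex"
  let ?e' = "\<lambda>(a::int) (j::int). exp (- \<i> * of_int a * of_real (grid_point K j)) :: complex"
  define P where "P = (\<lambda>(coef :: int \<Rightarrow> complex) x :: real.
       \<Sum>a\<in>?I. coef a * exp (\<i> * of_int a * of_real x))"
  define d where "d = (\<lambda>a. (\<Sum>j\<in>?I. g (grid_point K j) * ?e' a j) / of_nat (2 * K))"
  have sp: "trig_space K = range P" by (simp add: trig_space_def P_def)
  have dual: "(\<Sum>a\<in>?I. ?e a j * ?e' a l) = (if j = l then of_nat (2 * K) else 0)"
    if "j \<in> ?I" "l \<in> ?I" for j l
  proof -
    have "(\<Sum>a\<in>?I. ?e a j * ?e' a l) = (\<Sum>a\<in>?I. ?e j a * ?e' l a)"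
      by (simp add: grid_point_def mult_ac)
    then show ?thesis using trig_grid_orthogonal[OF K that] by simp
  qed
  have interp: "P d (grid_point K j) = g (grid_point K j)" if j: "j \<in> ?I" for j
  proof -
    have "P d (grid_point K j) = (\<Sum>a\<in>?I. \<Sum>l\<in>?I. g (grid_point K l) / of_nat (2 * K) * (?e a j * ?e' a l))"
      unfolding P_def d_def sum_divide_distrib sum_distrib_right
      by (intro sum.cong refl) (simp add: mult_ac)
    also have "\<dots> = (\<Sum>l\<in>?I. g (grid_point K l) / of_nat (2 * K) * (\<Sum>a\<in>?I. ?e a j * ?e' a l))"
      by (subst sum.swap) (simp only: sum_distrib_left)
    also have "\<dots> = (\<Sum>l\<in>?I. if j = l then g (grid_point K l) else 0)"
      using K dual[OF j] by (intro sum.cong refl) (simp del: of_nat_mult)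
    also have "\<dots> = g (grid_point K j)" using j by (subst sum.delta') auto
    finally show ?thesis .
  qed
  have coef: "c b = d b"
    if c: "\<forall>j\<in>?I. P c (grid_point K j) = g (grid_point K j)" and b: "b \<in> ?I" for c b
  proof -
    have "of_nat (2 * K) * d b = (\<Sum>j\<in>?I. P c (grid_point K j) * ?e' b j)"
      using c K by (simp add: d_def)
    also have "\<dots> = (\<Sum>j\<in>?I. \<Sum>a\<in>?I. c a * (?e a j * ?e' b j))"
      unfolding P_def sum_distrib_right by (intro sum.cong refl) (simp add: mult_ac)
    also have "\<dots> = (\<Sum>a\<in>?I. c a * (\<Sum>j\<in>?I. ?e a j * ?e' b j))"
      by (subst sum.swap) (simp only: sum_distrib_left)
    also have "\<dots> = (\<Sum>a\<in>?I. if a = b then of_nat (2 * K) * c a else 0)"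
      using trig_grid_orthogonal[OF K _ b] by (intro sum.cong refl) (simp del: of_nat_mult)
    also have "\<dots> = of_nat (2 * K) * c b" using b by (subst sum.delta) auto
    finally show ?thesis using K by simp
  qed
  show ?thesis
  proof (rule ex1I[of _ "P d"])
    show "P d \<in> trig_space K \<and> (\<forall>j\<in>?I. P d (grid_point K j) = g (grid_point K j))"
      using interp by (auto simp: sp)
  next
    fix p assume p: "p \<in> trig_space K \<and> (\<forall>j\<in>?I. p (grid_point K j) = g (grid_point K j))"
    then obtain c where c: "p = P c" by (auto simp: sp)
    have "c b = d b" if "b \<in> ?I" for b using coef[of c b] p that unfolding c by blast
    then show "p = P d" unfolding c P_def by (auto intro!: ext sum.cong)
  qed
qed

end

theory Submission imports Defs begin

text \<open>
  All estimates are carried out in the Wiener algebra of absolutely convergent Fourier series and its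
  weighted versions; its norm dominates the sup norm, hence the \<open>L\<^sup>2\<close> norm. There the flows of
  \<open>\<partial>\<^sub>x\<^sub>x\<close> are isometries, products cost nothing, and smooth data give solutions of both equations
  on a time interval independent of \<open>c\<close>.

  The ansatz \<open>(e\<^sup>i\<^sup>\<theta> u\<^sub>0 + e\<^sup>-\<^sup>i\<^sup>\<theta> v\<^sub>0\<^sup>*) / 2\<close> with \<open>\<theta> = c\<^sup>2 t\<close> solves the
  Klein--Gordon equation up to \<open>c\<^sup>-\<^sup>2\<close> and third harmonics \<open>e\<^sup>\<plusminus>\<^sup>3\<^sup>i\<^sup>\<theta>\<close>. The latter are
  not resonant, and a corrector of size \<open>c\<^sup>-\<^sup>2\<close> removes them; Gronwall's lemma does the rest.

  For the splitting, interpolation is aliasing of Fourier coefficients. This is a contraction of the Wiener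
  norm compatible with pointwise operations on the grid, so the discrete step is the aliased Strang step, it
  is Lipschitz with constant \<open>1 + O(\<tau>)\<close>, and its local error is that of the trapezoidal rule in the
  interaction picture plus \<open>\<tau>\<close> times the aliasing error of a regular function.
\<close>

text \<open>The delicate point is uniformity in \<open>c\<close>. The modes oscillate with frequency
  \<open>c sqrt(a^2 + c^2)\<close>, so time derivatives of \<open>z\<close> grow with
  \<open>c\<close>; a bound survives only where the factor \<open>c^2\<close> of the force meets the
  factor \<open>1/\<omega> \<le> 1/c^2\<close> of the Duhamel kernel. Moreover the theorem speaks of
  an arbitrary classical solution, which is not known in advance to lie in the algebra, let alone
  with a bound independent of \<open>c\<close>. Continuity of its second space derivative puts it
  there, and uniqueness identifies it with the constructed solution, whose bound is uniform in
  \<open>c\<close>. The order \<open>h^s\<close> for arbitrary \<open>s\<close> comes from the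
  smoothness of the data: with \<open>m\<close> the ceiling of \<open>s\<close>, the limit system is
  solved with \<open>m\<close> additional weights, and the final time may depend on
  \<open>m\<close>. Time derivatives are paid for in weights: a symbol of order two takes two, and
  one more buys continuity in norm. Numbers such as 10, 24 and 34 are sums of these costs.\<close>

abbreviation abs_summable :: "(int \<Rightarrow> complex) \<Rightarrow> bool" where
  "abs_summable f \<equiv> (\<lambda>a. cmod (f a)) summable_on UNIV"

section \<open>The Wiener algebra as a Banach space of absolutely summable coefficient
  families\<close>

typedef wiener = "{f :: int \<Rightarrow> complex. abs_summable f}"
  morphisms coef Abs_wiener
  by (rule exI[of _ "\<lambda>_. 0"]) simp

lemma coef_summable [simp, intro]: "(\<lambda>a. cmod (coef f a)) summable_on UNIV"
  using coef[of f] by simp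

lemma coef_Abs: "abs_summable f \<Longrightarrow> coef (Abs_wiener f) = f"
  by (simp add: Abs_wiener_inverse)

lemma wiener_eqI: "(\<And>a. coef f a = coef g a) \<Longrightarrow> f = g"
  by (metis coef_inject ext)

lemma abs_summableI:
  fixes f :: "int \<Rightarrow> complex"
  assumes "\<And>F. finite F \<Longrightarrow> (\<Sum>a\<in>F. cmod (f a)) \<le> B"
  shows "abs_summable f"
  by (rule nonneg_bdd_above_summable_on) (use assms in \<open>auto intro!: bdd_aboveI2\<close>)

lemma abs_summable_on_le:
  fixes f :: "int \<Rightarrow> complex"
  assumes "g summable_on UNIV" "\<And>a. cmod (f a) \<le> g a"
  shows "abs_summable f"
  by (rule summable_on_comparison_test[OF assms(1)]) (use assms(2) in auto)

instantiation wiener :: real_vector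
begin

definition "0 = Abs_wiener (\<lambda>_. 0)"
definition "f + g = Abs_wiener (\<lambda>a. coef f a + coef g a)"
definition "- f = Abs_wiener (\<lambda>a. - coef f a)"
definition "f - g = Abs_wiener (\<lambda>a. coef f a - coef g a)"
definition "r *\<^sub>R f = Abs_wiener (\<lambda>a. of_real r * coef f a)"
lemma coef_0 [simp]: "coef 0 a = 0"
  by (simp add: zero_wiener_def coef_Abs)

lemma coef_add [simp]: "coef (f + g) a = coef f a + coef g a"
  unfolding plus_wiener_def
  by (subst coef_Abs) (auto intro!: abs_summable_on_le[OF summable_on_add[OF coef_summable[of f] coef_summable[of g]]] norm_triangle_ineq)

lemma coef_minus [simp]: "coef (- f) a = - coef f a"
  by (simp add: uminus_wiener_def coef_Abs)

lemma coef_diff [simp]: "coef (f - g) a = coef f a - coef g a"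
  unfolding minus_wiener_def
  by (subst coef_Abs) (auto intro!: abs_summable_on_le[OF summable_on_add[OF coef_summable[of f] coef_summable[of g]]] norm_triangle_ineq4)

lemma coef_scaleR [simp]: "coef (r *\<^sub>R f) a = of_real r * coef f a"
  by (simp add: scaleR_wiener_def coef_Abs norm_mult summable_on_cmult_right)

instance
  by standard (auto intro!: wiener_eqI simp: algebra_simps)

end

instantiation wiener :: real_normed_vector
begin

definition "norm f = (\<Sum>\<^sub>\<infinity>a. cmod (coef f a))"
definition "dist (f::wiener) g = norm (f - g)"
definition "sgn (f::wiener) = f /\<^sub>R norm f"
definition "(uniformity :: (wiener \<times> wiener) filter) = (INF e\<in>{0<..}. principal {(x, y). dist x y < e})"
definition "open (U :: wiener set) \<longleftrightarrow> (\<forall>x\<in>U. eventually (\<lambda>(x', y). x' = x \<longrightarrow> y \<in> U) uniformity)"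

lemma sum_coef_le_norm: "finite F \<Longrightarrow> (\<Sum>a\<in>F. cmod (coef f a)) \<le> norm f"
  unfolding norm_wiener_def by (rule finite_sum_le_infsum) auto

lemma norm_wiener_leI:
  assumes "\<And>F. finite F \<Longrightarrow> (\<Sum>a\<in>F. cmod (coef f a)) \<le> B"
  shows "norm f \<le> B"
  unfolding norm_wiener_def by (rule infsum_le_finite_sums) (use assms in auto)

lemma cmod_coef_le: "cmod (coef f a) \<le> norm f"
  using sum_coef_le_norm[of "{a}" f] by simp

instance
proof
  fix x y z :: wiener and a b :: real
  show "dist x y = norm (x - y)" by (simp add: dist_wiener_def)
  show "sgn x = x /\<^sub>R norm x" by (rule sgn_wiener_def)
  show "uniformity = (INF e\<in>{0<..}. principal {(x::wiener, y). dist x y < e})"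
    by (rule uniformity_wiener_def)
  show "open U \<longleftrightarrow> (\<forall>x\<in>U. \<forall>\<^sub>F (x', y) in uniformity. x' = x \<longrightarrow> y \<in> U)" for U :: "wiener set"
    by (rule open_wiener_def)
  show "norm x = 0 \<longleftrightarrow> x = 0"
  proof
    assume "norm x = 0"
    then have "cmod (coef x a) \<le> 0" for a using cmod_coef_le[of x a] by simp
    then show "x = 0" by (intro wiener_eqI) auto
  qed (simp add: norm_wiener_def)
  show "norm (x + y) \<le> norm x + norm y"
  proof (rule norm_wiener_leI)
    fix F :: "int set" assume F: "finite F"
    have "(\<Sum>a\<in>F. cmod (coef (x + y) a)) \<le> (\<Sum>a\<in>F. cmod (coef x a)) + (\<Sum>a\<in>F. cmod (coef y a))"
      unfolding sum.distrib[symmetric] by (intro sum_mono) (simp add: norm_triangle_ineq)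
    then show "(\<Sum>a\<in>F. cmod (coef (x + y) a)) \<le> norm x + norm y"
      using sum_coef_le_norm[OF F, of x] sum_coef_le_norm[OF F, of y] by linarith
  qed
  show "norm (a *\<^sub>R x) = \<bar>a\<bar> * norm x"
    by (simp add: norm_wiener_def norm_mult infsum_cmult_right')
qed

end

lemma bounded_linear_coef: "bounded_linear (\<lambda>f. coef f a)"
  by (rule bounded_linear_intro[where K = 1]) (auto simp: cmod_coef_le scaleR_conv_of_real)

lemma coef_sum [simp]: "coef (sum f A) a = (\<Sum>i\<in>A. coef (f i) a)"
  by (induction A rule: infinite_finite_induct) auto

instance wiener :: banach
proof
  fix X :: "nat \<Rightarrow> wiener"
  assume X: "Cauchy X"
  have "Cauchy (\<lambda>n. coef (X n) a)" for a
    by (rule bounded_linear.Cauchy[OF bounded_linear_coef X])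
  then have lim: "(\<lambda>n. coef (X n) a) \<longlonglongrightarrow> lim (\<lambda>n. coef (X n) a)" for a
    by (simp add: Cauchy_convergent_iff convergent_LIMSEQ_iff)
  define l where "l = (\<lambda>a. lim (\<lambda>n. coef (X n) a))"
  \<comment> \<open>Closeness to the coefficientwise limit \<open>l\<close> is stated for finite
    sums, where the second index can be sent to infinity termwise. The full norm is formed only at
    the end.\<close>
  have close: "\<exists>N. \<forall>n\<ge>N. \<forall>F. finite F \<longrightarrow> (\<Sum>a\<in>F. cmod (coef (X n) a - l a)) \<le> e" if e: "e > 0" for e
  proof -
    obtain N where N: "\<And>m n. m \<ge> N \<Longrightarrow> n \<ge> N \<Longrightarrow> norm (X n - X m) < e"
      using X e by (meson CauchyD)
    have "(\<Sum>a\<in>F. cmod (coef (X n) a - l a)) \<le> e" if n: "n \<ge> N" and F: "finite F" for n F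
    proof (rule LIMSEQ_le_const2)
      show "(\<lambda>m. \<Sum>a\<in>F. cmod (coef (X n) a - coef (X m) a)) \<longlonglongrightarrow> (\<Sum>a\<in>F. cmod (coef (X n) a - l a))"
        unfolding l_def by (intro tendsto_intros lim)
      have "(\<Sum>a\<in>F. cmod (coef (X n) a - coef (X m) a)) \<le> e" if "m \<ge> N" for m
        using sum_coef_le_norm[OF F, of "X n - X m"] N[OF that n] by simp
      then show "\<exists>M. \<forall>m\<ge>M. (\<Sum>a\<in>F. cmod (coef (X n) a - coef (X m) a)) \<le> e" by blast
    qed
    then show ?thesis by blast
  qed
  obtain N where N: "\<And>F. finite F \<Longrightarrow> (\<Sum>a\<in>F. cmod (coef (X N) a - l a)) \<le> 1"
    using close[of 1] by auto
  have "abs_summable l"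
  proof (rule abs_summableI)
    fix F :: "int set" assume F: "finite F"
    have "(\<Sum>a\<in>F. cmod (l a)) \<le> (\<Sum>a\<in>F. cmod (coef (X N) a - l a)) + (\<Sum>a\<in>F. cmod (coef (X N) a))"
      unfolding sum.distrib[symmetric]
      by (intro sum_mono) (metis add.commute norm_minus_commute norm_triangle_sub)
    then show "(\<Sum>a\<in>F. cmod (l a)) \<le> 1 + norm (X N)"
      using N[OF F] sum_coef_le_norm[OF F, of "X N"] by linarith
  qed
  then have cl: "coef (Abs_wiener l) = l" by (rule coef_Abs)
  have "X \<longlonglongrightarrow> Abs_wiener l"
  proof (rule metric_LIMSEQ_I)
    fix e :: real assume "e > 0"
    then obtain N where N: "\<And>n F. n \<ge> N \<Longrightarrow> finite F \<Longrightarrow> (\<Sum>a\<in>F. cmod (coef (X n) a - l a)) \<le> e / 2"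
      using close[of "e / 2"] by auto
    have "dist (X n) (Abs_wiener l) < e" if "n \<ge> N" for n
    proof -
      have "norm (X n - Abs_wiener l) \<le> e / 2"
        by (rule norm_wiener_leI) (use N[OF that] cl in simp)
      then show ?thesis using \<open>e > 0\<close> by (simp add: dist_wiener_def)
    qed
    then show "\<exists>N. \<forall>n\<ge>N. dist (X n) (Abs_wiener l) < e" by blast
  qed
  then show "convergent X" by (auto simp: convergent_def)
qed

section \<open>Truncations, monomials and the density of trigonometric polynomials\<close>

definition truncation :: "int set \<Rightarrow> wiener \<Rightarrow> wiener" where
  "truncation F f = Abs_wiener (\<lambda>a. if a \<in> F then coef f a else 0)"

lemma coef_truncation [simp]: "coef (truncation F f) a = (if a \<in> F then coef f a else 0)"
  unfolding truncation_def
  by (subst coef_Abs) (auto intro!: abs_summable_on_le[OF coef_summable[of f]])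

lemma truncation_close:
  assumes "e > 0"
  obtains F where "finite F" "norm (f - truncation F f) \<le> e"
proof -
  obtain F where F: "finite F" "dist (\<Sum>a\<in>F. cmod (coef f a)) (norm f) \<le> e"
    using infsum_finite_approximation[OF coef_summable[of f] assms] unfolding norm_wiener_def by auto
  have "norm (f - truncation F f) \<le> e"
  proof (rule norm_wiener_leI)
    fix G :: "int set" assume G: "finite G"
    have "(\<Sum>a\<in>G. cmod (coef (f - truncation F f) a)) = (\<Sum>a\<in>G - F. cmod (coef f a))"
      by (rule sum.mono_neutral_cong_right) (use G in auto)
    moreover have "(\<Sum>a\<in>G - F. cmod (coef f a)) + (\<Sum>a\<in>F. cmod (coef f a)) \<le> norm f"
      by (subst sum.union_disjoint[symmetric]) (use F(1) G in \<open>auto intro!: sum_coef_le_norm\<close>)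
    ultimately show "(\<Sum>a\<in>G. cmod (coef (f - truncation F f) a)) \<le> e"
      using F(2) by (auto simp: dist_real_def)
  qed
  then show ?thesis using F that by blast
qed

definition monomial :: "int \<Rightarrow> complex \<Rightarrow> wiener" where
  "monomial b c = Abs_wiener (\<lambda>a. if a = b then c else 0)"

lemma coef_monomial [simp]: "coef (monomial b c) a = (if a = b then c else 0)"
proof -
  have "abs_summable (\<lambda>a. if a = b then c else 0)"
  proof (rule abs_summableI)
    fix F :: "int set" assume F: "finite F"
    have "(\<Sum>a\<in>F. cmod (if a = b then c else 0)) = (\<Sum>a\<in>F. if b = a then cmod c else 0)"
      by (intro sum.cong) auto
    then show "(\<Sum>a\<in>F. cmod (if a = b then c else 0)) \<le> cmod c"
      using F by (simp add: sum.delta')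
  qed
  then show ?thesis unfolding monomial_def by (simp add: coef_Abs)
qed

lemma norm_monomial [simp]: "norm (monomial b c) = cmod c"
proof (rule antisym)
  show "norm (monomial b c) \<le> cmod c"
  proof (rule norm_wiener_leI)
    fix F :: "int set" assume F: "finite F"
    have "(\<Sum>a\<in>F. cmod (coef (monomial b c) a)) = (\<Sum>a\<in>F. if b = a then cmod c else 0)"
      by (intro sum.cong) auto
    then show "(\<Sum>a\<in>F. cmod (coef (monomial b c) a)) \<le> cmod c"
      using F by (simp add: sum.delta')
  qed
  show "cmod c \<le> norm (monomial b c)"
    using cmod_coef_le[of "monomial b c" b] by simp
qed

lemma truncation_eq_sum:
  assumes "finite F"
  shows "truncation F f = (\<Sum>a\<in>F. monomial a (coef f a))"
proof (rule wiener_eqI)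
  fix a
  have "(\<Sum>b\<in>F. if a = b then coef f b else 0) = (if a \<in> F then coef f a else 0)"
    using assms by (subst sum.delta') auto
  then show "coef (truncation F f) a = coef (\<Sum>a\<in>F. monomial a (coef f a)) a"
    by simp
qed

text \<open>Truncations converge in norm and are finite sums of monomials, so a closed additive
  property has to be checked on single exponentials only.\<close>

lemma wiener_dense_induct:
  assumes "closed {f. P f}" "\<And>b c. P (monomial b c)" "P 0" "\<And>f g. P f \<Longrightarrow> P g \<Longrightarrow> P (f + g)"
  shows "P f"
proof -
  have "P (truncation F f)" if "finite F" for F
    unfolding truncation_eq_sum[OF that] using that by (induction) (auto intro: assms)
  moreover have "f \<in> closure {f. P f}"
    unfolding closure_approachable
  proof (intro allI impI)
    fix e :: real assume "e > 0"
    then obtain F where F: "finite F" "norm (f - truncation F f) \<le> e / 2"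
      using truncation_close[of "e / 2" f] by auto
    then show "\<exists>y\<in>{f. P f}. dist y f < e"
      using calculation \<open>e > 0\<close> by (intro bexI[of _ "truncation F f"]) (auto simp: dist_norm norm_minus_commute)
  qed
  ultimately show ?thesis using assms(1) by (simp add: closure_closed)
qed

subsection \<open>Evaluation and multiplication\<close>

definition ev :: "wiener \<Rightarrow> real \<Rightarrow> complex" where
  "ev f x = (\<Sum>\<^sub>\<infinity>a. coef f a * exp (\<i> * of_int a * of_real x))"

lemma norm_exp_i_int [simp]: "cmod (exp (\<i> * of_int a * of_real x)) = 1"
proof -
  have "\<i> * of_int a * of_real x = \<i> * of_real (of_int a * x)" by simp
  then show ?thesis by (metis norm_exp_i_times)
qed

lemma ev_has_sum: "((\<lambda>a. coef f a * exp (\<i> * of_int a * of_real x)) has_sum ev f x) UNIV"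
  unfolding ev_def by (rule has_sum_infsum, rule abs_summable_summable) (simp add: norm_mult)

lemma norm_ev_le: "cmod (ev f x) \<le> norm f"
  by (rule norm_infsum_le[OF ev_has_sum, of "\<lambda>a. cmod (coef f a)"])
     (auto simp: norm_wiener_def norm_mult)

lemma bounded_linear_ev: "bounded_linear (\<lambda>f. ev f x)"
proof (rule bounded_linear_intro[where K = 1])
  fix f g :: wiener and r :: real
  have "((\<lambda>a. coef (f + g) a * exp (\<i> * of_int a * of_real x)) has_sum (ev f x + ev g x)) UNIV"
    using has_sum_add[OF ev_has_sum[of f x] ev_has_sum[of g x]] by (simp add: algebra_simps)
  then show "ev (f + g) x = ev f x + ev g x"
    using ev_has_sum has_sum_unique by blast
  have "((\<lambda>a. coef (r *\<^sub>R f) a * exp (\<i> * of_int a * of_real x)) has_sum (r *\<^sub>R ev f x)) UNIV"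
    using has_sum_cmult_right[OF ev_has_sum[of f x], of "of_real r"] by (simp add: algebra_simps scaleR_conv_of_real)
  then show "ev (r *\<^sub>R f) x = r *\<^sub>R ev f x"
    using ev_has_sum has_sum_unique by blast
  show "norm (ev f x) \<le> norm f * 1" using norm_ev_le by simp
qed

lemmas ev_add [simp] = linear_add[OF bounded_linear.linear[OF bounded_linear_ev]]
  and ev_diff [simp] = linear_diff[OF bounded_linear.linear[OF bounded_linear_ev]]
  and ev_minus [simp] = linear_neg[OF bounded_linear.linear[OF bounded_linear_ev]]
  and ev_0 [simp] = linear_0[OF bounded_linear.linear[OF bounded_linear_ev]]
  and ev_scaleR = linear_scale[OF bounded_linear.linear[OF bounded_linear_ev]]

lemma ev_finite:
  assumes "finite F" "\<And>a. a \<notin> F \<Longrightarrow> coef f a = 0"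
  shows "ev f x = (\<Sum>a\<in>F. coef f a * exp (\<i> * of_int a * of_real x))"
proof -
  have "((\<lambda>a. coef f a * exp (\<i> * of_int a * of_real x)) has_sum
      (\<Sum>a\<in>F. coef f a * exp (\<i> * of_int a * of_real x))) UNIV"
    by (rule has_sum_finite_neutralI) (use assms in auto)
  then show ?thesis using ev_has_sum has_sum_unique by blast
qed

lemma ev_monomial [simp]: "ev (monomial b c) x = c * exp (\<i> * of_int b * of_real x)"
  by (subst ev_finite[of "{b}"]) auto

lemma ev_periodic: "ev f (x + 2 * pi) = ev f x"
proof -
  have "exp (\<i> * of_int a * of_real (x + 2 * pi)) = exp (\<i> * of_int a * of_real x)" for a
    using exp_integer_2pi[of "of_int a"] by (simp add: algebra_simps exp_add)
  then show ?thesis unfolding ev_def by simp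
qed

text \<open>The norm dominates the sup norm, so norm limits are uniform limits and continuity passes
  from exponentials to the whole algebra.\<close>

lemma continuous_ev: "continuous_on S (ev f)"
proof (rule continuous_on_subset[OF _ subset_UNIV])
  show "continuous_on UNIV (ev f)"
  proof (rule wiener_dense_induct[of "\<lambda>f. continuous_on UNIV (ev f)"])
    show "closed {f. continuous_on UNIV (ev f)}"
      unfolding closed_sequential_limits
    proof (intro allI impI, clarify)
      fix X l assume X: "\<forall>n. X n \<in> {f. continuous_on UNIV (ev f)}" "X \<longlonglongrightarrow> l"
      show "continuous_on UNIV (ev l)"
      proof (rule uniform_limit_theorem[of _ "\<lambda>n. ev (X n)" sequentially])
        show "uniform_limit UNIV (\<lambda>n. ev (X n)) (ev l) sequentially"
        proof (rule uniform_limitI)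
          fix e :: real assume "e > 0"
          then have "\<forall>\<^sub>F n in sequentially. dist (X n) l < e" using X(2) tendstoD by blast
          then show "\<forall>\<^sub>F n in sequentially. \<forall>x\<in>UNIV. dist (ev (X n) x) (ev l x) < e"
          proof eventually_elim
            case (elim n)
            then show ?case using norm_ev_le[of "X n - l"]
              by (auto simp: dist_norm intro: le_less_trans)
          qed
        qed
      qed (use X in auto)
    qed
  qed (auto intro!: continuous_intros simp: ev_monomial[abs_def] ev_add[abs_def] ev_0[abs_def])
qed

text \<open>Both sides are bounded linear functionals of \<open>f\<close>. By density it is enough
  to compare them on monomials, where the claim is orthogonality of exponentials.\<close>

lemma fourier_coeff_ev: "fourier_coeff (ev f) a = coef f a"
proof -
  define E where "E = (\<lambda>x::real. exp (- \<i> * of_int a * of_real x))"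
  have E1: "cmod (E x) = 1" for x using norm_exp_i_int[of "- a" x] by (simp add: E_def)
  have E: "continuous_on S E" for S unfolding E_def by (intro continuous_intros)
  have int: "(\<lambda>x. ev f x * E x) integrable_on {-pi..pi}" for f
    by (intro integrable_continuous_interval continuous_intros continuous_ev E)
  define L where "L = (\<lambda>f. integral {-pi..pi} (\<lambda>x. ev f x * E x) / of_real (2 * pi))"
  have "bounded_linear L"
  proof (rule bounded_linear_intro[where K = 1])
    fix f g :: wiener and r :: real
    show "L (f + g) = L f + L g"
      by (simp add: L_def distrib_right integral_add int add_divide_distrib)
    show "L (r *\<^sub>R f) = r *\<^sub>R L f"
      by (simp add: L_def ev_scaleR) (simp add: scaleR_conv_of_real)
    have "cmod (integral {-pi..pi} (\<lambda>x. ev f x * E x)) \<le> norm f * (pi - - pi)"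
      by (rule integral_bound) (auto intro!: continuous_intros continuous_ev E simp: norm_mult E1 norm_ev_le)
    then show "norm (L f) \<le> norm f * 1"
      by (simp add: L_def norm_divide field_simps)
  qed
  then have bl: "bounded_linear (\<lambda>f. L f - coef f a)"
    by (intro bounded_linear_sub bounded_linear_coef)
  have "L f - coef f a = 0"
  proof (rule wiener_dense_induct[of "\<lambda>f. L f - coef f a = 0"])
    have "{f. L f - coef f a = 0} = (\<lambda>f. L f - coef f a) -` {0}" by auto
    then show "closed {f. L f - coef f a = 0}"
      using continuous_closed_vimage[of "{0}" "\<lambda>f. L f - coef f a"]
        linear_continuous_at[OF bl] by auto
  next
    fix b c
    show "L (monomial b c) - coef (monomial b c) a = 0"
    proof (cases "b = a")
      case True
      then have c: "(\<lambda>x. ev (monomial b c) x * E x) = (\<lambda>_. c)"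
        by (auto simp: E_def mult_exp_exp)
      show ?thesis using True unfolding L_def c by (simp add: scaleR_conv_of_real field_simps)
    next
      case False
      \<comment> \<open>The antiderivative of \<open>exp (k x)\<close> is
        \<open>exp (k x) / k\<close>, and its values at both ends agree because
        \<open>2 pi k\<close> is a multiple of \<open>2 pi i\<close>.\<close>
      define k where "k = \<i> * of_int (b - a)"
      have k: "k \<noteq> 0" using False by (simp add: k_def)
      have eq: "ev (monomial b c) x * E x = c * exp (k * of_real x)" for x
        by (simp add: E_def k_def mult_exp_exp algebra_simps)
      have "((\<lambda>x. c * exp (k * of_real x)) has_integral
          (c / k * exp (k * of_real pi) - c / k * exp (k * of_real (- pi)))) {-pi..pi}"
        by (rule fundamental_theorem_of_calculus) 
           (auto intro!: derivative_eq_intros has_vector_derivative_real_field simp: k)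
      moreover have "exp (k * of_real (- pi)) = exp (k * of_real pi)"
      proof -
        have "k * of_real pi = (2 * of_int (b - a) * of_real pi) * \<i> + k * of_real (- pi)"
          by (simp add: k_def algebra_simps)
        then have "exp (k * of_real pi) = exp ((2 * of_int (b - a) * of_real pi) * \<i>) * exp (k * of_real (- pi))"
          by (metis exp_add)
        then show ?thesis using exp_integer_2pi[of "of_int (b - a)"] by (simp del: of_int_diff)
      qed
      ultimately have "((\<lambda>x. c * exp (k * of_real x)) has_integral 0) {-pi..pi}" by simp
      then have "integral {-pi..pi} (\<lambda>x. c * exp (k * of_real x)) = 0" by (rule integral_unique)
      then have "L (monomial b c) = 0" unfolding L_def eq by (simp only: div_0)
      then show ?thesis using False by simp
    qed
  qed (use bl in \<open>auto simp: linear_0[OF bounded_linear.linear[OF \<open>bounded_linear L\<close>]]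
      linear_add[OF bounded_linear.linear[OF \<open>bounded_linear L\<close>]]\<close>)
  then show ?thesis by (simp add: L_def fourier_coeff_def E_def)
qed

lemma ev_inject: "(\<And>x. ev f x = ev g x) \<Longrightarrow> f = g"
  by (metis ext fourier_coeff_ev wiener_eqI)

section \<open>The convolution product\<close>

lemma has_sum_prod_reindex:
  "((\<lambda>(a, b). f b * g (a - b)) has_sum S) UNIV \<longleftrightarrow> ((\<lambda>(b, d). f b * g d) has_sum S) (UNIV :: (int \<times> int) set)"
  by (rule has_sum_reindex_bij_witness[of _ "\<lambda>(b, d). (b + d, b)" "\<lambda>(a, b). (b, a - b)"]) auto

text \<open>The shear \<open>(a, b) \<mapsto> (b, a - b)\<close> turns the double series of the
  convolution into a product of two series, to which Tonelli applies.\<close>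

lemma conv_norm_has_sum:
  "((\<lambda>(a, b). cmod (coef f b) * cmod (coef g (a - b))) has_sum (norm f * norm g)) (UNIV :: (int \<times> int) set)"
proof -
  have f: "((\<lambda>b. cmod (coef f b)) has_sum norm f) UNIV" for f
    unfolding norm_wiener_def by (rule has_sum_infsum) auto
  have 1: "((\<lambda>d. cmod (coef f b) * cmod (coef g d)) has_sum (cmod (coef f b) * norm g)) UNIV" for b
    by (rule has_sum_cmult_right[OF f])
  have 2: "((\<lambda>b. cmod (coef f b) * norm g) has_sum (norm f * norm g)) UNIV"
    by (rule has_sum_cmult_left[OF f])
  have "((\<lambda>(b, d). cmod (coef f b) * cmod (coef g d)) has_sum (norm f * norm g)) (UNIV \<times> UNIV)"
  proof (rule has_sum_SigmaI[where g = "\<lambda>b. cmod (coef f b) * norm g"])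
    show "(\<lambda>(b, d). cmod (coef f b) * cmod (coef g d)) summable_on UNIV \<times> UNIV"
      by (rule summable_on_SigmaI[where g = "\<lambda>b. cmod (coef f b) * norm g"])
         (auto intro!: 1 has_sum_imp_summable[OF 2])
  qed (use 1 2 in auto)
  then show ?thesis
    using has_sum_prod_reindex[of "\<lambda>b. cmod (coef f b)" "\<lambda>d. cmod (coef g d)"] by simp
qed

lemma conv_summable:
  "(\<lambda>b. cmod (coef f b) * cmod (coef g (a - b))) summable_on UNIV"
  by (rule summable_on_SigmaD1[where f = "\<lambda>a b. cmod (coef f b) * cmod (coef g (a - b))" and A = UNIV])
     (use has_sum_imp_summable[OF conv_norm_has_sum[of f g]] in auto)

text \<open>Summing the same double series row by row yields both facts about the product: its
  coefficients are summable, and the norm is submultiplicative.\<close>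

lemma conv_norm_has_sum_outer:
  "((\<lambda>a. \<Sum>\<^sub>\<infinity>b. cmod (coef f b) * cmod (coef g (a - b))) has_sum (norm f * norm g)) UNIV"
  by (rule has_sum_SigmaD[where B = "\<lambda>_. UNIV" and f = "\<lambda>(a, b). cmod (coef f b) * cmod (coef g (a - b))"])
     (use conv_norm_has_sum[of f g] conv_summable in auto)

instantiation wiener :: "{times, one}"
begin

definition "f * g = Abs_wiener (\<lambda>a. \<Sum>\<^sub>\<infinity>b. coef f b * coef g (a - b))"
definition "(1 :: wiener) = monomial 0 1"

instance ..

end

lemma cmod_conv_le:
  "cmod (\<Sum>\<^sub>\<infinity>b. coef f b * coef g (a - b)) \<le> (\<Sum>\<^sub>\<infinity>b. cmod (coef f b) * cmod (coef g (a - b)))"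
  using norm_infsum_bound[of "\<lambda>b. coef f b * coef g (a - b)" UNIV] conv_summable[of f g a]
  by (simp add: norm_mult)

lemma coef_mult: "coef (f * g) a = (\<Sum>\<^sub>\<infinity>b. coef f b * coef g (a - b))"
  unfolding times_wiener_def
  by (subst coef_Abs)
     (auto intro!: abs_summable_on_le[OF has_sum_imp_summable[OF conv_norm_has_sum_outer[of f g]]] cmod_conv_le)

lemma coef_mult_has_sum: "((\<lambda>b. coef f b * coef g (a - b)) has_sum coef (f * g) a) UNIV"
  unfolding coef_mult
  by (rule has_sum_infsum, rule abs_summable_summable) (use conv_summable[of f g a] in \<open>simp add: norm_mult\<close>)

lemma norm_mult_wiener: "norm (f * g) \<le> norm f * norm (g :: wiener)"
proof (rule norm_wiener_leI)
  fix F :: "int set" assume F: "finite F"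
  have "(\<Sum>a\<in>F. cmod (coef (f * g) a)) \<le> (\<Sum>a\<in>F. \<Sum>\<^sub>\<infinity>b. cmod (coef f b) * cmod (coef g (a - b)))"
    unfolding coef_mult by (intro sum_mono cmod_conv_le)
  also have "\<dots> \<le> norm f * norm g"
    by (rule finite_sum_le_has_sum[OF conv_norm_has_sum_outer]) (use F in \<open>auto intro!: infsum_nonneg\<close>)
  finally show "(\<Sum>a\<in>F. cmod (coef (f * g) a)) \<le> norm f * norm g" .
qed

text \<open>The factor \<open>e a\<close> splits as \<open>e b * e (a - b)\<close>, so the
  absolutely convergent double series can be summed along diagonals or as a product.\<close>

lemma ev_mult [simp]: "ev (f * g) x = ev f x * ev g x"
proof -
  define e where "e = (\<lambda>a::int. exp (\<i> * of_int a * of_real x))"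
  have e: "e a = e b * e (a - b)" for a b
    by (simp add: e_def mult_exp_exp algebra_simps)
  have ee: "cmod (e a) = 1" for a unfolding e_def by (rule norm_exp_i_int)
  have s: "(\<lambda>(b, d). (coef f b * e b) * (coef g d * e d)) summable_on (UNIV :: (int \<times> int) set)"
    by (rule abs_summable_summable)
       (use has_sum_imp_summable[OF has_sum_prod_reindex[THEN iffD1, OF conv_norm_has_sum[of f g]]]
         in \<open>simp add: norm_mult ee case_prod_unfold\<close>)
  have "((\<lambda>(b, d). (coef f b * e b) * (coef g d * e d)) has_sum (ev f x * ev g x)) (UNIV \<times> UNIV)"
    using s by (intro has_sum_SigmaI[where g = "\<lambda>b. coef f b * e b * ev g x"])
       (auto intro!: has_sum_cmult_right has_sum_cmult_left ev_has_sum simp: e_def)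
  then have 1: "((\<lambda>(a, b). (coef f b * e b) * (coef g (a - b) * e (a - b))) has_sum (ev f x * ev g x)) (UNIV \<times> UNIV)"
    unfolding UNIV_Times_UNIV by (subst has_sum_prod_reindex)
  have eq: "coef f b * coef g (a - b) * e a = (coef f b * e b) * (coef g (a - b) * e (a - b))" for a b
    by (subst e[of a b]) (simp add: mult_ac)
  have 2: "((\<lambda>b. (coef f b * e b) * (coef g (a - b) * e (a - b))) has_sum (coef (f * g) a * e a)) UNIV" for a
    using has_sum_cmult_left[OF coef_mult_has_sum[of f g a], of "e a"] by (simp only: eq)
  have "((\<lambda>a. coef (f * g) a * e a) has_sum (ev f x * ev g x)) UNIV"
    by (rule has_sum_SigmaD[OF 1]) (use 2 in simp)
  then show ?thesis using ev_has_sum[of "f * g" x] has_sum_unique unfolding e_def by blast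
qed

lemma ev_1 [simp]: "ev 1 x = 1"
  by (simp add: one_wiener_def)

text \<open>Since evaluation is injective and multiplicative, the ring laws are inherited from \<open>\<complex>\<close>.\<close>

instance wiener :: "{comm_ring_1, real_normed_algebra_1}"
proof
  fix x y z :: wiener and r :: real
  show "x * y * z = x * (y * z)" "x * y = y * x" "1 * x = x" "(x + y) * z = x * z + y * z"
    "x * 1 = x" "x * (y + z) = x * y + x * z"
    "r *\<^sub>R x * y = r *\<^sub>R (x * y)" "x * r *\<^sub>R y = r *\<^sub>R (x * y)"
    by (auto intro!: ev_inject simp: algebra_simps ev_scaleR)
  show "norm (x * y) \<le> norm x * norm y" by (rule norm_mult_wiener)
  show "norm (1::wiener) = 1" by (simp add: one_wiener_def)
  show "(0::wiener) \<noteq> 1"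
    by (metis norm_monomial norm_one norm_zero one_wiener_def zero_neq_one)
qed

subsection \<open>Constants and conjugation\<close>

abbreviation const :: "complex \<Rightarrow> wiener" where
  "const \<equiv> monomial 0"

lemma const_minus: "const (- c) = - const c"
  and const_1: "const 1 = 1"
  by (auto intro!: ev_inject)

lemma coef_const_mult [simp]: "coef (const c * f) a = c * coef f a"
proof -
  have "((\<lambda>b. coef (const c) b * coef f (a - b)) has_sum (c * coef f a)) UNIV"
    using has_sum_finite_neutralI[of "{0}" UNIV "\<lambda>b. coef (const c) b * coef f (a - b)" "c * coef f a"] by simp
  then show ?thesis using coef_mult_has_sum has_sum_unique by blast
qed

definition wcnj :: "wiener \<Rightarrow> wiener" where
  "wcnj f = Abs_wiener (\<lambda>a. cnj (coef f (- a)))"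

lemma coef_wcnj [simp]: "coef (wcnj f) a = cnj (coef f (- a))"
proof -
  have "(\<lambda>a. cmod (coef f (- a))) summable_on UNIV"
    using coef_summable[of f] summable_on_reindex_bij_witness[of UNIV uminus uminus UNIV "\<lambda>a. cmod (coef f a)" "\<lambda>a. cmod (coef f (- a))"]
    by auto
  then show ?thesis unfolding wcnj_def by (simp add: coef_Abs)
qed

lemma norm_wcnj [simp]: "norm (wcnj f) = norm f"
  unfolding norm_wiener_def
  using infsum_reindex_bij_witness[of UNIV uminus uminus UNIV "\<lambda>a. cmod (coef f a)" "\<lambda>a. cmod (coef f (- a))"]
  by auto

lemma ev_wcnj [simp]: "ev (wcnj f) x = cnj (ev f x)"
proof -
  have "((\<lambda>a. cnj (coef f a * exp (\<i> * of_int a * of_real x))) has_sum cnj (ev f x)) UNIV"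
    using ev_has_sum[of f x] by (subst has_sum_cnj_iff)
  then have "((\<lambda>a. coef (wcnj f) a * exp (\<i> * of_int a * of_real x)) has_sum cnj (ev f x)) UNIV"
    by (subst has_sum_reindex_bij_witness[of UNIV uminus uminus UNIV]) (auto simp: exp_cnj)
  then show ?thesis using ev_has_sum has_sum_unique by blast
qed

lemma wcnj_add: "wcnj (f + g) = wcnj f + wcnj g"
  and wcnj_diff: "wcnj (f - g) = wcnj f - wcnj g"
  and wcnj_mult: "wcnj (f * g) = wcnj f * wcnj g"
  and wcnj_wcnj [simp]: "wcnj (wcnj f) = f"
  and wcnj_const: "wcnj (const c) = const (cnj c)"
  and wcnj_scaleR: "wcnj (r *\<^sub>R f) = r *\<^sub>R wcnj f"
  by (auto intro!: ev_inject simp: ev_scaleR)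

lemma bounded_linear_wcnj: "bounded_linear wcnj"
  by (rule bounded_linear_intro[where K = 1]) (auto simp: wcnj_add wcnj_scaleR)

lemma ev_power: "ev (f ^ n) x = ev f x ^ n"
  by (induction n) auto

text \<open>Evaluation is a continuous algebra homomorphism and hence commutes with the exponential
  series. This identifies the phase flow of the algebra with the pointwise one.\<close>

lemma ev_exp: "ev (exp f) x = exp (ev f x)"
proof -
  have "(\<lambda>n. ev f x ^ n /\<^sub>R fact n) sums ev (exp f) x"
    using bounded_linear.sums[OF bounded_linear_ev exp_converges[of f], of x] by (simp add: ev_scaleR ev_power)
  then show ?thesis using exp_converges sums_unique2 by blast
qed

subsection \<open>Weighted bounds\<close>

text \<open>This form is at least 1 and submultiplicative in the sense of
  \<open>weight_mult\<close>, so that products obey the weighted bounds with constant 1.\<close>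

definition weight :: "int \<Rightarrow> real" where
  "weight a = 1 + \<bar>of_int a\<bar>"

lemma weight_ge_1 [simp]: "1 \<le> weight a" and weight_pos [simp]: "0 < weight a" 
  and weight_nonneg [simp]: "0 \<le> weight a" and weight_minus [simp]: "weight (- a) = weight a"
  by (auto simp: weight_def)

lemma weight_mult: "weight (a + b) \<le> weight a * weight b"
  by (auto simp: weight_def algebra_simps intro!: order.trans[OF abs_triangle_ineq])

lemma weight_power_mult: "weight a ^ k \<le> weight b ^ k * weight (a - b) ^ k"
  using power_mono[OF weight_mult[of b "a - b"], of k] by (simp add: power_mult_distrib)

text \<open>\<open>wbound k R f\<close> says that \<open>f\<close> has norm at most \<open>R\<close> in the Wiener algebra weighted by \<open>(1 + |a|)^k\<close>.\<close>

definition wbound :: "nat \<Rightarrow> real \<Rightarrow> wiener \<Rightarrow> bool" where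
  "wbound k R f \<longleftrightarrow> (\<forall>F. finite F \<longrightarrow> (\<Sum>a\<in>F. weight a ^ k * cmod (coef f a)) \<le> R)"

lemma wbound_0_iff: "wbound 0 R f \<longleftrightarrow> norm f \<le> R"
  unfolding wbound_def using norm_wiener_leI[of f R] sum_coef_le_norm[of _ f] by (auto intro: order.trans)

lemma wbound_nonneg: "wbound k R f \<Longrightarrow> 0 \<le> R"
  unfolding wbound_def by (metis finite.emptyI sum.empty)

lemma wbound_mono:
  assumes "wbound k R f" "j \<le> k" "R \<le> S"
  shows "wbound j S f"
  unfolding wbound_def
proof (intro allI impI)
  fix F :: "int set" assume "finite F"
  have "(\<Sum>a\<in>F. weight a ^ j * cmod (coef f a)) \<le> (\<Sum>a\<in>F. weight a ^ k * cmod (coef f a))"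
    using assms(2) by (intro sum_mono mult_right_mono power_increasing) auto
  then show "(\<Sum>a\<in>F. weight a ^ j * cmod (coef f a)) \<le> S"
    using assms(1,3) \<open>finite F\<close> unfolding wbound_def by (meson order.trans)
qed

lemma wbound_norm: "wbound k R f \<Longrightarrow> norm f \<le> R"
  using wbound_mono[of k R f 0 R] by (simp add: wbound_0_iff)

lemma wbound_0 [simp]: "0 \<le> R \<Longrightarrow> wbound k R 0"
  by (simp add: wbound_def)

lemma wbound_1 [simp]: "wbound k 1 1"
  unfolding wbound_def
proof (intro allI impI)
  fix F :: "int set" assume F: "finite F"
  have "(\<Sum>a\<in>F. weight a ^ k * cmod (coef 1 a)) = (\<Sum>a\<in>F. if 0 = a then 1 else 0)"
    by (intro sum.cong) (auto simp: one_wiener_def weight_def)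
  then show "(\<Sum>a\<in>F. weight a ^ k * cmod (coef 1 a)) \<le> 1"
    using F by (simp add: sum.delta')
qed

lemma wbound_le_coef:
  assumes "wbound k R f" "\<And>a. weight a ^ j * cmod (coef g a) \<le> C * (weight a ^ k * cmod (coef f a))" "0 \<le> C"
  shows "wbound j (C * R) g"
  unfolding wbound_def
proof (intro allI impI)
  fix F :: "int set" assume F: "finite F"
  have "(\<Sum>a\<in>F. weight a ^ j * cmod (coef g a)) \<le> C * (\<Sum>a\<in>F. weight a ^ k * cmod (coef f a))"
    unfolding sum_distrib_left by (intro sum_mono assms)
  then show "(\<Sum>a\<in>F. weight a ^ j * cmod (coef g a)) \<le> C * R"
    using assms(1,3) F unfolding wbound_def by (meson mult_left_mono order.trans)
qed

lemma wbound_add: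
  assumes "wbound k R f" "wbound k S g"
  shows "wbound k (R + S) (f + g)"
  unfolding wbound_def
proof (intro allI impI)
  fix F :: "int set" assume F: "finite F"
  have "(\<Sum>a\<in>F. weight a ^ k * cmod (coef (f + g) a))
      \<le> (\<Sum>a\<in>F. weight a ^ k * cmod (coef f a)) + (\<Sum>a\<in>F. weight a ^ k * cmod (coef g a))"
    unfolding sum.distrib[symmetric] distrib_left[symmetric]
    by (intro sum_mono mult_left_mono) (auto simp: norm_triangle_ineq)
  then show "(\<Sum>a\<in>F. weight a ^ k * cmod (coef (f + g) a)) \<le> R + S"
    using assms F unfolding wbound_def by (meson add_mono order.trans)
qed

lemma wbound_const_mult: "wbound k R f \<Longrightarrow> wbound k (cmod c * R) (const c * f)"
  by (rule wbound_le_coef) (auto simp: norm_mult)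

lemma wbound_scaleR: "wbound k R f \<Longrightarrow> wbound k (\<bar>r\<bar> * R) (r *\<^sub>R f)"
  by (rule wbound_le_coef) (auto simp: norm_mult)

lemma wbound_minus: "wbound k R f \<Longrightarrow> wbound k R (- f)"
  by (simp add: wbound_def)

lemma wbound_diff: "wbound k R f \<Longrightarrow> wbound k S g \<Longrightarrow> wbound k (R + S) (f - g)"
  using wbound_add[of k R f S "- g"] wbound_minus by simp

lemma wbound_sum: "(\<And>i. i \<in> I \<Longrightarrow> wbound k (R i) (f i)) \<Longrightarrow> wbound k (\<Sum>i\<in>I. R i) (\<Sum>i\<in>I. f i)"
  by (induction I rule: infinite_finite_induct) (auto intro!: wbound_add)

lemma wbound_wcnj:
  assumes "wbound k R f"
  shows "wbound k R (wcnj f)"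
  unfolding wbound_def
proof (intro allI impI)
  fix F :: "int set" assume F: "finite F"
  have "(\<Sum>a\<in>F. weight a ^ k * cmod (coef (wcnj f) a)) = (\<Sum>a\<in>uminus ` F. weight a ^ k * cmod (coef f a))"
    by (subst sum.reindex) auto
  then show "(\<Sum>a\<in>F. weight a ^ k * cmod (coef (wcnj f) a)) \<le> R"
    using assms F unfolding wbound_def by auto
qed

text \<open>The weighted absolute values of the coefficients form elements \<open>lift f\<close> and
  \<open>lift g\<close> of the algebra. Submultiplicativity of the weight dominates the weighted
  coefficients of \<open>f * g\<close> by those of \<open>lift f * lift g\<close>, which leaves the
  unweighted norm inequality.\<close>

lemma wbound_mult:
  assumes f: "wbound k R f" and g: "wbound k S g"
  shows "wbound k (R * S) (f * g)"
proof -
  define lift where "lift = (\<lambda>f. Abs_wiener (\<lambda>a. of_real (weight a ^ k * cmod (coef f a))))"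
  have lift: "coef (lift f) a = of_real (weight a ^ k * cmod (coef f a))" if "wbound k R f" for f R a
    unfolding lift_def
    by (subst coef_Abs, rule abs_summableI[where B = R])
       (use that in \<open>auto simp: wbound_def norm_mult norm_power\<close>)
  have norm_lift: "norm (lift f) \<le> R" if "wbound k R f" for f R
    by (rule norm_wiener_leI) (use lift[OF that] that in \<open>auto simp: wbound_def norm_mult norm_power\<close>)
  have "weight a ^ k * cmod (coef (f * g) a) \<le> cmod (coef (lift f * lift g) a)" for a
  proof -
    have 1: "((\<lambda>b. cmod (coef (lift f) b) * cmod (coef (lift g) (a - b))) has_sum
        (\<Sum>\<^sub>\<infinity>b. cmod (coef (lift f) b) * cmod (coef (lift g) (a - b)))) UNIV"
      by (rule has_sum_infsum[OF conv_summable])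
    have 2: "((\<lambda>b. coef (lift f) b * coef (lift g) (a - b)) has_sum
        of_real (\<Sum>\<^sub>\<infinity>b. cmod (coef (lift f) b) * cmod (coef (lift g) (a - b)))) UNIV"
      using has_sum_of_real[OF 1, where 'a = complex] by (simp add: lift[OF f] lift[OF g] norm_mult norm_power)
    have 3: "coef (lift f * lift g) a = of_real (\<Sum>\<^sub>\<infinity>b. cmod (coef (lift f) b) * cmod (coef (lift g) (a - b)))"
      using has_sum_unique[OF coef_mult_has_sum 2] .
    have "cmod (of_real (weight a ^ k) * coef (f * g) a)
        \<le> (\<Sum>\<^sub>\<infinity>b. cmod (coef (lift f) b) * cmod (coef (lift g) (a - b)))"
    proof (rule norm_infsum_le[OF has_sum_cmult_right[OF coef_mult_has_sum] 1])
      fix b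
      show "cmod (of_real (weight a ^ k) * (coef f b * coef g (a - b)))
          \<le> cmod (coef (lift f) b) * cmod (coef (lift g) (a - b))"
        using mult_right_mono[OF weight_power_mult[of a k b], of "cmod (coef f b) * cmod (coef g (a - b))"]
        by (simp add: lift[OF f] lift[OF g] norm_mult norm_power mult_ac)
    qed
    also have "\<dots> \<le> cmod (coef (lift f * lift g) a)"
      unfolding 3 by simp
    finally show ?thesis by (simp add: norm_mult norm_power)
  qed
  moreover have "wbound 0 (R * S) (lift f * lift g)"
    unfolding wbound_0_iff
    using norm_mult_ineq[of "lift f" "lift g"] mult_mono[OF norm_lift[OF f] norm_lift[OF g] wbound_nonneg[OF f]]
    by simp
  ultimately show ?thesis using wbound_le_coef[of 0 "R * S" "lift f * lift g" k "f * g" 1] by simp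
qed

lemma wbound_power: "wbound k R f \<Longrightarrow> wbound k (R ^ n) (f ^ n)"
  by (induction n) (auto intro: wbound_mult)

text \<open>The bound is an intersection of conditions on finitely many coefficients, so it survives
  limits in the unweighted norm. Fixed points can therefore be found in the weak norm and still obey
  the strong bound.\<close>

lemma closed_wbound: "closed {f. wbound k R f}"
proof -
  have "{f. wbound k R f} = (\<Inter>F\<in>{F. finite F}. {f. (\<Sum>a\<in>F. weight a ^ k * cmod (coef f a)) \<le> R})"
    by (auto simp: wbound_def)
  moreover have "closed {f. (\<Sum>a\<in>F. weight a ^ k * cmod (coef f a)) \<le> R}" for F
    by (intro closed_Collect_le continuous_intros linear_continuous_on bounded_linear_coef)
  ultimately show ?thesis by auto
qed

lemma wbound_limit:
  assumes "\<And>n. wbound k R (X n)" "X \<longlonglongrightarrow> l"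
  shows "wbound k R l"
  using closed_wbound[of k R] assms unfolding closed_sequential_limits by blast

lemma wbound_exp:
  assumes "wbound k R f"
  shows "wbound k (exp R) (exp f)"
proof (rule wbound_limit)
  show "(\<lambda>n. \<Sum>i<n. f ^ i /\<^sub>R fact i) \<longlonglongrightarrow> exp f"
    using exp_converges[of f] by (simp add: sums_def)
  fix n
  have "wbound k (\<Sum>i<n. \<bar>inverse (fact i)\<bar> * R ^ i) (\<Sum>i<n. f ^ i /\<^sub>R fact i)"
    by (intro wbound_sum wbound_scaleR wbound_power assms)
  moreover have "(\<Sum>i<n. \<bar>inverse (fact i)\<bar> * R ^ i) \<le> exp R"
    using sum_le_suminf[OF summable_exp_generic[of R], of "{..<n}"] wbound_nonneg[OF assms]
    by (simp add: exp_def)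
  ultimately show "wbound k (exp R) (\<Sum>i<n. f ^ i /\<^sub>R fact i)"
    by (rule wbound_mono[OF _ order_refl])
qed

subsection \<open>Fourier multipliers\<close>

text \<open>The function is total, but for an unbounded symbol its value is meaningful only where
  the product is summable. Hence \<open>coef_multiplier\<close> pairs a growth bound on the symbol
  with a weighted bound on the argument.\<close>

definition multiplier :: "(int \<Rightarrow> complex) \<Rightarrow> wiener \<Rightarrow> wiener" where
  "multiplier m f = Abs_wiener (\<lambda>a. m a * coef f a)"

lemma coef_multiplier:
  assumes "wbound k R f" "\<And>a. cmod (m a) \<le> C * weight a ^ k"
  shows "coef (multiplier m f) a = m a * coef f a"
proof -
  have "abs_summable (\<lambda>a. m a * coef f a)"
  proof (rule abs_summableI)
    fix F :: "int set" assume F: "finite F"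
    have C: "0 \<le> C" using order.trans[OF norm_ge_zero assms(2)[of 0]] by (simp add: weight_def)
    have "(\<Sum>a\<in>F. cmod (m a * coef f a)) \<le> C * (\<Sum>a\<in>F. weight a ^ k * cmod (coef f a))"
      unfolding sum_distrib_left norm_mult mult.assoc[symmetric] by (intro sum_mono mult_right_mono assms) auto
    also have "\<dots> \<le> C * R" using assms(1) F C by (auto simp: wbound_def intro!: mult_left_mono)
    finally show "(\<Sum>a\<in>F. cmod (m a * coef f a)) \<le> C * R" .
  qed
  then show ?thesis unfolding multiplier_def by (simp add: coef_Abs)
qed

lemma wbound_norm_0: "wbound 0 (norm f) f"
  by (simp add: wbound_0_iff)

lemma coef_multiplier_bounded:
  "(\<And>a. cmod (m a) \<le> C) \<Longrightarrow> coef (multiplier m f) a = m a * coef f a"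
  by (rule coef_multiplier[OF wbound_norm_0, where C = C]) simp

lemma wbound_multiplier:
  assumes "wbound (k + j) R f" "\<And>a. cmod (m a) \<le> C * weight a ^ j"
  shows "wbound k (C * R) (multiplier m f)"
proof (rule wbound_le_coef[OF assms(1)])
  show "0 \<le> C" using order.trans[OF norm_ge_zero assms(2)[of 0]] by (simp add: weight_def)
  fix a
  have "coef (multiplier m f) a = m a * coef f a"
    by (rule coef_multiplier[where k = j and C = C, OF wbound_mono[OF assms(1)]]) (use assms(2) in auto)
  then show "weight a ^ k * cmod (coef (multiplier m f) a) \<le> C * (weight a ^ (k + j) * cmod (coef f a))"
    using mult_right_mono[OF assms(2)[of a], of "weight a ^ k * cmod (coef f a)"]
    by (simp add: norm_mult power_add mult_ac)
qed

lemma wbound_multiplier_bounded: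
  "wbound k R f \<Longrightarrow> (\<And>a. cmod (m a) \<le> C) \<Longrightarrow> wbound k (C * R) (multiplier m f)"
  using wbound_multiplier[of k 0 R f m C] by simp

lemma norm_multiplier_le:
  "(\<And>a. cmod (m a) \<le> C) \<Longrightarrow> norm (multiplier m f) \<le> C * norm f"
  using wbound_multiplier_bounded[OF wbound_norm_0, of m C f] by (simp add: wbound_0_iff)

subsection \<open>Curves in the Wiener algebra\<close>

text \<open>One extra weight makes the modes beyond \<open>N\<close> uniformly small, of total size
  \<open>R / N\<close>; for the finitely many others coefficientwise continuity suffices.\<close>

lemma continuous_on_wienerI:
  fixes f :: "real \<Rightarrow> wiener"
  assumes c: "\<And>a. continuous_on S (\<lambda>t. coef (f t) a)" and w: "\<And>t. t \<in> S \<Longrightarrow> wbound 1 R (f t)"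
  shows "continuous_on S f"
  unfolding continuous_on_iff
proof (intro ballI allI impI)
  fix s and e :: real assume s: "s \<in> S" and e: "0 < e"
  have R: "0 \<le> R" using wbound_nonneg[OF w[OF s]] .
  \<comment> \<open>The tails at \<open>t\<close> and at \<open>s\<close> contribute
    \<open>2 * R / N\<close>, which this choice pushes below \<open>e / 2\<close>; the modes in
    \<open>I\<close> contribute at most \<open>e / 4\<close>.\<close>
  obtain N :: nat where N: "4 * R / e < real N" using reals_Archimedean2 by blast
  have N0: "0 < real N" using N R e by (meson divide_nonneg_pos le_less_trans mult_nonneg_nonneg zero_le_numeral)
  define I where "I = {- int N..int N}"
  have "continuous_on S (\<lambda>t. \<Sum>a\<in>I. cmod (coef (f t) a - coef (f s) a))"
    by (intro continuous_intros c)
  then obtain d where d: "d > 0" "\<And>t. t \<in> S \<Longrightarrow> dist t s < d \<Longrightarrow>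
      dist (\<Sum>a\<in>I. cmod (coef (f t) a - coef (f s) a)) (\<Sum>a\<in>I. cmod (coef (f s) a - coef (f s) a)) < e / 4"
    using s e unfolding continuous_on_iff by (metis divide_pos_pos zero_less_numeral)
  have "dist (f t) (f s) < e" if t: "t \<in> S" "dist t s < d" for t
  proof -
    have "norm (f t - f s) \<le> e / 4 + 2 * R / real N"
    proof (rule norm_wiener_leI)
      fix F :: "int set" assume F: "finite F"
      have tail: "real N * (\<Sum>a\<in>F - I. cmod (coef (f r) a)) \<le> R" if "r \<in> S" for r
      proof -
        have "real N * (\<Sum>a\<in>F - I. cmod (coef (f r) a)) \<le> (\<Sum>a\<in>F - I. weight a ^ 1 * cmod (coef (f r) a))"
          unfolding sum_distrib_left by (intro sum_mono mult_right_mono) (auto simp: I_def weight_def)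
        also have "\<dots> \<le> R" using w[OF that, unfolded wbound_def, rule_format, of "F - I"] F by simp
        finally show ?thesis .
      qed
      have "(\<Sum>a\<in>F. cmod (coef (f t - f s) a))
          = (\<Sum>a\<in>F \<inter> I. cmod (coef (f t - f s) a)) + (\<Sum>a\<in>F - I. cmod (coef (f t - f s) a))"
        using F by (simp add: sum.Int_Diff)
      also have "\<dots> \<le> (\<Sum>a\<in>I. cmod (coef (f t - f s) a))
          + ((\<Sum>a\<in>F - I. cmod (coef (f t) a)) + (\<Sum>a\<in>F - I. cmod (coef (f s) a)))"
        unfolding sum.distrib[symmetric]
        by (intro add_mono sum_mono2 sum_mono) (auto simp: I_def norm_triangle_ineq4)
      also have "\<dots> \<le> e / 4 + (R / real N + R / real N)"
        using d(2)[OF t] tail[OF t(1)] tail[OF s] N0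
        by (intro add_mono) (auto simp: dist_real_def field_simps sum_nonneg)
      finally show "(\<Sum>a\<in>F. cmod (coef (f t - f s) a)) \<le> e / 4 + 2 * R / real N" by simp
    qed
    moreover have "2 * R / real N < e / 2" using N N0 e by (simp add: field_simps)
    ultimately show ?thesis using e by (simp add: dist_norm)
  qed
  then show "\<exists>d>0. \<forall>t\<in>S. dist t s < d \<longrightarrow> dist (f t) (f s) < e" using d(1) by blast
qed

lemma continuous_on_coef: "continuous_on S f \<Longrightarrow> continuous_on S (\<lambda>t. coef (f t) a)"
  by (rule bounded_linear.continuous_on[OF bounded_linear_coef])

text \<open>The candidate derivative \<open>g\<close> is continuous in norm, so its primitive is
  differentiable in norm. The primitive starting at \<open>f 0\<close> has the same coefficients as
  \<open>f\<close>, since they share initial value and derivative.\<close>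

lemma has_vector_derivative_wienerI:
  assumes f: "\<And>t a. t \<in> {0..T} \<Longrightarrow> ((\<lambda>t. coef (f t) a) has_vector_derivative coef (g t) a) (at t within {0..T})"
    and c: "\<And>a. continuous_on {0..T} (\<lambda>t. coef (g t) a)" and w: "\<And>t. t \<in> {0..T} \<Longrightarrow> wbound 1 R (g t)"
    and t: "t \<in> {0..T}"
  shows "(f has_vector_derivative g t) (at t within {0..T})"
proof -
  have cg: "continuous_on {0..T} g" by (rule continuous_on_wienerI[OF c w])
  define h where "h = (\<lambda>t. f 0 + integral {0..t} g)"
  have h: "(h has_vector_derivative g t) (at t within {0..T})" if "t \<in> {0..T}" for t
    unfolding h_def
    using has_vector_derivative_add[OF has_vector_derivative_const integral_has_vector_derivative[OF cg that]] by simp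
  have eq: "f t = h t" if t: "t \<in> {0..T}" for t
  proof (rule wiener_eqI)
    fix a
    have "((\<lambda>t. coef (f t) a - coef (h t) a) has_derivative (\<lambda>_. 0)) (at t within {0..T})" if "t \<in> {0..T}" for t
      using has_vector_derivative_diff[OF f[OF that, of a] bounded_linear.has_vector_derivative[OF bounded_linear_coef[of a] h[OF that]]]
      by (simp add: has_vector_derivative_def)
    then obtain c where "\<And>t. t \<in> {0..T} \<Longrightarrow> coef (f t) a - coef (h t) a = c"
      using has_derivative_zero_constant[of "{0..T}" "\<lambda>t. coef (f t) a - coef (h t) a"] by auto
    from this[of t] this[of 0] t show "coef (f t) a = coef (h t) a" by (simp add: h_def)
  qed
  show ?thesis by (rule has_vector_derivative_transform[OF t _ h[OF t]]) (rule eq)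
qed

text \<open>Curves with \<open>j\<close> time derivatives, all bounded in the norm of weight
  \<open>k\<close>. Continuity and differentiability refer to the unweighted norm, which is what
  coefficientwise information and one spare weight deliver. The bounds are existential: this is a
  qualitative notion, closed under the algebra operations.\<close>

primrec curve :: "nat \<Rightarrow> real \<Rightarrow> nat \<Rightarrow> (real \<Rightarrow> wiener) \<Rightarrow> bool" where
  "curve 0 T k f \<longleftrightarrow> (\<exists>R. \<forall>t\<in>{0..T}. wbound k R (f t)) \<and> continuous_on {0..T} f"
| "curve (Suc j) T k f \<longleftrightarrow> (\<exists>R. \<forall>t\<in>{0..T}. wbound k R (f t)) \<and>
     (\<exists>g. (\<forall>t\<in>{0..T}. (f has_vector_derivative g t) (at t within {0..T})) \<and> curve j T k g)"

declare curve.simps [simp del]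

lemma curve_bound:
  assumes "curve j T k f"
  obtains R where "0 \<le> R" "\<And>t. t \<in> {0..T} \<Longrightarrow> wbound k R (f t)"
proof -
  obtain R where R: "\<forall>t\<in>{0..T}. wbound k R (f t)" using assms by (cases j) (auto simp: curve.simps)
  show ?thesis
  proof (rule that)
    show "wbound k \<bar>R\<bar> (f t)" if "t \<in> {0..T}" for t
      by (rule wbound_mono[OF R[rule_format, OF that] order_refl abs_ge_self])
  qed simp
qed

lemma curve_deriv:
  assumes "curve (Suc j) T k f"
  obtains g where "\<And>t. t \<in> {0..T} \<Longrightarrow> (f has_vector_derivative g t) (at t within {0..T})" "curve j T k g"
  using assms unfolding curve.simps by blast

lemma curve_continuous: "curve j T k f \<Longrightarrow> continuous_on {0..T} f"
  by (cases j) (auto simp: curve.simps intro: continuous_on_vector_derivative)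

lemma curveI:
  "(\<And>t. t \<in> {0..T} \<Longrightarrow> wbound k R (f t)) \<Longrightarrow>
   (\<And>t. t \<in> {0..T} \<Longrightarrow> (f has_vector_derivative g t) (at t within {0..T})) \<Longrightarrow> curve j T k g \<Longrightarrow> curve (Suc j) T k f"
  unfolding curve.simps by blast

lemma curve_0I: "(\<And>t. t \<in> {0..T} \<Longrightarrow> wbound k R (f t)) \<Longrightarrow> continuous_on {0..T} f \<Longrightarrow> curve 0 T k f"
  unfolding curve.simps by blast

lemma curve_Suc_D: "curve (Suc j) T k f \<Longrightarrow> curve j T k f"
proof (induction j arbitrary: f)
  case 0
  obtain R where "\<And>t. t \<in> {0..T} \<Longrightarrow> wbound k R (f t)" using curve_bound[OF 0] by metis
  then show ?case using curve_continuous[OF 0] by (rule curve_0I)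
next
  case (Suc j)
  obtain R where R: "\<And>t. t \<in> {0..T} \<Longrightarrow> wbound k R (f t)" using curve_bound[OF Suc.prems] by metis
  obtain g where g: "\<And>t. t \<in> {0..T} \<Longrightarrow> (f has_vector_derivative g t) (at t within {0..T})" "curve (Suc j) T k g"
    using curve_deriv[OF Suc.prems] by metis
  show ?case by (rule curveI[OF R g(1) Suc.IH[OF g(2)]])
qed

lemma curve_weight_mono: "curve j T k f \<Longrightarrow> k' \<le> k \<Longrightarrow> curve j T k' f"
proof (induction j arbitrary: f)
  case 0
  obtain R where "\<And>t. t \<in> {0..T} \<Longrightarrow> wbound k R (f t)" using curve_bound[OF 0(1)] by metis
  then show ?case using curve_continuous[OF 0(1)] 0(2) by (intro curve_0I) (auto intro: wbound_mono)
next
  case (Suc j)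
  obtain R where R: "\<And>t. t \<in> {0..T} \<Longrightarrow> wbound k R (f t)" using curve_bound[OF Suc.prems(1)] by metis
  obtain g where g: "\<And>t. t \<in> {0..T} \<Longrightarrow> (f has_vector_derivative g t) (at t within {0..T})" "curve j T k g"
    using curve_deriv[OF Suc.prems(1)] by metis
  show ?case by (rule curveI[OF wbound_mono[OF R Suc.prems(2) order_refl] g(1) Suc.IH[OF g(2) Suc.prems(2)]])
qed

lemma curve_mono:
  assumes "curve j T k f" "j' \<le> j" "k' \<le> k"
  shows "curve j' T k' f"
proof -
  have "curve (j' + i) T k f \<Longrightarrow> curve j' T k f" for i
    by (induction i) (auto dest: curve_Suc_D)
  then show ?thesis using assms curve_weight_mono by (metis le_Suc_ex)
qed

lemma curve_cong:
  assumes f: "curve j T k f" and eq: "\<And>t. t \<in> {0..T} \<Longrightarrow> f t = g t"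
  shows "curve j T k g"
proof -
  obtain R where R: "\<And>t. t \<in> {0..T} \<Longrightarrow> wbound k R (f t)" using curve_bound[OF f] by metis
  show ?thesis
  proof (cases j)
    case 0
    have "continuous_on {0..T} g"
      using curve_continuous[OF f] continuous_on_cong[of "{0..T}" "{0..T}" f g] eq by blast
    then show ?thesis unfolding 0 using R eq by (intro curve_0I[of T k R]) auto
  next
    case (Suc i)
    obtain f' where f': "\<And>t. t \<in> {0..T} \<Longrightarrow> (f has_vector_derivative f' t) (at t within {0..T})" "curve i T k f'"
      using curve_deriv f unfolding Suc by metis
    show ?thesis unfolding Suc
    proof (rule curveI[OF _ _ f'(2)])
      show "(g has_vector_derivative f' t) (at t within {0..T})" if "t \<in> {0..T}" for t
        by (rule has_vector_derivative_transform[OF that _ f'(1)[OF that]]) (simp add: eq)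
    qed (use R eq in auto)
  qed
qed

lemma curve_constant: "wbound k R f \<Longrightarrow> curve j T k (\<lambda>_. f)"
proof (induction j arbitrary: f R)
  case 0
  then show ?case by (intro curve_0I) auto
next
  case (Suc j)
  show ?case
    by (rule curveI[OF _ _ Suc.IH[OF wbound_0[OF order_refl]]]) (use Suc.prems in auto)
qed

lemma curve_add: "curve j T k f \<Longrightarrow> curve j T k g \<Longrightarrow> curve j T k (\<lambda>t. f t + g t)"
proof (induction j arbitrary: f g)
  case 0
  obtain R S where "\<And>t. t \<in> {0..T} \<Longrightarrow> wbound k R (f t)" "\<And>t. t \<in> {0..T} \<Longrightarrow> wbound k S (g t)"
    using curve_bound[OF 0(1)] curve_bound[OF 0(2)] by metis
  then show ?case using 0[THEN curve_continuous] by (intro curve_0I[of T k "R + S"]) (auto intro: wbound_add intro!: continuous_intros)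
next
  case (Suc j)
  obtain R S where R: "\<And>t. t \<in> {0..T} \<Longrightarrow> wbound k R (f t)" "\<And>t. t \<in> {0..T} \<Longrightarrow> wbound k S (g t)"
    using curve_bound[OF Suc.prems(1)] curve_bound[OF Suc.prems(2)] by metis
  obtain f' where f': "\<And>t. t \<in> {0..T} \<Longrightarrow> (f has_vector_derivative f' t) (at t within {0..T})" "curve j T k f'"
    using curve_deriv[OF Suc.prems(1)] by metis
  obtain g' where g': "\<And>t. t \<in> {0..T} \<Longrightarrow> (g has_vector_derivative g' t) (at t within {0..T})" "curve j T k g'"
    using curve_deriv[OF Suc.prems(2)] by metis
  show ?case
    by (rule curveI[OF wbound_add[OF R] has_vector_derivative_add[OF f'(1) g'(1)] Suc.IH[OF f'(2) g'(2)]])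
qed

lemma curve_mult: "curve j T k f \<Longrightarrow> curve j T k g \<Longrightarrow> curve j T k (\<lambda>t. f t * g t)"
proof (induction j arbitrary: f g)
  case 0
  obtain R S where "\<And>t. t \<in> {0..T} \<Longrightarrow> wbound k R (f t)" "\<And>t. t \<in> {0..T} \<Longrightarrow> wbound k S (g t)"
    using curve_bound[OF 0(1)] curve_bound[OF 0(2)] by metis
  then show ?case using 0[THEN curve_continuous] by (intro curve_0I[of T k "R * S"]) (auto intro: wbound_mult intro!: continuous_intros)
next
  case (Suc j)
  obtain R S where R: "\<And>t. t \<in> {0..T} \<Longrightarrow> wbound k R (f t)" "\<And>t. t \<in> {0..T} \<Longrightarrow> wbound k S (g t)"
    using curve_bound[OF Suc.prems(1)] curve_bound[OF Suc.prems(2)] by metis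
  obtain f' where f': "\<And>t. t \<in> {0..T} \<Longrightarrow> (f has_vector_derivative f' t) (at t within {0..T})" "curve j T k f'"
    using curve_deriv[OF Suc.prems(1)] by metis
  obtain g' where g': "\<And>t. t \<in> {0..T} \<Longrightarrow> (g has_vector_derivative g' t) (at t within {0..T})" "curve j T k g'"
    using curve_deriv[OF Suc.prems(2)] by metis
  show ?case
    by (rule curveI[OF wbound_mult[OF R] has_vector_derivative_mult[OF f'(1) g'(1)] curve_add[OF
          Suc.IH[OF curve_Suc_D[OF Suc.prems(1)] g'(2)] Suc.IH[OF f'(2) curve_Suc_D[OF Suc.prems(2)]]]])
qed

lemma curve_const_mult: "curve j T k f \<Longrightarrow> curve j T k (\<lambda>t. const c * f t)"
  by (rule curve_mult[OF curve_constant[of k "cmod c * 1"]]) (use wbound_const_mult[of k 1 1 c] in auto)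

lemma curve_minus: "curve j T k f \<Longrightarrow> curve j T k (\<lambda>t. - f t)"
  using curve_const_mult[of j T k f "-1"] by (simp add: const_minus const_1)

lemma curve_wcnj: "curve j T k f \<Longrightarrow> curve j T k (\<lambda>t. wcnj (f t))"
proof (induction j arbitrary: f)
  case 0
  obtain R where "\<And>t. t \<in> {0..T} \<Longrightarrow> wbound k R (f t)" using curve_bound[OF 0] by metis
  then show ?case using 0[THEN curve_continuous]
    by (intro curve_0I[of T k R]) (auto intro: wbound_wcnj intro!: bounded_linear.continuous_on[OF bounded_linear_wcnj])
next
  case (Suc j)
  obtain R where R: "\<And>t. t \<in> {0..T} \<Longrightarrow> wbound k R (f t)" using curve_bound[OF Suc.prems] by metis
  obtain g where g: "\<And>t. t \<in> {0..T} \<Longrightarrow> (f has_vector_derivative g t) (at t within {0..T})" "curve j T k g"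
    using curve_deriv[OF Suc.prems] by metis
  show ?case
    by (rule curveI[OF wbound_wcnj[OF R] bounded_linear.has_vector_derivative[OF bounded_linear_wcnj g(1)] Suc.IH[OF g(2)]])
qed

text \<open>One order more than the multiplier costs is given up to have continuity in time.\<close>

lemma curve_multiplier:
  assumes m: "\<And>a. cmod (m a) \<le> C * weight a ^ i"
  shows "curve j T (k + i + 1) f \<Longrightarrow> curve j T k (\<lambda>t. multiplier m (f t))"
proof (induction j arbitrary: f)
  have coef: "coef (multiplier m f) a = m a * coef f a" if "wbound (k + i + 1) R f" for f R a
    by (rule coef_multiplier[where k = i and C = C, OF wbound_mono[OF that]]) (use m in auto)
  have bnd: "wbound (k + 1) (C * R) (multiplier m f)" if "wbound (k + i + 1) R f" for f R
    by (rule wbound_multiplier[where j = i]) (use that m in \<open>auto simp: ac_simps\<close>)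
  have cont: "continuous_on {0..T} (\<lambda>t. coef (multiplier m (f t)) a)" if f: "curve j T (k + i + 1) f" for f j a
  proof -
    obtain R where R: "\<And>t. t \<in> {0..T} \<Longrightarrow> wbound (k + i + 1) R (f t)" using curve_bound[OF f] by metis
    have "continuous_on {0..T} (\<lambda>t. m a * coef (f t) a)"
      by (intro continuous_intros continuous_on_coef curve_continuous[OF f])
    then show ?thesis using coef[OF R] by (simp cong: continuous_on_cong_simp)
  qed
  {
    case 0
    obtain R where R: "\<And>t. t \<in> {0..T} \<Longrightarrow> wbound (k + i + 1) R (f t)" using curve_bound[OF 0] by metis
    show ?case
    proof (rule curve_0I)
      show "wbound k (C * R) (multiplier m (f t))" if "t \<in> {0..T}" for t
        by (rule wbound_mono[OF bnd[OF R[OF that]]]) auto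
      show "continuous_on {0..T} (\<lambda>t. multiplier m (f t))"
        by (rule continuous_on_wienerI[OF cont[OF 0] wbound_mono[OF bnd[OF R]]]) auto
    qed
  next
    case (Suc j)
    obtain R where R: "\<And>t. t \<in> {0..T} \<Longrightarrow> wbound (k + i + 1) R (f t)" using curve_bound[OF Suc.prems] by metis
    obtain g where g: "\<And>t. t \<in> {0..T} \<Longrightarrow> (f has_vector_derivative g t) (at t within {0..T})" "curve j T (k + i + 1) g"
      using curve_deriv[OF Suc.prems] by metis
    obtain S where S: "\<And>t. t \<in> {0..T} \<Longrightarrow> wbound (k + i + 1) S (g t)" using curve_bound[OF g(2)] by metis
    show ?case
    proof (rule curveI[of T k "C * R" _ "\<lambda>t. multiplier m (g t)"])
      show "wbound k (C * R) (multiplier m (f t))" if "t \<in> {0..T}" for t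
        by (rule wbound_mono[OF bnd[OF R[OF that]]]) auto
      show "curve j T k (\<lambda>t. multiplier m (g t))" by (rule Suc.IH[OF g(2)])
      fix t assume t: "t \<in> {0..T}"
      show "((\<lambda>t. multiplier m (f t)) has_vector_derivative multiplier m (g t)) (at t within {0..T})"
      proof (rule has_vector_derivative_wienerI[OF _ cont[OF g(2)] wbound_mono[OF bnd[OF S]] t])
        fix t a assume t: "t \<in> {0..T}"
        have "((\<lambda>t. m a * coef (f t) a) has_vector_derivative m a * coef (g t) a) (at t within {0..T})"
          by (intro bounded_linear.has_vector_derivative[OF bounded_linear_mult_right]
              bounded_linear.has_vector_derivative[OF bounded_linear_coef] g t)
        then show "((\<lambda>t. coef (multiplier m (f t)) a) has_vector_derivative coef (multiplier m (g t)) a) (at t within {0..T})"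
          unfolding coef[OF S[OF t]]
          by (rule has_vector_derivative_transform[OF t, rotated]) (simp add: coef[OF R])
      qed auto
    qed
  }
qed

section \<open>Unitary groups of Fourier multipliers\<close>

lemma has_vector_derivative_exp_i:
  "((\<lambda>t. exp (\<i> * of_real (r * t))) has_vector_derivative \<i> * of_real r * exp (\<i> * of_real (r * t))) (at t within S)"
proof -
  have "((\<lambda>z. exp (\<i> * of_real r * z)) has_field_derivative \<i> * of_real r * exp (\<i> * of_real r * of_real t)) (at (of_real t))"
    by (auto intro!: derivative_eq_intros)
  from has_vector_derivative_real_field[OF this] show ?thesis by (simp add: mult.assoc)
qed

text \<open>The group \<open>exp (i t \<theta>(D))\<close>. It is the kinetic flow for
  \<open>half_square\<close>, gives the two halves of the Klein-Gordon group for plus and minus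
  \<open>kg_freq\<close>, and is translation in space when \<open>\<theta>\<close> is the
  identity.\<close>

definition twist :: "(int \<Rightarrow> real) \<Rightarrow> real \<Rightarrow> wiener \<Rightarrow> wiener" where
  "twist \<theta> t = multiplier (\<lambda>a. exp (\<i> * of_real (\<theta> a * t)))"

lemma coef_twist [simp]: "coef (twist \<theta> t f) a = exp (\<i> * of_real (\<theta> a * t)) * coef f a"
  unfolding twist_def by (rule coef_multiplier_bounded[of _ 1]) (simp add: norm_exp_i_times)

lemma wbound_twist [simp]: "wbound k R (twist \<theta> t f) \<longleftrightarrow> wbound k R f"
  by (simp add: wbound_def norm_mult del: of_real_mult)

lemma norm_twist [simp]: "norm (twist \<theta> t f) = norm f"
  by (simp add: norm_wiener_def norm_mult del: of_real_mult)

lemma twist_add: "twist \<theta> t (f + g) = twist \<theta> t f + twist \<theta> t g"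
  and twist_diff: "twist \<theta> t (f - g) = twist \<theta> t f - twist \<theta> t g"
  and twist_scaleR: "twist \<theta> t (r *\<^sub>R f) = r *\<^sub>R twist \<theta> t f"
  and twist_0 [simp]: "twist \<theta> 0 f = f"
  and twist_twist: "twist \<theta> s (twist \<theta> t f) = twist \<theta> (s + t) f"
  by (auto intro!: wiener_eqI simp: algebra_simps exp_add)

text \<open>Each coefficient obeys the product rule. The weight 4 on \<open>f\<close> is 2 for the
  symbol, 1 for continuity and 1 to be left over for
  \<open>has_vector_derivative_wienerI\<close>.\<close>

lemma has_vector_derivative_twist:
  assumes \<theta>: "\<And>a. \<bar>\<theta> a\<bar> \<le> C * weight a ^ 2"
    and f: "\<And>t. t \<in> {0..T} \<Longrightarrow> (f has_vector_derivative g t) (at t within {0..T})"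
    and cf: "curve 0 T 4 f" and cg: "curve 0 T 1 g" and t: "t \<in> {0..T}"
  shows "((\<lambda>t. twist \<theta> t (f t)) has_vector_derivative
    twist \<theta> t (g t + multiplier (\<lambda>a. \<i> * of_real (\<theta> a)) (f t))) (at t within {0..T})"
proof -
  define g' where "g' = (\<lambda>t. g t + multiplier (\<lambda>a. \<i> * of_real (\<theta> a)) (f t))"
  have m: "cmod (\<i> * of_real (\<theta> a)) \<le> C * weight a ^ 2" for a
    using \<theta>[of a] by (simp add: norm_mult)
  have g': "curve 0 T 1 g'"
    unfolding g'_def by (intro curve_add curve_multiplier[OF m] cg) (use cf in \<open>simp add: numeral_eq_Suc\<close>)
  obtain R where R: "\<And>t. t \<in> {0..T} \<Longrightarrow> wbound 4 R (f t)" using curve_bound[OF cf] by metis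
  obtain S where S: "\<And>t. t \<in> {0..T} \<Longrightarrow> wbound 1 S (g' t)" using curve_bound[OF g'] by metis
  have "((\<lambda>t. twist \<theta> t (f t)) has_vector_derivative twist \<theta> t (g' t)) (at t within {0..T})"
  proof (rule has_vector_derivative_wienerI[OF _ _ wbound_twist[THEN iffD2, OF S] t])
    show "continuous_on {0..T} (\<lambda>t. coef (twist \<theta> t (g' t)) a)" for a
      unfolding coef_twist by (intro continuous_intros continuous_on_coef curve_continuous[OF g'])
    fix t a assume t: "t \<in> {0..T}"
    have m': "coef (multiplier (\<lambda>a. \<i> * of_real (\<theta> a)) (f t)) a = \<i> * of_real (\<theta> a) * coef (f t) a"
      by (rule coef_multiplier[OF wbound_mono[OF R[OF t]] m]) auto
    show "((\<lambda>t. coef (twist \<theta> t (f t)) a) has_vector_derivative coef (twist \<theta> t (g' t)) a) (at t within {0..T})"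
      unfolding coef_twist
      by (rule has_vector_derivative_eq_rhs[OF has_vector_derivative_mult[OF has_vector_derivative_exp_i
            bounded_linear.has_vector_derivative[OF bounded_linear_coef f[OF t]]]])
         (simp add: g'_def m' algebra_simps)
  qed auto
  then show ?thesis by (simp only: g'_def)
qed

text \<open>Each time derivative brings down the symbol once, at the price of 2 weights and 1 for
  continuity; the final 1 is for continuity of the twisted curve itself.\<close>

lemma curve_twist:
  assumes \<theta>: "\<And>a. \<bar>\<theta> a\<bar> \<le> C * weight a ^ 2"
  shows "curve j T (k + 3 * j + 1) f \<Longrightarrow> curve j T k (\<lambda>t. twist \<theta> t (f t))"
proof (induction j arbitrary: f)
  case 0
  obtain R where R: "\<And>t. t \<in> {0..T} \<Longrightarrow> wbound (k + 1) R (f t)" using curve_bound[OF 0] by auto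
  have "continuous_on {0..T} (\<lambda>t. coef (twist \<theta> t (f t)) a)" for a
    unfolding coef_twist by (intro continuous_intros continuous_on_coef curve_continuous[OF 0])
  then show ?case
    by (intro curve_0I[of T k R] continuous_on_wienerI[of _ _ R]) (auto intro: wbound_mono[OF R])
next
  case (Suc j)
  obtain R where R: "\<And>t. t \<in> {0..T} \<Longrightarrow> wbound (k + 3 * Suc j + 1) R (f t)" using curve_bound[OF Suc.prems] by metis
  obtain g where g: "\<And>t. t \<in> {0..T} \<Longrightarrow> (f has_vector_derivative g t) (at t within {0..T})" "curve j T (k + 3 * Suc j + 1) g"
    using curve_deriv[OF Suc.prems] by metis
  have m: "cmod (\<i> * of_real (\<theta> a)) \<le> C * weight a ^ 2" for a
    using \<theta>[of a] by (simp add: norm_mult)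
  have g': "curve j T (k + 3 * j + 1) (\<lambda>t. g t + multiplier (\<lambda>a. \<i> * of_real (\<theta> a)) (f t))"
    by (intro curve_add curve_multiplier[OF m] curve_weight_mono[OF g(2)])
       (use curve_Suc_D[OF Suc.prems] in \<open>auto simp: algebra_simps numeral_eq_Suc\<close>)
  show ?case
  proof (rule curveI[OF wbound_twist[THEN iffD2, OF wbound_mono[OF R]]
        has_vector_derivative_twist[OF \<theta> g(1) curve_mono[OF Suc.prems] curve_mono[OF g(2)]] Suc.IH[OF g']])
  qed auto
qed

subsection \<open>Fixed points, Gronwall and Taylor estimates\<close>

text \<open>The contraction is phrased with pointwise bounds \<open>M\<close>, and the iterates are
  summed as a telescoping series with terms below \<open>M / 2^n\<close>. The closed set
  \<open>B\<close> will be a ball of a stronger norm than the one in which the map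
  contracts.\<close>

lemma picard_fixed_point:
  fixes \<Psi> :: "(real \<Rightarrow> 'a::banach) \<Rightarrow> real \<Rightarrow> 'a"
  assumes T: "0 \<le> T" and B: "closed B" "x0 \<in> B"
    and inv: "\<And>u. continuous_on {0..T} u \<Longrightarrow> u ` {0..T} \<subseteq> B \<Longrightarrow>
      continuous_on {0..T} (\<Psi> u) \<and> \<Psi> u ` {0..T} \<subseteq> B"
    and contr: "\<And>u v M t. continuous_on {0..T} u \<Longrightarrow> u ` {0..T} \<subseteq> B \<Longrightarrow> continuous_on {0..T} v \<Longrightarrow> v ` {0..T} \<subseteq> B \<Longrightarrow>
      (\<And>t. t \<in> {0..T} \<Longrightarrow> norm (u t - v t) \<le> M) \<Longrightarrow> t \<in> {0..T} \<Longrightarrow> norm (\<Psi> u t - \<Psi> v t) \<le> M / 2"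
  obtains u where "continuous_on {0..T} u" "u ` {0..T} \<subseteq> B" "\<And>t. t \<in> {0..T} \<Longrightarrow> u t = \<Psi> u t"
proof -
  define u where "u = (\<lambda>n. (\<Psi> ^^ n) (\<lambda>_. x0))"
  have u_Suc: "u (Suc n) = \<Psi> (u n)" for n by (simp add: u_def)
  have u: "continuous_on {0..T} (u n) \<and> u n ` {0..T} \<subseteq> B" for n
  proof (induction n)
    case 0
    then show ?case using B(2) by (auto simp: u_def)
  next
    case (Suc n)
    then show ?case unfolding u_Suc using inv by blast
  qed
  have "compact ((\<lambda>t. u 1 t - u 0 t) ` {0..T})"
    by (intro compact_continuous_image continuous_on_diff) (use u in auto)
  then have "bounded ((\<lambda>t. u 1 t - u 0 t) ` {0..T})" by (rule compact_imp_bounded)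
  then obtain M where M: "\<And>t. t \<in> {0..T} \<Longrightarrow> norm (u 1 t - u 0 t) \<le> M"
    unfolding bounded_iff by blast
  have step: "norm (u (Suc n) t - u n t) \<le> M * (1 / 2) ^ n" if "t \<in> {0..T}" for n t
    using that
  proof (induction n arbitrary: t)
    case 0
    then show ?case using M by simp
  next
    case (Suc n)
    have "norm (u (Suc (Suc n)) t - u (Suc n) t) \<le> (M * (1 / 2) ^ n) / 2"
      unfolding u_Suc[of "Suc n"] u_Suc[of n]
      by (rule contr) (use u[of n] u[of "Suc n"] Suc in \<open>auto simp flip: u_Suc\<close>)
    then show ?case by simp
  qed
  have ul: "uniform_limit {0..T} (\<lambda>n t. \<Sum>i<n. u (Suc i) t - u i t) (\<lambda>t. \<Sum>i. u (Suc i) t - u i t) sequentially"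
    by (rule Weierstrass_m_test[where M = "\<lambda>n. M * (1 / 2) ^ n"]) (use step in \<open>auto intro!: summable_mult\<close>)
  define l where "l = (\<lambda>t. u 0 t + (\<Sum>i. u (Suc i) t - u i t))"
  have tele: "(\<Sum>i<n. u (Suc i) t - u i t) = u n t - u 0 t" for n t
    by (induction n) auto
  have lim: "uniform_limit {0..T} u l sequentially"
    using uniform_limit_add[OF uniform_limit_const[where c = "u 0"] ul]
    by (simp add: l_def tele)
  have cont: "continuous_on {0..T} l"
    by (rule uniform_limit_theorem[OF _ lim]) (use u in auto)
  have pt: "(\<lambda>n. u n t) \<longlonglongrightarrow> l t" if "t \<in> {0..T}" for t
    using lim that by (rule tendsto_uniform_limitI)
  have lB: "l ` {0..T} \<subseteq> B"
  proof safe
    fix t assume t: "t \<in> {0..T}"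
    show "l t \<in> B"
      by (rule closed_sequentially[OF B(1) _ pt[OF t]]) (use u t in blast)
  qed
  have fix_eq: "l t = \<Psi> l t" if t: "t \<in> {0..T}" for t
  proof (rule LIMSEQ_unique)
    show "(\<lambda>n. u (Suc n) t) \<longlonglongrightarrow> l t" using pt[OF t] by (rule LIMSEQ_Suc)
    show "(\<lambda>n. u (Suc n) t) \<longlonglongrightarrow> \<Psi> l t"
    proof (rule LIMSEQ_I)
      fix e :: real assume e: "e > 0"
      have "\<forall>\<^sub>F n in sequentially. \<forall>t\<in>{0..T}. dist (u n t) (l t) < e"
        using lim e by (auto simp: uniform_limit_iff)
      then obtain N where N: "\<And>n t. n \<ge> N \<Longrightarrow> t \<in> {0..T} \<Longrightarrow> norm (u n t - l t) < e"
        unfolding eventually_sequentially dist_norm by blast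
      have "norm (u (Suc n) t - \<Psi> l t) < e" if n: "n \<ge> N" for n
      proof -
        have "norm (\<Psi> (u n) t - \<Psi> l t) \<le> e / 2"
        proof (rule contr[OF _ _ cont lB _ t])
          show "norm (u n t - l t) \<le> e" if "t \<in> {0..T}" for t
            using N[OF n that] by simp
        qed (use u in auto)
        then show ?thesis using e by (simp add: u_Suc)
      qed
      then show "\<exists>no. \<forall>n\<ge>no. norm (u (Suc n) t - \<Psi> l t) < e" by blast
    qed
  qed
  show ?thesis by (rule that[OF cont lB fix_eq])
qed

text \<open>The function \<open>\<phi>\<close> need not be measurable, hence the continuous majorants.\<close>

lemma gronwall_majorant:
  fixes \<phi> :: "real \<Rightarrow> real"
  assumes L: "0 \<le> L" and bound: "\<And>t. t \<in> {0..T} \<Longrightarrow> \<phi> t \<le> M"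
    and step: "\<And>\<psi> t. continuous_on {0..T} \<psi> \<Longrightarrow> (\<And>t. t \<in> {0..T} \<Longrightarrow> \<phi> t \<le> \<psi> t) \<Longrightarrow> t \<in> {0..T} \<Longrightarrow>
      \<phi> t \<le> A + L * integral {0..t} \<psi>"
    and t: "t \<in> {0..T}"
  shows "\<phi> t \<le> A * exp (L * t)"
proof -
  \<comment> \<open>The iterates of \<open>\<psi> \<mapsto> A + L * integral {0..t} \<psi>\<close>
    started from the constant \<open>M\<close>: a partial exponential sum times \<open>A\<close>,
    and a remainder that tends to 0.\<close>
  define \<psi> where "\<psi> = (\<lambda>n t. A * (\<Sum>j<n. (L * t) ^ j / fact j) + M * ((L * t) ^ n / fact n))"
  have cont: "continuous_on S (\<psi> n)" for n S
    unfolding \<psi>_def by (intro continuous_intros) auto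
  have int: "A + L * integral {0..t} (\<psi> n) = \<psi> (Suc n) t" if t: "0 \<le> t" for n t
  proof -
    have p: "((\<lambda>s. L * (L * s) ^ j / fact j) has_integral ((L * t) ^ Suc j / fact (Suc j) - (L * 0) ^ Suc j / fact (Suc j))) {0..t}" for j
    proof (rule fundamental_theorem_of_calculus[OF t])
      fix x
      have "((\<lambda>s. (L * s) ^ Suc j / fact (Suc j)) has_real_derivative (real (Suc j) * (L * x) ^ j * L / fact (Suc j))) (at x within {0..t})"
        by (auto intro!: derivative_eq_intros simp del: power_Suc fact_Suc simp: ac_simps)
      moreover have "real (Suc j) * (L * x) ^ j * L / fact (Suc j) = L * (L * x) ^ j / fact j"
        by (simp add: field_simps del: of_nat_Suc)
      ultimately show "((\<lambda>s. (L * s) ^ Suc j / fact (Suc j)) has_vector_derivative L * (L * x) ^ j / fact j) (at x within {0..t})"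
        unfolding has_real_derivative_iff_has_vector_derivative by (rule has_vector_derivative_eq_rhs)
    qed
    have hi: "((\<lambda>s. A * (\<Sum>j<n. L * (L * s) ^ j / fact j) + M * (L * (L * s) ^ n / fact n)) has_integral
        (A * (\<Sum>j<n. (L * t) ^ Suc j / fact (Suc j) - (L * 0) ^ Suc j / fact (Suc j))
          + M * ((L * t) ^ Suc n / fact (Suc n) - (L * 0) ^ Suc n / fact (Suc n)))) {0..t}"
      by (intro has_integral_add has_integral_mult_right has_integral_sum p) auto
    have eq: "(\<lambda>s. A * (\<Sum>j<n. L * (L * s) ^ j / fact j) + M * (L * (L * s) ^ n / fact n)) = (\<lambda>s. L * \<psi> n s)"
      by (auto simp: \<psi>_def algebra_simps sum_distrib_left)
    have "integral {0..t} (\<lambda>s. L * \<psi> n s) = A * (\<Sum>j<n. (L * t) ^ Suc j / fact (Suc j)) + M * ((L * t) ^ Suc n / fact (Suc n))"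
      using integral_unique[OF hi] unfolding eq by simp
    moreover have "(\<Sum>j<Suc n. (L * t) ^ j / fact j) = 1 + (\<Sum>j<n. (L * t) ^ Suc j / fact (Suc j))"
      by (subst sum.lessThan_Suc_shift) simp
    moreover have "integral {0..t} (\<lambda>s. L * \<psi> n s) = L * integral {0..t} (\<psi> n)" by simp
    moreover have "\<psi> (Suc n) t = A * (\<Sum>j<Suc n. (L * t) ^ j / fact j) + M * ((L * t) ^ Suc n / fact (Suc n))"
      by (simp only: \<psi>_def)
    ultimately show ?thesis by (simp only: distrib_left mult_1_right add.assoc)
  qed
  have le: "\<phi> t \<le> \<psi> n t" if "t \<in> {0..T}" for n t
    using that
  proof (induction n arbitrary: t)
    case 0
    then show ?case using bound by (simp add: \<psi>_def)
  next
    case (Suc n)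
    have "\<phi> t \<le> A + L * integral {0..t} (\<psi> n)"
      by (rule step[OF cont Suc.IH Suc.prems])
    then show ?case using int Suc.prems by simp
  qed
  have "(\<lambda>n. \<psi> n t) \<longlonglongrightarrow> A * exp (L * t) + M * 0"
    unfolding \<psi>_def
  proof (intro tendsto_intros)
    show "(\<lambda>n. \<Sum>j<n. (L * t) ^ j / fact j) \<longlonglongrightarrow> exp (L * t)"
      using exp_converges[of "L * t"] by (simp add: sums_def field_simps)
    show "(\<lambda>n. (L * t) ^ n / fact n) \<longlonglongrightarrow> 0"
      using summable_LIMSEQ_zero[OF summable_exp[of "L * t"]] by (simp add: field_simps)
  qed
  then show ?thesis using le[OF t] by (intro LIMSEQ_le_const[of _ "A * exp (L * t)" "\<phi> t"]) auto
qed

section \<open>Increments, the trapezoidal rule and the exponential\<close>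

lemma increment_bound:
  fixes f :: "real \<Rightarrow> 'a::real_normed_vector"
  assumes f: "\<And>t. t \<in> {0..T} \<Longrightarrow> (f has_vector_derivative f' t) (at t within {0..T})"
    and b: "\<And>t. t \<in> {0..T} \<Longrightarrow> norm (f' t) \<le> B" and st: "s \<in> {0..T}" "t \<in> {0..T}"
  shows "norm (f t - f s) \<le> B * \<bar>t - s\<bar>"
proof -
  have "norm (f t - f s) \<le> B * norm (t - s)"
  proof (rule differentiable_bound[of "{0..T}" f "\<lambda>t h. h *\<^sub>R f' t"])
    show "onorm (\<lambda>h. h *\<^sub>R f' t) \<le> B" if "t \<in> {0..T}" for t
      using b[OF that] by (intro onorm_le) (simp add: mult.commute[of B] mult_left_mono)
  qed (use f st in \<open>auto simp: has_vector_derivative_def\<close>)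
  then show ?thesis by simp
qed

text \<open>As a function of its right end the defect \<open>Q\<close> has derivative
  \<open>- P / 2\<close>, and \<open>P\<close> has derivative \<open>- (r - s) w3 r\<close>. Both
  vanish at \<open>s\<close>, so two mean value estimates give the third order.\<close>

lemma trapezoid_bound:
  fixes w :: "real \<Rightarrow> 'a::real_normed_vector"
  assumes d1: "\<And>t. t \<in> {0..T} \<Longrightarrow> (w has_vector_derivative w1 t) (at t within {0..T})"
    and d2: "\<And>t. t \<in> {0..T} \<Longrightarrow> (w1 has_vector_derivative w2 t) (at t within {0..T})"
    and d3: "\<And>t. t \<in> {0..T} \<Longrightarrow> (w2 has_vector_derivative w3 t) (at t within {0..T})"
    and b: "\<And>t. t \<in> {0..T} \<Longrightarrow> norm (w3 t) \<le> B" and st: "0 \<le> s" "s \<le> t" "t \<le> T"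
  shows "norm (w s + ((t - s) / 2) *\<^sub>R (w1 s + w1 t) - w t) \<le> B * (t - s) ^ 3"
proof -
  have sub: "{s..t} \<subseteq> {0..T}" using st by auto
  note ws = has_vector_derivative_within_subset[OF _ sub]
  have B: "0 \<le> B" using b[of s] st norm_ge_zero[of "w3 s"] by (auto intro: order.trans simp del: norm_ge_zero)
  have D1: "(w has_vector_derivative w1 r) (at r within {s..t})" 
    "(w1 has_vector_derivative w2 r) (at r within {s..t})"
    "(w2 has_vector_derivative w3 r) (at r within {s..t})" if "r \<in> {s..t}" for r
    using that sub by (auto intro!: ws d1 d2 d3)
  have diff_bound: "norm (F r - F s) \<le> C * \<bar>r - s\<bar>"
    if dF: "\<And>r. r \<in> {s..t} \<Longrightarrow> (F has_vector_derivative F' r) (at r within {s..t})"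
      and bd: "\<And>r. r \<in> {s..t} \<Longrightarrow> norm (F' r) \<le> C" and r: "r \<in> {s..t}" for F :: "real \<Rightarrow> 'a" and F' C r
  proof -
    have "norm (F r - F s) \<le> C * norm (r - s)"
    proof (rule differentiable_bound[of "{s..t}" F "\<lambda>t h. h *\<^sub>R F' t"])
      show "onorm (\<lambda>h. h *\<^sub>R F' q) \<le> C" if "q \<in> {s..t}" for q
        using bd[OF that] by (intro onorm_le) (simp add: mult.commute[of C] mult_left_mono)
    qed (use dF r st in \<open>auto simp: has_vector_derivative_def\<close>)
    then show ?thesis by simp
  qed
  define P where "P = (\<lambda>r. w1 r - w1 s - (r - s) *\<^sub>R w2 r)"
  have P: "norm (P r) \<le> B * (t - s) ^ 2" if r: "r \<in> {s..t}" for r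
  proof -
    have "norm (P r - P s) \<le> (B * (t - s)) * \<bar>r - s\<bar>"
    proof (rule diff_bound[OF _ _ r])
      fix r assume r: "r \<in> {s..t}"
      show "(P has_vector_derivative - ((r - s) *\<^sub>R w3 r)) (at r within {s..t})"
        unfolding P_def
        by (rule has_vector_derivative_eq_rhs, (rule derivative_intros D1 r)+) (use D1[OF r] in \<open>auto intro!: derivative_eq_intros\<close>)
      show "norm (- ((r - s) *\<^sub>R w3 r)) \<le> B * (t - s)"
        using r b[of r] sub mult_mono[of "r - s" "t - s" "norm (w3 r)" B] B by (auto simp: mult.commute)
    qed
    also have "\<dots> \<le> (B * (t - s)) * (t - s)"
      using r B st by (intro mult_left_mono) auto
    finally show ?thesis by (simp add: P_def power2_eq_square)
  qed
  define Q where "Q = (\<lambda>r. w s + ((r - s) / 2) *\<^sub>R (w1 s + w1 r) - w r)"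
  have "norm (Q t - Q s) \<le> (B * (t - s) ^ 2) * \<bar>t - s\<bar>"
  proof (rule diff_bound)
    fix r assume r: "r \<in> {s..t}"
    have "(Q has_vector_derivative (((r - s) / 2) *\<^sub>R w2 r + (1 / 2) *\<^sub>R (w1 s + w1 r)) - w1 r) (at r within {s..t})"
      unfolding Q_def
      by (rule has_vector_derivative_eq_rhs, (rule derivative_intros D1 r)+) (use D1[OF r] in \<open>auto intro!: derivative_eq_intros\<close>)
    moreover have "(((r - s) / 2) *\<^sub>R w2 r + (1 / 2) *\<^sub>R (w1 s + w1 r)) - w1 r = - ((1 / 2) *\<^sub>R P r)"
    proof -
      define y where "y = (1 / 2) *\<^sub>R w1 r"
      have "w1 r = y + y" by (simp add: y_def flip: scaleR_left.add)
      moreover have "(1 / 2) *\<^sub>R P r = y - (1 / 2) *\<^sub>R w1 s - ((r - s) / 2) *\<^sub>R w2 r"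
        by (simp add: P_def y_def scaleR_diff_right)
      moreover have "(1 / 2) *\<^sub>R (w1 s + w1 r) = (1 / 2) *\<^sub>R w1 s + y"
        by (simp add: y_def scaleR_add_right)
      ultimately show ?thesis by simp
    qed
    ultimately show "(Q has_vector_derivative - ((1 / 2) *\<^sub>R P r)) (at r within {s..t})" by simp
    show "norm (- ((1 / 2) *\<^sub>R P r)) \<le> B * (t - s) ^ 2" 
      using order.trans[OF norm_ge_zero P[OF r]] P[OF r] by simp
  qed (use st in auto)
  then show ?thesis using st by (simp add: Q_def power3_eq_cube power2_eq_square mult.assoc)
qed

lemma norm_exp_minus_1:
  fixes x :: "'a::{real_normed_algebra_1, banach}"
  shows "norm (exp x - 1) \<le> norm x * exp (norm x)"
proof -
  have s: "(\<lambda>n. x ^ Suc n /\<^sub>R fact (Suc n)) sums (exp x - 1)"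
    using sums_split_initial_segment[OF exp_converges[of x], of 1] by simp
  have t: "(\<lambda>n. norm x * (norm x ^ n /\<^sub>R fact n)) sums (norm x * exp (norm x))"
    by (intro sums_mult exp_converges)
  have "norm (suminf (\<lambda>n. x ^ Suc n /\<^sub>R fact (Suc n))) \<le> suminf (\<lambda>n. norm x * (norm x ^ n /\<^sub>R fact n))"
  proof (rule norm_suminf_le[OF _ sums_summable[OF t]])
    fix n
    have "norm (x ^ Suc n) \<le> norm x ^ Suc n" by (rule norm_power_ineq)
    moreover have "inverse (fact (Suc n)) \<le> (inverse (fact n) :: real)"
      by (intro le_imp_inverse_le fact_mono) auto
    ultimately show "norm (x ^ Suc n /\<^sub>R fact (Suc n)) \<le> norm x * (norm x ^ n /\<^sub>R fact n)"
      using mult_mono[of "inverse (fact (Suc n))" "inverse (fact n) :: real" "norm (x ^ Suc n)" "norm x ^ Suc n"]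
      by (simp add: mult_ac)
  qed
  then show ?thesis using s t by (simp add: sums_iff)
qed

lemma norm_exp_taylor2:
  fixes x :: "'a::{real_normed_algebra_1, banach}"
  shows "norm (exp x - (1 + x + x ^ 2 /\<^sub>R 2)) \<le> norm x ^ 3 * exp (norm x)"
proof -
  have s: "(\<lambda>n. x ^ (n + 3) /\<^sub>R fact (n + 3)) sums (exp x - (1 + x + x ^ 2 /\<^sub>R 2))"
    using sums_split_initial_segment[OF exp_converges[of x], of 3] by (simp add: numeral_eq_Suc)
  have t: "(\<lambda>n. norm x ^ 3 * (norm x ^ n /\<^sub>R fact n)) sums (norm x ^ 3 * exp (norm x))"
    by (intro sums_mult exp_converges)
  have "norm (suminf (\<lambda>n. x ^ (n + 3) /\<^sub>R fact (n + 3))) \<le> suminf (\<lambda>n. norm x ^ 3 * (norm x ^ n /\<^sub>R fact n))"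
  proof (rule norm_suminf_le[OF _ sums_summable[OF t]])
    fix n
    have "norm (x ^ (n + 3)) \<le> norm x ^ (n + 3)" by (rule norm_power_ineq)
    moreover have "inverse (fact (n + 3)) \<le> (inverse (fact n) :: real)"
      by (intro le_imp_inverse_le fact_mono) auto
    ultimately show "norm (x ^ (n + 3) /\<^sub>R fact (n + 3)) \<le> norm x ^ 3 * (norm x ^ n /\<^sub>R fact n)"
      using mult_mono[of "inverse (fact (n + 3))" "inverse (fact n) :: real" "norm (x ^ (n + 3))" "norm x ^ (n + 3)"]
      by (simp add: power_add mult_ac)
  qed
  then show ?thesis using s t by (simp add: sums_iff)
qed

text \<open>By commutativity the difference is \<open>exp y * (exp (x - y) - 1)\<close>; the
  exponents add up to at most \<open>R + 2 R\<close>.\<close>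

lemma norm_exp_diff:
  fixes x y :: wiener
  assumes "norm x \<le> R" "norm y \<le> R"
  shows "norm (exp x - exp y) \<le> norm (x - y) * exp (3 * R)"
proof -
  have "exp x = exp y * exp (x - y)"
    by (subst exp_add_commuting[symmetric]) (auto simp: mult.commute)
  then have "exp x - exp y = exp y * (exp (x - y) - 1)" by (simp add: algebra_simps)
  also have "norm \<dots> \<le> norm (exp y) * norm (exp (x - y) - 1)" by (rule norm_mult_ineq)
  also have "\<dots> \<le> exp (norm y) * (norm (x - y) * exp (norm (x - y)))"
    by (intro mult_mono norm_exp norm_exp_minus_1) auto
  also have "\<dots> = norm (x - y) * exp (norm y + norm (x - y))" by (simp add: exp_add)
  also have "\<dots> \<le> norm (x - y) * exp (3 * R)"
    using assms norm_triangle_ineq4[of x y] by (intro mult_left_mono) auto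
  finally show ?thesis .
qed

section \<open>Integrals of curves\<close>

lemma coef_integral:
  assumes "F integrable_on S"
  shows "coef (integral S F) a = integral S (\<lambda>s. coef (F s) a)"
  using integral_linear[OF assms bounded_linear_coef[of a]] by (simp add: o_def)

text \<open>The integrand is continuous only in the unweighted norm, so the weighted bound is
  obtained by exchanging the integral with finite sums of weighted coefficients.\<close>

lemma wbound_integral:
  assumes F: "continuous_on {0..t} F" and w: "\<And>s. s \<in> {0..t} \<Longrightarrow> wbound k R (F s)" and t: "0 \<le> t"
  shows "wbound k (t * R) (integral {0..t} F)"
  unfolding wbound_def
proof (intro allI impI)
  fix I :: "int set" assume I: "finite I"
  have c: "continuous_on {0..t} (\<lambda>s. coef (F s) a)" for a by (rule continuous_on_coef[OF F])
  have "(\<Sum>a\<in>I. weight a ^ k * cmod (coef (integral {0..t} F) a))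
      \<le> (\<Sum>a\<in>I. weight a ^ k * integral {0..t} (\<lambda>s. cmod (coef (F s) a)))"
    unfolding coef_integral[OF integrable_continuous_interval[OF F]]
    by (intro sum_mono mult_left_mono integral_norm_bound_integral integrable_continuous_interval continuous_intros c) auto
  also have "\<dots> = integral {0..t} (\<lambda>s. \<Sum>a\<in>I. weight a ^ k * cmod (coef (F s) a))"
    by (subst integral_sum[OF I]) (auto intro!: integrable_continuous_interval continuous_intros c)
  also have "\<dots> \<le> integral {0..t} (\<lambda>s. R)"
    by (intro integral_le integrable_continuous_interval continuous_intros c)
       (use w I in \<open>auto simp: wbound_def\<close>)
  also have "\<dots> = t * R" using t by simp
  finally show "(\<Sum>a\<in>I. weight a ^ k * cmod (coef (integral {0..t} F) a)) \<le> t * R" .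
qed

lemma norm_integral_le:
  fixes F :: "real \<Rightarrow> wiener"
  assumes F: "continuous_on {0..t} F" and w: "\<And>s. s \<in> {0..t} \<Longrightarrow> norm (F s) \<le> R" and t: "0 \<le> t"
  shows "norm (integral {0..t} F) \<le> t * R"
  using wbound_integral[OF F, of 0 R] w t by (simp add: wbound_0_iff)

lemma curve_integral:
  assumes F: "curve j T k F" and g: "wbound k R0 g"
  shows "curve (Suc j) T k (\<lambda>t. g + integral {0..t} F)"
proof -
  obtain R where R: "0 \<le> R" "\<And>t. t \<in> {0..T} \<Longrightarrow> wbound k R (F t)" using curve_bound[OF F] by metis
  show ?thesis
  proof (rule curveI[OF _ _ F])
    fix t assume t: "t \<in> {0..T}"
    have "wbound k (t * R) (integral {0..t} F)"
      by (rule wbound_integral[OF continuous_on_subset[OF curve_continuous[OF F]] R(2)]) (use t in auto)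
    then show "wbound k (R0 + T * R) (g + integral {0..t} F)"
      by (intro wbound_add[OF g]) (use t R(1) in \<open>auto intro: wbound_mono mult_right_mono\<close>)
    show "((\<lambda>t. g + integral {0..t} F) has_vector_derivative F t) (at t within {0..T})"
      using has_vector_derivative_add[OF has_vector_derivative_const
          integral_has_vector_derivative[OF curve_continuous[OF F] t]] by simp
  qed
qed

lemma curve_restrict: "curve j T k f \<Longrightarrow> T' \<le> T \<Longrightarrow> curve j T' k f"
proof (induction j arbitrary: f)
  case 0
  obtain R where R: "\<And>t. t \<in> {0..T} \<Longrightarrow> wbound k R (f t)" using curve_bound[OF 0(1)] by metis
  show ?case
    by (rule curve_0I[OF R continuous_on_subset[OF curve_continuous[OF 0(1)]]]) (use 0 in auto)
next
  case (Suc j)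
  obtain R where R: "\<And>t. t \<in> {0..T} \<Longrightarrow> wbound k R (f t)" using curve_bound[OF Suc.prems(1)] by metis
  obtain g where g: "\<And>t. t \<in> {0..T} \<Longrightarrow> (f has_vector_derivative g t) (at t within {0..T})" "curve j T k g"
    using curve_deriv[OF Suc.prems(1)] by metis
  show ?case
    by (rule curveI[OF R has_vector_derivative_within_subset[OF g(1)] Suc.IH[OF g(2) Suc.prems(2)]])
       (use Suc.prems in auto)
qed

subsection \<open>The limit system\<close>

lemma norm_triple_diff:
  fixes x y z x' y' z' :: wiener
  assumes "norm x' \<le> R" "norm y \<le> R" "norm y' \<le> R" "norm z \<le> R"
    and "norm (x - x') \<le> M" "norm (y - y') \<le> M" "norm (z - z') \<le> M"
  shows "norm (x * y * z - x' * y' * z') \<le> 3 * R\<^sup>2 * M"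
proof -
  have R: "0 \<le> R" using assms(1) norm_ge_zero by (rule order.trans[rotated])
  have M: "0 \<le> M" using assms(5) norm_ge_zero by (rule order.trans[rotated])
  have eq: "x * y * z - x' * y' * z' = (x - x') * y * z + x' * (y - y') * z + x' * y' * (z - z')"
    by (simp add: algebra_simps)
  have 1: "norm ((x - x') * y * z) \<le> M * R * R"
    by (intro order.trans[OF norm_mult_ineq] mult_mono assms) (auto simp: M R)
  have 2: "norm (x' * (y - y') * z) \<le> R * M * R"
    by (intro order.trans[OF norm_mult_ineq] mult_mono assms) (auto simp: M R)
  have 3: "norm (x' * y' * (z - z')) \<le> R * R * M"
    by (intro order.trans[OF norm_mult_ineq] mult_mono assms) (auto simp: M R)
  have "norm (x * y * z - x' * y' * z') \<le> M * R * R + R * M * R + R * R * M"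
    unfolding eq by (intro order.trans[OF norm_triangle_ineq] add_mono 1 2 3)
  then show ?thesis by (simp add: power2_eq_square algebra_simps)
qed

definition potential :: "wiener \<Rightarrow> wiener \<Rightarrow> wiener" where
  "potential u v = u * wcnj u + 2 * (v * wcnj v)"

definition nls_force :: "real \<Rightarrow> wiener \<Rightarrow> wiener \<Rightarrow> wiener" where
  "nls_force \<mu> u v = const (- \<i> * of_real \<mu>) * (potential u v * u)"

lemma wbound_double: "wbound k R f \<Longrightarrow> wbound k (2 * R) (2 * f)"
  using wbound_add[of k R f R f] by simp

lemma wbound_potential: 
  assumes "wbound k R u" "wbound k R v"
  shows "wbound k (3 * R\<^sup>2) (potential u v)"
proof -
  have "wbound k (R * R + 2 * (R * R)) (potential u v)"
    unfolding potential_def by (intro wbound_add wbound_double wbound_mult wbound_wcnj assms)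
  then show ?thesis by (simp add: power2_eq_square)
qed

lemma wbound_nls_force: 
  assumes "wbound k R u" "wbound k R v"
  shows "wbound k (3 * \<bar>\<mu>\<bar> * R ^ 3) (nls_force \<mu> u v)"
  using wbound_const_mult[OF wbound_mult[OF wbound_potential[OF assms] assms(1)], of "- \<i> * of_real \<mu>"]
  by (simp add: nls_force_def norm_mult power3_eq_cube power2_eq_square mult_ac)

lemma potential_lipschitz:
  assumes "norm u \<le> R" "norm v \<le> R" "norm u' \<le> R" "norm v' \<le> R" "norm (u - u') \<le> M" "norm (v - v') \<le> M"
  shows "norm (potential u v - potential u' v') \<le> 6 * R * M"
proof -
  have R: "0 \<le> R" using assms(1) norm_ge_zero by (rule order.trans[rotated])
  have M: "0 \<le> M" using assms(5) norm_ge_zero by (rule order.trans[rotated])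
  have two: "norm (f * wcnj f - g * wcnj g) \<le> 2 * R * M" if "norm f \<le> R" "norm g \<le> R" "norm (f - g) \<le> M" for f g
  proof -
    have "f * wcnj f - g * wcnj g = (f - g) * wcnj f + g * wcnj (f - g)"
      by (simp add: algebra_simps wcnj_diff)
    moreover have "norm ((f - g) * wcnj f) \<le> M * R"
      by (intro order.trans[OF norm_mult_ineq] mult_mono) (use that M R in auto)
    moreover have "norm (g * wcnj (f - g)) \<le> R * M"
      by (intro order.trans[OF norm_mult_ineq] mult_mono) (use that M R in auto)
    ultimately show ?thesis
      using norm_triangle_ineq[of "(f - g) * wcnj f" "g * wcnj (f - g)"] by (simp add: mult.commute)
  qed
  have "potential u v - potential u' v' = (u * wcnj u - u' * wcnj u') + ((v * wcnj v - v' * wcnj v') + (v * wcnj v - v' * wcnj v'))"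
    by (simp add: potential_def algebra_simps)
  then have "norm (potential u v - potential u' v') \<le> norm (u * wcnj u - u' * wcnj u')
      + (norm (v * wcnj v - v' * wcnj v') + norm (v * wcnj v - v' * wcnj v'))"
    by (metis add_left_mono norm_triangle_ineq order.trans)
  then show ?thesis using two[of u u'] two[of v v'] assms by simp
qed

lemma nls_force_lipschitz:
  assumes "norm u \<le> R" "norm v \<le> R" "norm u' \<le> R" "norm v' \<le> R" "norm (u - u') \<le> M" "norm (v - v') \<le> M"
  shows "norm (nls_force \<mu> u v - nls_force \<mu> u' v') \<le> 9 * \<bar>\<mu>\<bar> * R\<^sup>2 * M"
proof -
  have R: "0 \<le> R" using assms(1) norm_ge_zero by (rule order.trans[rotated])
  have M: "0 \<le> M" using assms(5) norm_ge_zero by (rule order.trans[rotated])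
  have 1: "norm (potential u v * (u - u')) \<le> (3 * R\<^sup>2) * M"
    using wbound_potential[of 0 R u v] assms
    by (intro order.trans[OF norm_mult_ineq] mult_mono) (auto simp: wbound_0_iff)
  have 2: "norm ((potential u v - potential u' v') * u') \<le> (6 * R * M) * R"
    using potential_lipschitz[OF assms] assms R M by (intro order.trans[OF norm_mult_ineq] mult_mono) auto
  have "nls_force \<mu> u v - nls_force \<mu> u' v'
      = const (- \<i> * of_real \<mu>) * (potential u v * (u - u') + (potential u v - potential u' v') * u')"
    by (simp add: nls_force_def algebra_simps)
  then have "norm (nls_force \<mu> u v - nls_force \<mu> u' v')
      \<le> \<bar>\<mu>\<bar> * norm (potential u v * (u - u') + (potential u v - potential u' v') * u')"
    using norm_mult_ineq[of "const (- \<i> * of_real \<mu>)"] by (simp add: norm_mult)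
  also have "\<dots> \<le> \<bar>\<mu>\<bar> * ((3 * R\<^sup>2) * M + (6 * R * M) * R)"
    by (intro mult_left_mono order.trans[OF norm_triangle_ineq] add_mono 1 2) auto
  also have "\<dots> = 9 * \<bar>\<mu>\<bar> * R\<^sup>2 * M" by (simp add: power2_eq_square algebra_simps)
  finally show ?thesis .
qed

lemma curve_potential: "curve j T k u \<Longrightarrow> curve j T k v \<Longrightarrow> curve j T k (\<lambda>t. potential (u t) (v t))"
  unfolding potential_def mult_2 by (intro curve_add curve_mult curve_wcnj)

lemma curve_nls_force: "curve j T k u \<Longrightarrow> curve j T k v \<Longrightarrow> curve j T k (\<lambda>t. nls_force \<mu> (u t) (v t))"
  unfolding nls_force_def by (intro curve_const_mult curve_mult curve_potential)

definition half_square :: "int \<Rightarrow> real" where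
  "half_square a = (of_int a)\<^sup>2 / 2"

lemma half_square_bound: "\<bar>half_square a\<bar> \<le> 1 * weight a ^ 2"
proof -
  have "(of_int a)\<^sup>2 \<le> weight a ^ 2"
    unfolding weight_def by (metis abs_ge_zero add_increasing add_0 le_add_same_cancel2 power2_abs power_mono zero_le_one)
  then have "half_square a \<le> weight a ^ 2"
    unfolding half_square_def using zero_le_power2[of "weight a"] by linarith
  moreover have "0 \<le> half_square a" by (simp add: half_square_def)
  ultimately show ?thesis by simp
qed

lemma half_square_bound_minus: "\<bar>- half_square a\<bar> \<le> 1 * weight a ^ 2"
  using half_square_bound[of a] by simp

text \<open>The operator \<open>-(i/2) \<partial>\<^sub>x\<^sub>x\<close>, generator of the kinetic flow.\<close>

definition schroedinger :: "wiener \<Rightarrow> wiener" where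
  "schroedinger = multiplier (\<lambda>a. \<i> * of_real (half_square a))"

lemma schroedinger_symbol: "cmod (\<i> * of_real (half_square a)) \<le> 1 * weight a ^ 2"
  using half_square_bound[of a] by (simp add: norm_mult)

lemma coef_schroedinger:
  "wbound 2 R f \<Longrightarrow> coef (schroedinger f) a = \<i> * of_real (half_square a) * coef f a"
  unfolding schroedinger_def by (rule coef_multiplier[OF _ schroedinger_symbol])

text \<open>The nonlinear term carries \<open>\<mu> = \<lambda>/8\<close>.\<close>

definition nls_solution :: "real \<Rightarrow> real \<Rightarrow> nat \<Rightarrow> (real \<Rightarrow> wiener) \<Rightarrow> (real \<Rightarrow> wiener) \<Rightarrow> bool" where
  "nls_solution \<mu> T k u v \<longleftrightarrow> curve 3 T k u \<and> curve 3 T k v \<and>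
     (\<forall>t\<in>{0..T}. (u has_vector_derivative schroedinger (u t) + nls_force \<mu> (u t) (v t)) (at t within {0..T})) \<and>
     (\<forall>t\<in>{0..T}. (v has_vector_derivative schroedinger (v t) + nls_force \<mu> (v t) (u t)) (at t within {0..T}))"

text \<open>Picard iteration in the interaction picture. Twists are isometries for every weight, so
  the ball of weight \<open>Suc k\<close> is preserved, while continuity in time uses up one weight
  and contraction is measured in the unweighted norm.\<close>

lemma nls_mild_exists:
  assumes f: "wbound (Suc k) R0 f" and g: "wbound (Suc k) R0 g"
  obtains T u v where "0 < T" "curve 0 T (Suc k) u" "curve 0 T (Suc k) v"
    "\<And>t. t \<in> {0..T} \<Longrightarrow> u t = twist half_square t (f + integral {0..t} (\<lambda>s. twist (\<lambda>a. - half_square a) s (nls_force \<mu> (u s) (v s))))"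
    "\<And>t. t \<in> {0..T} \<Longrightarrow> v t = twist half_square t (g + integral {0..t} (\<lambda>s. twist (\<lambda>a. - half_square a) s (nls_force \<mu> (v s) (u s))))"
proof -
  define R where "R = R0 + 1"
  have R0: "0 \<le> R0" using wbound_nonneg[OF f] .
  \<comment> \<open>The force is at most \<open>3 |\<mu>| R^3\<close>, so its integral stays below 1
    and the ball of radius \<open>R0 + 1\<close> is kept. Its Lipschitz constant
    \<open>9 |\<mu>| R^2\<close> yields a factor 1/4 per component, hence 36.\<close>
  define T where "T = 1 / (1 + 36 * \<bar>\<mu>\<bar> * R ^ 3)"
  have R1: "1 \<le> R" using R0 by (simp add: R_def)
  have den: "0 < 1 + 36 * \<bar>\<mu>\<bar> * R ^ 3" using R1 by (intro add_pos_nonneg) auto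
  have T: "0 < T" using den by (simp add: T_def)
  have T3: "T * (36 * \<bar>\<mu>\<bar> * R ^ 3) \<le> 1" using den by (simp add: T_def field_simps)
  have T2: "T * (36 * \<bar>\<mu>\<bar> * R ^ 2) \<le> 1"
  proof -
    have "T * (36 * \<bar>\<mu>\<bar> * R ^ 2) \<le> T * (36 * \<bar>\<mu>\<bar> * R ^ 3)"
      using T R1 by (intro mult_left_mono power_increasing) auto
    then show ?thesis using T3 by linarith
  qed
  define W where "W = (\<lambda>p s. twist (\<lambda>a. - half_square a) s (nls_force \<mu> (fst (p s)) (snd (p s))))"
  define W' where "W' = (\<lambda>p s. twist (\<lambda>a. - half_square a) s (nls_force \<mu> (snd (p s)) (fst (p s))))"
  define \<Psi> where "\<Psi> = (\<lambda>p t. (twist half_square t (f + integral {0..t} (W p)), twist half_square t (g + integral {0..t} (W' p))))"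
  define B where "B = {f. wbound (Suc k) R f} \<times> {f. wbound (Suc k) R f}"
  have curves: "curve 0 T (Suc k) (\<lambda>t. fst (p t))" "curve 0 T (Suc k) (\<lambda>t. snd (p t))"
    if p: "continuous_on {0..T} p" "p ` {0..T} \<subseteq> B" for p
  proof -
    have "wbound (Suc k) R (fst (p t)) \<and> wbound (Suc k) R (snd (p t))" if "t \<in> {0..T}" for t
      using p(2) that by (auto simp: B_def image_subset_iff mem_Times_iff)
    then show "curve 0 T (Suc k) (\<lambda>t. fst (p t))" "curve 0 T (Suc k) (\<lambda>t. snd (p t))"
      using p(1) by (auto intro!: curve_0I[where R = R] continuous_intros)
  qed
  have Wk: "curve 0 T k (W p)" "curve 0 T k (W' p)" if p: "continuous_on {0..T} p" "p ` {0..T} \<subseteq> B" for p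
    unfolding W_def W'_def
    by (rule curve_twist[OF half_square_bound_minus]; use curves[OF p] in \<open>auto intro!: curve_nls_force\<close>)+
  have Wb: "wbound (Suc k) (3 * \<bar>\<mu>\<bar> * R ^ 3) (W p s)" "wbound (Suc k) (3 * \<bar>\<mu>\<bar> * R ^ 3) (W' p s)"
    if "p ` {0..T} \<subseteq> B" "s \<in> {0..T}" for p s
  proof -
    have "wbound (Suc k) R (fst (p s)) \<and> wbound (Suc k) R (snd (p s))"
      using that by (auto simp: B_def image_subset_iff mem_Times_iff)
    then show "wbound (Suc k) (3 * \<bar>\<mu>\<bar> * R ^ 3) (W p s)" "wbound (Suc k) (3 * \<bar>\<mu>\<bar> * R ^ 3) (W' p s)"
      unfolding W_def W'_def wbound_twist by (auto intro!: wbound_nls_force)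
  qed
  have Ib: "wbound (Suc k) R (h + integral {0..t} F)" 
    if "continuous_on {0..T} F" "\<And>s. s \<in> {0..T} \<Longrightarrow> wbound (Suc k) (3 * \<bar>\<mu>\<bar> * R ^ 3) (F s)" "t \<in> {0..T}" "wbound (Suc k) R0 h" for F t h
  proof -
    have "wbound (Suc k) (t * (3 * \<bar>\<mu>\<bar> * R ^ 3)) (integral {0..t} F)"
      by (rule wbound_integral[OF continuous_on_subset[OF that(1)] that(2)]) (use that(3) in auto)
    moreover have "t * (3 * \<bar>\<mu>\<bar> * R ^ 3) \<le> T * (36 * \<bar>\<mu>\<bar> * R ^ 3)"
      using that(3) T R1 by (intro mult_mono mult_right_mono) auto
    ultimately have "wbound (Suc k) 1 (integral {0..t} F)" using T3 by (auto intro: wbound_mono)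
    then show ?thesis unfolding R_def by (rule wbound_add[OF that(4)])
  qed
  obtain p where p: "continuous_on {0..T} p" "p ` {0..T} \<subseteq> B" "\<And>t. t \<in> {0..T} \<Longrightarrow> p t = \<Psi> p t"
  proof (rule picard_fixed_point[of T B "0" \<Psi>])
    show "closed B" unfolding B_def by (intro closed_Times closed_wbound)
    show "0 \<in> B" using R1 by (simp add: B_def zero_prod_def)
  next
    fix p assume p: "continuous_on {0..T} p" "p ` {0..T} \<subseteq> B"
    have "\<Psi> p t \<in> B" if t: "t \<in> {0..T}" for t
      unfolding B_def \<Psi>_def using Ib[OF curve_continuous[OF Wk(1)[OF p]] Wb(1)[OF p(2)] t f]
        Ib[OF curve_continuous[OF Wk(2)[OF p]] Wb(2)[OF p(2)] t g] by simp
    moreover have cont: "continuous_on {0..T} (\<lambda>t. twist half_square t (h + integral {0..t} F))"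
      if F: "curve 0 T k F" "\<And>s. s \<in> {0..T} \<Longrightarrow> wbound (Suc k) (3 * \<bar>\<mu>\<bar> * R ^ 3) (F s)" and h: "wbound (Suc k) R0 h" for F h
    proof -
      have "curve 0 T (k + 3 * 0 + 1) (\<lambda>t. h + integral {0..t} F)"
        by (rule curve_0I[where R = R])
           (use Ib[OF curve_continuous[OF F(1)] F(2) _ h]
              in \<open>auto intro!: continuous_intros indefinite_integral_continuous_1 integrable_continuous_interval curve_continuous[OF F(1)]\<close>)
      then have "curve 0 T k (\<lambda>t. twist half_square t (h + integral {0..t} F))"
        by (rule curve_twist[OF half_square_bound])
      then show ?thesis by (rule curve_continuous)
    qed
    have "continuous_on {0..T} (\<Psi> p)"
      unfolding \<Psi>_def by (intro continuous_on_Pair cont Wk[OF p] Wb[OF p(2)] f g)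
    ultimately show "continuous_on {0..T} (\<Psi> p) \<and> \<Psi> p ` {0..T} \<subseteq> B" by blast
  next
    fix p q M t
    assume p: "continuous_on {0..T} p" "p ` {0..T} \<subseteq> B" and q: "continuous_on {0..T} q" "q ` {0..T} \<subseteq> B"
      and M: "\<And>t. t \<in> {0..T} \<Longrightarrow> norm (p t - q t) \<le> M" and t: "t \<in> {0..T}"
    have M': "norm (fst (p s) - fst (q s)) \<le> M" "norm (snd (p s) - snd (q s)) \<le> M" if "s \<in> {0..T}" for s
    proof -
      have e: "p s - q s = (fst (p s) - fst (q s), snd (p s) - snd (q s))" by (simp add: prod_eq_iff)
      show "norm (fst (p s) - fst (q s)) \<le> M" "norm (snd (p s) - snd (q s)) \<le> M"
        using M[OF that] norm_fst_le[of "fst (p s) - fst (q s)" "snd (p s) - snd (q s)"]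
          norm_snd_le[of "snd (p s) - snd (q s)" "fst (p s) - fst (q s)"]
        unfolding e by linarith+
    qed
    have N: "norm (fst (p s)) \<le> R" "norm (snd (p s)) \<le> R" "norm (fst (q s)) \<le> R" "norm (snd (q s)) \<le> R" if "s \<in> {0..T}" for s
      using p(2) q(2) that wbound_norm[of "Suc k" R] by (auto simp: B_def image_subset_iff mem_Times_iff)
    have M0: "0 \<le> M" using M[OF t] norm_ge_zero order.trans by blast
    have d: "norm (twist half_square t (h + integral {0..t} F) - twist half_square t (h + integral {0..t} G)) \<le> M / 4"
      if F: "continuous_on {0..T} F" "continuous_on {0..T} G"
        "\<And>s. s \<in> {0..T} \<Longrightarrow> norm (F s - G s) \<le> 9 * \<bar>\<mu>\<bar> * R\<^sup>2 * M" for F G h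
    proof -
      have sub: "{0..t} \<subseteq> {0..T}" using t by auto
      have "twist half_square t (h + integral {0..t} F) - twist half_square t (h + integral {0..t} G)
          = twist half_square t (integral {0..t} (\<lambda>s. F s - G s))"
        using F sub by (subst integral_diff) (auto intro!: integrable_continuous_interval intro: continuous_on_subset simp: twist_diff[symmetric])
      moreover have "norm (integral {0..t} (\<lambda>s. F s - G s)) \<le> t * (9 * \<bar>\<mu>\<bar> * R\<^sup>2 * M)"
        by (rule norm_integral_le) (use F sub t in \<open>auto intro!: continuous_intros intro: continuous_on_subset\<close>)
      moreover have "t * (9 * \<bar>\<mu>\<bar> * R\<^sup>2 * M) \<le> T * (9 * \<bar>\<mu>\<bar> * R\<^sup>2 * M)"
        using t M0 by (intro mult_right_mono) auto
      moreover have "T * (9 * \<bar>\<mu>\<bar> * R\<^sup>2 * M) \<le> M / 4"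
        using mult_right_mono[OF T2, of "M / 4"] M0 by (simp add: field_simps)
      ultimately show ?thesis by simp
    qed
    have "norm (W p s - W q s) \<le> 9 * \<bar>\<mu>\<bar> * R\<^sup>2 * M" "norm (W' p s - W' q s) \<le> 9 * \<bar>\<mu>\<bar> * R\<^sup>2 * M"
      if "s \<in> {0..T}" for s
      unfolding W_def W'_def twist_diff[symmetric] norm_twist
      by (intro nls_force_lipschitz N M' that)+
    then have "norm (fst (\<Psi> p t - \<Psi> q t)) \<le> M / 4" "norm (snd (\<Psi> p t - \<Psi> q t)) \<le> M / 4"
      unfolding \<Psi>_def fst_diff snd_diff fst_conv snd_conv
      by (intro d curve_continuous[OF Wk(1)] curve_continuous[OF Wk(2)] p q; blast)+
    then show "norm (\<Psi> p t - \<Psi> q t) \<le> M / 2"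
      using norm_Pair_le[of "fst (\<Psi> p t - \<Psi> q t)" "snd (\<Psi> p t - \<Psi> q t)"]
      unfolding prod.collapse by linarith
  qed (use T in auto)
  show ?thesis
  proof (rule that[OF T curves[OF p(1,2)]])
    fix t assume t: "t \<in> {0..T}"
    show "fst (p t) = twist half_square t (f + integral {0..t} (\<lambda>s. twist (\<lambda>a. - half_square a) s (nls_force \<mu> (fst (p s)) (snd (p s)))))"
      using arg_cong[OF p(3)[OF t], of fst] by (simp add: \<Psi>_def W_def)
    show "snd (p t) = twist half_square t (g + integral {0..t} (\<lambda>s. twist (\<lambda>a. - half_square a) s (nls_force \<mu> (snd (p s)) (fst (p s)))))"
      using arg_cong[OF p(3)[OF t], of snd] by (simp add: \<Psi>_def W'_def)
  qed
qed

text \<open>Each pass through the mild formulation gains one time derivative, at the cost of weights.\<close>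

lemma mild_gain:
  assumes \<theta>: "\<And>a. \<bar>\<theta> a\<bar> \<le> C * weight a ^ 2"
    and u: "\<And>t. t \<in> {0..T} \<Longrightarrow> u t = twist \<theta> t (f + integral {0..t} (\<lambda>s. twist (\<lambda>a. - \<theta> a) s (F s)))"
    and F: "curve j T (k + 6 * j + 5) F" and f: "wbound (k + 6 * j + 5) R f"
  shows "curve (Suc j) T k u"
proof -
  have \<theta>': "\<bar>- \<theta> a\<bar> \<le> C * weight a ^ 2" for a using \<theta>[of a] by simp
  have 1: "curve j T (k + 3 * Suc j + 1) (\<lambda>s. twist (\<lambda>a. - \<theta> a) s (F s))"
    by (rule curve_twist[OF \<theta>']) (use F in \<open>simp add: algebra_simps\<close>)
  have "curve (Suc j) T k (\<lambda>t. twist \<theta> t (f + integral {0..t} (\<lambda>s. twist (\<lambda>a. - \<theta> a) s (F s))))"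
    by (rule curve_twist[OF \<theta> curve_integral[OF 1 wbound_mono[OF f]]]) auto
  then show ?thesis by (rule curve_cong) (simp add: u)
qed

text \<open>Differentiating the twist yields the generator, and the integral yields the force, whose
  backward twist is cancelled by the outer one. Twisting \<open>F\<close> takes one of its five
  weights, and the derivative rule for twists asks for four on the primitive.\<close>

lemma mild_derivative:
  assumes \<theta>: "\<And>a. \<bar>\<theta> a\<bar> \<le> C * weight a ^ 2"
    and u: "\<And>t. t \<in> {0..T} \<Longrightarrow> u t = twist \<theta> t (f + integral {0..t} (\<lambda>s. twist (\<lambda>a. - \<theta> a) s (F s)))"
    and F: "curve 0 T 5 F" and f: "wbound 4 R f" and t: "t \<in> {0..T}"
  shows "(u has_vector_derivative multiplier (\<lambda>a. \<i> * of_real (\<theta> a)) (u t) + F t) (at t within {0..T})"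
proof -
  have \<theta>': "\<bar>- \<theta> a\<bar> \<le> C * weight a ^ 2" for a using \<theta>[of a] by simp
  have m: "cmod (\<i> * of_real (\<theta> a)) \<le> C * weight a ^ 2" for a
    using \<theta>[of a] by (simp add: norm_mult)
  define w where "w = (\<lambda>t. f + integral {0..t} (\<lambda>s. twist (\<lambda>a. - \<theta> a) s (F s)))"
  have 1: "curve 0 T 4 (\<lambda>s. twist (\<lambda>a. - \<theta> a) s (F s))"
    by (rule curve_twist[OF \<theta>']) (use F in simp)
  have w: "curve 1 T 4 w" using curve_integral[OF 1 f] by (simp add: w_def)
  have "((\<lambda>t. twist \<theta> t (w t)) has_vector_derivative
      twist \<theta> t (twist (\<lambda>a. - \<theta> a) t (F t) + multiplier (\<lambda>a. \<i> * of_real (\<theta> a)) (w t))) (at t within {0..T})"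
  proof (rule has_vector_derivative_twist[OF \<theta> _ curve_mono[OF w] curve_mono[OF 1] t])
    show "(w has_vector_derivative twist (\<lambda>a. - \<theta> a) t (F t)) (at t within {0..T})" if "t \<in> {0..T}" for t
      unfolding w_def using has_vector_derivative_add[OF has_vector_derivative_const
          integral_has_vector_derivative[OF curve_continuous[OF 1] that]] by simp
  qed auto
  moreover obtain S where S: "wbound 4 S (w t)" using curve_bound[OF w] t by metis
  have "twist \<theta> t (twist (\<lambda>a. - \<theta> a) t (F t) + multiplier (\<lambda>a. \<i> * of_real (\<theta> a)) (w t))
      = multiplier (\<lambda>a. \<i> * of_real (\<theta> a)) (u t) + F t"
  proof (rule wiener_eqI)
    fix a
    have w2: "wbound 2 S (w t)" by (rule wbound_mono[OF S]) auto
    have 2: "coef (multiplier (\<lambda>a. \<i> * of_real (\<theta> a)) (w t)) a = \<i> * of_real (\<theta> a) * coef (w t) a"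
      by (rule coef_multiplier[OF w2 m])
    have 3: "coef (multiplier (\<lambda>a. \<i> * of_real (\<theta> a)) (twist \<theta> t (w t))) a = \<i> * of_real (\<theta> a) * coef (twist \<theta> t (w t)) a"
      by (rule coef_multiplier[OF wbound_twist[THEN iffD2, OF w2] m])
    have "u t = twist \<theta> t (w t)" using u[OF t] by (simp add: w_def)
    then show "coef (twist \<theta> t (twist (\<lambda>a. - \<theta> a) t (F t) + multiplier (\<lambda>a. \<i> * of_real (\<theta> a)) (w t))) a
        = coef (multiplier (\<lambda>a. \<i> * of_real (\<theta> a)) (u t) + F t) a"
      by (simp add: 2 3 algebra_simps flip: exp_add)
  qed
  ultimately have "((\<lambda>t. twist \<theta> t (w t)) has_vector_derivative multiplier (\<lambda>a. \<i> * of_real (\<theta> a)) (u t) + F t) (at t within {0..T})" by simp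
  then show ?thesis
    by (rule has_vector_derivative_transform[OF t, rotated]) (simp add: u w_def)
qed

text \<open>Passing from 0 to 3 time derivatives with \<open>mild_gain\<close> costs 5, 11 and 17
  weights, 33 in all; the mild solution is built with \<open>k + 33\<close>, whose successor is the
  34 of the hypotheses.\<close>

lemma nls_exists:
  assumes f: "wbound (k + 34) R0 f" and g: "wbound (k + 34) R0 g"
  obtains T u v where "0 < T" "nls_solution \<mu> T k u v" "u 0 = f" "v 0 = g"
proof -
  obtain T u v where T: "0 < T" and c: "curve 0 T (k + 34) u" "curve 0 T (k + 34) v"
    and u: "\<And>t. t \<in> {0..T} \<Longrightarrow> u t = twist half_square t (f + integral {0..t} (\<lambda>s. twist (\<lambda>a. - half_square a) s (nls_force \<mu> (u s) (v s))))"
    and v: "\<And>t. t \<in> {0..T} \<Longrightarrow> v t = twist half_square t (g + integral {0..t} (\<lambda>s. twist (\<lambda>a. - half_square a) s (nls_force \<mu> (v s) (u s))))"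
    using nls_mild_exists[of "k + 33" R0 f g \<mu>] f g by (auto simp: numeral_eq_Suc)
  have gain: "curve (Suc j) T m u \<and> curve (Suc j) T m v"
    if "curve j T (m + 6 * j + 5) u \<and> curve j T (m + 6 * j + 5) v" "m + 6 * j + 5 \<le> k + 34" for j m
    using that by (intro conjI mild_gain[OF half_square_bound u] mild_gain[OF half_square_bound v] curve_nls_force wbound_mono[OF f] wbound_mono[OF g]) auto
  have "curve 1 T (k + 28) u \<and> curve 1 T (k + 28) v"
    using gain[of 0 "k + 28"] curve_weight_mono[OF c(1), of "k + 33"] curve_weight_mono[OF c(2), of "k + 33"]
    by (simp add: numeral_eq_Suc)
  then have "curve 2 T (k + 17) u \<and> curve 2 T (k + 17) v"
    using gain[of 1 "k + 17"] by (simp add: numeral_eq_Suc)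
  then have 3: "curve 3 T k u \<and> curve 3 T k v"
    using gain[of 2 k] by (simp add: numeral_eq_Suc)
  have "curve 0 T 5 u" "curve 0 T 5 v" using c by (auto intro: curve_weight_mono)
  then have "nls_solution \<mu> T k u v"
    unfolding nls_solution_def schroedinger_def using 3
    by (intro conjI ballI mild_derivative[OF half_square_bound u] mild_derivative[OF half_square_bound v] curve_nls_force wbound_mono[OF f] wbound_mono[OF g]) auto
  then show ?thesis
    using that[OF T] u[of 0] v[of 0] T by simp
qed

subsection \<open>The Klein--Gordon equation\<close>

text \<open>After multiplication of the equation by \<open>c^2\<close>, mode \<open>a\<close> is an
  oscillator of this frequency with force \<open>c^2\<close> times the cubic term.\<close>

definition kg_freq :: "real \<Rightarrow> int \<Rightarrow> real" where
  "kg_freq c a = c * sqrt ((of_int a)\<^sup>2 + c\<^sup>2)"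

definition cubic :: "wiener \<Rightarrow> wiener" where
  "cubic z = z * wcnj z * z"

lemma kg_freq_ge: 
  assumes "0 < c" shows "c\<^sup>2 \<le> kg_freq c a" "0 < kg_freq c a"
proof -
  have "c \<le> sqrt ((of_int a)\<^sup>2 + c\<^sup>2)" by (rule real_le_rsqrt) simp
  then show "c\<^sup>2 \<le> kg_freq c a" using assms by (simp add: kg_freq_def power2_eq_square mult_left_mono)
  then show "0 < kg_freq c a" using assms zero_less_power[of c 2] by linarith
qed

lemma kg_freq_square: "(kg_freq c a)\<^sup>2 = c\<^sup>2 * ((of_int a)\<^sup>2 + c\<^sup>2)"
  by (simp add: kg_freq_def power_mult_distrib)

text \<open>The constant grows with \<open>c\<close>. That is harmless, as the bound serves only for
  continuity and differentiability in time, never for a size estimate.\<close>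

lemma kg_freq_bound:
  assumes "0 < c" shows "\<bar>kg_freq c a\<bar> \<le> (c * (1 + c)) * weight a ^ 2"
proof -
  have "sqrt ((of_int a)\<^sup>2 + c\<^sup>2) \<le> \<bar>of_int a\<bar> + c"
    using sqrt_sum_squares_le_sum_abs[of "of_int a" c] assms by simp
  also have "\<dots> \<le> (1 + c) * weight a" using assms by (simp add: weight_def algebra_simps)
  also have "\<dots> \<le> (1 + c) * weight a ^ 2"
    using assms self_le_power[of "weight a" 2] by (intro mult_left_mono) auto
  finally have "c * sqrt ((of_int a)\<^sup>2 + c\<^sup>2) \<le> c * ((1 + c) * weight a ^ 2)"
    using assms by (intro mult_left_mono) auto
  then show ?thesis using kg_freq_ge(2)[OF assms, of a] by (simp add: kg_freq_def mult.assoc)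
qed

text \<open>The source of uniformity in \<open>c\<close>: in the variation of constants formula the
  force \<open>c^2\<close> is divided by the frequency.\<close>

lemma kg_ratio_le: "0 < c \<Longrightarrow> cmod (of_real (c\<^sup>2 / kg_freq c a)) \<le> 1"
  using kg_freq_ge[of c a] by (simp add: norm_divide norm_power)

lemma wbound_cubic: "wbound k R z \<Longrightarrow> wbound k (R ^ 3) (cubic z)"
  unfolding cubic_def power3_eq_cube by (intro wbound_mult wbound_wcnj)

lemma curve_cubic: "curve j T k z \<Longrightarrow> curve j T k (\<lambda>t. cubic (z t))"
  unfolding cubic_def by (intro curve_mult curve_wcnj)

lemma cubic_lipschitz:
  assumes "norm y \<le> R" "norm z \<le> R" "norm (y - z) \<le> M"
  shows "norm (cubic y - cubic z) \<le> 3 * R\<^sup>2 * M"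
  unfolding cubic_def by (rule norm_triple_diff) (use assms in \<open>auto simp: wcnj_diff[symmetric]\<close>)

lemma ev_cubic: "ev (cubic z) x = of_real ((cmod (ev z x))\<^sup>2) * ev z x"
  unfolding cubic_def by (simp only: ev_mult ev_wcnj complex_norm_square)

definition kg_damp :: "real \<Rightarrow> wiener \<Rightarrow> wiener" where
  "kg_damp c = multiplier (\<lambda>a. of_real (c\<^sup>2 / kg_freq c a))"

text \<open>Variation of constants, with \<open>sin\<close> and \<open>cos\<close> of the Klein--Gordon group split into exponentials.\<close>

definition kg_mild :: "real \<Rightarrow> real \<Rightarrow> real \<Rightarrow> wiener \<Rightarrow> wiener \<Rightarrow> (real \<Rightarrow> wiener) \<Rightarrow>
    (real \<Rightarrow> wiener) \<Rightarrow> (real \<Rightarrow> wiener) \<Rightarrow> (real \<Rightarrow> wiener) \<Rightarrow> bool" where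
  "kg_mild lam c T f g Z A B F \<longleftrightarrow>
     (\<forall>t. F t = kg_damp c (const (of_real lam / (2 * \<i>)) * cubic (Z t))) \<and>
     (\<forall>t\<in>{0..T}. Z t = A t + B t) \<and>
     (\<forall>t\<in>{0..T}. A t = twist (kg_freq c) t (const (1 / 2) * (f - kg_damp c (const \<i> * g))
         + integral {0..t} (\<lambda>s. twist (\<lambda>a. - kg_freq c a) s (F s)))) \<and>
     (\<forall>t\<in>{0..T}. B t = twist (\<lambda>a. - kg_freq c a) t (const (1 / 2) * (f + kg_damp c (const \<i> * g))
         + integral {0..t} (\<lambda>s. twist (\<lambda>a. - (- kg_freq c a)) s (- F s))))"

lemma kg_mildD:
  assumes "kg_mild lam c T f g Z A B F"
  shows "F t = kg_damp c (const (of_real lam / (2 * \<i>)) * cubic (Z t))"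
    and "t \<in> {0..T} \<Longrightarrow> Z t = A t + B t"
    and "t \<in> {0..T} \<Longrightarrow> A t = twist (kg_freq c) t (const (1 / 2) * (f - kg_damp c (const \<i> * g))
         + integral {0..t} (\<lambda>s. twist (\<lambda>a. - kg_freq c a) s (F s)))"
    and "t \<in> {0..T} \<Longrightarrow> B t = twist (\<lambda>a. - kg_freq c a) t (const (1 / 2) * (f + kg_damp c (const \<i> * g))
         + integral {0..t} (\<lambda>s. twist (\<lambda>a. - (- kg_freq c a)) s (- F s)))"
  using assms unfolding kg_mild_def by blast+

text \<open>\<open>T0\<close> and \<open>R\<close> are fixed before \<open>c\<close>. This is
  possible because \<open>c\<close> enters the iteration through isometric twists and through
  \<open>kg_damp\<close>, a contraction for every weight.\<close>

lemma kg_mild_exists: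
  assumes f: "wbound (Suc k) R0 f" and g: "wbound (Suc k) R0 g"
  obtains T0 R where "0 < T0" "\<And>T c. 0 < T \<Longrightarrow> T \<le> T0 \<Longrightarrow> 0 < c \<Longrightarrow>
     \<exists>Z A B F. (\<forall>t\<in>{0..T}. wbound (Suc k) R (Z t)) \<and> continuous_on {0..T} Z \<and> kg_mild lam c T f g Z A B F"
proof -
  define R where "R = 2 * R0 + 1"
  have R0: "0 \<le> R0" using wbound_nonneg[OF f] .
  have R1: "1 \<le> R" using R0 by (simp add: R_def)
  \<comment> \<open>Each of the two halves starts within \<open>R0\<close> and receives a force of
    at most \<open>|lam| R^3 / 2\<close>, so the sum stays within \<open>2 R0 + 1\<close>. The
    Lipschitz constant \<open>3 |lam| R^2 / 2\<close> of each half must give a factor 1/4, hence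
    6.\<close>
  define T0 where "T0 = 1 / (1 + 6 * \<bar>lam\<bar> * R ^ 3)"
  have den: "0 < 1 + 6 * \<bar>lam\<bar> * R ^ 3" using R1 by (intro add_pos_nonneg) auto
  have T0: "0 < T0" using den by (simp add: T0_def)
  have T03: "T0 * (6 * \<bar>lam\<bar> * R ^ 3) \<le> 1" using den by (simp add: T0_def field_simps)
  have *: "\<exists>Z A B F. (\<forall>t\<in>{0..T}. wbound (Suc k) R (Z t)) \<and> continuous_on {0..T} Z \<and> kg_mild lam c T f g Z A B F"
    if T: "0 < T" and TT0: "T \<le> T0" and c: "0 < c" for T c
  proof -
    have T3: "T * (6 * \<bar>lam\<bar> * R ^ 3) \<le> 1"
      using T03 mult_right_mono[OF TT0, of "6 * \<bar>lam\<bar> * R ^ 3"] R1 by simp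
    have T2: "T * (6 * \<bar>lam\<bar> * R ^ 2) \<le> 1"
    proof -
      have "T * (6 * \<bar>lam\<bar> * R ^ 2) \<le> T * (6 * \<bar>lam\<bar> * R ^ 3)"
        using T R1 by (intro mult_left_mono power_increasing) auto
      then show ?thesis using T3 by linarith
    qed
    define \<omega> where "\<omega> = kg_freq c"
    define J where "J = kg_damp c"
    note kb = kg_freq_bound[OF c]
    have kb': "\<bar>- \<omega> a\<bar> \<le> (c * (1 + c)) * weight a ^ 2" "\<bar>\<omega> a\<bar> \<le> (c * (1 + c)) * weight a ^ 2" for a
      using kb[of a] by (auto simp: \<omega>_def)
    have J: "wbound i S (J h)" if "wbound i S h" for i S h
      using wbound_multiplier_bounded[OF that kg_ratio_le[OF c]] by (simp add: J_def kg_damp_def)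
    have Jdiff: "J h1 - J h2 = J (h1 - h2)" for h1 h2
      unfolding J_def kg_damp_def
      by (rule wiener_eqI) (simp only: coef_diff coef_multiplier_bounded[OF kg_ratio_le[OF c]] right_diff_distrib)
    have Jn: "norm (J h) \<le> norm h" for h
      using norm_multiplier_le[OF kg_ratio_le[OF c]] by (simp add: J_def kg_damp_def)
    have Jc: "continuous_on S (\<lambda>t. J (h t))" if "continuous_on S h" for S and h :: "real \<Rightarrow> wiener"
    proof -
      have "continuous_on UNIV J"
        by (rule continuous_on_iff[THEN iffD2])
           (metis Jdiff Jn dist_norm le_less_trans)
      then show ?thesis using continuous_on_compose2[OF _ that] by blast
    qed
    define p where "p = const (1 / 2) * (f - J (const \<i> * g))"
    define q where "q = const (1 / 2) * (f + J (const \<i> * g))"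
    have Jg: "wbound (Suc k) R0 (J (const \<i> * g))" using J[OF wbound_const_mult[OF g, of \<i>]] by simp
    have p: "wbound (Suc k) R0 p"
      using wbound_const_mult[OF wbound_diff[OF f Jg], of "1 / 2"] by (simp add: p_def)
    have q: "wbound (Suc k) R0 q"
      using wbound_const_mult[OF wbound_add[OF f Jg], of "1 / 2"] by (simp add: q_def)
    define F where "F = (\<lambda>Z (t::real). J (const (of_real lam / (2 * \<i>)) * cubic (Z t)))"
    define A where "A = (\<lambda>Z t. twist \<omega> t (p + integral {0..t} (\<lambda>s. twist (\<lambda>a. - \<omega> a) s (F Z s))))"
    define B where "B = (\<lambda>Z t. twist (\<lambda>a. - \<omega> a) t (q + integral {0..t} (\<lambda>s. twist (\<lambda>a. - (- \<omega> a)) s (- F Z s))))"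
    define D where "D = {f. wbound (Suc k) R f}"
    have cz: "curve 0 T (Suc k) Z" if "continuous_on {0..T} Z" "Z ` {0..T} \<subseteq> D" for Z
      by (rule curve_0I[where R = R]) (use that in \<open>auto simp: D_def image_subset_iff\<close>)
    have Fb: "wbound (Suc k) (\<bar>lam\<bar> / 2 * R ^ 3) (F Z s)" if "Z ` {0..T} \<subseteq> D" "s \<in> {0..T}" for Z s
    proof -
      have "wbound (Suc k) R (Z s)" using that by (auto simp: D_def image_subset_iff)
      then have "wbound (Suc k) (cmod (of_real lam / (2 * \<i>)) * R ^ 3) (F Z s)"
        unfolding F_def by (intro J wbound_const_mult wbound_cubic)
      then show ?thesis by (simp add: norm_divide norm_mult)
    qed
    have Fc: "curve 0 T (Suc k) (F Z)" if "continuous_on {0..T} Z" "Z ` {0..T} \<subseteq> D" for Z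
    proof (rule curve_0I[OF Fb[OF that(2)]])
      show "continuous_on {0..T} (F Z)"
        unfolding F_def by (intro Jc curve_continuous[OF curve_const_mult[OF curve_cubic[OF cz[OF that]]]])
    qed
    have W: "continuous_on {0..T} (\<lambda>s. twist \<theta> s (G s))"
      if "curve 0 T (Suc k) G" "\<And>a. \<bar>\<theta> a\<bar> \<le> (c * (1 + c)) * weight a ^ 2" for \<theta> G
      using curve_continuous[OF curve_twist[of \<theta> "c * (1 + c)" 0 T k G]] that by simp
    have half: "continuous_on {0..T} (\<lambda>t. twist \<theta> t (h + integral {0..t} (\<lambda>s. twist \<theta>' s (G s))))"
      "\<And>t. t \<in> {0..T} \<Longrightarrow> wbound (Suc k) (R0 + T * (\<bar>lam\<bar> / 2 * R ^ 3)) (twist \<theta> t (h + integral {0..t} (\<lambda>s. twist \<theta>' s (G s))))"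
      if G: "curve 0 T (Suc k) G" and Gb: "\<And>s. s \<in> {0..T} \<Longrightarrow> wbound (Suc k) (\<bar>lam\<bar> / 2 * R ^ 3) (G s)" and h: "wbound (Suc k) R0 h" and 
        \<theta>: "\<And>a. \<bar>\<theta> a\<bar> \<le> (c * (1 + c)) * weight a ^ 2" "\<And>a. \<bar>\<theta>' a\<bar> \<le> (c * (1 + c)) * weight a ^ 2" for \<theta> \<theta>' G h
    proof -
      have 1: "wbound (Suc k) (R0 + T * (\<bar>lam\<bar> / 2 * R ^ 3)) (h + integral {0..t} (\<lambda>s. twist \<theta>' s (G s)))" if t: "t \<in> {0..T}" for t
      proof -
        have "wbound (Suc k) (t * (\<bar>lam\<bar> / 2 * R ^ 3)) (integral {0..t} (\<lambda>s. twist \<theta>' s (G s)))"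
          by (rule wbound_integral[OF continuous_on_subset[OF W[OF G \<theta>(2)]]]) (use t Gb in auto)
        then have "wbound (Suc k) (T * (\<bar>lam\<bar> / 2 * R ^ 3)) (integral {0..t} (\<lambda>s. twist \<theta>' s (G s)))"
          by (rule wbound_mono) (use t R1 in \<open>auto intro!: mult_right_mono\<close>)
        then show ?thesis by (rule wbound_add[OF h])
      qed
      have "curve 0 T (Suc k) (\<lambda>t. h + integral {0..t} (\<lambda>s. twist \<theta>' s (G s)))"
        by (rule curve_0I[OF 1])
           (auto intro!: continuous_intros indefinite_integral_continuous_1 integrable_continuous_interval W[OF G \<theta>(2)])
      then show "continuous_on {0..T} (\<lambda>t. twist \<theta> t (h + integral {0..t} (\<lambda>s. twist \<theta>' s (G s))))"
        by (rule W[OF _ \<theta>(1)])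
      show "wbound (Suc k) (R0 + T * (\<bar>lam\<bar> / 2 * R ^ 3)) (twist \<theta> t (h + integral {0..t} (\<lambda>s. twist \<theta>' s (G s))))" if "t \<in> {0..T}" for t
        using 1[OF that] by simp
    qed
    have mF: "curve 0 T (Suc k) (\<lambda>s. - F Z s)" "\<And>s. s \<in> {0..T} \<Longrightarrow> wbound (Suc k) (\<bar>lam\<bar> / 2 * R ^ 3) (- F Z s)"
      if "continuous_on {0..T} Z" "Z ` {0..T} \<subseteq> D" for Z
      using curve_minus[OF Fc[OF that]] wbound_minus[OF Fb[OF that(2)]] by auto
    obtain Z where Z: "continuous_on {0..T} Z" "Z ` {0..T} \<subseteq> D" "\<And>t. t \<in> {0..T} \<Longrightarrow> Z t = A Z t + B Z t"
    proof (rule picard_fixed_point[of T D "0" "\<lambda>Z t. A Z t + B Z t"])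
      show "closed D" unfolding D_def by (rule closed_wbound)
      show "0 \<in> D" using R1 by (simp add: D_def)
    next
      fix Z assume Z: "continuous_on {0..T} Z" "Z ` {0..T} \<subseteq> D"
      note A = half[OF Fc[OF Z] Fb[OF Z(2)] p kb'(2) kb'(1)] 
      have kb'': "\<bar>- (- \<omega> a)\<bar> \<le> (c * (1 + c)) * weight a ^ 2" for a using kb'(2)[of a] by simp
      note B = half[OF mF(1)[OF Z] mF(2)[OF Z] q kb'(1) kb'']
      have "A Z t + B Z t \<in> D" if t: "t \<in> {0..T}" for t
      proof -
        have "wbound (Suc k) ((R0 + T * (\<bar>lam\<bar> / 2 * R ^ 3)) + (R0 + T * (\<bar>lam\<bar> / 2 * R ^ 3))) (A Z t + B Z t)"
          unfolding A_def B_def by (intro wbound_add A(2) B(2) t)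
        moreover have "0 \<le> T * (\<bar>lam\<bar> * R ^ 3)" using T R1 by simp
        then have "(R0 + T * (\<bar>lam\<bar> / 2 * R ^ 3)) + (R0 + T * (\<bar>lam\<bar> / 2 * R ^ 3)) \<le> R"
          using T3 by (simp add: R_def algebra_simps)
        ultimately show ?thesis unfolding D_def by (auto intro: wbound_mono)
      qed
      moreover have "continuous_on {0..T} (\<lambda>t. A Z t + B Z t)"
        unfolding A_def B_def by (intro continuous_on_add A(1) B(1))
      ultimately show "continuous_on {0..T} (\<lambda>t. A Z t + B Z t) \<and> (\<lambda>t. A Z t + B Z t) ` {0..T} \<subseteq> D" by blast
    next
      fix Y Z M t
      assume Y: "continuous_on {0..T} Y" "Y ` {0..T} \<subseteq> D" and Z: "continuous_on {0..T} Z" "Z ` {0..T} \<subseteq> D"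
        and M: "\<And>t. t \<in> {0..T} \<Longrightarrow> norm (Y t - Z t) \<le> M" and t: "t \<in> {0..T}"
      have M0: "0 \<le> M" using M[OF t] norm_ge_zero order.trans by blast
      have dF: "norm (F Y s - F Z s) \<le> \<bar>lam\<bar> / 2 * (3 * R\<^sup>2 * M)" if s: "s \<in> {0..T}" for s
      proof -
        have "norm (Y s) \<le> R" "norm (Z s) \<le> R"
          using Y(2) Z(2) s wbound_norm[of "Suc k" R] by (auto simp: D_def image_subset_iff)
        then have 1: "norm (cubic (Y s) - cubic (Z s)) \<le> 3 * R\<^sup>2 * M" using M[OF s] by (rule cubic_lipschitz)
        have "F Y s - F Z s = J (const (of_real lam / (2 * \<i>)) * (cubic (Y s) - cubic (Z s)))"
          by (simp add: F_def Jdiff algebra_simps)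
        then have "norm (F Y s - F Z s) \<le> norm (const (of_real lam / (2 * \<i>)) * (cubic (Y s) - cubic (Z s)))"
          using Jn by simp
        also have "\<dots> \<le> cmod (of_real lam / (2 * \<i>)) * norm (cubic (Y s) - cubic (Z s))"
          using norm_mult_ineq[of "const (of_real lam / (2 * \<i>))" "cubic (Y s) - cubic (Z s)"] by simp
        also have "\<dots> \<le> \<bar>lam\<bar> / 2 * (3 * R\<^sup>2 * M)"
          using mult_left_mono[OF 1, of "\<bar>lam\<bar> / 2"] by (simp add: norm_divide norm_mult)
        finally show ?thesis .
      qed
      have d: "norm (twist \<theta> t (h + integral {0..t} (\<lambda>s. twist \<theta>' s (G s))) - twist \<theta> t (h + integral {0..t} (\<lambda>s. twist \<theta>' s (H s)))) \<le> M / 4"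
        if G: "curve 0 T (Suc k) G" "curve 0 T (Suc k) H" and \<theta>': "\<And>a. \<bar>\<theta>' a\<bar> \<le> (c * (1 + c)) * weight a ^ 2"
          and GH: "\<And>s. s \<in> {0..T} \<Longrightarrow> norm (G s - H s) \<le> \<bar>lam\<bar> / 2 * (3 * R\<^sup>2 * M)" for G H h \<theta> \<theta>'
      proof -
        have sub: "{0..t} \<subseteq> {0..T}" using t by auto
        note cG = continuous_on_subset[OF W[OF G(1) \<theta>'] sub] and cH = continuous_on_subset[OF W[OF G(2) \<theta>'] sub]
        have e: "twist \<theta> t (h + integral {0..t} (\<lambda>s. twist \<theta>' s (G s))) - twist \<theta> t (h + integral {0..t} (\<lambda>s. twist \<theta>' s (H s)))
            = twist \<theta> t (integral {0..t} (\<lambda>s. twist \<theta>' s (G s) - twist \<theta>' s (H s)))"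
          by (subst integral_diff[OF integrable_continuous_interval[OF cG] integrable_continuous_interval[OF cH]])
             (simp add: twist_diff[symmetric])
        have 1: "norm (integral {0..t} (\<lambda>s. twist \<theta>' s (G s) - twist \<theta>' s (H s))) \<le> t * (\<bar>lam\<bar> / 2 * (3 * R\<^sup>2 * M))"
          by (rule norm_integral_le[OF continuous_on_diff[OF cG cH]]) (use t GH in \<open>auto simp: twist_diff[symmetric]\<close>)
        have 2: "t * (\<bar>lam\<bar> / 2 * (3 * R\<^sup>2 * M)) \<le> T * (\<bar>lam\<bar> / 2 * (3 * R\<^sup>2 * M))"
          using t M0 by (intro mult_right_mono) auto
        have 3: "T * (\<bar>lam\<bar> / 2 * (3 * R\<^sup>2 * M)) \<le> M / 4"
          using mult_right_mono[OF T2, of "M / 4"] M0 by (simp add: field_simps)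
        show ?thesis unfolding e norm_twist using 1 2 3 by linarith
      qed
      have kb'': "\<bar>- (- \<omega> a)\<bar> \<le> (c * (1 + c)) * weight a ^ 2" for a using kb'(2)[of a] by simp
      have "norm (A Y t - A Z t) \<le> M / 4"
        unfolding A_def by (rule d[OF Fc[OF Y] Fc[OF Z] kb'(1) dF])
      moreover have "norm (B Y t - B Z t) \<le> M / 4"
        unfolding B_def 
      proof (rule d[OF mF(1)[OF Y] mF(1)[OF Z] kb''])
        show "norm (- F Y s - - F Z s) \<le> \<bar>lam\<bar> / 2 * (3 * R\<^sup>2 * M)" if "s \<in> {0..T}" for s
          using dF[OF that] by (simp add: norm_minus_commute)
      qed
      ultimately show "norm (A Y t + B Y t - (A Z t + B Z t)) \<le> M / 2"
        using norm_triangle_ineq[of "A Y t - A Z t" "B Y t - B Z t"] unfolding add_diff_add by linarith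
    qed (use T in auto)
    have "kg_mild lam c T f g Z (A Z) (B Z) (F Z)"
      unfolding kg_mild_def using Z(3) by (simp add: A_def B_def F_def J_def p_def q_def \<omega>_def)
    then show ?thesis using Z(1,2) unfolding D_def image_subset_iff by blast
  qed
  show ?thesis by (rule that[OF T0 *])
qed

lemma wiener_eq_iff: "f = g \<longleftrightarrow> (\<forall>a. coef f a = coef g a)"
  using wiener_eqI by auto

lemma coef_mult_const [simp]: "coef (f * const c) a = c * coef f a"
  by (subst mult.commute) simp

text \<open>\<open>curve\<close> asserts only that a derivative exists; uniqueness on a
  nondegenerate interval matches it with an explicit formula, at the end points as well.\<close>

lemma curve_pointwise_unique:
  assumes "0 < T" "t \<in> {0..T}" "(f has_vector_derivative x) (at t within {0..T})"
    "(f has_vector_derivative y) (at t within {0..T})"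
  shows "x = y"
  using vector_derivative_unique_within_closed_interval[of 0 T t f x y] assms by auto

lemma coef_has_vector_derivative:
  "(f has_vector_derivative g) (at t within S) \<Longrightarrow> ((\<lambda>t. coef (f t) a) has_vector_derivative coef g a) (at t within S)"
  by (rule bounded_linear.has_vector_derivative[OF bounded_linear_coef])

text \<open>Regularity is gained twice, at the cost of 6 and 12 weights: one more per pass than for
  the limit system, since the damping multiplier in \<open>F\<close> takes a weight. The second
  order equation is then read off mode by mode from the first order system for \<open>A\<close> and
  \<open>B\<close>.\<close>

lemma kg_exists:
  assumes f: "wbound (k + 24) R0 f" and g: "wbound (k + 24) R0 g"
  obtains T0 R where "0 < T0" "\<And>T c. 0 < T \<Longrightarrow> T \<le> T0 \<Longrightarrow> 0 < c \<Longrightarrow>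
     \<exists>Z Z1 Z2. curve 0 T (k + 4) Z \<and> curve 0 T (k + 4) Z1 \<and> curve 0 T (k + 4) Z2 \<and>
       (\<forall>t\<in>{0..T}. norm (Z t) \<le> R \<and> (Z has_vector_derivative Z1 t) (at t within {0..T}) \<and> (Z1 has_vector_derivative Z2 t) (at t within {0..T})) \<and>
       Z 0 = f \<and> (\<forall>a. coef (Z1 0) a = of_real (c\<^sup>2) * coef g a) \<and>
       (\<forall>t\<in>{0..T}. \<forall>a. coef (Z2 t) a = - of_real ((kg_freq c a)\<^sup>2) * coef (Z t) a + of_real (c\<^sup>2 * lam) * coef (cubic (Z t)) a)"
proof -
  have e: "k + 24 = Suc (k + 23)" by simp
  obtain T0 R where T0: "0 < T0" and ex: "\<And>T c. 0 < T \<Longrightarrow> T \<le> T0 \<Longrightarrow> 0 < c \<Longrightarrow>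
     \<exists>Z A B F. (\<forall>t\<in>{0..T}. wbound (Suc (k + 23)) R (Z t)) \<and> continuous_on {0..T} Z \<and> kg_mild lam c T f g Z A B F"
    by (rule kg_mild_exists[OF f[unfolded e] g[unfolded e], where lam = lam]) (rule that)
  have "\<exists>Z Z1 Z2. curve 0 T (k + 4) Z \<and> curve 0 T (k + 4) Z1 \<and> curve 0 T (k + 4) Z2 \<and>
       (\<forall>t\<in>{0..T}. norm (Z t) \<le> R \<and> (Z has_vector_derivative Z1 t) (at t within {0..T}) \<and> (Z1 has_vector_derivative Z2 t) (at t within {0..T})) \<and>
       Z 0 = f \<and> (\<forall>a. coef (Z1 0) a = of_real (c\<^sup>2) * coef g a) \<and>
       (\<forall>t\<in>{0..T}. \<forall>a. coef (Z2 t) a = - of_real ((kg_freq c a)\<^sup>2) * coef (Z t) a + of_real (c\<^sup>2 * lam) * coef (cubic (Z t)) a)"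
    if T: "0 < T" and TT0: "T \<le> T0" and c: "0 < c" for T c
  proof -
    define \<omega> where "\<omega> = kg_freq c"
    define \<omega>' where "\<omega>' = (\<lambda>a. - \<omega> a)"
    define J where "J = kg_damp c"
    obtain Z A B F where Zb: "\<forall>t\<in>{0..T}. wbound (Suc (k + 23)) R (Z t)" and Zc: "continuous_on {0..T} Z"
      and mild: "kg_mild lam c T f g Z A B F"
      using ex[OF T TT0 c] by blast
    have Zb: "wbound (k + 24) R (Z t)" if "t \<in> {0..T}" for t
      using bspec[OF Zb that] unfolding e .
    note F = kg_mildD(1)[OF mild, folded J_def] and ZAB = kg_mildD(2)[OF mild]
      and A = kg_mildD(3)[OF mild, folded J_def \<omega>_def]
    have B: "B t = twist \<omega>' t (const (1 / 2) * (f + J (const \<i> * g)) + integral {0..t} (\<lambda>s. twist (\<lambda>a. - \<omega>' a) s (- F s)))"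
      if "t \<in> {0..T}" for t
      using kg_mildD(4)[OF mild that] by (simp only: J_def \<omega>_def \<omega>'_def)
    have kb: "\<bar>\<omega> a\<bar> \<le> (c * (1 + c)) * weight a ^ 2" "\<bar>\<omega>' a\<bar> \<le> (c * (1 + c)) * weight a ^ 2" for a
      using kg_freq_bound[OF c, of a] by (auto simp: \<omega>_def \<omega>'_def)
    have coefJ: "coef (J h) a = of_real (c\<^sup>2 / \<omega> a) * coef h a" for h a
      unfolding J_def kg_damp_def \<omega>_def by (rule coef_multiplier_bounded[OF kg_ratio_le[OF c]])
    have J: "wbound i S (J h)" if "wbound i S h" for i S h
      using wbound_multiplier_bounded[OF that kg_ratio_le[OF c]] by (simp add: J_def kg_damp_def)
    have Jg: "wbound (k + 24) R0 (J (const \<i> * g))" using J[OF wbound_const_mult[OF g, of \<i>]] by simp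
    have p: "wbound (k + 24) R0 (const (1 / 2) * (f - J (const \<i> * g)))"
      using wbound_const_mult[OF wbound_diff[OF f Jg], of "1 / 2"] by simp
    have q: "wbound (k + 24) R0 (const (1 / 2) * (f + J (const \<i> * g)))"
      using wbound_const_mult[OF wbound_add[OF f Jg], of "1 / 2"] by simp
    have p4: "wbound 4 R0 (const (1 / 2) * (f - J (const \<i> * g)))" by (rule wbound_mono[OF p]) auto
    have q4: "wbound 4 R0 (const (1 / 2) * (f + J (const \<i> * g)))" by (rule wbound_mono[OF q]) auto
    have FI: "curve j T m F" if "curve j T (m + 1) Z" for j m
    proof -
      have "curve j T m (\<lambda>t. J (const (of_real lam / (2 * \<i>)) * cubic (Z t)))"
        unfolding J_def kg_damp_def
        by (rule curve_multiplier[of _ 1 0])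
           (use kg_ratio_le[OF c] curve_const_mult[OF curve_cubic[OF that]] in auto)
      then show ?thesis by (simp add: F[abs_def])
    qed
    have gain: "curve (Suc j) T m A \<and> curve (Suc j) T m B \<and> curve (Suc j) T m Z"
      if Z: "curve j T (m + 6 * j + 6) Z" and m: "m + 6 * j + 5 \<le> k + 24" for j m
    proof -
      have F': "curve j T (m + 6 * j + 5) F" by (rule FI) (use Z in \<open>simp add: numeral_eq_Suc\<close>)
      have AB: "curve (Suc j) T m A" "curve (Suc j) T m B"
        by (rule mild_gain[OF kb(1) A F' wbound_mono[OF p m order_refl]], simp)
           (rule mild_gain[OF kb(2) B curve_minus[OF F'] wbound_mono[OF q m order_refl]], simp)
      have "curve (Suc j) T m Z"
        by (rule curve_cong[OF curve_add[OF AB]]) (simp add: ZAB)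
      then show ?thesis using AB by simp
    qed
    have Z0: "curve 0 T (k + 24) Z" by (rule curve_0I[OF Zb Zc])
    have n: "k + 18 + 6 * 0 + 6 = k + 24" "k + 6 + 6 * 1 + 6 = k + 18" by simp_all
    have "curve 1 T (k + 18) Z" using gain[of 0 "k + 18", unfolded n, OF Z0] by simp
    then have g2: "curve 2 T (k + 6) Z" "curve 2 T (k + 6) A" "curve 2 T (k + 6) B"
      using gain[of 1 "k + 6", unfolded n] by (simp_all add: numeral_2_eq_2)
    then obtain Z1 where Z1: "\<And>t. t \<in> {0..T} \<Longrightarrow> (Z has_vector_derivative Z1 t) (at t within {0..T})" "curve 1 T (k + 6) Z1"
      using curve_deriv[of 1 T "k + 6" Z] by (auto simp: numeral_2_eq_2)
    then obtain Z2 where Z2: "\<And>t. t \<in> {0..T} \<Longrightarrow> (Z1 has_vector_derivative Z2 t) (at t within {0..T})" "curve 0 T (k + 6) Z2"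
      using curve_deriv[of 0 T "k + 6" Z1] by auto
    have F5: "curve 0 T 5 F" by (rule FI[OF curve_mono[OF Z0]]) auto
    have dA: "((\<lambda>t. coef (A t) a) has_vector_derivative \<i> * of_real (\<omega> a) * coef (A t) a + coef (F t) a) (at t within {0..T})"
      and dB: "((\<lambda>t. coef (B t) a) has_vector_derivative - \<i> * of_real (\<omega> a) * coef (B t) a - coef (F t) a) (at t within {0..T})"
      if t: "t \<in> {0..T}" for t a
    proof -
      obtain S where S: "wbound (k + 6) S (A t)" using curve_bound[OF g2(2)] t by metis
      obtain S' where S': "wbound (k + 6) S' (B t)" using curve_bound[OF g2(3)] t by metis
      have k: "cmod (\<i> * of_real (\<omega> a)) \<le> (c * (1 + c)) * weight a ^ 2"
        "cmod (\<i> * of_real (\<omega>' a)) \<le> (c * (1 + c)) * weight a ^ 2" for a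
        using kb[of a] by (simp_all add: norm_mult)
      have mA: "coef (multiplier (\<lambda>a. \<i> * of_real (\<omega> a)) (A t)) a = \<i> * of_real (\<omega> a) * coef (A t) a"
        by (rule coef_multiplier[OF wbound_mono[OF S] k(1)]) auto
      have mB: "coef (multiplier (\<lambda>a. \<i> * of_real (\<omega>' a)) (B t)) a = \<i> * of_real (\<omega>' a) * coef (B t) a"
        by (rule coef_multiplier[OF wbound_mono[OF S'] k(2)]) auto
      show "((\<lambda>t. coef (A t) a) has_vector_derivative \<i> * of_real (\<omega> a) * coef (A t) a + coef (F t) a) (at t within {0..T})"
        using coef_has_vector_derivative[OF mild_derivative[OF kb(1) A F5 p4 t], of a]
        by (simp add: mA)
      show "((\<lambda>t. coef (B t) a) has_vector_derivative - \<i> * of_real (\<omega> a) * coef (B t) a - coef (F t) a) (at t within {0..T})"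
        using coef_has_vector_derivative[OF mild_derivative[OF kb(2) B curve_minus[OF F5] q4 t], of a]
        unfolding coef_add coef_minus mB by (simp add: \<omega>'_def)
    qed
    \<comment> \<open>The force enters \<open>A\<close> and \<open>B\<close> with opposite signs and
      cancels in the derivative of the sum.\<close>
    have c1: "coef (Z1 t) a = \<i> * of_real (\<omega> a) * (coef (A t) a - coef (B t) a)" if t: "t \<in> {0..T}" for t a
    proof (rule curve_pointwise_unique[OF T t coef_has_vector_derivative[OF Z1(1)[OF t]]])
      have "((\<lambda>t. coef (A t) a + coef (B t) a) has_vector_derivative \<i> * of_real (\<omega> a) * (coef (A t) a - coef (B t) a)) (at t within {0..T})"
        using has_vector_derivative_add[OF dA[OF t, of a] dB[OF t, of a]] by (simp add: algebra_simps)
      then show "((\<lambda>t. coef (Z t) a) has_vector_derivative \<i> * of_real (\<omega> a) * (coef (A t) a - coef (B t) a)) (at t within {0..T})"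
        by (rule has_vector_derivative_transform[OF t, rotated]) (simp add: ZAB)
    qed
    have \<omega>0: "\<omega> a \<noteq> 0" for a using kg_freq_ge(2)[OF c, of a] by (simp add: \<omega>_def)
    have cF: "coef (F t) a = of_real (c\<^sup>2 / \<omega> a) * (of_real lam / (2 * \<i>)) * coef (cubic (Z t)) a" for t a
      by (simp add: F coefJ)
    \<comment> \<open>In the derivative of the difference the force doubles:
      \<open>2 i \<omega>\<close> times \<open>(c^2 / \<omega>) lam / (2 i)\<close> is
      \<open>c^2 lam\<close>.\<close>
    have c2: "coef (Z2 t) a = - of_real ((\<omega> a)\<^sup>2) * coef (Z t) a + of_real (c\<^sup>2 * lam) * coef (cubic (Z t)) a" if t: "t \<in> {0..T}" for t a
    proof (rule curve_pointwise_unique[OF T t coef_has_vector_derivative[OF Z2(1)[OF t]]])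
      have "((\<lambda>t. \<i> * of_real (\<omega> a) * (coef (A t) a - coef (B t) a)) has_vector_derivative
          \<i> * of_real (\<omega> a) * ((\<i> * of_real (\<omega> a) * coef (A t) a + coef (F t) a) - (- \<i> * of_real (\<omega> a) * coef (B t) a - coef (F t) a))) (at t within {0..T})"
        by (intro bounded_linear.has_vector_derivative[OF bounded_linear_mult_right] has_vector_derivative_diff dA dB t)
      moreover have "\<i> * of_real (\<omega> a) * ((\<i> * of_real (\<omega> a) * coef (A t) a + coef (F t) a) - (- \<i> * of_real (\<omega> a) * coef (B t) a - coef (F t) a))
          = - of_real ((\<omega> a)\<^sup>2) * coef (Z t) a + of_real (c\<^sup>2 * lam) * coef (cubic (Z t)) a"
        using \<omega>0[of a] by (simp add: cF ZAB[OF t] field_simps power2_eq_square)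
      ultimately have "((\<lambda>t. \<i> * of_real (\<omega> a) * (coef (A t) a - coef (B t) a)) has_vector_derivative
          - of_real ((\<omega> a)\<^sup>2) * coef (Z t) a + of_real (c\<^sup>2 * lam) * coef (cubic (Z t)) a) (at t within {0..T})" by simp
      then show "((\<lambda>t. coef (Z1 t) a) has_vector_derivative
          - of_real ((\<omega> a)\<^sup>2) * coef (Z t) a + of_real (c\<^sup>2 * lam) * coef (cubic (Z t)) a) (at t within {0..T})"
        by (rule has_vector_derivative_transform[OF t, rotated]) (simp add: c1)
    qed
    have AB0: "A 0 = const (1 / 2) * (f - J (const \<i> * g))" "B 0 = const (1 / 2) * (f + J (const \<i> * g))"
      using A[of 0] B[of 0] T by auto
    have "Z 0 = f"
      using T unfolding wiener_eq_iff by (simp add: ZAB AB0) (simp add: field_simps)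
    moreover have "coef (Z1 0) a = of_real (c\<^sup>2) * coef g a" for a
      using T \<omega>0[of a] by (simp add: c1 AB0 coefJ field_simps)
    ultimately show ?thesis
      using Z1(1) Z2(1) c2 wbound_norm[OF Zb] Z0 Z1(2) Z2(2)
      by (intro exI[of _ Z] exI[of _ Z1] exI[of _ Z2] conjI ballI allI)
         (auto simp: \<omega>_def intro: curve_mono)
  qed
  then show ?thesis using that[OF T0] by blast
qed

subsection \<open>Classical solutions\<close>

definition ddx :: "wiener \<Rightarrow> wiener" where
  "ddx = multiplier (\<lambda>a. \<i> * of_int a)"

lemma ddx_symbol: "cmod (\<i> * of_int a) \<le> 1 * weight a ^ 1"
  by (simp add: norm_mult weight_def)

lemma coef_ddx: "wbound 1 R f \<Longrightarrow> coef (ddx f) a = \<i> * of_int a * coef f a"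
  unfolding ddx_def by (rule coef_multiplier[OF _ ddx_symbol])

lemma wbound_ddx: "wbound (Suc k) R f \<Longrightarrow> wbound k R (ddx f)"
  unfolding ddx_def using wbound_multiplier[of k 1 R f _ 1, OF _ ddx_symbol] by simp

text \<open>Translation in \<open>x\<close> is a twist, so that time differentiation of twists applies.\<close>

lemma ev_has_vector_derivative:
  assumes f: "wbound 4 R f"
  shows "(ev f has_vector_derivative ev (ddx f) x) (at x)"
proof -
  have sh: "ev (twist of_int y h) 0 = ev h y" for y h
    unfolding ev_def by (simp add: mult_ac)
  have b: "\<bar>real_of_int a\<bar> \<le> 1 * weight a ^ 2" for a
    using self_le_power[of "weight a" 2] by (simp add: weight_def)
  have i: "at (1::real) within {0..2} = at 1" by (rule at_within_Icc_at) auto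
  define h where "h = twist of_int (x - 1) f"
  have h: "wbound 4 R h" using f by (simp add: h_def)
  have "((\<lambda>t. twist of_int t h) has_vector_derivative twist of_int 1 (0 + multiplier (\<lambda>a. \<i> * of_real (of_int a)) h)) (at 1 within {0..2})"
    by (rule has_vector_derivative_twist[OF b _ curve_constant[OF h] curve_constant[OF wbound_0[OF order_refl]]]) auto
  then have "((\<lambda>t. twist of_int t h) has_vector_derivative twist of_int 1 (ddx h)) (at 1)"
    by (simp only: i add_0 of_real_of_int_eq ddx_def)
  then have "((\<lambda>t. ev (twist of_int t h) 0) has_vector_derivative ev (twist of_int 1 (ddx h)) 0) (at 1)"
    by (rule bounded_linear.has_vector_derivative[OF bounded_linear_ev])
  moreover have "twist of_int 1 (ddx h) = twist of_int x (ddx f)"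
  proof (rule wiener_eqI)
    fix a
    show "coef (twist of_int 1 (ddx h)) a = coef (twist of_int x (ddx f)) a"
      using wbound_mono[OF f, of 1 R] wbound_mono[OF h, of 1 R]
      by (simp add: coef_ddx) (simp add: h_def algebra_simps flip: exp_add)
  qed
  moreover have "ev (twist of_int t h) 0 = ev f (x - 1 + t)" for t
    by (simp add: h_def twist_twist sh add.commute)
  ultimately have 1: "((\<lambda>t. ev f (x - 1 + t)) has_vector_derivative ev (ddx f) x) (at 1)" by (simp add: sh)
  have "((\<lambda>y. y - (x - 1)) has_vector_derivative 1) (at x)"
    by (auto intro!: derivative_eq_intros)
  from vector_diff_chain_at[OF this, of "\<lambda>t. ev f (x - 1 + t)"] 1
  show ?thesis by (simp add: o_def)
qed

text \<open>Moving \<open>t\<close> changes the value by at most the norm of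
  \<open>Z (fst p) - Z t\<close>, uniformly in the space variable, so joint continuity splits into
  continuity in norm and continuity of one fixed function.\<close>

lemma continuous_on_ev_pair:
  assumes Z: "continuous_on S Z"
  shows "continuous_on (S \<times> UNIV) (\<lambda>(t, x). ev (Z t) x)"
proof -
  have main: "((\<lambda>p. ev (Z (fst p)) (snd p)) \<longlongrightarrow> ev (Z t) x) (at (t, x) within S \<times> UNIV)" if t: "t \<in> S" for t x
  proof -
  let ?F = "at (t, x) within S \<times> UNIV"
  have "((\<lambda>p. Z (fst p)) \<longlongrightarrow> Z t) ?F"
  proof -
    have "continuous_on (S \<times> (UNIV :: real set)) (\<lambda>p. Z (fst p))"
      by (rule continuous_on_compose2[OF Z]) (auto intro!: continuous_intros)
    then show ?thesis using t unfolding continuous_on_def by force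
  qed
  then have "((\<lambda>p. norm (Z (fst p) - Z t)) \<longlongrightarrow> 0) ?F"
    by (simp add: tendsto_norm_zero LIM_zero)
  then have 1: "((\<lambda>p. ev (Z (fst p) - Z t) (snd p)) \<longlongrightarrow> 0) ?F"
    by (rule Lim_null_comparison[rotated]) (intro always_eventually allI norm_ev_le)
  have 2: "((\<lambda>p. ev (Z t) (snd p)) \<longlongrightarrow> ev (Z t) x) ?F"
  proof -
    have "continuous_on (S \<times> (UNIV :: real set)) (\<lambda>p. ev (Z t) (snd p))"
      by (rule continuous_on_compose2[OF continuous_ev[of UNIV]]) (auto intro!: continuous_intros)
    then show ?thesis using t unfolding continuous_on_def by force
  qed
  show ?thesis using tendsto_add[OF 1 2] by simp
  qed
  then show ?thesis unfolding continuous_on_def by (auto simp: case_prod_unfold)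
qed

lemma kg_classical:
  assumes T: "0 < T" and c: "0 < c" and cu: "curve 0 T 6 Z" "curve 0 T 6 Z1" "curve 0 T 6 Z2"
    and d: "\<And>t. t \<in> {0..T} \<Longrightarrow> (Z has_vector_derivative Z1 t) (at t within {0..T})"
      "\<And>t. t \<in> {0..T} \<Longrightarrow> (Z1 has_vector_derivative Z2 t) (at t within {0..T})"
    and init: "Z 0 = f" "\<And>a. coef (Z1 0) a = of_real (c\<^sup>2) * coef g a"
    and eq: "\<And>t a. t \<in> {0..T} \<Longrightarrow> coef (Z2 t) a = - of_real ((kg_freq c a)\<^sup>2) * coef (Z t) a + of_real (c\<^sup>2 * lam) * coef (cubic (Z t)) a"
  shows "klein_gordon_solution lam c (ev f) (ev g) T (\<lambda>t. ev (Z t))"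
proof -
  have cx: "curve 0 T 4 (\<lambda>t. ddx (Z t))" "curve 0 T 2 (\<lambda>t. ddx (ddx (Z t)))"
  proof -
    show 1: "curve 0 T 4 (\<lambda>t. ddx (Z t))"
      unfolding ddx_def by (rule curve_multiplier[OF ddx_symbol]) (use cu(1) in simp)
    show "curve 0 T 2 (\<lambda>t. ddx (ddx (Z t)))"
      unfolding ddx_def[of] by (rule curve_multiplier[OF ddx_symbol]) (use 1 in \<open>simp add: ddx_def\<close>)
  qed
  have pde: "of_real (1 / c\<^sup>2) * ev (Z2 t) x - ev (ddx (ddx (Z t))) x + of_real (c\<^sup>2) * ev (Z t) x
      = of_real (lam * (cmod (ev (Z t) x))\<^sup>2) * ev (Z t) x" if t: "t \<in> {0..T}" for t x
  proof -
    obtain R where R: "wbound 6 R (Z t)" using curve_bound[OF cu(1)] t by metis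
    have "wbound 1 R (Z t)" "wbound 1 R (ddx (Z t))"
      using wbound_mono[OF R, of 1 R] wbound_ddx[of 1 R "Z t"] wbound_mono[OF R, of 2 R] by (auto simp: numeral_2_eq_2)
    then have "coef (ddx (ddx (Z t))) a = - of_real ((of_int a)\<^sup>2) * coef (Z t) a" for a
      by (simp add: coef_ddx power2_eq_square) (simp add: mult_ac)
    then have "const (of_real (1 / c\<^sup>2)) * Z2 t - ddx (ddx (Z t)) + const (of_real (c\<^sup>2)) * Z t = const (of_real lam) * cubic (Z t)"
      using c by (intro wiener_eqI) (simp add: eq[OF t] kg_freq_square field_simps)
    from arg_cong[OF this, of "\<lambda>f. ev f x"] show ?thesis by (simp add: ev_cubic mult.assoc)
  qed
  have g: "ev (Z1 0) x = of_real (c\<^sup>2) * ev g x" for x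
  proof -
    have "Z1 0 = const (of_real (c\<^sup>2)) * g" by (rule wiener_eqI) (simp add: init)
    then show ?thesis by simp
  qed
  have dx: "(ev (Z t) has_vector_derivative ev (ddx (Z t)) x) (at x)"
    "(ev (ddx (Z t)) has_vector_derivative ev (ddx (ddx (Z t))) x) (at x)" if t: "t \<in> {0..T}" for t x
  proof -
    obtain R where R: "wbound 6 R (Z t)" using curve_bound[OF cu(1)] t by metis
    have R': "wbound 5 R (Z t)" by (rule wbound_mono[OF R]) auto
    have "wbound 4 R (Z t)" "wbound 4 R (ddx (Z t))"
      using wbound_mono[OF R, of 4 R] wbound_ddx[of 4 R "Z t"] R' by auto
    then show "(ev (Z t) has_vector_derivative ev (ddx (Z t)) x) (at x)"
      "(ev (ddx (Z t)) has_vector_derivative ev (ddx (ddx (Z t))) x) (at x)"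
      by (auto intro: ev_has_vector_derivative)
  qed
  have dt: "((\<lambda>r. ev (Z r) x) has_vector_derivative ev (Z1 t) x) (at t within {0..T})"
    "((\<lambda>r. ev (Z1 r) x) has_vector_derivative ev (Z2 t) x) (at t within {0..T})" if "t \<in> {0..T}" for t x
    by (rule bounded_linear.has_vector_derivative[OF bounded_linear_ev d(1)[OF that]])
       (rule bounded_linear.has_vector_derivative[OF bounded_linear_ev d(2)[OF that]])
  show ?thesis
    unfolding klein_gordon_solution_def
  proof (intro conjI)
    show "\<forall>t\<in>{0..T}. torus_periodic (ev (Z t))" by (simp add: torus_periodic_def ev_periodic)
    show "\<exists>zt ztt zx zxx.
        (\<forall>w\<in>{\<lambda>t. ev (Z t), zt, ztt, zx, zxx}. continuous_on ({0..T} \<times> UNIV) (\<lambda>(t, x). w t x)) \<and>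
        (\<forall>t\<in>{0..T}. \<forall>x.
           ((\<lambda>r. ev (Z r) x) has_vector_derivative zt t x) (at t within {0..T}) \<and>
           ((\<lambda>r. zt r x) has_vector_derivative ztt t x) (at t within {0..T}) \<and>
           (ev (Z t) has_vector_derivative zx t x) (at x) \<and>
           (zx t has_vector_derivative zxx t x) (at x) \<and>
           of_real (1 / c\<^sup>2) * ztt t x - zxx t x + of_real (c\<^sup>2) * ev (Z t) x
             = of_real (lam * (cmod (ev (Z t) x))\<^sup>2) * ev (Z t) x) \<and>
        (\<forall>x. ev (Z 0) x = ev f x \<and> zt 0 x = of_real (c\<^sup>2) * ev g x)"
      by (rule exI[of _ "\<lambda>t. ev (Z1 t)"], rule exI[of _ "\<lambda>t. ev (Z2 t)"], rule exI[of _ "\<lambda>t. ev (ddx (Z t))"],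
          rule exI[of _ "\<lambda>t. ev (ddx (ddx (Z t)))"])
         (intro conjI ballI allI pde dx dt; 
          use cu cx init(1) g in \<open>auto intro!: continuous_on_ev_pair dest: curve_continuous\<close>)
  qed
qed

subsection \<open>Aliasing and trigonometric interpolation\<close>

text \<open>The representative of \<open>b\<close> modulo \<open>2 K\<close> in the band from
  \<open>-K\<close> to \<open>K - 1\<close>: adding and subtracting \<open>K\<close> centres the
  residue. Modes with the same representative coincide on the grid.\<close>

definition alias_mode :: "nat \<Rightarrow> int \<Rightarrow> int" where
  "alias_mode K b = (b + int K) mod (2 * int K) - int K"

definition aliased :: "nat \<Rightarrow> wiener \<Rightarrow> wiener" where
  "aliased K f = Abs_wiener (\<lambda>a. \<Sum>\<^sub>\<infinity>b\<in>{b. alias_mode K b = a}. coef f b)"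

lemma alias_mode_range: "K \<ge> 1 \<Longrightarrow> alias_mode K b \<in> {- int K..int K - 1}"
  unfolding alias_mode_def
  using pos_mod_bound[of "2 * int K" "b + int K"] pos_mod_sign[of "2 * int K" "b + int K"] by auto

lemma alias_mode_eq: "b \<in> {- int K..int K - 1} \<Longrightarrow> alias_mode K b = b"
  unfolding alias_mode_def by (subst mod_pos_pos_trivial) auto

lemma exp_alias_mode:
  assumes K: "K \<ge> 1"
  shows "exp (\<i> * of_int (alias_mode K b) * of_real (grid_point K j)) = exp (\<i> * of_int b * of_real (grid_point K j))"
proof -
  define q where "q = (b + int K) div (2 * int K)"
  define r where "r = alias_mode K b"
  have b: "b = r + q * (2 * int K)"
    unfolding r_def alias_mode_def q_def using div_mult_mod_eq[of "b + int K" "2 * int K"] by linarith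
  have "\<i> * of_int (r + q * (2 * int K)) * of_real (grid_point K j)
      = \<i> * of_int r * of_real (grid_point K j) + (2 * of_int (q * j) * of_real pi) * \<i>"
    using K by (simp add: grid_point_def field_simps)
  moreover have one: "exp ((2 * of_int (q * j) * of_real pi) * \<i>) = 1"
    using exp_integer_2pi[of "of_int (q * j)"] by (simp del: of_int_mult)
  ultimately have "exp (\<i> * of_int b * of_real (grid_point K j)) = exp (\<i> * of_int r * of_real (grid_point K j))"
    using one by (subst b) (simp only: exp_add mult_1_right)
  then show ?thesis by (simp only: r_def)
qed

text \<open>The fibres of \<open>alias_mode\<close> partition the integers, so a sum may be taken
  fibre by fibre.\<close>

lemma has_sum_alias:
  fixes h :: "int \<Rightarrow> 'a::{topological_comm_monoid_add, t3_space}"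
  assumes "(h has_sum S) UNIV" "\<And>a. (h has_sum g a) {b. alias_mode K b = a}"
  shows "(g has_sum S) UNIV"
proof (rule has_sum_SigmaD)
  have "bij_betw snd (Sigma UNIV (\<lambda>a. {b. alias_mode K b = a})) UNIV"
    by (rule bij_betwI[where g = "\<lambda>b. (alias_mode K b, b)"]) auto
  then show "((\<lambda>(a, b). h b) has_sum S) (Sigma UNIV (\<lambda>a. {b. alias_mode K b = a}))"
    using has_sum_reindex_bij_betw[of snd _ UNIV h S] assms(1) by (simp add: case_prod_unfold)
qed (use assms(2) in simp)

lemma alias_norm_has_sum:
  "((\<lambda>a. \<Sum>\<^sub>\<infinity>b\<in>{b. alias_mode K b = a}. cmod (coef f b)) has_sum norm f) UNIV"
proof (rule has_sum_alias)
  show "((\<lambda>b. cmod (coef f b)) has_sum norm f) UNIV"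
    unfolding norm_wiener_def by (rule has_sum_infsum) auto
  show "((\<lambda>b. cmod (coef f b)) has_sum (\<Sum>\<^sub>\<infinity>b\<in>{b. alias_mode K b = a}. cmod (coef f b))) {b. alias_mode K b = a}" for a
    by (intro has_sum_infsum summable_on_subset[OF coef_summable]) auto
qed

lemma cmod_alias_le:
  "cmod (\<Sum>\<^sub>\<infinity>b\<in>{b. alias_mode K b = a}. coef f b) \<le> (\<Sum>\<^sub>\<infinity>b\<in>{b. alias_mode K b = a}. cmod (coef f b))"
  by (rule norm_infsum_bound) (rule summable_on_subset[OF coef_summable], simp)

lemma coef_aliased: "coef (aliased K f) a = (\<Sum>\<^sub>\<infinity>b\<in>{b. alias_mode K b = a}. coef f b)"
  unfolding aliased_def
  by (subst coef_Abs) (auto intro!: abs_summable_on_le[OF has_sum_imp_summable[OF alias_norm_has_sum[where K = K and f = f]]] cmod_alias_le)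

lemma aliased_has_sum: "(coef f has_sum coef (aliased K f) a) {b. alias_mode K b = a}"
  unfolding coef_aliased
  by (rule has_sum_infsum, rule abs_summable_summable, rule summable_on_subset[OF coef_summable]) simp

lemma norm_aliased: "norm (aliased K f) \<le> norm f"
proof (rule norm_wiener_leI)
  fix F :: "int set" assume F: "finite F"
  have "(\<Sum>a\<in>F. cmod (coef (aliased K f) a)) \<le> (\<Sum>a\<in>F. \<Sum>\<^sub>\<infinity>b\<in>{b. alias_mode K b = a}. cmod (coef f b))"
    unfolding coef_aliased by (intro sum_mono cmod_alias_le)
  also have "\<dots> \<le> norm f"
    by (rule finite_sum_le_has_sum[OF alias_norm_has_sum]) (use F in \<open>auto intro!: infsum_nonneg\<close>)
  finally show "(\<Sum>a\<in>F. cmod (coef (aliased K f) a)) \<le> norm f" .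
qed

lemma aliased_diff: "aliased K (f - g) = aliased K f - aliased K g"
proof (rule wiener_eqI)
  fix a
  have "((\<lambda>b. coef f b + - coef g b) has_sum (coef (aliased K f) a + - coef (aliased K g) a)) {b. alias_mode K b = a}"
    by (intro has_sum_add has_sum_uminusI aliased_has_sum)
  moreover have e: "coef (f - g) = (\<lambda>b. coef f b + - coef g b)" by auto
  ultimately show "coef (aliased K (f - g)) a = coef (aliased K f - aliased K g) a"
    using has_sum_unique[OF aliased_has_sum[of "f - g" K a, unfolded e]] by simp
qed

definition band_limited :: "nat \<Rightarrow> wiener \<Rightarrow> bool" where
  "band_limited K f \<longleftrightarrow> (\<forall>a. a \<notin> {- int K..int K - 1} \<longrightarrow> coef f a = 0)"

lemma band_limited_aliased: "K \<ge> 1 \<Longrightarrow> band_limited K (aliased K f)"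
  unfolding band_limited_def coef_aliased
proof (intro allI impI)
  fix a assume "K \<ge> 1" "a \<notin> {- int K..int K - 1}"
  then have "{b. alias_mode K b = a} = {}" using alias_mode_range by blast
  then show "(\<Sum>\<^sub>\<infinity>b\<in>{b. alias_mode K b = a}. coef f b) = 0" by simp
qed

lemma band_limited_twist: "band_limited K f \<Longrightarrow> band_limited K (twist \<theta> t f)"
  by (simp add: band_limited_def)

lemma ev_band_limited:
  "band_limited K f \<Longrightarrow> ev f x = (\<Sum>a\<in>{- int K..int K - 1}. coef f a * exp (\<i> * of_int a * of_real x))"
  by (rule ev_finite) (auto simp: band_limited_def)

lemma ev_band_limited_trig_space: "band_limited K f \<Longrightarrow> ev f \<in> trig_space K"
  unfolding trig_space_def using ev_band_limited by blast

lemma ev_aliased_grid: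
  assumes K: "K \<ge> 1"
  shows "ev (aliased K f) (grid_point K j) = ev f (grid_point K j)"
proof -
  let ?e = "\<lambda>a. exp (\<i> * of_int a * of_real (grid_point K j))"
  have "((\<lambda>a. coef (aliased K f) a * ?e a) has_sum ev f (grid_point K j)) UNIV"
  proof (rule has_sum_alias[OF ev_has_sum])
    fix a
    have "((\<lambda>b. coef f b * ?e a) has_sum (coef (aliased K f) a * ?e a)) {b. alias_mode K b = a}"
      by (rule has_sum_cmult_left[OF aliased_has_sum])
    then show "((\<lambda>b. coef f b * ?e b) has_sum (coef (aliased K f) a * ?e a)) {b. alias_mode K b = a}"
      by (rule has_sum_cong[THEN iffD1, rotated]) (use exp_alias_mode[OF K] in auto)
  qed
  then show ?thesis using ev_has_sum has_sum_unique by blast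
qed

lemma trig_interp_ev:
  assumes K: "K \<ge> 1" and g: "\<And>j. j \<in> {- int K..int K - 1} \<Longrightarrow> g (grid_point K j) = ev f (grid_point K j)"
  shows "trig_interp K g = ev (aliased K f)"
  unfolding trig_interp_def
  by (rule the1_equality[OF trig_interp_ex1[OF K]])
     (use ev_band_limited_trig_space[OF band_limited_aliased[OF K]] in \<open>auto simp: ev_aliased_grid[OF K] g\<close>)

text \<open>Aliasing is interpolation and thus sees grid values only. This lets pointwise operations
  be carried out before or after it.\<close>

lemma aliased_cong:
  assumes K: "K \<ge> 1" and "\<And>j. ev f (grid_point K j) = ev g (grid_point K j)"
  shows "aliased K f = aliased K g"
proof (rule ev_inject)
  fix x
  have "ev (aliased K f) = trig_interp K (ev f)" "ev (aliased K g) = trig_interp K (ev f)"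
    using trig_interp_ev[OF K, of "ev f" f] trig_interp_ev[OF K, of "ev f" g] assms(2) by auto
  then show "ev (aliased K f) x = ev (aliased K g) x" by simp
qed

lemma aliased_band_limited:
  assumes K: "K \<ge> 1" and f: "band_limited K f"
  shows "aliased K f = f"
proof (rule ev_inject)
  fix x
  have "trig_interp K (ev f) = ev f"
    unfolding trig_interp_def
    by (rule the1_equality[OF trig_interp_ex1[OF K]]) (use ev_band_limited_trig_space[OF f] in auto)
  then show "ev (aliased K f) x = ev f x" using trig_interp_ev[OF K, of "ev f" f] by simp
qed

text \<open>The truncation of \<open>f\<close> to the band is fixed by aliasing, so only the tail
  matters. It is counted twice, for itself and for its alias.\<close>

lemma aliased_error:
  assumes K: "K \<ge> 1" and f: "wbound m R f"
  shows "norm (f - aliased K f) \<le> 2 * R / real K ^ m"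
proof -
  define g where "g = truncation {- int K..int K - 1} f"
  have g: "aliased K g = g"
    by (rule aliased_band_limited[OF K]) (simp add: band_limited_def g_def)
  have "wbound 0 (1 / real K ^ m * R) (f - g)"
  proof (rule wbound_le_coef[OF f])
    fix a
    show "weight a ^ 0 * cmod (coef (f - g) a) \<le> 1 / real K ^ m * (weight a ^ m * cmod (coef f a))"
    proof (cases "a \<in> {- int K..int K - 1}")
      case False
      then have "real K ^ m \<le> weight a ^ m" by (intro power_mono) (auto simp: weight_def)
      then have "cmod (coef f a) * real K ^ m \<le> cmod (coef f a) * weight a ^ m" by (rule mult_left_mono) simp
      then show ?thesis using False K by (simp add: g_def field_simps)
    qed (simp add: g_def)
  qed simp
  then have b: "norm (f - g) \<le> R / real K ^ m" by (simp add: wbound_0_iff)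
  have "f - aliased K f = (f - g) - aliased K (f - g)" by (simp add: aliased_diff g)
  then have "norm (f - aliased K f) \<le> norm (f - g) + norm (aliased K (f - g))"
    by (simp only: norm_triangle_ineq4)
  then show ?thesis using norm_aliased[of K "f - g"] b by simp
qed

lemma exp_i_diff_le: "cmod (exp (\<i> * of_real x) - exp (\<i> * of_real y)) \<le> \<bar>x - y\<bar>"
proof -
  have "exp (\<i> * of_real x) - exp (\<i> * of_real y) = exp (\<i> * of_real y) * (exp (\<i> * of_real (x - y)) - 1)"
    by (simp add: algebra_simps flip: exp_add)
  then have "cmod (exp (\<i> * of_real x) - exp (\<i> * of_real y)) = cmod (exp (\<i> * of_real (x - y)) - 1)"
    by (simp only: norm_mult norm_exp_i_times mult_1)
  also have "\<dots> = 2 * \<bar>sin ((x - y) / 2)\<bar>" by (rule dist_exp_i_1)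
  also have "\<dots> \<le> \<bar>x - y\<bar>" using abs_sin_x_le_abs_x[of "(x - y) / 2"] by simp
  finally show ?thesis .
qed

text \<open>The commutator is the alias of a multiplier whose symbol \<open>d\<close> compares the
  kinetic phases of a mode and of its alias. It vanishes on the band and carries a factor
  \<open>t\<close>, so that over \<open>T / \<tau>\<close> steps the aliasing errors add up to order
  \<open>h^m\<close> without a loss of \<open>1 / \<tau>\<close>.\<close>

lemma twist_aliased_commutator:
  assumes K: "K \<ge> 1" and f: "wbound (m + 2) R f" and t: "0 \<le> t"
  shows "norm (twist half_square t (aliased K f) - aliased K (twist half_square t f)) \<le> t * R / real K ^ m"
proof -
  define d where "d = (\<lambda>b. exp (\<i> * of_real (half_square (alias_mode K b) * t)) - exp (\<i> * of_real (half_square b * t)))"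
  have d: "cmod (d b) \<le> (t / real K ^ m) * weight b ^ (m + 2)" for b
  proof (cases "b \<in> {- int K..int K - 1}")
    case True
    then show ?thesis using t by (simp add: d_def alias_mode_eq)
  next
    case False
    \<comment> \<open>Outside the band the alias is the smaller mode in absolute value, so the
      difference of the two phases is at most \<open>half_square b * t\<close>.\<close>
    have "\<bar>alias_mode K b\<bar> \<le> \<bar>b\<bar>" using False alias_mode_range[OF K, of b] by auto
    then have "real_of_int \<bar>alias_mode K b\<bar> ^ 2 \<le> real_of_int \<bar>b\<bar> ^ 2" by (intro power_mono) auto
    then have le: "0 \<le> half_square (alias_mode K b)" "half_square (alias_mode K b) \<le> half_square b"
      by (auto simp: half_square_def)
    have "cmod (d b) \<le> \<bar>half_square (alias_mode K b) * t - half_square b * t\<bar>"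
      unfolding d_def by (rule exp_i_diff_le)
    also have "\<dots> = \<bar>half_square (alias_mode K b) - half_square b\<bar> * t"
      using t by (simp add: left_diff_distrib[symmetric] abs_mult)
    also have "\<dots> \<le> weight b ^ 2 * t"
      using le half_square_bound[of b] t by (intro mult_right_mono) auto
    also have "\<dots> \<le> (weight b ^ 2 * t) * (weight b ^ m / real K ^ m)"
    proof -
      have "real K ^ m \<le> weight b ^ m" using False by (intro power_mono) (auto simp: weight_def)
      then have "1 \<le> weight b ^ m / real K ^ m" using K by (simp add: field_simps)
      then show ?thesis using t mult_left_mono[of 1 "weight b ^ m / real K ^ m" "weight b ^ 2 * t"] by simp
    qed
    also have "\<dots> = (t / real K ^ m) * weight b ^ (m + 2)" unfolding power_add by simp
    finally show ?thesis .
  qed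
  have "twist half_square t (aliased K f) - aliased K (twist half_square t f) = aliased K (multiplier d f)"
  proof (rule wiener_eqI)
    fix a
    have cm: "coef (multiplier d f) b = d b * coef f b" for b by (rule coef_multiplier[OF f d])
    have pt: "exp (\<i> * of_real (half_square a * t)) * coef f b + - coef (twist half_square t f) b = coef (multiplier d f) b"
      if "b \<in> {b. alias_mode K b = a}" for b
      unfolding cm using that by (simp add: d_def algebra_simps)
    have "((\<lambda>b. exp (\<i> * of_real (half_square a * t)) * coef f b + - coef (twist half_square t f) b) has_sum
        (exp (\<i> * of_real (half_square a * t)) * coef (aliased K f) a + - coef (aliased K (twist half_square t f)) a)) {b. alias_mode K b = a}"
      by (intro has_sum_add has_sum_uminusI aliased_has_sum has_sum_cmult_right)
    then have "((\<lambda>b. coef (multiplier d f) b) has_sum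
        (exp (\<i> * of_real (half_square a * t)) * coef (aliased K f) a + - coef (aliased K (twist half_square t f)) a)) {b. alias_mode K b = a}"
      by (rule has_sum_cong[THEN iffD1, rotated]) (rule pt)
    then show "coef (twist half_square t (aliased K f) - aliased K (twist half_square t f)) a = coef (aliased K (multiplier d f)) a"
      using has_sum_unique[OF aliased_has_sum] by (simp add: algebra_simps)
  qed
  also have "norm \<dots> \<le> norm (multiplier d f)" by (rule norm_aliased)
  also have "\<dots> \<le> t / real K ^ m * R"
    using wbound_multiplier[of 0 "m + 2" R f d, OF _ d] f by (simp add: wbound_0_iff)
  finally show ?thesis by simp
qed

subsection \<open>The splitting scheme in the Wiener algebra\<close>

definition phase_flow :: "real \<Rightarrow> real \<Rightarrow> wiener \<Rightarrow> wiener \<Rightarrow> wiener" where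
  "phase_flow \<mu> t u v = exp (const (- \<i> * of_real (t * \<mu>)) * potential u v) * u"

lemma ev_potential: "ev (potential u v) x = of_real ((cmod (ev u x))\<^sup>2 + 2 * (cmod (ev v x))\<^sup>2)"
proof -
  have "ev (potential u v) x = ev u x * cnj (ev u x) + (ev v x * cnj (ev v x) + ev v x * cnj (ev v x))"
    unfolding potential_def mult_2 by (simp only: ev_add ev_mult ev_wcnj)
  then show ?thesis by (simp only: complex_norm_square[symmetric] of_real_add[symmetric] mult_2)
qed

lemma ev_phase_flow:
  "ev (phase_flow \<mu> t u v) x = exp (- \<i> * of_real (t * \<mu> * ((cmod (ev u x))\<^sup>2 + 2 * (cmod (ev v x))\<^sup>2))) * ev u x"
  by (simp only: phase_flow_def ev_mult ev_exp ev_monomial ev_potential) (simp add: mult_ac)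

text \<open>Only the phase flows are aliased: the kinetic flow is diagonal in the modes and keeps
  the band.\<close>

definition disc_step :: "nat \<Rightarrow> real \<Rightarrow> real \<Rightarrow> wiener \<times> wiener \<Rightarrow> wiener \<times> wiener" where
  "disc_step K \<mu> \<tau> = (\<lambda>(u, v).
     let u1 = twist half_square \<tau> (aliased K (phase_flow \<mu> (\<tau> / 2) u v));
         v1 = twist half_square \<tau> (aliased K (phase_flow \<mu> (\<tau> / 2) v u))
     in (aliased K (phase_flow \<mu> (\<tau> / 2) u1 v1), aliased K (phase_flow \<mu> (\<tau> / 2) v1 u1)))"

lemma potential_flow_ev:
  assumes "K \<ge> 1"
  shows "potential_flow K lam t (ev u, ev v) =
    (ev (aliased K (phase_flow (lam / 8) t u v)), ev (aliased K (phase_flow (lam / 8) t v u)))"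
  unfolding potential_flow_def prod.case
  by (intro arg_cong2[where f = Pair] trig_interp_ev[OF assms]) (simp_all only: ev_phase_flow)

lemma kinetic_mult_ev:
  assumes "band_limited K f"
  shows "kinetic_mult K t (ev f) = ev (twist half_square t f)"
proof
  fix x
  have "exp (\<i> * of_real (t * (of_int a)\<^sup>2 / 2)) * coef f a = coef (twist half_square t f) a" for a
    by (simp add: half_square_def mult.commute)
  then show "kinetic_mult K t (ev f) x = ev (twist half_square t f) x"
    unfolding kinetic_mult_def fourier_coeff_ev ev_band_limited[OF band_limited_twist[OF assms]] by presburger
qed

lemma strang_step_ev:
  assumes "K \<ge> 1"
  shows "strang_step K lam \<tau> (ev u, ev v) = map_prod ev ev (disc_step K (lam / 8) \<tau> (u, v))"
  unfolding strang_step_def disc_step_def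
  by (simp add: potential_flow_ev[OF assms] kinetic_flow_def kinetic_mult_ev band_limited_aliased[OF assms] Let_def)

lemma strang_approx_ev:
  assumes K: "K \<ge> 1" and u: "\<And>x. ev u x = \<phi> x - \<i> * \<gamma> x" and v: "\<And>x. ev v x = cnj (\<phi> x + \<i> * \<gamma> x)"
  shows "strang_approx K lam \<tau> \<phi> \<gamma> n = map_prod ev ev ((disc_step K (lam / 8) \<tau> ^^ n) (aliased K u, aliased K v))"
proof (induction n)
  case 0
  then show ?case by (simp add: strang_approx_def trig_interp_ev[OF K, of _ u] trig_interp_ev[OF K, of _ v] u v)
next
  case (Suc n)
  then show ?case
    using strang_step_ev[OF K, of lam \<tau> "fst p" "snd p" for p]
    by (simp add: strang_approx_def map_prod_def case_prod_unfold)
qed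

lemma wbound_phase:
  assumes "wbound k R u" "wbound k R v" "\<bar>t\<bar> \<le> 1"
  shows "wbound k (3 * \<bar>\<mu>\<bar> * R\<^sup>2) (const (- \<i> * of_real (t * \<mu>)) * potential u v)"
proof -
  have "wbound k (cmod (- \<i> * of_real (t * \<mu>)) * (3 * R\<^sup>2)) (const (- \<i> * of_real (t * \<mu>)) * potential u v)"
    by (rule wbound_const_mult[OF wbound_potential[OF assms(1,2)]])
  moreover have "cmod (- \<i> * of_real (t * \<mu>)) * (3 * R\<^sup>2) \<le> 3 * \<bar>\<mu>\<bar> * R\<^sup>2"
    using mult_right_mono[OF assms(3), of "\<bar>\<mu>\<bar> * (3 * R\<^sup>2)"] by (simp add: norm_mult abs_mult mult_ac)
  ultimately show ?thesis by (rule wbound_mono[OF _ order_refl])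
qed

lemma wbound_phase_flow:
  assumes "wbound k R u" "wbound k R v" "\<bar>t\<bar> \<le> 1"
  shows "wbound k (exp (3 * \<bar>\<mu>\<bar> * R\<^sup>2) * R) (phase_flow \<mu> t u v)"
  unfolding phase_flow_def by (intro wbound_mult wbound_exp wbound_phase assms)

text \<open>The leading constant must be exactly 1 for the estimate to be iterated. Hence the
  difference is split into \<open>u - u'\<close>, a term with \<open>exp x - 1\<close> and a term
  with \<open>exp x - exp y\<close>, the last two being of order \<open>t\<close>.\<close>

lemma phase_flow_lipschitz:
  assumes n: "norm u \<le> R" "norm v \<le> R" "norm u' \<le> R" "norm v' \<le> R" and t: "0 \<le> t" "t \<le> 1"
  shows "norm (phase_flow \<mu> t u v - phase_flow \<mu> t u' v')
    \<le> norm (u - u') + 9 * \<bar>\<mu>\<bar> * R\<^sup>2 * exp (9 * \<bar>\<mu>\<bar> * R\<^sup>2) * t * (norm (u - u') + norm (v - v'))"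
proof -
  define e where "e = norm (u - u') + norm (v - v')"
  define Q where "Q = 3 * \<bar>\<mu>\<bar> * R\<^sup>2"
  have R: "0 \<le> R" using n(1) norm_ge_zero by (rule order.trans[rotated])
  have e0: "0 \<le> e" by (simp add: e_def)
  have Q: "0 \<le> Q" by (simp add: Q_def)
  define x where "x = const (- \<i> * of_real (t * \<mu>)) * potential u v"
  define y where "y = const (- \<i> * of_real (t * \<mu>)) * potential u' v'"
  have c: "norm (const (- \<i> * of_real (t * \<mu>)) * p) \<le> t * \<bar>\<mu>\<bar> * norm p" for p
    using norm_mult_ineq[of "const (- \<i> * of_real (t * \<mu>))" p] t by (simp add: norm_mult abs_mult)
  have "norm (potential u v) \<le> 3 * R\<^sup>2" using wbound_potential[of 0 R u v] n by (simp add: wbound_0_iff)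
  then have "t * \<bar>\<mu>\<bar> * norm (potential u v) \<le> t * \<bar>\<mu>\<bar> * (3 * R\<^sup>2)" using t by (intro mult_left_mono) auto
  then have x1: "norm x \<le> t * Q" using c[of "potential u v"] by (simp add: x_def Q_def mult_ac)
  have "wbound 0 Q x" "wbound 0 Q y"
    unfolding x_def y_def Q_def by (rule wbound_phase; use n t in \<open>auto simp: wbound_0_iff\<close>)+
  then have xy: "norm x \<le> Q" "norm y \<le> Q" by (auto simp: wbound_0_iff)
  have "norm (x - y) \<le> t * \<bar>\<mu>\<bar> * norm (potential u v - potential u' v')"
    using c[of "potential u v - potential u' v'"] by (simp add: x_def y_def right_diff_distrib)
  also have "\<dots> \<le> t * \<bar>\<mu>\<bar> * (6 * R * e)"
    using t by (intro mult_left_mono potential_lipschitz n) (auto simp: e_def)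
  finally have dxy: "norm (x - y) \<le> t * \<bar>\<mu>\<bar> * (6 * R * e)" .
  have 1: "norm ((exp x - 1) * (u - u')) \<le> (t * Q * exp (3 * Q)) * e"
  proof (intro order.trans[OF norm_mult_ineq] mult_mono)
    have "norm (exp x - 1) \<le> norm x * exp (norm x)" by (rule norm_exp_minus_1)
    also have "\<dots> \<le> (t * Q) * exp (3 * Q)"
      using x1 xy(1) Q t by (intro mult_mono) auto
    finally show "norm (exp x - 1) \<le> t * Q * exp (3 * Q)" .
  qed (use Q t in \<open>auto simp: e_def\<close>)
  have 2: "norm ((exp x - exp y) * u') \<le> (t * \<bar>\<mu>\<bar> * (6 * R * e) * exp (3 * Q)) * R"
  proof (intro order.trans[OF norm_mult_ineq] mult_mono)
    have "norm (exp x - exp y) \<le> norm (x - y) * exp (3 * Q)" by (rule norm_exp_diff[OF xy])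
    also have "\<dots> \<le> (t * \<bar>\<mu>\<bar> * (6 * R * e)) * exp (3 * Q)" by (intro mult_right_mono dxy) auto
    finally show "norm (exp x - exp y) \<le> t * \<bar>\<mu>\<bar> * (6 * R * e) * exp (3 * Q)" .
  qed (use n t R e0 in auto)
  have "phase_flow \<mu> t u v - phase_flow \<mu> t u' v' = (u - u') + ((exp x - 1) * (u - u') + (exp x - exp y) * u')"
    by (simp add: phase_flow_def x_def y_def algebra_simps)
  then have "norm (phase_flow \<mu> t u v - phase_flow \<mu> t u' v')
      \<le> norm (u - u') + ((t * Q * exp (3 * Q)) * e + (t * \<bar>\<mu>\<bar> * (6 * R * e) * exp (3 * Q)) * R)"
    by (simp only:) (intro order.trans[OF norm_triangle_ineq] add_mono 1 2 order_refl)
  also have "\<dots> = norm (u - u') + 9 * \<bar>\<mu>\<bar> * R\<^sup>2 * exp (9 * \<bar>\<mu>\<bar> * R\<^sup>2) * t * e"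
    by (simp add: Q_def power2_eq_square algebra_simps)
  finally show ?thesis by (simp add: e_def)
qed

text \<open>The moduli are conserved, so forward and backward phases are opposite at each
  point.\<close>

lemma phase_flow_inverse: "phase_flow \<mu> t (phase_flow \<mu> (- t) u v) (phase_flow \<mu> (- t) v u) = u"
proof (rule ev_inject)
  fix x
  have c: "cmod (ev (phase_flow \<mu> (- t) u v) x) = cmod (ev u x)" for u v
  proof -
    have "cmod (exp (- \<i> * of_real r)) = 1" for r using norm_exp_i_times[of "- r"] by simp
    then show ?thesis by (simp only: ev_phase_flow norm_mult mult_1)
  qed
  show "ev (phase_flow \<mu> t (phase_flow \<mu> (- t) u v) (phase_flow \<mu> (- t) v u)) x = ev u x"
    unfolding ev_phase_flow[of \<mu> t] c by (simp add: ev_phase_flow flip: exp_add mult.assoc)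
qed

text \<open>The phase flow acts point by point, so on the grid it does not see whether its arguments
  have been aliased.\<close>

lemma aliased_phase_flow:
  assumes "K \<ge> 1"
  shows "aliased K (phase_flow \<mu> t (aliased K u) (aliased K v)) = aliased K (phase_flow \<mu> t u v)"
  by (rule aliased_cong[OF assms]) (simp add: ev_phase_flow ev_aliased_grid[OF assms])

subsection \<open>Convergence of the splitting scheme\<close>

text \<open>The second time derivative of the phase flow at time 0. The potential is conserved, so
  it is \<open>(- i \<mu>)^2\<close> times the square of the potential times
  \<open>u\<close>.\<close>

definition phase_second :: "real \<Rightarrow> wiener \<Rightarrow> wiener \<Rightarrow> wiener" where
  "phase_second \<mu> u v = const (of_real (- \<mu>\<^sup>2)) * (potential u v * potential u v * u)"

lemma phase_flow_expand:
  assumes u: "norm u \<le> R" "norm v \<le> R" and t: "\<bar>t\<bar> \<le> 1"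
  shows "norm (phase_flow \<mu> t u v - (u + t *\<^sub>R nls_force \<mu> u v + (t\<^sup>2 / 2) *\<^sub>R phase_second \<mu> u v))
    \<le> \<bar>t\<bar> ^ 3 * ((3 * \<bar>\<mu>\<bar> * R\<^sup>2) ^ 3 * exp (3 * \<bar>\<mu>\<bar> * R\<^sup>2) * R)"
proof -
  define Q where "Q = 3 * \<bar>\<mu>\<bar> * R\<^sup>2"
  define x where "x = const (- \<i> * of_real (t * \<mu>)) * potential u v"
  have Q: "0 \<le> Q" by (simp add: Q_def)
  have R: "0 \<le> R" using u(1) norm_ge_zero by (rule order.trans[rotated])
  have "norm (potential u v) \<le> 3 * R\<^sup>2" using wbound_potential[of 0 R u v] u by (simp add: wbound_0_iff)
  then have "norm (const (- \<i> * of_real (t * \<mu>))) * norm (potential u v) \<le> \<bar>t\<bar> * \<bar>\<mu>\<bar> * (3 * R\<^sup>2)"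
    by (intro mult_mono) (auto simp: norm_mult abs_mult)
  then have x: "norm x \<le> \<bar>t\<bar> * Q"
    using norm_mult_ineq[of "const (- \<i> * of_real (t * \<mu>))" "potential u v"] by (simp add: x_def Q_def mult_ac)
  have xQ: "norm x \<le> Q" using x mult_right_mono[OF t Q] by simp
  have "norm x ^ 3 * exp (norm x) \<le> (\<bar>t\<bar> * Q) ^ 3 * exp Q"
    using x xQ Q by (intro mult_mono power_mono) auto
  then have "norm (exp x - (1 + x + x\<^sup>2 /\<^sub>R 2)) \<le> (\<bar>t\<bar> * Q) ^ 3 * exp Q"
    using norm_exp_taylor2[of x] by linarith
  then have "norm (exp x - (1 + x + x\<^sup>2 /\<^sub>R 2)) * norm u \<le> ((\<bar>t\<bar> * Q) ^ 3 * exp Q) * R"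
    using u Q by (intro mult_mono) auto
  then have "norm ((exp x - (1 + x + x\<^sup>2 /\<^sub>R 2)) * u) \<le> ((\<bar>t\<bar> * Q) ^ 3 * exp Q) * R"
    by (rule order.trans[OF norm_mult_ineq])
  moreover have "phase_flow \<mu> t u v - (u + t *\<^sub>R nls_force \<mu> u v + (t\<^sup>2 / 2) *\<^sub>R phase_second \<mu> u v)
      = (exp x - (1 + x + x\<^sup>2 /\<^sub>R 2)) * u"
    by (rule ev_inject)
       (simp add: phase_flow_def nls_force_def phase_second_def x_def[symmetric] ev_scaleR ev_power,
        simp add: x_def scaleR_conv_of_real power2_eq_square field_simps)
  ultimately show ?thesis by (simp add: Q_def power_mult_distrib mult_ac)
qed

lemma twist_diff_bound:
  assumes f: "wbound 2 R f" and t: "0 \<le> t"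
  shows "norm (twist half_square t f - f) \<le> t * R"
proof -
  have "wbound 0 (t * R) (twist half_square t f - f)"
  proof (rule wbound_le_coef[OF f _ t])
    fix a
    have "cmod (exp (\<i> * of_real (half_square a * t)) - 1) \<le> \<bar>half_square a * t\<bar>"
      using exp_i_diff_le[of "half_square a * t" 0] by simp
    also have "\<dots> \<le> weight a ^ 2 * t"
      using half_square_bound[of a] t by (simp add: abs_mult mult_right_mono)
    finally have "cmod (exp (\<i> * of_real (half_square a * t)) - 1) * cmod (coef f a) \<le> weight a ^ 2 * t * cmod (coef f a)"
      by (rule mult_right_mono) simp
    moreover have "coef (twist half_square t f - f) a = (exp (\<i> * of_real (half_square a * t)) - 1) * coef f a"
      by (simp add: left_diff_distrib)
    ultimately show "weight a ^ 0 * cmod (coef (twist half_square t f - f) a) \<le> t * (weight a ^ 2 * cmod (coef f a))"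
      by (simp add: norm_mult mult_ac)
  qed
  then show ?thesis by (simp add: wbound_0_iff)
qed

lemma nls_solution_swap: "nls_solution \<mu> T k u v \<Longrightarrow> nls_solution \<mu> T k v u"
  by (auto simp: nls_solution_def)

text \<open>
  In the interaction picture \<open>w\<close> the exact flow obeys \<open>w' = w1\<close>, and two half steps of the phase flow, one
  forward from \<open>t\<close> and one backward from \<open>t + \<tau>\<close>, differ by the error of the trapezoidal rule for
  \<open>\<integral>w1\<close>, up to \<open>O(\<tau>\<^sup>3)\<close>: by symmetry the second order terms of the phase flow cancel.
\<close>

lemma splitting_defect:
  assumes sol: "nls_solution \<mu> T 10 u v"
  obtains C where "0 \<le> C" "\<And>t \<tau>. 0 \<le> t \<Longrightarrow> 0 \<le> \<tau> \<Longrightarrow> \<tau> \<le> 1 \<Longrightarrow> t + \<tau> \<le> T \<Longrightarrow>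
    norm (twist half_square \<tau> (phase_flow \<mu> (\<tau> / 2) (u t) (v t)) - phase_flow \<mu> (- (\<tau> / 2)) (u (t + \<tau>)) (v (t + \<tau>))) \<le> C * \<tau> ^ 3"
proof -
  define \<theta> where "\<theta> = (\<lambda>a. - half_square a)"
  define p where "p = (\<lambda>s. nls_force \<mu> (u s) (v s))"
  define w where "w = (\<lambda>s. twist \<theta> s (u s))"
  define w1 where "w1 = (\<lambda>s. twist \<theta> s (p s))"
  define q where "q = (\<lambda>s. phase_second \<mu> (u s) (v s))"
  have cu: "curve 3 T 10 u" "curve 3 T 10 v"
    and du: "\<And>t. t \<in> {0..T} \<Longrightarrow> (u has_vector_derivative schroedinger (u t) + p t) (at t within {0..T})"
    using sol by (auto simp: nls_solution_def p_def)
  have \<theta>: "\<bar>\<theta> a\<bar> \<le> 1 * weight a ^ 2" for a using half_square_bound_minus[of a] by (simp add: \<theta>_def)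
  have cp: "curve 3 T 10 p" unfolding p_def by (rule curve_nls_force[OF cu])
  have cq: "curve 3 T 10 q" unfolding q_def phase_second_def
    by (intro curve_const_mult curve_mult curve_potential cu)
  \<comment> \<open>The trapezoidal rule asks for two derivatives of \<open>w1\<close>. With
    \<open>j = 2\<close> and three weights to be left, \<open>curve_twist\<close> costs
    \<open>3 + 3 * 2 + 1\<close>, which is the weight 10 of the hypothesis.\<close>
  have cw1: "curve 2 T 3 w1" unfolding w1_def
    by (rule curve_twist[OF \<theta>]) (use curve_mono[OF cp, of 2 10] in simp)
  have u4: "curve 0 T 4 u" by (rule curve_mono[OF cu(1)]) auto
  have cs: "curve 0 T 1 (\<lambda>t. schroedinger (u t) + p t)"
    unfolding schroedinger_def
    by (intro curve_add curve_multiplier[OF schroedinger_symbol] curve_mono[OF cp] curve_mono[OF cu(1)]) auto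
  have dw: "(w has_vector_derivative w1 t) (at t within {0..T})" if t: "t \<in> {0..T}" for t
  proof -
    obtain S where S: "wbound 4 S (u t)" using curve_bound[OF u4] t by metis
    have S2: "wbound 2 S (u t)" by (rule wbound_mono[OF S]) auto
    have m: "cmod (\<i> * of_real (\<theta> a)) \<le> 1 * weight a ^ 2" for a using \<theta>[of a] by (simp add: norm_mult)
    \<comment> \<open>The generator of the backward twist cancels the kinetic part, so that only the
      twisted force drives \<open>w\<close>.\<close>
    have z: "schroedinger (u t) + p t + multiplier (\<lambda>a. \<i> * of_real (\<theta> a)) (u t) = p t"
      by (rule wiener_eqI) (simp only: coef_add coef_schroedinger[OF S2] coef_multiplier[OF S2 m], simp add: \<theta>_def)
    show ?thesis
      using has_vector_derivative_twist[OF \<theta> du u4 cs t] unfolding z w_def w1_def .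
  qed
  obtain w2 where w2: "\<And>t. t \<in> {0..T} \<Longrightarrow> (w1 has_vector_derivative w2 t) (at t within {0..T})" "curve 1 T 3 w2"
    using curve_deriv[of 1 T 3 w1] cw1 by (auto simp: numeral_2_eq_2)
  obtain w3 where w3: "\<And>t. t \<in> {0..T} \<Longrightarrow> (w2 has_vector_derivative w3 t) (at t within {0..T})" "curve 0 T 3 w3"
    using curve_deriv[of 0 T 3 w2] w2(2) by auto
  obtain B where B: "0 \<le> B" "\<And>t. t \<in> {0..T} \<Longrightarrow> wbound 3 B (w3 t)" using curve_bound[OF w3(2)] by metis
  obtain q1 where q1: "\<And>t. t \<in> {0..T} \<Longrightarrow> (q has_vector_derivative q1 t) (at t within {0..T})" "curve 0 T 10 q1"
    using curve_deriv[of 0 T 10 q] curve_mono[OF cq, of 1 10] by auto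
  obtain B1 where B1: "0 \<le> B1" "\<And>t. t \<in> {0..T} \<Longrightarrow> wbound 10 B1 (q1 t)" using curve_bound[OF q1(2)] by metis
  obtain S where S: "0 \<le> S" "\<And>t. t \<in> {0..T} \<Longrightarrow> wbound 10 S (q t)" using curve_bound[OF cq] by metis
  obtain R1 where R1: "0 \<le> R1" "\<And>t. t \<in> {0..T} \<Longrightarrow> wbound 10 R1 (u t)" using curve_bound[OF cu(1)] by metis
  obtain R2 where R2: "0 \<le> R2" "\<And>t. t \<in> {0..T} \<Longrightarrow> wbound 10 R2 (v t)" using curve_bound[OF cu(2)] by metis
  define R where "R = R1 + R2"
  have R: "norm (u t) \<le> R" "norm (v t) \<le> R" if "t \<in> {0..T}" for t
    using wbound_norm[OF R1(2)[OF that]] wbound_norm[OF R2(2)[OF that]] R1(1) R2(1) by (auto simp: R_def)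
  define X where "X = (3 * \<bar>\<mu>\<bar> * R\<^sup>2) ^ 3 * exp (3 * \<bar>\<mu>\<bar> * R\<^sup>2) * R"
  have X: "0 \<le> X" using R1(1) R2(1) by (simp add: X_def R_def)
  have "norm (twist half_square \<tau> (phase_flow \<mu> (\<tau> / 2) (u t) (v t)) - phase_flow \<mu> (- (\<tau> / 2)) (u (t + \<tau>)) (v (t + \<tau>)))
      \<le> (B + (S + B1) + 2 * X) * \<tau> ^ 3"
    if t: "0 \<le> t" and \<tau>: "0 \<le> \<tau>" "\<tau> \<le> 1" and tT: "t + \<tau> \<le> T" for t \<tau>
  proof -
    have in1: "t \<in> {0..T}" and in2: "t + \<tau> \<in> {0..T}" using t \<tau> tT by auto
    define E where "E = twist half_square \<tau>"
    define r0 where "r0 = phase_flow \<mu> (\<tau> / 2) (u t) (v t) - (u t + (\<tau> / 2) *\<^sub>R p t + ((\<tau> / 2)\<^sup>2 / 2) *\<^sub>R q t)"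
    define r1 where "r1 = phase_flow \<mu> (- (\<tau> / 2)) (u (t + \<tau>)) (v (t + \<tau>))
      - (u (t + \<tau>) + (- (\<tau> / 2)) *\<^sub>R p (t + \<tau>) + ((- (\<tau> / 2))\<^sup>2 / 2) *\<^sub>R q (t + \<tau>))"
    have r: "norm r0 \<le> \<bar>\<tau> / 2\<bar> ^ 3 * X" "norm r1 \<le> \<bar>- (\<tau> / 2)\<bar> ^ 3 * X"
      unfolding r0_def r1_def p_def q_def X_def using \<tau> by (intro phase_flow_expand R in1 in2; simp)+
    have \<tau>3: "\<bar>\<tau> / 2\<bar> ^ 3 \<le> \<tau> ^ 3" using \<tau> by (intro power_mono) auto
    have r': "norm r0 \<le> \<tau> ^ 3 * X" "norm r1 \<le> \<tau> ^ 3 * X"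
      using r mult_right_mono[OF \<tau>3 X] by auto
    define a where "a = w t + ((t + \<tau> - t) / 2) *\<^sub>R (w1 t + w1 (t + \<tau>)) - w (t + \<tau>)"
    have a: "norm a \<le> B * \<tau> ^ 3"
      unfolding a_def using trapezoid_bound[OF dw w2(1) w3(1), of B t "t + \<tau>"] B(2) wbound_norm t \<tau> tT by auto
    \<comment> \<open>The second order terms of both half steps carry the same factor
      \<open>(\<tau> / 2)^2 / 2\<close>, as the sign of the backward step is squared away. They
      differ by the motion of \<open>q\<close> over one step, which is of order
      \<open>\<tau>\<close>.\<close>
    define b where "b = E (q t) - q (t + \<tau>)"
    have "norm (E (q t) - q t) \<le> \<tau> * S"
      unfolding E_def using wbound_mono[OF S(2)[OF in1], of 2 S] \<tau> by (intro twist_diff_bound) auto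
    moreover have "norm (q (t + \<tau>) - q t) \<le> B1 * \<bar>t + \<tau> - t\<bar>"
      by (rule increment_bound[OF q1(1) _ in1 in2]) (use B1(2) wbound_norm in auto)
    moreover have "norm b \<le> norm (E (q t) - q t) + norm (q (t + \<tau>) - q t)"
      using norm_triangle_ineq4[of "E (q t) - q t" "q (t + \<tau>) - q t"] by (simp add: b_def)
    ultimately have b: "norm b \<le> \<tau> * (S + B1)"
      using \<tau> by (simp add: distrib_left mult.commute)
    have eq: "E (phase_flow \<mu> (\<tau> / 2) (u t) (v t)) - phase_flow \<mu> (- (\<tau> / 2)) (u (t + \<tau>)) (v (t + \<tau>))
        = (twist half_square (t + \<tau>) a + ((\<tau> / 2)\<^sup>2 / 2) *\<^sub>R b) + (E r0 - r1)"
    proof -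
      have exps: "exp (\<i> * of_real x) * exp (\<i> * of_real y) = exp (\<i> * of_real (x + y))" for x y
        by (simp add: exp_add distrib_left)
      have 1: "twist half_square (t + \<tau>) (twist \<theta> t f) = E f" for f
        by (rule wiener_eqI) (simp only: E_def coef_twist mult.assoc[symmetric] exps, simp add: \<theta>_def algebra_simps)
      have 2: "twist half_square (t + \<tau>) (twist \<theta> (t + \<tau>) f) = f" for f
        by (rule wiener_eqI) (simp only: coef_twist mult.assoc[symmetric] exps, simp add: \<theta>_def)
      have A: "twist half_square (t + \<tau>) a = E (u t) + (\<tau> / 2) *\<^sub>R (E (p t) + p (t + \<tau>)) - u (t + \<tau>)"
        by (simp add: a_def twist_add twist_diff twist_scaleR w_def w1_def 1 2)
      have "phase_flow \<mu> (\<tau> / 2) (u t) (v t) = r0 + (u t + (\<tau> / 2) *\<^sub>R p t + ((\<tau> / 2)\<^sup>2 / 2) *\<^sub>R q t)"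
        "phase_flow \<mu> (- (\<tau> / 2)) (u (t + \<tau>)) (v (t + \<tau>))
          = r1 + (u (t + \<tau>) + (- (\<tau> / 2)) *\<^sub>R p (t + \<tau>) + ((\<tau> / 2)\<^sup>2 / 2) *\<^sub>R q (t + \<tau>))"
        by (simp_all add: r0_def r1_def)
      then show ?thesis
        unfolding A b_def E_def by (simp only: twist_add twist_scaleR) (simp add: scaleR_add_right scaleR_diff_right)
    qed
    have b': "norm (((\<tau> / 2)\<^sup>2 / 2) *\<^sub>R b) \<le> (S + B1) * \<tau> ^ 3"
    proof -
      have "norm (((\<tau> / 2)\<^sup>2 / 2) *\<^sub>R b) \<le> \<tau>\<^sup>2 * (\<tau> * (S + B1))"
        unfolding norm_scaleR using b \<tau> S(1) B1(1) by (intro mult_mono) (auto simp: power2_eq_square field_simps)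
      then show ?thesis by (simp add: power2_eq_square power3_eq_cube mult_ac)
    qed
    have "norm (E (phase_flow \<mu> (\<tau> / 2) (u t) (v t)) - phase_flow \<mu> (- (\<tau> / 2)) (u (t + \<tau>)) (v (t + \<tau>)))
        \<le> (B * \<tau> ^ 3 + (S + B1) * \<tau> ^ 3) + (\<tau> ^ 3 * X + \<tau> ^ 3 * X)"
      unfolding eq
      by (intro order.trans[OF norm_triangle_ineq] order.trans[OF norm_triangle_ineq4] add_mono b')
         (use a r' in \<open>auto simp: E_def\<close>)
    then show ?thesis by (simp add: E_def algebra_simps)
  qed
  moreover have "0 \<le> B + (S + B1) + 2 * X" using B(1) S(1) B1(1) X by simp
  ultimately show ?thesis using that by blast
qed

section \<open>Stability of one step and the global error\<close>

definition pair_dist :: "wiener \<times> wiener \<Rightarrow> wiener \<times> wiener \<Rightarrow> real" where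
  "pair_dist p q = norm (fst p - fst q) + norm (snd p - snd q)"

lemma pair_dist_triangle: "pair_dist p r \<le> pair_dist p q + pair_dist q r"
  using norm_triangle_ineq[of "fst p - fst q" "fst q - fst r"] norm_triangle_ineq[of "snd p - snd q" "snd q - snd r"]
  by (simp add: pair_dist_def)

text \<open>Twice the rate 9 of \<open>phase_flow_lipschitz\<close>: each of the two components is
  charged with the errors of both.\<close>

definition phase_rate :: "real \<Rightarrow> real \<Rightarrow> real" where
  "phase_rate \<mu> R = 18 * \<bar>\<mu>\<bar> * R\<^sup>2 * exp (9 * \<bar>\<mu>\<bar> * R\<^sup>2)"

lemma phase_pair_lipschitz:
  assumes n: "norm u \<le> R" "norm v \<le> R" "norm u' \<le> R" "norm v' \<le> R" and t: "0 \<le> t" "t \<le> 1"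
  shows "pair_dist (aliased K (phase_flow \<mu> t u v), aliased K (phase_flow \<mu> t v u))
      (aliased K (phase_flow \<mu> t u' v'), aliased K (phase_flow \<mu> t v' u'))
    \<le> (1 + phase_rate \<mu> R * t) * pair_dist (u, v) (u', v')"
proof -
  have "pair_dist (aliased K (phase_flow \<mu> t u v), aliased K (phase_flow \<mu> t v u))
      (aliased K (phase_flow \<mu> t u' v'), aliased K (phase_flow \<mu> t v' u'))
    \<le> norm (phase_flow \<mu> t u v - phase_flow \<mu> t u' v') + norm (phase_flow \<mu> t v u - phase_flow \<mu> t v' u')"
    unfolding pair_dist_def fst_conv snd_conv aliased_diff[symmetric] by (intro add_mono norm_aliased)
  then show ?thesis
    using phase_flow_lipschitz[OF n t, of \<mu>] phase_flow_lipschitz[OF n(2,1,4,3) t, of \<mu>]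
    by (simp add: pair_dist_def phase_rate_def algebra_simps)
qed

text \<open>The numerical solution is compared with the aliased exact one. They coincide initially,
  each step adds \<open>\<tau>\<close> times \<open>\<tau>^2 + K^(-m)\<close>, and the aliasing
  error of the exact solution is paid once at the end. The Lipschitz constants hold in a tube of
  radius 1 around the exact solution, so the induction must also keep the iterates in the
  tube.\<close>

lemma strang_error:
  assumes sol: "nls_solution \<mu> T (m + 10) u v" and T: "0 < T" and m: "1 \<le> m"
  obtains C \<tau>0 where "0 < C" "0 < \<tau>0" "\<tau>0 \<le> 1"
    "\<And>\<tau> K n. 0 < \<tau> \<Longrightarrow> \<tau> < \<tau>0 \<Longrightarrow> 1 \<le> K \<Longrightarrow> 1 / real K < \<tau>0 \<Longrightarrow> real n * \<tau> \<le> T \<Longrightarrow>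
      pair_dist ((disc_step K \<mu> \<tau> ^^ n) (aliased K (u 0), aliased K (v 0))) (u (real n * \<tau>), v (real n * \<tau>))
        \<le> C * (\<tau>\<^sup>2 + 1 / real K ^ m)"
proof -
  have cu: "curve 3 T (m + 10) u" "curve 3 T (m + 10) v" using sol by (auto simp: nls_solution_def)
  have sol10: "nls_solution \<mu> T 10 u v"
    using sol by (auto simp: nls_solution_def intro: curve_weight_mono)
  obtain C1 where C1: "0 \<le> C1" "\<And>t \<tau>. 0 \<le> t \<Longrightarrow> 0 \<le> \<tau> \<Longrightarrow> \<tau> \<le> 1 \<Longrightarrow> t + \<tau> \<le> T \<Longrightarrow>
    norm (twist half_square \<tau> (phase_flow \<mu> (\<tau> / 2) (u t) (v t)) - phase_flow \<mu> (- (\<tau> / 2)) (u (t + \<tau>)) (v (t + \<tau>))) \<le> C1 * \<tau> ^ 3"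
    by (rule splitting_defect[OF sol10]) (rule that)
  obtain C2 where C2: "0 \<le> C2" "\<And>t \<tau>. 0 \<le> t \<Longrightarrow> 0 \<le> \<tau> \<Longrightarrow> \<tau> \<le> 1 \<Longrightarrow> t + \<tau> \<le> T \<Longrightarrow>
    norm (twist half_square \<tau> (phase_flow \<mu> (\<tau> / 2) (v t) (u t)) - phase_flow \<mu> (- (\<tau> / 2)) (v (t + \<tau>)) (u (t + \<tau>))) \<le> C2 * \<tau> ^ 3"
    by (rule splitting_defect[OF nls_solution_swap[OF sol10]]) (rule that)
  obtain Ra where Ra: "0 \<le> Ra" "\<And>t. t \<in> {0..T} \<Longrightarrow> wbound (m + 10) Ra (u t)" using curve_bound[OF cu(1)] by metis
  obtain Rb where Rb: "0 \<le> Rb" "\<And>t. t \<in> {0..T} \<Longrightarrow> wbound (m + 10) Rb (v t)" using curve_bound[OF cu(2)] by metis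
  define R where "R = Ra + Rb"
  have R0: "0 \<le> R" using Ra Rb by (simp add: R_def)
  have wu: "wbound (m + 10) R (u t)" "wbound (m + 10) R (v t)" if "t \<in> {0..T}" for t
    using wbound_mono[OF Ra(2)[OF that], of "m + 10" R] wbound_mono[OF Rb(2)[OF that], of "m + 10" R] Ra(1) Rb(1)
    by (auto simp: R_def)
  have nu: "norm (u t) \<le> R" "norm (v t) \<le> R" if "t \<in> {0..T}" for t
    using wbound_norm[OF wu(1)[OF that]] wbound_norm[OF wu(2)[OF that]] by auto
  \<comment> \<open>\<open>R1\<close> bounds the iterates in the tube of radius 1, and
    \<open>R2\<close> bounds what a half step of the phase flow makes of them. \<open>L1\<close> and
    \<open>L2\<close> are the rates of the first and the last half step.\<close>
  define R1 where "R1 = R + 1"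
  define R2 where "R2 = exp (3 * \<bar>\<mu>\<bar> * R1\<^sup>2) * R1"
  define L1 where "L1 = phase_rate \<mu> R1"
  define L2 where "L2 = phase_rate \<mu> R2"
  define S where "S = exp (3 * \<bar>\<mu>\<bar> * R\<^sup>2) * R"
  \<comment> \<open>For \<open>\<tau> \<le> 1\<close> the product
    \<open>(1 + L1 \<tau>) (1 + L2 \<tau>)\<close> is at most \<open>1 + L \<tau>\<close>. In
    \<open>M\<close>, \<open>S\<close> comes from the commutators, \<open>C1\<close> and
    \<open>C2\<close> from the splitting defects, and \<open>1 + L2\<close> from the last half
    step.\<close>
  define L where "L = L1 + L2 + L1 * L2"
  define M where "M = (1 + L2) * (2 * S + C1 + C2)"
  have L: "0 \<le> L1" "0 \<le> L2" "0 \<le> L" by (auto simp: L1_def L2_def L_def phase_rate_def)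
  have S0: "0 \<le> S" using R0 by (simp add: S_def)
  have M0: "0 \<le> M" using L S0 C1(1) C2(1) by (simp add: M_def)
  \<comment> \<open>Chosen so that the global error is at most \<open>G * \<delta>\<close>, where
    \<open>\<delta>\<close> is \<open>\<tau>^2 + K^(-m)\<close>. With \<open>\<tau>\<close> and
    \<open>h\<close> below \<open>1 / (2 G)\<close> this is at most 1, which keeps the iterates in
    the tube.\<close>
  define G where "G = exp (L * T) * T * M + 1"
  have G1: "1 \<le> G" using M0 T by (simp add: G_def)
  have step: "pair_dist (disc_step K \<mu> \<tau> (U, V)) (aliased K (u (t + \<tau>)), aliased K (v (t + \<tau>)))
      \<le> (1 + L * \<tau>) * pair_dist (U, V) (aliased K (u t), aliased K (v t)) + \<tau> * (M * (\<tau>\<^sup>2 + 1 / real K ^ m))"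
    if K: "1 \<le> K" and t: "0 \<le> t" and \<tau>: "0 < \<tau>" "\<tau> \<le> 1" and tT: "t + \<tau> \<le> T" and UV: "norm U \<le> R1" "norm V \<le> R1"
    for K \<tau> t U V
  proof -
    have in1: "t \<in> {0..T}" and in2: "t + \<tau> \<in> {0..T}" using t \<tau> tT by auto
    define h where "h = \<tau> / 2"
    have h: "0 \<le> h" "h \<le> 1" "\<bar>h\<bar> \<le> 1" "\<bar>- h\<bar> \<le> 1" using \<tau> by (auto simp: h_def)
    define E where "E = twist half_square \<tau>"
    \<comment> \<open>The exact solution at \<open>t + \<tau>\<close>, pulled back by half a phase
      step. Errors are compared at this intermediate stage, and the last half step of the scheme
      takes \<open>b\<close> back to the exact solution.\<close>
    define b where "b = phase_flow \<mu> (- h) (u (t + \<tau>)) (v (t + \<tau>))"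
    define b' where "b' = phase_flow \<mu> (- h) (v (t + \<tau>)) (u (t + \<tau>))"
    define U1 where "U1 = E (aliased K (phase_flow \<mu> h U V))"
    define V1 where "V1 = E (aliased K (phase_flow \<mu> h V U))"
    define Y1 where "Y1 = E (aliased K (phase_flow \<mu> h (u t) (v t)))"
    define Z1 where "Z1 = E (aliased K (phase_flow \<mu> h (v t) (u t)))"
    have al: "norm (aliased K f) \<le> R1" if "norm f \<le> R" for f
      using order.trans[OF norm_aliased that, of K] by (simp add: R1_def)
    have "pair_dist (aliased K (phase_flow \<mu> h U V), aliased K (phase_flow \<mu> h V U))
       (aliased K (phase_flow \<mu> h (aliased K (u t)) (aliased K (v t))), aliased K (phase_flow \<mu> h (aliased K (v t)) (aliased K (u t))))
       \<le> (1 + L1 * h) * pair_dist (U, V) (aliased K (u t), aliased K (v t))"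
      unfolding L1_def by (rule phase_pair_lipschitz) (use UV al nu in1 h in auto)
    then have "pair_dist (U1, V1) (Y1, Z1) \<le> (1 + L1 * h) * pair_dist (U, V) (aliased K (u t), aliased K (v t))"
      unfolding aliased_phase_flow[OF K]
      by (simp add: pair_dist_def U1_def V1_def Y1_def Z1_def E_def twist_diff[symmetric])
    also have "\<dots> \<le> (1 + L1 * \<tau>) * pair_dist (U, V) (aliased K (u t), aliased K (v t))"
      using L \<tau> by (intro mult_right_mono) (auto simp: pair_dist_def h_def mult_left_mono)
    finally have d1: "pair_dist (U1, V1) (Y1, Z1) \<le> (1 + L1 * \<tau>) * pair_dist (U, V) (aliased K (u t), aliased K (v t))" .
    have comm: "norm (E (aliased K (phase_flow \<mu> h f g)) - aliased K c) \<le> \<tau> * S / real K ^ m + norm (E (phase_flow \<mu> h f g) - c)"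
      if "wbound (m + 10) R f" "wbound (m + 10) R g" for f g c
    proof -
      have "wbound (m + 2) S (phase_flow \<mu> h f g)"
        unfolding S_def by (rule wbound_mono[OF wbound_phase_flow[OF that h(3)]]) auto
      then have "norm (E (aliased K (phase_flow \<mu> h f g)) - aliased K (E (phase_flow \<mu> h f g))) \<le> \<tau> * S / real K ^ m"
        unfolding E_def by (rule twist_aliased_commutator[OF K]) (use \<tau> in simp)
      moreover have "norm (aliased K (E (phase_flow \<mu> h f g)) - aliased K c) \<le> norm (E (phase_flow \<mu> h f g) - c)"
        unfolding aliased_diff[symmetric] by (rule norm_aliased)
      ultimately show ?thesis
        using norm_triangle_ineq[of "E (aliased K (phase_flow \<mu> h f g)) - aliased K (E (phase_flow \<mu> h f g))"
            "aliased K (E (phase_flow \<mu> h f g)) - aliased K c"] by simp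
    qed
    have d2: "pair_dist (Y1, Z1) (aliased K b, aliased K b') \<le> (2 * S + C1 + C2) * (\<tau> * (\<tau>\<^sup>2 + 1 / real K ^ m))"
    proof -
      have "norm (Y1 - aliased K b) \<le> \<tau> * S / real K ^ m + C1 * \<tau> ^ 3"
        unfolding Y1_def b_def using comm[OF wu[OF in1], of "phase_flow \<mu> (- h) (u (t + \<tau>)) (v (t + \<tau>))"] C1(2)[of t \<tau>] t \<tau> tT
        by (simp add: E_def h_def)
      moreover have "norm (Z1 - aliased K b') \<le> \<tau> * S / real K ^ m + C2 * \<tau> ^ 3"
        unfolding Z1_def b'_def using comm[OF wu(2)[OF in1] wu(1)[OF in1], of "phase_flow \<mu> (- h) (v (t + \<tau>)) (u (t + \<tau>))"] C2(2)[of t \<tau>] t \<tau> tT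
        by (simp add: E_def h_def)
      ultimately have "pair_dist (Y1, Z1) (aliased K b, aliased K b')
          \<le> (\<tau> * S / real K ^ m + C1 * \<tau> ^ 3) + (\<tau> * S / real K ^ m + C2 * \<tau> ^ 3)"
        unfolding pair_dist_def fst_conv snd_conv by (rule add_mono)
      also have "\<dots> = 2 * S * (\<tau> / real K ^ m) + (C1 + C2) * \<tau> ^ 3" by (simp add: algebra_simps)
      also have "\<dots> \<le> 2 * S * (\<tau> / real K ^ m) + (C1 + C2) * \<tau> ^ 3 + (2 * S * \<tau> ^ 3 + (C1 + C2) * (\<tau> / real K ^ m))"
        using S0 C1(1) C2(1) \<tau> by simp
      also have "\<dots> = (2 * S + C1 + C2) * (\<tau> * (\<tau>\<^sup>2 + 1 / real K ^ m))"
        by (simp add: algebra_simps power2_eq_square power3_eq_cube add_divide_distrib)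
      finally show ?thesis .
    qed
    have Ex: "1 \<le> exp (3 * \<bar>\<mu>\<bar> * R1\<^sup>2)" by simp
    have nU1: "norm U1 \<le> R2" "norm V1 \<le> R2"
    proof -
      have "norm (phase_flow \<mu> h U V) \<le> R2" "norm (phase_flow \<mu> h V U) \<le> R2"
        using wbound_phase_flow[of 0 R1 U V h \<mu>] wbound_phase_flow[of 0 R1 V U h \<mu>] UV h by (auto simp: wbound_0_iff R2_def)
      then show "norm U1 \<le> R2" "norm V1 \<le> R2"
        unfolding U1_def V1_def E_def norm_twist using norm_aliased order.trans by blast+
    qed
    have nb: "norm (aliased K b) \<le> R2" "norm (aliased K b') \<le> R2"
    proof -
      have "norm (u (t + \<tau>)) \<le> R1" "norm (v (t + \<tau>)) \<le> R1" using nu[OF in2] by (auto simp: R1_def)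
      then have "norm b \<le> R2" "norm b' \<le> R2"
        unfolding b_def b'_def R2_def
        using wbound_phase_flow[of 0 R1 "u (t + \<tau>)" "v (t + \<tau>)" "- h" \<mu>] wbound_phase_flow[of 0 R1 "v (t + \<tau>)" "u (t + \<tau>)" "- h" \<mu>] h
        by (auto simp: wbound_0_iff)
      then show "norm (aliased K b) \<le> R2" "norm (aliased K b') \<le> R2" using norm_aliased order.trans by blast+
    qed
    have ds: "disc_step K \<mu> \<tau> (U, V) = (aliased K (phase_flow \<mu> h U1 V1), aliased K (phase_flow \<mu> h V1 U1))"
      by (simp add: disc_step_def Let_def U1_def V1_def E_def h_def)
    have "pair_dist (disc_step K \<mu> \<tau> (U, V)) (aliased K (phase_flow \<mu> h (aliased K b) (aliased K b')), aliased K (phase_flow \<mu> h (aliased K b') (aliased K b)))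
        \<le> (1 + L2 * h) * pair_dist (U1, V1) (aliased K b, aliased K b')"
      unfolding ds L2_def by (rule phase_pair_lipschitz[OF nU1 nb h(1,2)])
    moreover have "phase_flow \<mu> h b b' = u (t + \<tau>)" "phase_flow \<mu> h b' b = v (t + \<tau>)"
      unfolding b_def b'_def by (rule phase_flow_inverse)+
    ultimately have "pair_dist (disc_step K \<mu> \<tau> (U, V)) (aliased K (u (t + \<tau>)), aliased K (v (t + \<tau>)))
        \<le> (1 + L2 * h) * pair_dist (U1, V1) (aliased K b, aliased K b')"
      by (simp add: aliased_phase_flow[OF K])
    also have "\<dots> \<le> (1 + L2 * \<tau>) * pair_dist (U1, V1) (aliased K b, aliased K b')"
      using L \<tau> by (intro mult_right_mono) (auto simp: pair_dist_def h_def mult_left_mono)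
    also have "\<dots> \<le> (1 + L2 * \<tau>) * ((1 + L1 * \<tau>) * pair_dist (U, V) (aliased K (u t), aliased K (v t))
        + (2 * S + C1 + C2) * (\<tau> * (\<tau>\<^sup>2 + 1 / real K ^ m)))"
      using order.trans[OF pair_dist_triangle[of "(U1, V1)" "(aliased K b, aliased K b')" "(Y1, Z1)"] add_mono[OF d1 d2]] L \<tau>
      by (intro mult_left_mono) auto
    also have "\<dots> = ((1 + L2 * \<tau>) * (1 + L1 * \<tau>)) * pair_dist (U, V) (aliased K (u t), aliased K (v t))
        + (1 + L2 * \<tau>) * ((2 * S + C1 + C2) * (\<tau> * (\<tau>\<^sup>2 + 1 / real K ^ m)))"
      by (simp add: algebra_simps)
    also have "\<dots> \<le> (1 + L * \<tau>) * pair_dist (U, V) (aliased K (u t), aliased K (v t))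
        + (1 + L2) * ((2 * S + C1 + C2) * (\<tau> * (\<tau>\<^sup>2 + 1 / real K ^ m)))"
    proof (intro add_mono mult_right_mono)
      have "L2 * L1 * (\<tau> * \<tau>) \<le> L2 * L1 * \<tau>" using L \<tau> by (intro mult_left_mono) (auto simp: mult_left_le)
      then show "(1 + L2 * \<tau>) * (1 + L1 * \<tau>) \<le> 1 + L * \<tau>" by (simp add: L_def algebra_simps)
    qed (use L S0 C1(1) C2(1) \<tau> in \<open>auto simp: pair_dist_def mult_left_le\<close>)
    finally show ?thesis by (simp add: M_def mult_ac)
  qed
  have glob: "pair_dist ((disc_step K \<mu> \<tau> ^^ n) (aliased K (u 0), aliased K (v 0))) (aliased K (u (real n * \<tau>)), aliased K (v (real n * \<tau>)))
      \<le> exp (L * (real n * \<tau>)) * (real n * \<tau>) * (M * (\<tau>\<^sup>2 + 1 / real K ^ m))"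
    if \<tau>: "0 < \<tau>" "\<tau> < 1 / (2 * G)" and K: "1 \<le> K" "1 / real K < 1 / (2 * G)" and nT: "real n * \<tau> \<le> T" for \<tau> K n
    using nT
  proof (induction n)
    case 0
    then show ?case by (simp add: pair_dist_def)
  next
    case (Suc n)
    define \<delta> where "\<delta> = \<tau>\<^sup>2 + 1 / real K ^ m"
    have \<delta>0: "0 \<le> \<delta>" using K by (simp add: \<delta>_def)
    define t where "t = real n * \<tau>"
    have t0: "0 \<le> t" using \<tau> by (simp add: t_def)
    have tS: "real (Suc n) * \<tau> = t + \<tau>" by (simp add: t_def algebra_simps)
    have tT: "t + \<tau> \<le> T" using Suc.prems tS by simp
    have G2: "1 / (2 * G) \<le> 1" using G1 by simp
    have \<tau>1: "\<tau> \<le> 1" using \<tau>(2) G2 by simp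
    obtain U V where UV: "(disc_step K \<mu> \<tau> ^^ n) (aliased K (u 0), aliased K (v 0)) = (U, V)" by fastforce
    have IH: "pair_dist (U, V) (aliased K (u t), aliased K (v t)) \<le> exp (L * t) * t * (M * \<delta>)"
      using Suc.IH tT \<tau> unfolding UV t_def[symmetric] \<delta>_def by simp
    \<comment> \<open>Since \<open>\<tau>\<close> and \<open>1 / K\<close> are at most 1 and
      \<open>m\<close> is at least 1, both powers are below their bases, each less than
      \<open>1 / (2 G)\<close>.\<close>
    have \<delta>1: "\<delta> \<le> 1 / G"
    proof -
      have "\<tau>\<^sup>2 \<le> \<tau>" using \<tau> \<tau>1 by (simp add: power2_eq_square mult_left_le)
      moreover have "1 / real K ^ m \<le> 1 / real K"
        using K m self_le_power[of "real K" m] by (intro divide_left_mono) auto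
      ultimately have "\<delta> \<le> 1 / (2 * G) + 1 / (2 * G)" using \<tau> K unfolding \<delta>_def by linarith
      then show ?thesis by simp
    qed
    have "exp (L * t) * t * (M * \<delta>) \<le> exp (L * T) * T * (M * \<delta>)"
      using t0 tT \<tau> L M0 \<delta>0 by (intro mult_right_mono mult_mono) (auto intro: mult_left_mono)
    also have "\<dots> \<le> G * \<delta>" using \<delta>0 by (simp add: G_def distrib_right)
    also have "\<dots> \<le> 1" using mult_left_mono[OF \<delta>1, of G] G1 by simp
    finally have small: "pair_dist (U, V) (aliased K (u t), aliased K (v t)) \<le> 1" using IH by simp
    have in1: "t \<in> {0..T}" using t0 tT \<tau> by auto
    have "norm U \<le> R1" "norm V \<le> R1"
      using small norm_triangle_sub[of U "aliased K (u t)"] norm_triangle_sub[of V "aliased K (v t)"]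
        order.trans[OF norm_aliased nu(1)[OF in1], of K] order.trans[OF norm_aliased nu(2)[OF in1], of K]
        norm_ge_zero[of "U - aliased K (u t)"] norm_ge_zero[of "V - aliased K (v t)"]
      unfolding pair_dist_def R1_def fst_conv snd_conv by linarith+
    then have "pair_dist (disc_step K \<mu> \<tau> (U, V)) (aliased K (u (t + \<tau>)), aliased K (v (t + \<tau>)))
      \<le> (1 + L * \<tau>) * pair_dist (U, V) (aliased K (u t), aliased K (v t)) + \<tau> * (M * \<delta>)"
      unfolding \<delta>_def by (intro step K(1) t0 \<tau>(1) \<tau>1 tT)
    also have "\<dots> \<le> exp (L * \<tau>) * (exp (L * t) * t * (M * \<delta>)) + exp (L * (t + \<tau>)) * (\<tau> * (M * \<delta>))"
    proof (rule add_mono)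
      show "(1 + L * \<tau>) * pair_dist (U, V) (aliased K (u t), aliased K (v t)) \<le> exp (L * \<tau>) * (exp (L * t) * t * (M * \<delta>))"
        by (intro mult_mono IH exp_ge_add_one_self) (auto simp: pair_dist_def)
      have "1 \<le> exp (L * (t + \<tau>))" using L t0 \<tau> by simp
      moreover have "0 \<le> \<tau> * (M * \<delta>)" using \<tau> M0 \<delta>0 by simp
      ultimately show "\<tau> * (M * \<delta>) \<le> exp (L * (t + \<tau>)) * (\<tau> * (M * \<delta>))"
        using mult_right_mono[of 1 "exp (L * (t + \<tau>))" "\<tau> * (M * \<delta>)"] by simp
    qed
    also have "\<dots> = exp (L * (t + \<tau>)) * (t + \<tau>) * (M * \<delta>)"
      by (simp add: exp_add algebra_simps)
    finally show ?case unfolding tS \<delta>_def by (simp add: UV)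
  qed
  show ?thesis
  \<comment> \<open>The summand \<open>4 * R\<close> accounts for the aliasing errors
    \<open>2 R / K^m\<close> of \<open>u\<close> and of \<open>v\<close>; the 1 makes the constant
    positive.\<close>
  proof (rule that[of "exp (L * T) * T * M + 4 * R + 1" "1 / (2 * G)"])
    show "0 < exp (L * T) * T * M + 4 * R + 1" using T M0 R0 by (intro add_nonneg_pos) auto
    show "0 < 1 / (2 * G)" "1 / (2 * G) \<le> 1" using G1 by auto
    fix \<tau> K and n :: nat
    assume \<tau>: "0 < \<tau>" "\<tau> < 1 / (2 * G)" and K: "1 \<le> K" "1 / real K < 1 / (2 * G)" and nT: "real n * \<tau> \<le> T"
    define t where "t = real n * \<tau>"
    have t: "t \<in> {0..T}" using \<tau> nT by (auto simp: t_def)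
    define \<delta> where "\<delta> = \<tau>\<^sup>2 + 1 / real K ^ m"
    have \<delta>0: "0 \<le> \<delta>" using K by (simp add: \<delta>_def)
    have "exp (L * t) * t * (M * \<delta>) \<le> exp (L * T) * T * (M * \<delta>)"
      using t L M0 \<delta>0 by (intro mult_right_mono mult_mono) (auto intro: mult_left_mono)
    then have 1: "pair_dist ((disc_step K \<mu> \<tau> ^^ n) (aliased K (u 0), aliased K (v 0))) (aliased K (u t), aliased K (v t)) \<le> exp (L * T) * T * (M * \<delta>)"
      using glob[OF \<tau> K nT] unfolding t_def \<delta>_def by linarith
    have "norm (u t - aliased K (u t)) \<le> 2 * R / real K ^ m" "norm (v t - aliased K (v t)) \<le> 2 * R / real K ^ m"
      using aliased_error[OF K(1) wbound_mono[OF wu(1)[OF t], of m R]] aliased_error[OF K(1) wbound_mono[OF wu(2)[OF t], of m R]] by auto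
    then have "pair_dist (aliased K (u t), aliased K (v t)) (u t, v t) \<le> 4 * R * (1 / real K ^ m)"
      by (simp add: pair_dist_def norm_minus_commute)
    also have "\<dots> \<le> 4 * R * \<delta>" using R0 by (intro mult_left_mono) (auto simp: \<delta>_def)
    finally have "pair_dist ((disc_step K \<mu> \<tau> ^^ n) (aliased K (u 0), aliased K (v 0))) (u t, v t) \<le> exp (L * T) * T * (M * \<delta>) + 4 * R * \<delta>"
      using 1 pair_dist_triangle[of "(disc_step K \<mu> \<tau> ^^ n) (aliased K (u 0), aliased K (v 0))" "(u t, v t)" "(aliased K (u t), aliased K (v t))"] by linarith
    also have "\<dots> \<le> (exp (L * T) * T * M + 4 * R + 1) * \<delta>" using \<delta>0 by (simp add: algebra_simps)
    finally show "pair_dist ((disc_step K \<mu> \<tau> ^^ n) (aliased K (u 0), aliased K (v 0))) (u (real n * \<tau>), v (real n * \<tau>))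
        \<le> (exp (L * T) * T * M + 4 * R + 1) * (\<tau>\<^sup>2 + 1 / real K ^ m)"
      by (simp add: t_def \<delta>_def)
  qed
qed

subsection \<open>Fourier series of differentiable functions\<close>

lemma continuous_on_fourier_kernel: "continuous_on S (\<lambda>x::real. exp (- \<i> * of_int a * of_real x))"
  by (intro continuous_intros)

lemma fourier_coeff_bound:
  assumes "continuous_on {-pi..pi} g" "\<And>x. x \<in> {-pi..pi} \<Longrightarrow> cmod (g x) \<le> M"
  shows "cmod (fourier_coeff g a) \<le> M"
proof -
  have "cmod (integral {-pi..pi} (\<lambda>x. g x * exp (- \<i> * of_int a * of_real x))) \<le> M * (pi - - pi)"
    by (rule integral_bound) (use assms in \<open>auto intro!: continuous_intros simp: norm_mult simp del: mult_minus_left\<close>)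
  then show ?thesis by (simp add: fourier_coeff_def norm_divide field_simps)
qed

lemma fourier_coeff_diff:
  assumes "continuous_on {-pi..pi} g" "continuous_on {-pi..pi} h"
  shows "fourier_coeff (\<lambda>x. g x - h x) a = fourier_coeff g a - fourier_coeff h a"
proof -
  have "integral {-pi..pi} (\<lambda>x. g x * exp (- \<i> * of_int a * of_real x) - h x * exp (- \<i> * of_int a * of_real x))
    = integral {-pi..pi} (\<lambda>x. g x * exp (- \<i> * of_int a * of_real x)) - integral {-pi..pi} (\<lambda>x. h x * exp (- \<i> * of_int a * of_real x))"
    by (intro integral_diff integrable_continuous_interval continuous_on_mult continuous_on_fourier_kernel assms)
  then show ?thesis by (simp add: fourier_coeff_def left_diff_distrib diff_divide_distrib)
qed

lemma fourier_coeff_cmult: "fourier_coeff (\<lambda>x. c * g x) a = c * fourier_coeff g a"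
  by (simp add: fourier_coeff_def mult.assoc)

text \<open>\<open>S\<close> is the partial Fourier sum of \<open>g\<close>. Its pairing with itself
  and its pairing with \<open>g\<close> both equal \<open>2 pi P\<close>, by the same computation
  \<open>I\<close>, so the squared distance from \<open>g\<close> to \<open>S\<close> integrates to
  the difference of the two sides.\<close>

lemma bessel:
  assumes g: "continuous_on {-pi..pi} g" and A: "finite A"
  shows "2 * pi * (\<Sum>a\<in>A. (cmod (fourier_coeff g a))\<^sup>2) \<le> integral {-pi..pi} (\<lambda>x. (cmod (g x))\<^sup>2)"
proof -
  define S where "S = (\<Sum>a\<in>A. monomial a (fourier_coeff g a))"
  define P where "P = (\<Sum>a\<in>A. (cmod (fourier_coeff g a))\<^sup>2)"
  have coefS: "coef S b = (if b \<in> A then fourier_coeff g b else 0)" for b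
    using A by (simp add: S_def sum.delta)
  have evS: "cnj (ev S x) = (\<Sum>a\<in>A. cnj (fourier_coeff g a) * exp (- \<i> * of_int a * of_real x))" for x
    using A by (subst ev_finite[OF A]) (auto simp: coefS exp_cnj)
  have s: "continuous_on {-pi..pi} (ev S)" by (rule continuous_ev)
  have I: "integral {-pi..pi} (\<lambda>x. h x * cnj (ev S x)) = of_real (2 * pi * P)"
    if h: "continuous_on {-pi..pi} h" and eq: "\<And>a. a \<in> A \<Longrightarrow> fourier_coeff h a = fourier_coeff g a" for h
  proof -
    have "integral {-pi..pi} (\<lambda>x. h x * cnj (ev S x))
        = integral {-pi..pi} (\<lambda>x. \<Sum>a\<in>A. cnj (fourier_coeff g a) * (h x * exp (- \<i> * of_int a * of_real x)))"
      unfolding evS by (simp add: sum_distrib_left mult_ac)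
    also have "\<dots> = (\<Sum>a\<in>A. cnj (fourier_coeff g a) * integral {-pi..pi} (\<lambda>x. h x * exp (- \<i> * of_int a * of_real x)))"
      by (subst integral_sum[OF A])
         (auto intro!: integrable_continuous_interval continuous_intros h simp del: mult_minus_left)
    also have "\<dots> = (\<Sum>a\<in>A. of_real (2 * pi) * of_real ((cmod (fourier_coeff g a))\<^sup>2))"
    proof (rule sum.cong[OF refl])
      fix a assume a: "a \<in> A"
      have "integral {-pi..pi} (\<lambda>x. h x * exp (- \<i> * of_int a * of_real x)) = of_real (2 * pi) * fourier_coeff g a"
        unfolding eq[OF a, symmetric] by (simp add: fourier_coeff_def)
      then show "cnj (fourier_coeff g a) * integral {-pi..pi} (\<lambda>x. h x * exp (- \<i> * of_int a * of_real x))
          = of_real (2 * pi) * of_real ((cmod (fourier_coeff g a))\<^sup>2)"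
        unfolding complex_norm_square by simp
    qed
    finally show ?thesis by (simp add: P_def sum_distrib_left)
  qed
  have I1: "integral {-pi..pi} (\<lambda>x. g x * cnj (ev S x)) = of_real (2 * pi * P)" by (rule I[OF g]) simp
  have I2: "integral {-pi..pi} (\<lambda>x. ev S x * cnj (ev S x)) = of_real (2 * pi * P)"
    by (rule I[OF s]) (simp add: fourier_coeff_ev coefS)
  have reI: "integral {-pi..pi} (\<lambda>x. Re (h x)) = Re (integral {-pi..pi} h)" if "continuous_on {-pi..pi} h" for h
    using integral_linear[OF integrable_continuous_interval[OF that] bounded_linear_Re] by (simp add: o_def)
  have c1: "continuous_on {-pi..pi} (\<lambda>x. g x * cnj (ev S x))" and c2: "continuous_on {-pi..pi} (\<lambda>x. ev S x * cnj (ev S x))"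
    by (intro continuous_intros g s)+
  have pt: "(cmod (g x - ev S x))\<^sup>2 = ((cmod (g x))\<^sup>2 + Re (ev S x * cnj (ev S x))) - 2 * Re (g x * cnj (ev S x))" for x
    by (simp only: cmod_power2) (simp add: power2_eq_square algebra_simps)
  have "0 \<le> integral {-pi..pi} (\<lambda>x. (cmod (g x - ev S x))\<^sup>2)"
    by (intro integral_nonneg integrable_continuous_interval continuous_intros g s) auto
  also have "\<dots> = (integral {-pi..pi} (\<lambda>x. (cmod (g x))\<^sup>2) + integral {-pi..pi} (\<lambda>x. Re (ev S x * cnj (ev S x))))
      - 2 * integral {-pi..pi} (\<lambda>x. Re (g x * cnj (ev S x)))"
    unfolding pt
    by (rule integral_unique)
       (intro has_integral_diff has_integral_add has_integral_mult_right integrable_integral integrable_continuous_interval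
         continuous_on_power continuous_on_norm continuous_on_Re g c1 c2)
  also have "\<dots> = integral {-pi..pi} (\<lambda>x. (cmod (g x))\<^sup>2) - 2 * pi * P"
    unfolding reI[OF c1] reI[OF c2] I1 I2 by simp
  finally show ?thesis by (simp add: P_def)
qed

text \<open>By Bessel's inequality the squares along any injective sequence of modes are
  summable.\<close>

lemma riemann_lebesgue:
  fixes \<sigma> :: "nat \<Rightarrow> int"
  assumes g: "continuous_on {-pi..pi} g" and \<sigma>: "inj \<sigma>"
  shows "(\<lambda>n. fourier_coeff g (\<sigma> n)) \<longlonglongrightarrow> 0"
proof -
  have "summable (\<lambda>n. (cmod (fourier_coeff g (\<sigma> n)))\<^sup>2)"
  proof (rule summableI_nonneg_bounded)
    fix n
    have "(\<Sum>i<n. (cmod (fourier_coeff g (\<sigma> i)))\<^sup>2) = (\<Sum>a\<in>\<sigma> ` {..<n}. (cmod (fourier_coeff g a))\<^sup>2)"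
      by (subst sum.reindex) (use \<sigma> in \<open>auto intro: inj_on_subset\<close>)
    then show "(\<Sum>i<n. (cmod (fourier_coeff g (\<sigma> i)))\<^sup>2) \<le> integral {-pi..pi} (\<lambda>x. (cmod (g x))\<^sup>2) / (2 * pi)"
      using bessel[OF g, of "\<sigma> ` {..<n}"] by (simp add: field_simps)
  qed simp
  then have "(\<lambda>n. (cmod (fourier_coeff g (\<sigma> n)))\<^sup>2) \<longlonglongrightarrow> 0" by (rule summable_LIMSEQ_zero)
  then have "(\<lambda>n. sqrt ((cmod (fourier_coeff g (\<sigma> n)))\<^sup>2)) \<longlonglongrightarrow> sqrt 0" by (rule tendsto_real_sqrt)
  then show ?thesis by (simp add: tendsto_norm_zero_iff)
qed

lemma has_vector_derivative_shift:
  assumes "(f has_vector_derivative d) (at (x + c))"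
  shows "((\<lambda>x. f (x + c)) has_vector_derivative d) (at x)"
proof -
  have "((\<lambda>x. x + c) has_vector_derivative 1) (at x)" by (auto intro!: derivative_eq_intros)
  from vector_diff_chain_at[OF this assms] show ?thesis by (simp add: o_def)
qed

text \<open>The integral over a window of length \<open>2 pi\<close> has zero derivative in the
  position of the window.\<close>

lemma periodic_integral_shift:
  fixes k :: "real \<Rightarrow> complex"
  assumes k: "continuous_on UNIV k" and per: "\<And>x. k (x + 2 * pi) = k x"
  shows "integral {-pi..pi} (\<lambda>x. k (x + s)) = integral {-pi..pi} k"
proof -
  \<comment> \<open>All windows centred between \<open>-|s|\<close> and \<open>|s|\<close> lie
    strictly inside \<open>(-R, R)\<close>, where the primitive \<open>A\<close> has a two-sided
    derivative.\<close>
  define R where "R = \<bar>s\<bar> + pi + 1"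
  define A where "A = (\<lambda>y. integral {-R..y} k)"
  have ck: "continuous_on S k" for S using k continuous_on_subset by blast
  have dA: "(A has_vector_derivative k y) (at y)" if "- R < y" "y < R" for y
    using integral_has_vector_derivative[OF ck, of y "-R" R] that at_within_Icc_at[of "-R" y R] by (auto simp: A_def)
  define B where "B = (\<lambda>r. A (r + pi) - A (r - pi))"
  have dB: "(B has_derivative (\<lambda>_. 0)) (at r within {- \<bar>s\<bar>..\<bar>s\<bar>})" if r: "r \<in> {- \<bar>s\<bar>..\<bar>s\<bar>}" for r
  proof -
    have 1: "((\<lambda>r. A (r + pi)) has_vector_derivative k (r + pi)) (at r)"
      by (rule has_vector_derivative_shift[OF dA]) (use r pi_gt_zero in \<open>unfold R_def atLeastAtMost_iff, linarith+\<close>)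
    have 2: "((\<lambda>r. A (r - pi)) has_vector_derivative k (r - pi)) (at r)"
    proof -
      have "- R < r - pi" "r - pi < R" using r pi_gt_zero unfolding R_def atLeastAtMost_iff by linarith+
      then show ?thesis using has_vector_derivative_shift[of A "k (r - pi)" r "- pi"] dA[of "r - pi"] by simp
    qed
    have "k (r + pi) = k (r - pi)" using per[of "r - pi"] by (simp add: algebra_simps)
    then have "(B has_vector_derivative 0) (at r)"
      unfolding B_def using has_vector_derivative_diff[OF 1 2] by simp
    then show ?thesis by (simp add: has_vector_derivative_def has_derivative_at_withinI)
  qed
  obtain c where c: "\<And>r. r \<in> {- \<bar>s\<bar>..\<bar>s\<bar>} \<Longrightarrow> B r = c"
    using has_derivative_zero_constant[of "{- \<bar>s\<bar>..\<bar>s\<bar>}" B] dB by auto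
  have B: "B r = integral {r - pi..r + pi} k" if "r \<in> {- \<bar>s\<bar>..\<bar>s\<bar>}" for r
    using Henstock_Kurzweil_Integration.integral_combine[where a = "-R" and c = "r - pi" and b = "r + pi" and f = k] integrable_continuous_interval[OF ck] that
    by (auto simp: B_def A_def R_def algebra_simps)
  have "integral {-pi..pi} (\<lambda>x. k (x + s)) = integral {s - pi..s + pi} k"
    using integral_shift_real_ivl[of "s - pi" s "s + pi" k] by simp
  also have "\<dots> = B s" by (rule B[symmetric]) auto
  also have "\<dots> = B 0"
  proof -
    have "s \<in> {- \<bar>s\<bar>..\<bar>s\<bar>}" unfolding atLeastAtMost_iff by linarith
    then show ?thesis using c[of s] c[of 0] by simp
  qed
  also have "\<dots> = integral {-pi..pi} k" using B[of 0] by simp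
  finally show ?thesis .
qed

lemma difference_quotient:
  fixes F :: "real \<Rightarrow> complex"
  assumes F: "(F has_vector_derivative d) (at 0)" and cF: "continuous_on UNIV F"
  obtains q where "\<And>x. F x - F 0 = of_real x * q x" "continuous_on UNIV q" "q 0 = d"
proof -
  define q where "q = (\<lambda>x. if x = 0 then d else (F x - F 0) / of_real x)"
  have "isCont q 0"
  proof -
    have "((\<lambda>h. norm (F (0 + h) - F 0 - h *\<^sub>R d) / norm h) \<longlongrightarrow> 0) (at 0)"
      using F by (simp add: has_vector_derivative_def has_derivative_at)
    then have "((\<lambda>h. norm (q h - d)) \<longlongrightarrow> 0) (at 0)"
    proof (rule Lim_transform_eventually)
      show "\<forall>\<^sub>F h in at 0. norm (F (0 + h) - F 0 - h *\<^sub>R d) / norm h = norm (q h - d)"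
        unfolding eventually_at_filter
      proof (intro always_eventually allI impI)
        fix h :: real assume h: "h \<noteq> 0"
        have "q h - d = (F h - F 0 - h *\<^sub>R d) / of_real h" using h by (simp add: q_def field_simps scaleR_conv_of_real)
        then show "norm (F (0 + h) - F 0 - h *\<^sub>R d) / norm h = norm (q h - d)" by (simp add: norm_divide)
      qed
    qed
    then have "(q \<longlongrightarrow> d) (at 0)" by (simp add: tendsto_norm_zero_iff LIM_zero_iff)
    then show ?thesis by (simp add: isCont_def q_def)
  qed
  moreover have "isCont q x" if "x \<noteq> 0" for x
  proof -
    have "continuous_on (- {0}) (\<lambda>x. (F x - F 0) / of_real x)"
      by (intro continuous_intros continuous_on_subset[OF cF]) auto
    then have "continuous_on (- {0}) q"
      by (rule continuous_on_eq) (simp add: q_def)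
    then show ?thesis using that by (simp add: continuous_on_eq_continuous_at open_Compl)
  qed
  ultimately have "isCont q x" for x by (cases "x = 0") auto
  then have "continuous_on UNIV q" by (simp add: continuous_at_imp_continuous_on)
  moreover have "F x - F 0 = of_real x * q x" for x by (simp add: q_def)
  ultimately show ?thesis using that[of q] by (simp add: q_def)
qed

text \<open>
  Chernoff's argument: writing \<open>f(x + x0) - f(x0) = (e^{ix} - 1) G(x)\<close> with \<open>G\<close> continuous makes the
  symmetric partial sums of the Fourier series at \<open>x0\<close> telescope.
\<close>

lemma fourier_inversion:
  assumes per: "torus_periodic f" and df: "\<And>x. (f has_vector_derivative f' x) (at x)"
    and F: "\<And>a. coef F a = fourier_coeff f a"
  shows "ev F x0 = f x0"
proof -
  have cf: "continuous_on S f" for S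
    using df has_vector_derivative_continuous by (metis continuous_at_imp_continuous_on)
  define h where "h = (\<lambda>x. f (x + x0))"
  have ch: "continuous_on S h" for S
    unfolding h_def by (rule continuous_on_compose2[OF cf[of UNIV]]) (auto intro!: continuous_intros)
  have "(h has_vector_derivative f' x0) (at 0)"
    unfolding h_def by (rule has_vector_derivative_shift) (use df[of x0] in simp)
  then obtain q where q: "\<And>x. h x - h 0 = of_real x * q x" "continuous_on UNIV q"
    using difference_quotient[OF _ ch] by metis
  define E where "E = (\<lambda>x::real. exp (\<i> * of_real x))"
  have "(E has_vector_derivative \<i>) (at 0)"
    unfolding E_def using has_vector_derivative_exp_i[of 1 0 UNIV] by simp
  moreover have "continuous_on UNIV E" unfolding E_def by (intro continuous_intros)
  ultimately obtain e where e: "\<And>x. E x - E 0 = of_real x * e x" "continuous_on UNIV e" "e 0 = \<i>"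
    by (rule difference_quotient) blast
  \<comment> \<open>The denominator is \<open>\<i>\<close> at 0, and elsewhere on this interval
    \<open>e^{ix}\<close> differs from 1, as 0 is the only multiple of \<open>2 pi\<close>
    there.\<close>
  have e0: "e x \<noteq> 0" if x: "x \<in> {-pi..pi}" for x
  proof (cases "x = 0")
    case False
    have "E x \<noteq> 1"
    proof
      assume "E x = 1"
      then obtain n :: int where n: "x = of_int (2 * n) * pi" by (auto simp: E_def exp_eq_1)
      then have "\<bar>of_int (2 * n)\<bar> * pi \<le> 1 * pi" using x by (auto simp: abs_mult[symmetric] abs_le_iff)
      then have "\<bar>real_of_int (2 * n)\<bar> \<le> 1" by (rule mult_right_le_imp_le) simp
      then have "n = 0" by linarith
      then show False using n False by simp
    qed
    then show ?thesis using e(1)[of x] by (auto simp: E_def)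
  qed (simp add: e(3))
  define G where "G = (\<lambda>x. q x / e x)"
  have cG: "continuous_on {-pi..pi} G"
    unfolding G_def using e0 by (intro continuous_on_divide continuous_on_subset[OF q(2)] continuous_on_subset[OF e(2)]) auto
  have hG: "h x = f x0 + (E x - 1) * G x" if "x \<in> {-pi..pi}" for x
    using q(1)[of x] e(1)[of x] e0[OF that] by (simp add: h_def G_def E_def field_simps)
  \<comment> \<open>Multiplication by \<open>e^{ix}\<close> shifts the Fourier index by one. In a
    symmetric partial sum only the coefficients of \<open>G\<close> at \<open>-N - 1\<close> and
    \<open>N\<close> remain, and these vanish in the limit by Riemann-Lebesgue.\<close>
  have fc: "fourier_coeff h a = (if a = 0 then f x0 else 0) + fourier_coeff G (a - 1) - fourier_coeff G a" for a
  proof -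
    let ?k = "\<lambda>(a::int) (x::real). exp (- \<i> * of_int a * of_real x)"
    have int: "(\<lambda>x. g x * ?k a x) integrable_on {-pi..pi}" if "continuous_on {-pi..pi} g" for g a
      by (intro integrable_continuous_interval continuous_on_mult continuous_on_fourier_kernel that)
    have "integral {-pi..pi} (\<lambda>x. h x * ?k a x) = integral {-pi..pi} (\<lambda>x. f x0 * (1 * ?k a x) + G x * ?k (a - 1) x - G x * ?k a x)"
    proof (rule integral_cong)
      fix x assume "x \<in> {-pi..pi}"
      then have "h x * ?k a x = f x0 * (1 * ?k a x) + G x * (E x * ?k a x) - G x * ?k a x"
        by (simp add: hG algebra_simps)
      moreover have "E x * ?k a x = ?k (a - 1) x"
        unfolding E_def by (simp add: mult_exp_exp algebra_simps)
      ultimately show "h x * ?k a x = f x0 * (1 * ?k a x) + G x * ?k (a - 1) x - G x * ?k a x" by simp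
    qed
    also have "\<dots> = f x0 * integral {-pi..pi} (\<lambda>x. 1 * ?k a x) + integral {-pi..pi} (\<lambda>x. G x * ?k (a - 1) x) - integral {-pi..pi} (\<lambda>x. G x * ?k a x)"
      by (subst integral_diff[OF integrable_add[OF integrable_on_mult_right[OF int] int[OF cG]] int[OF cG]], simp,
          subst integral_add[OF integrable_on_mult_right[OF int] int[OF cG]], simp, simp)
    finally have "fourier_coeff h a = f x0 * fourier_coeff (\<lambda>_. 1) a + fourier_coeff G (a - 1) - fourier_coeff G a"
      by (simp add: fourier_coeff_def add_divide_distrib diff_divide_distrib)
    moreover have ev1: "ev 1 = (\<lambda>_. 1)" by auto
    have "fourier_coeff (\<lambda>_. 1) a = (if a = 0 then 1 else 0)"
      using fourier_coeff_ev[of 1 a] unfolding ev1 by (simp add: one_wiener_def)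
    ultimately show ?thesis by simp
  qed
  have partial: "(\<Sum>a\<in>{- int N..int N}. fourier_coeff h a) = f x0 + fourier_coeff G (- int N - 1) - fourier_coeff G (int N)" for N
  proof (induction N)
    case (Suc N)
    have "{- int (Suc N)..int (Suc N)} = insert (- int N - 1) (insert (int N + 1) {- int N..int N})" by auto
    then have "(\<Sum>a\<in>{- int (Suc N)..int (Suc N)}. fourier_coeff h a)
        = fourier_coeff h (- int N - 1) + (fourier_coeff h (int N + 1) + (\<Sum>a\<in>{- int N..int N}. fourier_coeff h a))"
      by (simp only:) (subst sum.insert; simp)+
    then show ?case unfolding Suc by (simp add: fc algebra_simps)
  qed (simp add: fc)
  have shift: "fourier_coeff h a = coef F a * exp (\<i> * of_int a * of_real x0)" for a
  proof -
    define k where "k = (\<lambda>x. f x * exp (- \<i> * of_int a * of_real x))"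
    have "exp (- \<i> * of_int a * of_real (x + 2 * pi)) = exp (- \<i> * of_int a * of_real x)" for x
      using exp_integer_2pi[of "of_int (- a)"] by (simp add: algebra_simps exp_add exp_diff)
    then have "k (x + 2 * pi) = k x" for x
      using per unfolding k_def torus_periodic_def by simp
    moreover have "continuous_on UNIV k"
      unfolding k_def by (intro continuous_on_mult continuous_on_fourier_kernel cf)
    ultimately have "integral {-pi..pi} (\<lambda>x. k (x + x0)) = integral {-pi..pi} k"
      by (intro periodic_integral_shift)
    moreover have "h x * exp (- \<i> * of_int a * of_real x) = exp (\<i> * of_int a * of_real x0) * k (x + x0)" for x
      by (simp add: h_def k_def algebra_simps mult_exp_exp)
    ultimately show ?thesis by (simp add: F fourier_coeff_def k_def mult.commute)
  qed
  have "(\<lambda>N. \<Sum>a\<in>{- int N..int N}. coef F a * exp (\<i> * of_int a * of_real x0)) \<longlonglongrightarrow> ev F x0"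
  proof -
    \<comment> \<open>The series of \<open>F\<close> converges unconditionally, so its sum may be
      computed along the symmetric intervals.\<close>
    have "filterlim (\<lambda>N. {- int N..int N}) (finite_subsets_at_top UNIV) sequentially"
      unfolding filterlim_finite_subsets_at_top
    proof safe
      fix X :: "int set" assume X: "finite X"
      then obtain M where M: "\<And>a. a \<in> X \<Longrightarrow> \<bar>a\<bar> \<le> M" by (metis finite_abs_int_segment finite_imageI Max_ge image_eqI)
      show "\<forall>\<^sub>F N in sequentially. finite {- int N..int N} \<and> X \<subseteq> {- int N..int N} \<and> {- int N..int N} \<subseteq> UNIV"
        unfolding eventually_sequentially using M by (intro exI[of _ "nat M"]) fastforce
    qed
    then show ?thesis using ev_has_sum[of F x0] filterlim_compose unfolding has_sum_def by blast
  qed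
  then have "(\<lambda>N. f x0 + fourier_coeff G (- int N - 1) - fourier_coeff G (int N)) \<longlonglongrightarrow> ev F x0"
    unfolding shift[symmetric] partial .
  moreover have "(\<lambda>N. f x0 + fourier_coeff G (- int N - 1) - fourier_coeff G (int N)) \<longlonglongrightarrow> f x0 + 0 - 0"
    by (intro tendsto_intros riemann_lebesgue cG) (auto simp: inj_on_def)
  ultimately show ?thesis using LIMSEQ_unique by fastforce
qed

text \<open>Integration by parts; the boundary terms cancel by periodicity.\<close>

lemma fourier_coeff_derivative:
  assumes per: "torus_periodic f" and df: "\<And>x. (f has_vector_derivative f' x) (at x)" and cf': "continuous_on UNIV f'"
  shows "fourier_coeff f' a = \<i> * of_int a * fourier_coeff f a"
proof -
  define k where "k = (\<lambda>x::real. exp (- \<i> * of_int a * of_real x))"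
  define \<alpha> where "\<alpha> = - \<i> * of_int a"
  have cf: "continuous_on S f" for S
    using df has_vector_derivative_continuous by (metis continuous_at_imp_continuous_on)
  have ck: "continuous_on S k" for S unfolding k_def by (rule continuous_on_fourier_kernel)
  have dk: "(k has_vector_derivative \<alpha> * k x) (at x within S)" for x S
    using has_vector_derivative_exp_i[of "- of_int a" x S] by (simp add: k_def \<alpha>_def mult.assoc)
  have "((\<lambda>x. f x * (\<alpha> * k x) + f' x * k x) has_integral (f pi * k pi - f (- pi) * k (- pi))) {-pi..pi}"
  proof (rule fundamental_theorem_of_calculus)
    show "((\<lambda>x. f x * k x) has_vector_derivative f x * (\<alpha> * k x) + f' x * k x) (at x within {-pi..pi})" for x
      by (intro has_vector_derivative_mult dk has_vector_derivative_at_within[OF df])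
  qed simp
  moreover have "f pi = f (- pi)" using per[unfolded torus_periodic_def, rule_format, of "-pi"] by simp
  moreover have "k pi = k (- pi)"
  proof -
    have "- \<i> * of_int a * of_real pi = (2 * of_int (- a) * of_real pi) * \<i> + (- \<i> * of_int a * of_real (- pi))"
      by (simp add: algebra_simps)
    moreover have "exp ((2 * of_int (- a) * of_real pi) * \<i>) = 1"
      using exp_integer_2pi[of "of_int (- a)"] by (simp del: of_int_minus)
    ultimately show ?thesis unfolding k_def by (simp only: exp_add mult_1)
  qed
  ultimately have "integral {-pi..pi} (\<lambda>x. f x * (\<alpha> * k x) + f' x * k x) = 0"
    by (simp add: integral_unique)
  moreover have "integral {-pi..pi} (\<lambda>x. f x * (\<alpha> * k x) + f' x * k x)
      = integral {-pi..pi} (\<lambda>x. \<alpha> * (f x * k x)) + integral {-pi..pi} (\<lambda>x. f' x * k x)"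
  proof -
    have e: "f x * (\<alpha> * k x) = \<alpha> * (f x * k x)" for x by (simp add: mult_ac)
    show ?thesis unfolding e
      by (intro integral_add integrable_continuous_interval continuous_on_mult continuous_on_const
          ck cf continuous_on_subset[OF cf']) auto
  qed
  ultimately have "integral {-pi..pi} (\<lambda>x. f' x * k x) = - \<alpha> * integral {-pi..pi} (\<lambda>x. f x * k x)"
    by (simp add: eq_neg_iff_add_eq_0 add.commute)
  then show ?thesis by (simp add: fourier_coeff_def k_def \<alpha>_def)
qed

section \<open>Decay of Fourier coefficients and weighted summability\<close>

lemma sum_inverse_weight_bounded: "\<exists>W. \<forall>F. finite F \<longrightarrow> (\<Sum>a\<in>F. 1 / weight a ^ 2) \<le> W"
proof -
  define s where "s = (\<lambda>n::nat. inverse (real (Suc n) ^ 2))"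
  have sm: "summable s" unfolding s_def using inverse_power_summable[of 2, where 'a = real] by (subst summable_Suc_iff) auto
  have "(\<Sum>a\<in>F. 1 / weight a ^ 2) \<le> 2 * suminf s" if F: "finite F" for F
  proof -
    define P where "P = {a \<in> F. 0 \<le> a}"
    have half: "(\<Sum>a\<in>G. 1 / weight a ^ 2) \<le> suminf s" if "finite G" "inj_on (\<lambda>a. nat \<bar>a\<bar>) G" for G
    proof -
      have "(\<Sum>a\<in>G. 1 / weight a ^ 2) = (\<Sum>a\<in>G. s (nat \<bar>a\<bar>))"
        by (intro sum.cong) (auto simp: s_def weight_def field_simps)
      also have "\<dots> = sum s ((\<lambda>a. nat \<bar>a\<bar>) ` G)" by (rule sum.reindex_cong[OF that(2), symmetric]) auto
      also have "\<dots> \<le> suminf s" using that(1) by (intro sum_le_suminf sm) (auto simp: s_def)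
      finally show ?thesis .
    qed
    have "(\<Sum>a\<in>F. 1 / weight a ^ 2) = (\<Sum>a\<in>P. 1 / weight a ^ 2) + (\<Sum>a\<in>F - P. 1 / weight a ^ 2)"
      using F by (subst sum.subset_diff[of P F]) (auto simp: P_def)
    moreover have "inj_on (\<lambda>a. nat \<bar>a\<bar>) P" "inj_on (\<lambda>a. nat \<bar>a\<bar>) (F - P)"
      by (auto simp: P_def inj_on_def)
    ultimately show ?thesis using half[of P] half[of "F - P"] F by (auto simp: P_def)
  qed
  then show ?thesis by blast
qed

text \<open>Two orders of decay beyond the weight suffice, as the inverse squares of the weights are
  summable. \<open>W\<close> is chosen once for all \<open>f\<close>, so that a decay uniform in
  time gives a norm bound uniform in time.\<close>

lemma wbound_of_decay:
  obtains W where "0 \<le> W" "\<And>k C f. (\<And>a. weight a ^ (k + 2) * cmod (f a) \<le> C) \<Longrightarrow>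
    (\<forall>a. coef (Abs_wiener f) a = f a) \<and> wbound k (C * W) (Abs_wiener f)"
proof -
  obtain W where W: "\<And>F. finite F \<Longrightarrow> (\<Sum>a\<in>F. 1 / weight a ^ 2) \<le> W"
    using sum_inverse_weight_bounded by blast
  have W0: "0 \<le> W" using W[of "{}"] by simp
  have "(\<forall>a. coef (Abs_wiener f) a = f a) \<and> wbound k (C * W) (Abs_wiener f)"
    if f: "\<And>a. weight a ^ (k + 2) * cmod (f a) \<le> C" for k C f
  proof -
    have C: "0 \<le> C" using f[of 0] by (simp add: weight_def order.trans[OF norm_ge_zero])
    have b: "(\<Sum>a\<in>F. weight a ^ k * cmod (f a)) \<le> C * W" if F: "finite F" for F
    proof -
      have "(\<Sum>a\<in>F. weight a ^ k * cmod (f a)) \<le> (\<Sum>a\<in>F. C * (1 / weight a ^ 2))"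
      proof (rule sum_mono)
        fix a
        have "0 < weight a ^ 2" by (rule zero_less_power) simp
        then show "weight a ^ k * cmod (f a) \<le> C * (1 / weight a ^ 2)"
          using f[of a, unfolded power_add] by (simp add: pos_le_divide_eq mult_ac)
      qed
      also have "\<dots> \<le> C * W" unfolding sum_distrib_left[symmetric] by (intro mult_left_mono W F C)
      finally show ?thesis .
    qed
    have "abs_summable f"
    proof (rule abs_summableI)
      fix F :: "int set" assume F: "finite F"
      have "(\<Sum>a\<in>F. cmod (f a)) \<le> (\<Sum>a\<in>F. weight a ^ k * cmod (f a))"
        by (intro sum_mono) (simp add: mult_le_cancel_right1)
      then show "(\<Sum>a\<in>F. cmod (f a)) \<le> C * W" using b[OF F] by linarith
    qed
    then have "coef (Abs_wiener f) = f" by (rule coef_Abs)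
    then show ?thesis using b by (simp add: wbound_def)
  qed
  then show ?thesis using that[OF W0] by blast
qed

lemma weight_le_double: "a \<noteq> 0 \<Longrightarrow> weight a \<le> 2 * \<bar>of_int a\<bar>"
proof -
  assume "a \<noteq> 0"
  then have "1 \<le> \<bar>a\<bar>" by simp
  then have "1 \<le> \<bar>real_of_int a\<bar>" by (metis of_int_abs of_int_le_iff of_int_1)
  then show ?thesis by (simp add: weight_def)
qed

text \<open>For nonzero modes the weight is at most \<open>2 |a|\<close>; the mode 0, on which
  powers of \<open>a\<close> say nothing when \<open>j\<close> is positive, is covered by
  \<open>N\<close>.\<close>

lemma weight_power_le:
  assumes "0 \<le> x" "\<bar>real_of_int a\<bar> ^ j * x \<le> M" "x \<le> N"
  shows "weight a ^ j * x \<le> 2 ^ j * M + N"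
proof (cases "a = 0")
  case True
  have "0 \<le> M" using assms(1,2) by (meson abs_ge_zero mult_nonneg_nonneg order.trans zero_le_power)
  then have "0 \<le> 2 ^ j * M" by simp
  then show ?thesis using True assms by (simp add: weight_def)
next
  case False
  have "weight a ^ j * x \<le> (2 * \<bar>of_int a\<bar>) ^ j * x"
    using weight_le_double[OF False] assms(1) by (intro mult_right_mono power_mono) auto
  also have "\<dots> = 2 ^ j * (\<bar>of_int a\<bar> ^ j * x)" by (simp add: power_mult_distrib)
  also have "\<dots> \<le> 2 ^ j * M" using assms(2) by simp
  finally show ?thesis using assms by linarith
qed

text \<open>Every derivative is periodic and continuous, so repeated integration by parts gives
  decay of every order; the inversion theorem identifies the resulting series with the
  function.\<close>

lemma smooth_wiener:
  assumes "torus_smooth \<phi>"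
  obtains f where "ev f = \<phi>" "\<And>k. \<exists>R. wbound k R f"
proof -
  define D where "D = (\<lambda>k. ((\<lambda>g x. vector_derivative g (at x)) ^^ k) \<phi>)"
  have per: "torus_periodic \<phi>" and dif: "D k differentiable_on UNIV" for k
    using assms by (auto simp: torus_smooth_def D_def)
  have dD: "(D k has_vector_derivative D (Suc k) x) (at x)" for k x
  proof -
    have "D k differentiable (at x)" using dif[of k] by (simp add: differentiable_on_def)
    then show ?thesis by (simp add: D_def vector_derivative_works)
  qed
  have cD: "continuous_on S (D k)" for S k
    using dD has_vector_derivative_continuous by (metis continuous_at_imp_continuous_on)
  have perD: "torus_periodic (D k)" for k
  proof (induction k)
    case 0
    then show ?case using per by (simp add: D_def)
  next
    case (Suc k)
    have "D (Suc k) (x + 2 * pi) = D (Suc k) x" for x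
    proof (rule vector_derivative_unique_at)
      show "(D k has_vector_derivative D (Suc k) x) (at x)" by (rule dD)
      have "((\<lambda>y. D k (y + 2 * pi)) has_vector_derivative D (Suc k) (x + 2 * pi)) (at x)"
        by (rule has_vector_derivative_shift[OF dD])
      moreover have "(\<lambda>y. D k (y + 2 * pi)) = D k" using Suc by (auto simp: torus_periodic_def)
      ultimately show "(D k has_vector_derivative D (Suc k) (x + 2 * pi)) (at x)" by simp
    qed
    then show ?case by (simp add: torus_periodic_def)
  qed
  have fcD: "fourier_coeff (D k) a = (\<i> * of_int a) ^ k * fourier_coeff \<phi> a" for k a
  proof (induction k)
    case 0
    then show ?case by (simp add: D_def)
  next
    case (Suc k)
    then show ?case using fourier_coeff_derivative[OF perD dD cD, of k a] by simp
  qed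
  have "\<exists>M. \<forall>x\<in>{-pi..pi}. cmod (D k x) \<le> M" for k
    using compact_imp_bounded[OF compact_continuous_image[OF cD compact_Icc], of k "-pi" pi]
    unfolding bounded_iff by blast
  then obtain M where M: "\<And>k x. x \<in> {-pi..pi} \<Longrightarrow> cmod (D k x) \<le> M k" by metis
  have fcb: "\<bar>real_of_int a\<bar> ^ k * cmod (fourier_coeff \<phi> a) \<le> M k" for a k
    using fourier_coeff_bound[OF cD M, of k a] by (simp add: fcD norm_mult norm_power)
  have decay: "weight a ^ j * cmod (fourier_coeff \<phi> a) \<le> 2 ^ j * M j + M 0" for a j
    by (rule weight_power_le[OF _ fcb]) (use fcb[of a 0] in auto)
  obtain W where W: "\<And>k C f. (\<And>a. weight a ^ (k + 2) * cmod (f a) \<le> C) \<Longrightarrow>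
    (\<forall>a. coef (Abs_wiener f) a = f a) \<and> wbound k (C * W) (Abs_wiener f)"
    using wbound_of_decay by metis
  define f where "f = Abs_wiener (fourier_coeff \<phi>)"
  have f: "coef f a = fourier_coeff \<phi> a" "\<exists>R. wbound k R f" for a k
    using W[OF decay] unfolding f_def by blast+
  have d0: "(\<phi> has_vector_derivative D 1 x) (at x)" for x using dD[of 0] by (simp add: D_def)
  have "ev f x = \<phi> x" for x by (rule fourier_inversion[OF per d0 f(1)])
  then show ?thesis using that f(2) by blast
qed

subsection \<open>Stability of the Klein--Gordon equation\<close>

text \<open>With \<open>S\<close> and \<open>C\<close> the sine and cosine solutions seen from the
  end time, the sum \<open>C y + S y1\<close> has derivative \<open>S\<close> times the defect of
  the oscillator equation. The bound of the kernel \<open>S\<close> by \<open>1 / c^2\<close> is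
  what absorbs the factor \<open>c^2\<close> of the force.\<close>

lemma kg_duhamel_bound:
  assumes c: "0 < c" and t: "t \<in> {0..T}"
    and d1: "\<And>s. s \<in> {0..T} \<Longrightarrow> (y has_vector_derivative y1 s) (at s within {0..T})"
    and d2: "\<And>s. s \<in> {0..T} \<Longrightarrow> (y1 has_vector_derivative y2 s) (at s within {0..T})"
    and c2: "continuous_on {0..T} y2"
  shows "cmod (y t) \<le> cmod (y 0) + cmod (y1 0) / c\<^sup>2
    + integral {0..t} (\<lambda>s. cmod (y2 s + of_real ((kg_freq c a)\<^sup>2) * y s) / c\<^sup>2)"
proof -
  define \<omega> where "\<omega> = kg_freq c a"
  have \<omega>: "0 < \<omega>" "c\<^sup>2 \<le> \<omega>" using kg_freq_ge[OF c] by (auto simp: \<omega>_def)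
  define S where "S = (\<lambda>s. sin (\<omega> * (t - s)) / \<omega>)"
  define C where "C = (\<lambda>s. cos (\<omega> * (t - s)))"
  have sub: "{0..t} \<subseteq> {0..T}" using t by auto
  have dC: "(C has_vector_derivative \<omega> * sin (\<omega> * (t - s))) (at s within {0..t})" for s
    unfolding C_def has_real_derivative_iff_has_vector_derivative[symmetric]
    by (auto intro!: derivative_eq_intros)
  have dS: "(S has_vector_derivative - C s) (at s within {0..t})" for s
    unfolding S_def C_def has_real_derivative_iff_has_vector_derivative[symmetric]
    using \<omega> by (auto intro!: derivative_eq_intros)
  have cont: "continuous_on {0..t} y" "continuous_on {0..t} y2"
    using continuous_on_subset[OF continuous_on_vector_derivative[OF d1] sub] continuous_on_subset[OF c2 sub] by auto
  have cS: "continuous_on {0..t} S" unfolding S_def using \<omega> by (intro continuous_intros) auto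
  have D: "((\<lambda>s. C s *\<^sub>R y s + S s *\<^sub>R y1 s) has_vector_derivative S s *\<^sub>R (y2 s + of_real (\<omega>\<^sup>2) * y s)) (at s within {0..t})"
    if s: "s \<in> {0..t}" for s
  proof -
    have s': "s \<in> {0..T}" using s sub by blast
    have "((\<lambda>s. C s *\<^sub>R y s + S s *\<^sub>R y1 s) has_vector_derivative
        (C s *\<^sub>R y1 s + (\<omega> * sin (\<omega> * (t - s))) *\<^sub>R y s) + (S s *\<^sub>R y2 s + (- C s) *\<^sub>R y1 s)) (at s within {0..t})"
      by (intro has_vector_derivative_add has_vector_derivative_scaleR
          has_vector_derivative_within_subset[OF d1[OF s'] sub] has_vector_derivative_within_subset[OF d2[OF s'] sub])
         (use dC dS in \<open>auto simp: has_real_derivative_iff_has_vector_derivative\<close>)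
    moreover have "\<omega> * sin (\<omega> * (t - s)) = S s * \<omega>\<^sup>2" using \<omega> by (simp add: S_def power2_eq_square)
    then have "(C s *\<^sub>R y1 s + (\<omega> * sin (\<omega> * (t - s))) *\<^sub>R y s) + (S s *\<^sub>R y2 s + (- C s) *\<^sub>R y1 s)
        = S s *\<^sub>R (y2 s + of_real (\<omega>\<^sup>2) * y s)"
      by (simp only:) (simp add: scaleR_conv_of_real algebra_simps)
    ultimately show ?thesis by (simp only:)
  qed
  have "((\<lambda>s. S s *\<^sub>R (y2 s + of_real (\<omega>\<^sup>2) * y s)) has_integral
      (C t *\<^sub>R y t + S t *\<^sub>R y1 t) - (C 0 *\<^sub>R y 0 + S 0 *\<^sub>R y1 0)) {0..t}"
    by (rule fundamental_theorem_of_calculus[OF _ D]) (use t in auto)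
  then have eq: "y t = (C 0 *\<^sub>R y 0 + S 0 *\<^sub>R y1 0) + integral {0..t} (\<lambda>s. S s *\<^sub>R (y2 s + of_real (\<omega>\<^sup>2) * y s))"
    by (simp add: integral_unique C_def S_def)
  have Sb: "\<bar>S s\<bar> \<le> 1 / c\<^sup>2" for s
  proof -
    have "\<bar>S s\<bar> \<le> 1 / \<omega>" using \<omega> by (simp add: S_def divide_right_mono)
    also have "\<dots> \<le> 1 / c\<^sup>2" using \<omega> c by (intro divide_left_mono) auto
    finally show ?thesis .
  qed
  have 1: "cmod (C 0 *\<^sub>R y 0) \<le> cmod (y 0)"
    using mult_right_mono[of "\<bar>C 0\<bar>" 1 "cmod (y 0)"] by (simp add: C_def)
  have 2: "cmod (S 0 *\<^sub>R y1 0) \<le> cmod (y1 0) / c\<^sup>2"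
    using mult_right_mono[OF Sb[of 0], of "cmod (y1 0)"] by simp
  have 3: "cmod (integral {0..t} (\<lambda>s. S s *\<^sub>R (y2 s + of_real (\<omega>\<^sup>2) * y s)))
      \<le> integral {0..t} (\<lambda>s. cmod (y2 s + of_real (\<omega>\<^sup>2) * y s) / c\<^sup>2)"
  proof (rule integral_norm_bound_integral)
    show "(\<lambda>s. S s *\<^sub>R (y2 s + of_real (\<omega>\<^sup>2) * y s)) integrable_on {0..t}"
      by (intro integrable_continuous_interval continuous_on_scaleR continuous_on_add continuous_on_mult continuous_on_const cS cont)
    show "(\<lambda>s. cmod (y2 s + of_real (\<omega>\<^sup>2) * y s) / c\<^sup>2) integrable_on {0..t}"
      using c by (intro integrable_continuous_interval continuous_on_divide continuous_on_norm continuous_on_add continuous_on_mult continuous_on_const cont) auto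
    show "cmod (S s *\<^sub>R (y2 s + of_real (\<omega>\<^sup>2) * y s)) \<le> cmod (y2 s + of_real (\<omega>\<^sup>2) * y s) / c\<^sup>2" for s
      using mult_right_mono[OF Sb[of s], of "cmod (y2 s + of_real (\<omega>\<^sup>2) * y s)"] by simp
  qed
  have "cmod (y t) \<le> (cmod (y 0) + cmod (y1 0) / c\<^sup>2) + integral {0..t} (\<lambda>s. cmod (y2 s + of_real (\<omega>\<^sup>2) * y s) / c\<^sup>2)"
    unfolding eq by (intro order.trans[OF norm_triangle_ineq] add_mono 1 2 3)
  then show ?thesis by (simp only: \<omega>_def)
qed

text \<open>Derivatives and residual appear mode by mode under finite sums, because a classical
  solution is not known to be differentiable, or even continuous, in the norm of the algebra. In
  \<open>2 + T\<close> the initial value, the initial velocity and the integrated residual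
  contribute 1, 1 and \<open>T\<close>. With \<open>\<epsilon>\<close> equal to 0 this is
  uniqueness.\<close>

lemma kg_stability:
  fixes y z :: "real \<Rightarrow> wiener"
  assumes c: "0 < c" and L: "0 \<le> L" and \<epsilon>: "0 \<le> \<epsilon>"
    and d1: "\<And>t a. t \<in> {0..T} \<Longrightarrow> ((\<lambda>t. coef (y t - z t) a) has_vector_derivative D1 a t) (at t within {0..T})"
    and d2: "\<And>t a. t \<in> {0..T} \<Longrightarrow> (D1 a has_vector_derivative D2 a t) (at t within {0..T})"
    and c2: "\<And>a. continuous_on {0..T} (D2 a)"
    and init0: "norm (y 0 - z 0) \<le> \<epsilon>" and init1: "\<And>F. finite F \<Longrightarrow> (\<Sum>a\<in>F. cmod (D1 a 0)) \<le> c\<^sup>2 * \<epsilon>"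
    and force: "\<And>t F. t \<in> {0..T} \<Longrightarrow> finite F \<Longrightarrow>
      (\<Sum>a\<in>F. cmod (D2 a t + of_real ((kg_freq c a)\<^sup>2) * coef (y t - z t) a)) \<le> c\<^sup>2 * (L * norm (y t - z t) + \<epsilon>)"
    and bound: "\<And>t. t \<in> {0..T} \<Longrightarrow> norm (y t - z t) \<le> M" and t: "t \<in> {0..T}"
  shows "norm (y t - z t) \<le> ((2 + T) * \<epsilon>) * exp (L * t)"
proof (rule gronwall_majorant[OF L bound _ t])
  fix \<psi> t assume \<psi>: "continuous_on {0..T} \<psi>" and le: "\<And>t. t \<in> {0..T} \<Longrightarrow> norm (y t - z t) \<le> \<psi> t" and t: "t \<in> {0..T}"
  have sub: "{0..t} \<subseteq> {0..T}" using t by auto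
  have c0: "0 < c\<^sup>2" using c by simp
  show "norm (y t - z t) \<le> (2 + T) * \<epsilon> + L * integral {0..t} \<psi>"
  proof (rule norm_wiener_leI)
    fix F :: "int set" assume F: "finite F"
    let ?g = "\<lambda>a s. cmod (D2 a s + of_real ((kg_freq c a)\<^sup>2) * coef (y s - z s) a) / c\<^sup>2"
    have g: "?g a integrable_on {0..t}" for a
      using c by (intro integrable_continuous_interval continuous_on_divide continuous_on_norm continuous_on_add continuous_on_mult
          continuous_on_const continuous_on_subset[OF c2 sub] continuous_on_subset[OF continuous_on_vector_derivative[OF d1] sub]) auto
    have "(\<Sum>a\<in>F. cmod (coef (y t - z t) a)) \<le> (\<Sum>a\<in>F. cmod (coef (y 0 - z 0) a) + cmod (D1 a 0) / c\<^sup>2 + integral {0..t} (?g a))"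
      by (intro sum_mono kg_duhamel_bound[OF c t d1 d2 c2])
    also have "\<dots> = (\<Sum>a\<in>F. cmod (coef (y 0 - z 0) a)) + (\<Sum>a\<in>F. cmod (D1 a 0)) / c\<^sup>2 + integral {0..t} (\<lambda>s. \<Sum>a\<in>F. ?g a s)"
      by (simp only: sum.distrib sum_divide_distrib integral_sum[OF F g])
    also have "\<dots> \<le> \<epsilon> + \<epsilon> + (L * integral {0..t} \<psi> + \<epsilon> * t)"
    proof (intro add_mono)
      show "(\<Sum>a\<in>F. cmod (coef (y 0 - z 0) a)) \<le> \<epsilon>" using sum_coef_le_norm[OF F, of "y 0 - z 0"] init0 by linarith
      show "(\<Sum>a\<in>F. cmod (D1 a 0)) / c\<^sup>2 \<le> \<epsilon>" using init1[OF F] c0 by (simp add: field_simps)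
      have I: "((\<lambda>s. L * \<psi> s + \<epsilon>) has_integral (L * integral {0..t} \<psi> + \<epsilon> * t)) {0..t}"
      proof (intro has_integral_add has_integral_mult_right integrable_integral integrable_continuous_interval continuous_on_subset[OF \<psi> sub])
        show "((\<lambda>_. \<epsilon>) has_integral \<epsilon> * t) {0..t}" using has_integral_const_real[of \<epsilon> 0 t] t by (simp add: mult.commute)
      qed
      have "integral {0..t} (\<lambda>s. \<Sum>a\<in>F. ?g a s) \<le> integral {0..t} (\<lambda>s. L * \<psi> s + \<epsilon>)"
      proof (rule integral_le)
        show "(\<lambda>s. \<Sum>a\<in>F. ?g a s) integrable_on {0..t}" by (rule integrable_sum[OF F g])
        show "(\<lambda>s. L * \<psi> s + \<epsilon>) integrable_on {0..t}" using I by blast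
        fix s assume "s \<in> {0..t}"
        then have s: "s \<in> {0..T}" using sub by blast
        have "(\<Sum>a\<in>F. ?g a s) \<le> L * norm (y s - z s) + \<epsilon>"
          using force[OF s F] c0 unfolding sum_divide_distrib[symmetric] by (simp add: pos_divide_le_eq mult.commute)
        also have "\<dots> \<le> L * \<psi> s + \<epsilon>" using le[OF s] L by (simp add: mult_left_mono)
        finally show "(\<Sum>a\<in>F. ?g a s) \<le> L * \<psi> s + \<epsilon>" .
      qed
      then show "integral {0..t} (\<lambda>s. \<Sum>a\<in>F. ?g a s) \<le> L * integral {0..t} \<psi> + \<epsilon> * t"
        using integral_unique[OF I] by simp
    qed
    also have "\<dots> \<le> (2 + T) * \<epsilon> + L * integral {0..t} \<psi>"
      using mult_left_mono[of t T \<epsilon>] t \<epsilon> by (simp add: algebra_simps)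
    finally show "(\<Sum>a\<in>F. cmod (coef (y t - z t) a)) \<le> (2 + T) * \<epsilon> + L * integral {0..t} \<psi>" .
  qed
qed

text \<open>Any classical solution enters the algebra: continuity of the second space derivative on
  the compact cylinder gives quadratic decay, uniformly in time, and time derivatives pass to the
  coefficients under the integral sign. The bound \<open>M\<close> may depend on \<open>c\<close>
  and on the solution.\<close>

lemma kg_classical_modes:
  assumes sol: "klein_gordon_solution lam c \<phi> \<gamma> T z" and T: "0 < T" and c: "0 < c"
    and f: "ev f = \<phi>" and g: "ev g = \<gamma>"
  obtains Z D1 D2 M where "\<And>t. t \<in> {0..T} \<Longrightarrow> ev (Z t) = z t" "\<And>t. t \<in> {0..T} \<Longrightarrow> norm (Z t) \<le> M"
    "\<And>t a. t \<in> {0..T} \<Longrightarrow> ((\<lambda>t. coef (Z t) a) has_vector_derivative D1 a t) (at t within {0..T})"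
    "\<And>t a. t \<in> {0..T} \<Longrightarrow> (D1 a has_vector_derivative D2 a t) (at t within {0..T})"
    "\<And>a. continuous_on {0..T} (D2 a)"
    "\<And>t a. t \<in> {0..T} \<Longrightarrow> D2 a t = - of_real ((kg_freq c a)\<^sup>2) * coef (Z t) a + of_real (c\<^sup>2 * lam) * coef (cubic (Z t)) a"
    "Z 0 = f" "\<And>a. D1 a 0 = of_real (c\<^sup>2) * coef g a"
proof -
  have per: "torus_periodic (z t)" if "t \<in> {0..T}" for t
    using sol[unfolded klein_gordon_solution_def, THEN conjunct1, rule_format, OF that] .
  obtain zt ztt zx zxx where all: "(\<forall>w\<in>{z, zt, ztt, zx, zxx}. continuous_on ({0..T} \<times> UNIV) (\<lambda>(t, x). w t x)) \<and>
        (\<forall>t\<in>{0..T}. \<forall>x.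
           ((\<lambda>r. z r x) has_vector_derivative zt t x) (at t within {0..T}) \<and>
           ((\<lambda>r. zt r x) has_vector_derivative ztt t x) (at t within {0..T}) \<and>
           (z t has_vector_derivative zx t x) (at x) \<and>
           (zx t has_vector_derivative zxx t x) (at x) \<and>
           of_real (1 / c\<^sup>2) * ztt t x - zxx t x + of_real (c\<^sup>2) * z t x
             = of_real (lam * (cmod (z t x))\<^sup>2) * z t x) \<and>
        (\<forall>x. z 0 x = \<phi> x \<and> zt 0 x = of_real (c\<^sup>2) * \<gamma> x)"
    using sol[unfolded klein_gordon_solution_def, THEN conjunct2] by (elim exE) (erule that)
  have cont: "continuous_on ({0..T} \<times> UNIV) (\<lambda>(t, x). w t x)" if "w \<in> {z, zt, ztt, zx, zxx}" for w
    by (rule all[THEN conjunct1, rule_format, OF that])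
  note eqs = all[THEN conjunct2, THEN conjunct1, rule_format]
  note dt = eqs[THEN conjunct1] eqs[THEN conjunct2, THEN conjunct1]
  note dx = eqs[THEN conjunct2, THEN conjunct2, THEN conjunct1] eqs[THEN conjunct2, THEN conjunct2, THEN conjunct2, THEN conjunct1]
  note pde = eqs[THEN conjunct2, THEN conjunct2, THEN conjunct2, THEN conjunct2]
  have init: "z 0 x = \<phi> x" "zt 0 x = of_real (c\<^sup>2) * \<gamma> x" for x
    using all[THEN conjunct2, THEN conjunct2] by simp_all
  have cx: "continuous_on S (w t)" if "w \<in> {z, zt, ztt, zx, zxx}" "t \<in> {0..T}" for w t S
  proof -
    have "continuous_on UNIV (\<lambda>x. (\<lambda>(t, x). w t x) (t, x))"
      by (rule continuous_on_compose2[OF cont[OF that(1)]]) (use that(2) in \<open>auto intro!: continuous_intros\<close>)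
    then show ?thesis using continuous_on_subset by auto
  qed
  have bnd: "\<exists>M. \<forall>t\<in>{0..T}. \<forall>x\<in>{-pi..pi}. cmod (w t x) \<le> M" if "w \<in> {z, zt, ztt, zx, zxx}" for w
  proof -
    have "compact ((\<lambda>(t, x). w t x) ` ({0..T} \<times> {-pi..pi}))"
      by (intro compact_continuous_image continuous_on_subset[OF cont[OF that]] compact_Times compact_Icc) auto
    then have "bounded ((\<lambda>(t, x). w t x) ` ({0..T} \<times> {-pi..pi}))" by (rule compact_imp_bounded)
    then obtain M where M: "\<And>v. v \<in> (\<lambda>(t, x). w t x) ` ({0..T} \<times> {-pi..pi}) \<Longrightarrow> cmod v \<le> M"
      unfolding bounded_iff by blast
    have "cmod (w t x) \<le> M" if "t \<in> {0..T}" "x \<in> {-pi..pi}" for t x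
      by (rule M, rule image_eqI[of _ _ "(t, x)"]) (use that in auto)
    then show ?thesis by blast
  qed
  obtain M0 where M0: "\<And>t x. t \<in> {0..T} \<Longrightarrow> x \<in> {-pi..pi} \<Longrightarrow> cmod (z t x) \<le> M0" using bnd[of z] by blast
  obtain M2 where M2: "\<And>t x. t \<in> {0..T} \<Longrightarrow> x \<in> {-pi..pi} \<Longrightarrow> cmod (zxx t x) \<le> M2" using bnd[of zxx] by blast
  have perx: "torus_periodic (zx t)" if t: "t \<in> {0..T}" for t
    unfolding torus_periodic_def
  proof
    fix x
    show "zx t (x + 2 * pi) = zx t x"
    proof (rule vector_derivative_unique_at)
      show "(z t has_vector_derivative zx t x) (at x)" by (rule dx(1)[OF t])
      have "((\<lambda>y. z t (y + 2 * pi)) has_vector_derivative zx t (x + 2 * pi)) (at x)"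
        by (rule has_vector_derivative_shift[OF dx(1)[OF t]])
      moreover have "(\<lambda>y. z t (y + 2 * pi)) = z t" using per[OF t] by (auto simp: torus_periodic_def)
      ultimately show "(z t has_vector_derivative zx t (x + 2 * pi)) (at x)" by simp
    qed
  qed
  have fcxx: "fourier_coeff (zxx t) a = - of_real ((of_int a)\<^sup>2) * fourier_coeff (z t) a" if t: "t \<in> {0..T}" for t a
  proof -
    have "fourier_coeff (zxx t) a = \<i> * of_int a * (\<i> * of_int a * fourier_coeff (z t) a)"
      using fourier_coeff_derivative[OF perx[OF t] dx(2)[OF t] cx[where w = zxx, OF _ t], of a]
        fourier_coeff_derivative[OF per[OF t] dx(1)[OF t] cx[where w = zx, OF _ t], of a] by simp
    then show ?thesis by (simp add: power2_eq_square) (simp add: mult_ac)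
  qed
  \<comment> \<open>Two orders of decay are all that is available, so only weight 0 is
    obtained.\<close>
  have decay: "weight a ^ (0 + 2) * cmod (fourier_coeff (z t) a) \<le> 2 ^ 2 * M2 + M0" if t: "t \<in> {0..T}" for t a
  proof -
    have "cmod (fourier_coeff (zxx t) a) \<le> M2" by (rule fourier_coeff_bound[OF cx[where w = zxx, OF _ t] M2[OF t]]) auto
    moreover have "cmod (fourier_coeff (z t) a) \<le> M0" by (rule fourier_coeff_bound[OF cx[where w = z, OF _ t] M0[OF t]]) auto
    ultimately show ?thesis
      unfolding add_0 using weight_power_le[of "cmod (fourier_coeff (z t) a)" a 2 M2 M0]
      by (simp add: fcxx[OF t] norm_mult norm_power)
  qed
  obtain W where W: "\<And>k C f. (\<And>a. weight a ^ (k + 2) * cmod (f a) \<le> C) \<Longrightarrow>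
    (\<forall>a. coef (Abs_wiener f) a = f a) \<and> wbound k (C * W) (Abs_wiener f)"
    using wbound_of_decay by metis
  define Z where "Z = (\<lambda>t. Abs_wiener (fourier_coeff (z t)))"
  have coefZ: "coef (Z t) a = fourier_coeff (z t) a" and wZ: "wbound 0 ((2 ^ 2 * M2 + M0) * W) (Z t)" if "t \<in> {0..T}" for t a
    using W[OF decay[OF that]] unfolding Z_def by blast+
  have evZ: "ev (Z t) = z t" if t: "t \<in> {0..T}" for t
    by (rule ext, rule fourier_inversion[OF per[OF t] dx(1)[OF t] coefZ[OF t]])
  have leib: "((\<lambda>t. fourier_coeff (w t) a) has_vector_derivative fourier_coeff (w' t) a) (at t within {0..T})"
    if w: "w \<in> {z, zt, ztt, zx, zxx}" and w': "w' \<in> {z, zt, ztt, zx, zxx}" and t: "t \<in> {0..T}"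
      and d: "\<And>t x. t \<in> {0..T} \<Longrightarrow> ((\<lambda>r. w r x) has_vector_derivative w' t x) (at t within {0..T})" for w w' t a
  proof -
    let ?k = "\<lambda>x::real. exp (- \<i> * of_int a * of_real x)"
    have "((\<lambda>t. integral (cbox (-pi) pi) (\<lambda>x. w t x * ?k x)) has_vector_derivative integral (cbox (-pi) pi) (\<lambda>x. w' t x * ?k x)) (at t within {0..T})"
    proof (rule leibniz_rule_vector_derivative[OF _ _ _ t])
      show "((\<lambda>r. w r x * ?k x) has_vector_derivative w' t x * ?k x) (at t within {0..T})" if "t \<in> {0..T}" for t x
        by (intro bounded_linear.has_vector_derivative[OF bounded_linear_mult_left] d that)
      show "(\<lambda>x. w t x * ?k x) integrable_on cbox (-pi) pi" if "t \<in> {0..T}" for t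
        unfolding cbox_interval
        by (intro integrable_continuous_interval continuous_on_mult continuous_on_fourier_kernel cx[OF w that])
      have "continuous_on ({0..T} \<times> cbox (- pi) pi) (\<lambda>p. (\<lambda>(t, x). w' t x) p * ?k (snd p))"
        by (intro continuous_on_mult continuous_on_subset[OF cont[OF w']] continuous_intros) auto
      then show "continuous_on ({0..T} \<times> cbox (- pi) pi) (\<lambda>(t, x). w' t x * ?k x)"
        by (simp add: case_prod_unfold)
    qed auto
    then have "((\<lambda>t. integral {-pi..pi} (\<lambda>x. w t x * ?k x) / of_real (2 * pi)) has_vector_derivative integral {-pi..pi} (\<lambda>x. w' t x * ?k x) / of_real (2 * pi)) (at t within {0..T})"
      unfolding cbox_interval by (rule bounded_linear.has_vector_derivative[OF bounded_linear_divide])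
    then show ?thesis by (simp only: fourier_coeff_def)
  qed
  define D1 where "D1 = (\<lambda>a t. fourier_coeff (zt t) a)"
  define D2 where "D2 = (\<lambda>a t. fourier_coeff (ztt t) a)"
  have dZ: "((\<lambda>t. coef (Z t) a) has_vector_derivative D1 a t) (at t within {0..T})" if t: "t \<in> {0..T}" for t a
  proof -
    have l: "((\<lambda>t. fourier_coeff (z t) a) has_vector_derivative fourier_coeff (zt t) a) (at t within {0..T})"
      by (rule leib[OF _ _ t dt(1)]) auto
    show ?thesis unfolding D1_def
      by (rule has_vector_derivative_transform[OF t _ l]) (rule coefZ)
  qed
  have dD1: "(D1 a has_vector_derivative D2 a t) (at t within {0..T})" if t: "t \<in> {0..T}" for t a
    unfolding D1_def D2_def by (rule leib[OF _ _ t dt(2)]) auto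
  have cD2: "continuous_on {0..T} (D2 a)" for a
  proof -
    let ?k = "\<lambda>x::real. exp (- \<i> * of_int a * of_real x)"
    have "continuous_on ({0..T} \<times> cbox (- pi) pi) (\<lambda>p. (\<lambda>(t, x). ztt t x) p * ?k (snd p))"
      by (intro continuous_on_mult continuous_on_subset[OF cont[of ztt]] continuous_intros) auto
    then have "continuous_on {0..T} (\<lambda>t. integral (cbox (-pi) pi) (\<lambda>x. ztt t x * ?k x))"
      by (intro integral_continuous_on_param) (simp add: case_prod_unfold)
    then have "continuous_on {0..T} (\<lambda>t. integral {-pi..pi} (\<lambda>x. ztt t x * ?k x) / of_real (2 * pi))"
      unfolding cbox_interval by (rule bounded_linear.continuous_on[OF bounded_linear_divide])
    then show ?thesis by (simp only: D2_def fourier_coeff_def)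
  qed
  have modal: "D2 a t = - of_real ((kg_freq c a)\<^sup>2) * coef (Z t) a + of_real (c\<^sup>2 * lam) * coef (cubic (Z t)) a" if t: "t \<in> {0..T}" for t a
  proof -
    have c2: "of_real (c\<^sup>2) \<noteq> (0 :: complex)" using c by simp
    have "ztt t = (\<lambda>x. of_real (c\<^sup>2) * (zxx t x - (of_real (c\<^sup>2) * z t x - of_real lam * ev (cubic (Z t)) x)))"
    proof
      fix x
      have "of_real (1 / c\<^sup>2) * ztt t x = zxx t x - (of_real (c\<^sup>2) * z t x - of_real lam * ev (cubic (Z t)) x)"
        using pde[OF t, of x] by (simp add: ev_cubic evZ[OF t] algebra_simps)
      then have "of_real (c\<^sup>2) * (of_real (1 / c\<^sup>2) * ztt t x) = of_real (c\<^sup>2) * (zxx t x - (of_real (c\<^sup>2) * z t x - of_real lam * ev (cubic (Z t)) x))"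
        by (rule arg_cong)
      moreover have "of_real (c\<^sup>2) * (of_real (1 / c\<^sup>2) * ztt t x) = ztt t x" using c by simp
      ultimately show "ztt t x = of_real (c\<^sup>2) * (zxx t x - (of_real (c\<^sup>2) * z t x - of_real lam * ev (cubic (Z t)) x))" by simp
    qed
    moreover have cz: "continuous_on {-pi..pi} (\<lambda>x. of_real (c\<^sup>2) * z t x)"
      by (intro continuous_on_mult continuous_on_const cx[where w = z, OF _ t]) simp
    moreover have cc: "continuous_on {-pi..pi} (\<lambda>x. of_real lam * ev (cubic (Z t)) x)"
      by (intro continuous_on_mult continuous_on_const continuous_ev)
    moreover have czxx: "continuous_on {-pi..pi} (zxx t)" by (rule cx[where w = zxx, OF _ t]) simp
    ultimately have "D2 a t = of_real (c\<^sup>2) * (fourier_coeff (zxx t) a - (of_real (c\<^sup>2) * fourier_coeff (z t) a - of_real lam * coef (cubic (Z t)) a))"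
      unfolding D2_def
      by (simp only: fourier_coeff_cmult fourier_coeff_ev fourier_coeff_diff[OF czxx continuous_on_diff[OF cz cc]]
          fourier_coeff_diff[OF cz cc])
    then show ?thesis
      by (simp add: fcxx[OF t] coefZ[OF t] kg_freq_square) (simp add: algebra_simps)
  qed
  have t0: "0 \<in> {0..T}" using T by simp
  have "Z 0 = f" using evZ[OF t0] f init(1) by (intro ev_inject) simp
  moreover have "D1 a 0 = of_real (c\<^sup>2) * coef g a" for a
  proof -
    have "zt 0 = ev (const (of_real (c\<^sup>2)) * g)" using init(2) g by auto
    then show ?thesis unfolding D1_def by (simp add: fourier_coeff_ev)
  qed
  ultimately show ?thesis
    using that[OF evZ wbound_norm[OF wZ] dZ dD1 cD2 modal] by blast
qed

subsection \<open>The nonrelativistic limit\<close>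

definition osc :: "real \<Rightarrow> real \<Rightarrow> complex" where
  "osc r t = exp (\<i> * of_real (r * t))"

lemma norm_osc [simp]: "cmod (osc r t) = 1"
  unfolding osc_def by (rule norm_exp_i_times)

lemma osc_zero [simp]: "osc r 0 = 1"
  by (simp add: osc_def)

lemma osc_cnj: "cnj (osc r t) = osc (- r) t"
  by (simp add: osc_def exp_cnj)

lemma osc_cancel: "osc r t * osc (- r) t = 1"
  by (simp add: osc_def flip: exp_add)

lemma osc_cube: "osc (3 * r) t = osc r t ^ 3"
proof -
  have "of_nat 3 * (\<i> * complex_of_real (r * t)) = \<i> * complex_of_real (3 * r * t)" by simp
  then show ?thesis unfolding osc_def by (metis exp_of_nat_mult)
qed

lemma osc_has_vector_derivative:
  assumes "(U has_vector_derivative U1) (at t within S)"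
  shows "((\<lambda>t. osc r t * U t) has_vector_derivative osc r t * (\<i> * of_real r * U t + U1)) (at t within S)"
proof -
  have "((\<lambda>t. osc r t) has_vector_derivative \<i> * of_real r * osc r t) (at t within S)"
    unfolding osc_def by (rule has_vector_derivative_exp_i)
  from has_vector_derivative_mult[OF this assms] show ?thesis by (simp add: algebra_simps)
qed

definition limit_profile :: "real \<Rightarrow> (real \<Rightarrow> wiener) \<Rightarrow> (real \<Rightarrow> wiener) \<Rightarrow> real \<Rightarrow> wiener" where
  "limit_profile c u v t = const (osc (c\<^sup>2) t / 2) * u t + const (osc (- c\<^sup>2) t / 2) * wcnj (v t)"

text \<open>The resonant terms are those of the limit system; the third harmonics are left over.\<close>

lemma cubic_limit_profile:
  "cubic (limit_profile c u v t) =
    const (osc (c\<^sup>2) t / 8) * (potential (u t) (v t) * u t) + const (osc (- c\<^sup>2) t / 8) * (potential (v t) (u t) * wcnj (v t))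
    + (const (osc (3 * c\<^sup>2) t / 8) * (u t * u t * v t) + const (osc (- (3 * c\<^sup>2)) t / 8) * (wcnj (v t) * wcnj (v t) * wcnj (u t)))"
proof (rule ev_inject)
  fix x
  define e where "e = osc (c\<^sup>2) t"
  define d where "d = osc (- c\<^sup>2) t"
  have ed: "e * d = 1" unfolding e_def d_def by (rule osc_cancel)
  have cj: "cnj e = d" "cnj d = e" by (simp_all add: e_def d_def osc_cnj)
  have cubes: "osc (3 * c\<^sup>2) t = e ^ 3" "osc (- (3 * c\<^sup>2)) t = d ^ 3"
    using osc_cube[of "c\<^sup>2" t] osc_cube[of "- c\<^sup>2" t] by (simp_all add: e_def d_def)
  define U where "U = ev (u t) x"
  define U' where "U' = cnj U"
  define V where "V = ev (v t) x"
  define V' where "V' = cnj V"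
  have key: "(e * U + d * V') * (d * U' + e * V) * (e * U + d * V')
      = e * ((U * U' + 2 * (V * V')) * U) + d * ((V * V' + 2 * (U * U')) * V')
        + (e ^ 3 * (U * U * V) + d ^ 3 * (V' * V' * U'))"
    using ed by algebra
  have two: "ev 2 x = 2" 
  proof -
    have "(2::wiener) = 1 + 1" by simp
    then show ?thesis by (simp only: ev_add ev_1) simp
  qed
  show "ev (cubic (limit_profile c u v t)) x = ev (const (osc (c\<^sup>2) t / 8) * (potential (u t) (v t) * u t) + const (osc (- c\<^sup>2) t / 8) * (potential (v t) (u t) * wcnj (v t))
    + (const (osc (3 * c\<^sup>2) t / 8) * (u t * u t * v t) + const (osc (- (3 * c\<^sup>2)) t / 8) * (wcnj (v t) * wcnj (v t) * wcnj (u t)))) x"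
  proof -
    have "ev (cubic (limit_profile c u v t)) x = (e * U + d * V') * (d * U' + e * V) * (e * U + d * V') / 8"
      by (simp add: cubic_def limit_profile_def e_def[symmetric] d_def[symmetric] U_def[symmetric] V_def[symmetric]
          V'_def[symmetric] U'_def[symmetric] cj) (simp add: V'_def field_simps)
    also have "\<dots> = (e * ((U * U' + 2 * (V * V')) * U) + d * ((V * V' + 2 * (U * U')) * V')
        + (e ^ 3 * (U * U * V) + d ^ 3 * (V' * V' * U'))) / 8"
      by (simp only: key)
    finally show ?thesis
      by (simp add: potential_def two cubes e_def[symmetric] d_def[symmetric] U_def[symmetric] V_def[symmetric]
          V'_def[symmetric] U'_def[symmetric] add_divide_distrib)
  qed
qed

text \<open>Weight 2 is kept for the curve itself, since the residual of the ansatz contains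
  \<open>half_square\<close> times the curve but its derivatives without a symbol.\<close>

lemma curve_two_derivatives:
  assumes "curve 3 T 10 x"
  obtains x1 x2 B where "0 \<le> B"
    "\<And>t. t \<in> {0..T} \<Longrightarrow> (x has_vector_derivative x1 t) (at t within {0..T})"
    "\<And>t. t \<in> {0..T} \<Longrightarrow> (x1 has_vector_derivative x2 t) (at t within {0..T})" "continuous_on {0..T} x2"
    "\<And>t. t \<in> {0..T} \<Longrightarrow> wbound 2 B (x t) \<and> norm (x1 t) \<le> B \<and> norm (x2 t) \<le> B"
proof -
  have "curve (Suc 2) T 10 x" using assms by (simp add: numeral_eq_Suc)
  then obtain x1 where x1: "\<And>t. t \<in> {0..T} \<Longrightarrow> (x has_vector_derivative x1 t) (at t within {0..T})" "curve 2 T 10 x1"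
    using curve_deriv by metis
  then have "curve (Suc 1) T 10 x1" by (simp add: numeral_eq_Suc)
  then obtain x2 where x2: "\<And>t. t \<in> {0..T} \<Longrightarrow> (x1 has_vector_derivative x2 t) (at t within {0..T})" "curve 1 T 10 x2"
    using curve_deriv by metis
  obtain A0 where A0: "0 \<le> A0" "\<And>t. t \<in> {0..T} \<Longrightarrow> wbound 10 A0 (x t)" using curve_bound[OF assms] by metis
  obtain A1 where A1: "0 \<le> A1" "\<And>t. t \<in> {0..T} \<Longrightarrow> wbound 10 A1 (x1 t)" using curve_bound[OF x1(2)] by metis
  obtain A2 where A2: "0 \<le> A2" "\<And>t. t \<in> {0..T} \<Longrightarrow> wbound 10 A2 (x2 t)" using curve_bound[OF x2(2)] by metis
  show ?thesis
  proof (rule that[of "A0 + A1 + A2", OF _ x1(1) x2(1) curve_continuous[OF x2(2)]])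
    show "0 \<le> A0 + A1 + A2" using A0(1) A1(1) A2(1) by simp
    fix t assume t: "t \<in> {0..T}"
    show "wbound 2 (A0 + A1 + A2) (x t) \<and> norm (x1 t) \<le> A0 + A1 + A2 \<and> norm (x2 t) \<le> A0 + A1 + A2"
      using wbound_mono[OF A0(2)[OF t], of 2 "A0 + A1 + A2"] wbound_norm[OF A1(2)[OF t]] wbound_norm[OF A2(2)[OF t]]
        A0(1) A1(1) A2(1) by auto
  qed
qed

lemma wcnj_potential: "wcnj (potential u v) = potential u v"
  by (rule ev_inject) (simp only: ev_wcnj ev_potential complex_cnj_complex_of_real)

text \<open>With \<open>C = c^2\<close> and \<open>\<Theta> = a^2 / 2\<close> the squared frequency
  is \<open>C * C + 2 * C * \<Theta>\<close>. The left side is the oscillator operator applied to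
  \<open>e^{j C t} U\<close>, without the exponential: the \<open>C * C\<close> terms cancel by
  \<open>j * j = - 1\<close>, and the \<open>\<Theta>\<close> terms by the Schroedinger equation.
  \<open>j\<close> is \<open>\<i>\<close> for \<open>u\<close> and \<open>- \<i>\<close> for the
  conjugate of \<open>v\<close>.\<close>

lemma mode_identity:
  fixes C \<Theta> \<mu> U U1 U2 X j :: complex
  assumes "j * j = - 1" "U1 = j * \<Theta> * U - j * \<mu> * X"
  shows "(j * C * (j * C * U + U1) + (j * C * U1 + U2)) + (C * C + 2 * C * \<Theta>) * U = 2 * C * \<mu> * X + U2"
  using assms by algebra

text \<open>The same operator on the third harmonic: the leading terms \<open>- 9 + 1\<close> leave
  \<open>- 8\<close>, so that a corrector divided by \<open>C\<close> produces a term of the order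
  of the force.\<close>

lemma harmonic_identity:
  fixes C \<Theta> Q Q1 Q2 j :: complex
  assumes "j * j = - 1"
  shows "(j * (3 * C) * (j * (3 * C) * Q + Q1) + (j * (3 * C) * Q1 + Q2)) + (C * C + 2 * C * \<Theta>) * Q
    = C * (- 8 * C * Q + (6 * j * Q1 + 2 * \<Theta> * Q)) + Q2"
  using assms by algebra

lemma sum_cmod_le3:
  fixes h :: "'a \<Rightarrow> complex"
  assumes "\<And>a. a \<in> F \<Longrightarrow> cmod (h a) \<le> p a + q a" "sum p F \<le> P" "sum q F \<le> Q"
  shows "(\<Sum>a\<in>F. cmod (h a)) \<le> P + Q"
  using sum_mono[of F "\<lambda>a. cmod (h a)" "\<lambda>a. p a + q a"] assms by (simp add: sum.distrib)

text \<open>The equation is recorded mode by mode, because this is the only sense in which a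
  classical solution is known to be differentiable in time within the algebra.\<close>

definition kg_modes :: "real \<Rightarrow> real \<Rightarrow> real \<Rightarrow> wiener \<Rightarrow> wiener \<Rightarrow> (real \<Rightarrow> wiener) \<Rightarrow>
    (int \<Rightarrow> real \<Rightarrow> complex) \<Rightarrow> (int \<Rightarrow> real \<Rightarrow> complex) \<Rightarrow> bool" where
  "kg_modes lam c T f g Z D1 D2 \<longleftrightarrow>
     (\<forall>t\<in>{0..T}. \<forall>a. ((\<lambda>t. coef (Z t) a) has_vector_derivative D1 a t) (at t within {0..T})) \<and>
     (\<forall>t\<in>{0..T}. \<forall>a. (D1 a has_vector_derivative D2 a t) (at t within {0..T})) \<and>
     (\<forall>a. continuous_on {0..T} (D2 a)) \<and>
     (\<forall>t\<in>{0..T}. \<forall>a. D2 a t = - of_real ((kg_freq c a)\<^sup>2) * coef (Z t) a + of_real (c\<^sup>2 * lam) * coef (cubic (Z t)) a) \<and>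
     Z 0 = f \<and> (\<forall>a. D1 a 0 = of_real (c\<^sup>2) * coef g a)"

text \<open>
  The corrector \<open>\<kappa>/c\<^sup>2 (e\<^sup>3\<^sup>i\<^sup>c\<^sup>2\<^sup>t u\<^sup>2v + \<dots>)\<close> removes the third harmonics: on them
  \<open>c\<^sup>-\<^sup>2 \<partial>\<^sub>t\<^sub>t + c\<^sup>2\<close> acts as \<open>-8 c\<^sup>2\<close>, whence \<open>\<kappa> = -\<lambda>/64\<close>.
\<close>

lemma kg_approximation:
  assumes sol: "nls_solution (lam / 8) T 10 u v" and T: "0 < T"
    and u0: "u 0 = f - const \<i> * g" and v0: "v 0 = wcnj (f + const \<i> * g)" and RZ: "0 \<le> RZ"
  shows "\<exists>A\<ge>0. \<forall>c Z D1 D2. 1 \<le> c \<and> (\<forall>t\<in>{0..T}. norm (Z t) \<le> RZ) \<and> kg_modes lam c T f g Z D1 D2 \<longrightarrow>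
     (\<forall>t\<in>{0..T}. norm (Z t - limit_profile c u v t) \<le> A / c\<^sup>2)"
proof -
  define \<mu> where "\<mu> = lam / 8"
  define w where "w = (\<lambda>t. wcnj (v t))"
  define q where "q = (\<lambda>t. u t * u t * v t)"
  define p where "p = (\<lambda>t. w t * w t * wcnj (u t))"
  have cu: "curve 3 T 10 u" and cv: "curve 3 T 10 v" using sol by (auto simp: nls_solution_def)
  have cw: "curve 3 T 10 w" unfolding w_def by (rule curve_wcnj[OF cv])
  have cq: "curve 3 T 10 q" and cp: "curve 3 T 10 p"
    unfolding q_def p_def by (intro curve_mult curve_wcnj cu cv cw)+
  obtain u1 u2 Bu where du: "0 \<le> Bu" "\<And>t. t \<in> {0..T} \<Longrightarrow> (u has_vector_derivative u1 t) (at t within {0..T})"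
    "\<And>t. t \<in> {0..T} \<Longrightarrow> (u1 has_vector_derivative u2 t) (at t within {0..T})" "continuous_on {0..T} u2"
    "\<And>t. t \<in> {0..T} \<Longrightarrow> wbound 2 Bu (u t) \<and> norm (u1 t) \<le> Bu \<and> norm (u2 t) \<le> Bu"
    by (rule curve_two_derivatives[OF cu]) (rule that)
  obtain w1 w2 Bw where dw: "0 \<le> Bw" "\<And>t. t \<in> {0..T} \<Longrightarrow> (w has_vector_derivative w1 t) (at t within {0..T})"
    "\<And>t. t \<in> {0..T} \<Longrightarrow> (w1 has_vector_derivative w2 t) (at t within {0..T})" "continuous_on {0..T} w2"
    "\<And>t. t \<in> {0..T} \<Longrightarrow> wbound 2 Bw (w t) \<and> norm (w1 t) \<le> Bw \<and> norm (w2 t) \<le> Bw"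
    by (rule curve_two_derivatives[OF cw]) (rule that)
  obtain q1 q2 Bq where dq: "0 \<le> Bq" "\<And>t. t \<in> {0..T} \<Longrightarrow> (q has_vector_derivative q1 t) (at t within {0..T})"
    "\<And>t. t \<in> {0..T} \<Longrightarrow> (q1 has_vector_derivative q2 t) (at t within {0..T})" "continuous_on {0..T} q2"
    "\<And>t. t \<in> {0..T} \<Longrightarrow> wbound 2 Bq (q t) \<and> norm (q1 t) \<le> Bq \<and> norm (q2 t) \<le> Bq"
    by (rule curve_two_derivatives[OF cq]) (rule that)
  obtain p1 p2 Bp where dp: "0 \<le> Bp" "\<And>t. t \<in> {0..T} \<Longrightarrow> (p has_vector_derivative p1 t) (at t within {0..T})"
    "\<And>t. t \<in> {0..T} \<Longrightarrow> (p1 has_vector_derivative p2 t) (at t within {0..T})" "continuous_on {0..T} p2"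
    "\<And>t. t \<in> {0..T} \<Longrightarrow> wbound 2 Bp (p t) \<and> norm (p1 t) \<le> Bp \<and> norm (p2 t) \<le> Bp"
    by (rule curve_two_derivatives[OF cp]) (rule that)
  define B where "B = Bu + Bw + Bq + Bp"
  have B0: "0 \<le> B" using du(1) dw(1) dq(1) dp(1) by (simp add: B_def)
  have le: "Bu \<le> B" "Bw \<le> B" "Bq \<le> B" "Bp \<le> B" using du(1) dw(1) dq(1) dp(1) by (auto simp: B_def)
  define K where "K = \<bar>lam\<bar> / 64"
  define \<kappa> where "\<kappa> = - (of_real lam / 64 :: complex)"
  have K0: "0 \<le> K" and nk: "cmod \<kappa> = K" by (auto simp: K_def \<kappa>_def norm_divide)
  define R where "R = B + RZ"
  define L where "L = 3 * \<bar>lam\<bar> * R\<^sup>2"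
  \<comment> \<open>The four summands are, in order: replacing the profile by the corrected profile
    \<open>Y\<close> in the cubic term, the residual \<open>\<rho>\<close>, the error of the initial
    velocity, and the corrector at time 0.\<close>
  define A0 where "A0 = L * (2 * K * B) + (2 + 18 * K) * B + (1 + 8 * K) * B + 2 * K * B"
  have L0: "0 \<le> L" by (simp add: L_def)
  have A00: "0 \<le> A0" using L0 K0 B0 by (simp add: A0_def)
  \<comment> \<open>The error of \<open>Y\<close> after Gronwall, and the size of the corrector that
    separates \<open>Y\<close> from the profile.\<close>
  define A where "A = (2 + T) * A0 * exp (L * T) + 2 * K * B"
  have A_0: "0 \<le> A" using A00 T K0 B0 by (simp add: A_def)
  have sw: "(\<Sum>a\<in>F. weight a ^ 2 * cmod (coef h a)) \<le> B" "(\<Sum>a\<in>F. cmod (coef h a)) \<le> B" "norm h \<le> B"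
    if "wbound 2 b h" "b \<le> B" "finite F" for b h F
  proof -
    have 1: "wbound 2 B h" by (rule wbound_mono[OF that(1) order_refl that(2)])
    show "(\<Sum>a\<in>F. weight a ^ 2 * cmod (coef h a)) \<le> B" using 1 that(3) by (simp add: wbound_def)
    show "norm h \<le> B" by (rule wbound_norm[OF 1])
    then show "(\<Sum>a\<in>F. cmod (coef h a)) \<le> B" using sum_coef_le_norm[OF that(3), of h] by linarith
  qed
  have main: "norm (Z t - limit_profile c u v t) \<le> A / c\<^sup>2"
    if c: "1 \<le> c" and Zb: "\<And>t. t \<in> {0..T} \<Longrightarrow> norm (Z t) \<le> RZ"
      and dZ: "\<And>t a. t \<in> {0..T} \<Longrightarrow> ((\<lambda>t. coef (Z t) a) has_vector_derivative D1 a t) (at t within {0..T})"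
      and dD1: "\<And>t a. t \<in> {0..T} \<Longrightarrow> (D1 a has_vector_derivative D2 a t) (at t within {0..T})"
      and cD2: "\<And>a. continuous_on {0..T} (D2 a)"
      and modal: "\<And>t a. t \<in> {0..T} \<Longrightarrow> D2 a t = - of_real ((kg_freq c a)\<^sup>2) * coef (Z t) a + of_real (c\<^sup>2 * lam) * coef (cubic (Z t)) a"
      and Z0: "Z 0 = f" and D10: "\<And>a. D1 a 0 = of_real (c\<^sup>2) * coef g a" and t: "t \<in> {0..T}" for c Z D1 D2 t
  proof -
    define r where "r = c\<^sup>2"
    have r1: "1 \<le> r" using c by (simp add: r_def)
    define C where "C = complex_of_real r"
    have C0: "C \<noteq> 0" using r1 by (simp add: C_def)
    define k where "k = \<kappa> / C"
    have nkk: "cmod k \<le> K" "cmod k = K / r"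
    proof -
      show "cmod k = K / r" using r1 by (simp add: k_def C_def norm_divide nk)
      then show "cmod k \<le> K" using r1 K0 by (simp add: divide_le_eq mult_left_le mult_le_cancel_left1)
    qed
    define \<Theta> where "\<Theta> = (\<lambda>a. complex_of_real (half_square a))"
    define corr where "corr = (\<lambda>t. const (k * osc (3 * r) t) * q t + const (k * osc (- (3 * r)) t) * p t)"
    define Y where "Y = (\<lambda>t. limit_profile c u v t + corr t)"
    have corr: "norm (corr t) \<le> 2 * K * B / r" if t: "t \<in> {0..T}" for t
    proof -
      have "norm (const (k * osc s t) * h) \<le> K / r * B" if "norm h \<le> B" for s h
        using order.trans[OF norm_mult_ineq mult_left_mono[OF that norm_ge_zero], of "const (k * osc s t)"]
        by (simp add: norm_mult nkk(2))
      then have "norm (corr t) \<le> K / r * B + K / r * B"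
        unfolding corr_def using sw(3)[of Bq "q t" "{}"] sw(3)[of Bp "p t" "{}"] dq(5)[OF t] dp(5)[OF t] le
        by (intro order.trans[OF norm_triangle_ineq] add_mono) auto
      also have "\<dots> = 2 * K * B / r" using r1 by (simp add: field_simps)
      finally show ?thesis .
    qed
    define y1 where "y1 = (\<lambda>a t. osc r t * (\<i> * of_real r * coef (u t) a + coef (u1 t) a) / 2
       + osc (- r) t * (\<i> * of_real (- r) * coef (w t) a + coef (w1 t) a) / 2
       + k * (osc (3 * r) t * (\<i> * of_real (3 * r) * coef (q t) a + coef (q1 t) a))
       + k * (osc (- (3 * r)) t * (\<i> * of_real (- (3 * r)) * coef (p t) a + coef (p1 t) a)))"
    define osc2 where "osc2 = (\<lambda>s t U U1 U2. osc s t * (\<i> * of_real s * (\<i> * of_real s * U + U1) + (\<i> * of_real s * U1 + U2)))"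
    define y2 where "y2 = (\<lambda>a t. osc2 r t (coef (u t) a) (coef (u1 t) a) (coef (u2 t) a) / 2
       + osc2 (- r) t (coef (w t) a) (coef (w1 t) a) (coef (w2 t) a) / 2
       + k * osc2 (3 * r) t (coef (q t) a) (coef (q1 t) a) (coef (q2 t) a)
       + k * osc2 (- (3 * r)) t (coef (p t) a) (coef (p1 t) a) (coef (p2 t) a))"
    have coefY: "coef (Y t) a = osc r t * coef (u t) a / 2 + osc (- r) t * coef (w t) a / 2
        + k * (osc (3 * r) t * coef (q t) a) + k * (osc (- (3 * r)) t * coef (p t) a)" for t a
      by (simp add: Y_def corr_def limit_profile_def w_def r_def[symmetric])
    have half: "((\<lambda>t. h t / 2) has_vector_derivative h' / 2) F" if "(h has_vector_derivative h') F" for h :: "real \<Rightarrow> complex" and h' F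
      by (rule bounded_linear.has_vector_derivative[OF bounded_linear_divide that])
    have kmult: "((\<lambda>t. k * h t) has_vector_derivative k * h') F" if "(h has_vector_derivative h') F" for h :: "real \<Rightarrow> complex" and h' F
      by (rule bounded_linear.has_vector_derivative[OF bounded_linear_mult_right that])
    have dY: "((\<lambda>t. coef (Y t) a) has_vector_derivative y1 a t) (at t within {0..T})" if t: "t \<in> {0..T}" for t a
      unfolding coefY y1_def
      by (intro has_vector_derivative_add half kmult osc_has_vector_derivative coef_has_vector_derivative du(2) dw(2) dq(2) dp(2) t)
    have inner: "((\<lambda>t. \<i> * of_real s * coef (h t) a + coef (h1 t) a) has_vector_derivative \<i> * of_real s * coef (h1 t) a + coef (h2 t) a) (at t within {0..T})"
      if "(h has_vector_derivative h1 t) (at t within {0..T})" "(h1 has_vector_derivative h2 t) (at t within {0..T})" for s h h1 h2 t a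
      by (intro has_vector_derivative_add bounded_linear.has_vector_derivative[OF bounded_linear_mult_right] coef_has_vector_derivative that)
    have dy1: "(y1 a has_vector_derivative y2 a t) (at t within {0..T})" if t: "t \<in> {0..T}" for t a
      unfolding y1_def y2_def osc2_def
      by (intro has_vector_derivative_add half kmult osc_has_vector_derivative inner du(2,3) dw(2,3) dq(2,3) dp(2,3) t)
    have cont: "continuous_on {0..T} (\<lambda>t. coef (h t) a)" if "\<And>t. t \<in> {0..T} \<Longrightarrow> (h has_vector_derivative h1 t) (at t within {0..T})" for h h1 a
      by (rule continuous_on_coef[OF continuous_on_vector_derivative[OF that]])
    have cosc: "continuous_on S (osc s)" for S s unfolding osc_def by (intro continuous_intros)
    have cy2: "continuous_on {0..T} (y2 a)" for a
      unfolding y2_def osc2_def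
      by (intro continuous_on_add continuous_on_mult continuous_on_divide continuous_on_const cosc cont[OF du(2)] cont[OF du(3)]
          cont[OF dw(2)] cont[OF dw(3)] cont[OF dq(2)] cont[OF dq(3)] cont[OF dp(2)] cont[OF dp(3)]
          continuous_on_coef[OF du(4)] continuous_on_coef[OF dw(4)] continuous_on_coef[OF dq(4)] continuous_on_coef[OF dp(4)]) auto
    have U1: "coef (u1 t) a = \<i> * \<Theta> a * coef (u t) a - \<i> * of_real \<mu> * coef (potential (u t) (v t) * u t) a" if t: "t \<in> {0..T}" for t a
    proof -
      have "u1 t = schroedinger (u t) + nls_force \<mu> (u t) (v t)"
        by (rule curve_pointwise_unique[OF T t du(2)[OF t]]) (use sol t in \<open>simp add: nls_solution_def \<mu>_def\<close>)
      then show ?thesis using coef_schroedinger[of Bu "u t" a] du(5)[OF t] by (simp add: nls_force_def \<Theta>_def)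
    qed
    \<comment> \<open>Conjugation reverses the sign of \<open>\<i>\<close>, so the conjugate of
      \<open>v\<close> satisfies the hypothesis of \<open>mode_identity\<close> with
      \<open>j = - \<i>\<close>.\<close>
    have W1: "coef (w1 t) a = - \<i> * \<Theta> a * coef (w t) a - (- \<i>) * of_real \<mu> * coef (potential (v t) (u t) * w t) a" if t: "t \<in> {0..T}" for t a
    proof -
      have "(v has_vector_derivative schroedinger (v t) + nls_force \<mu> (v t) (u t)) (at t within {0..T})"
        using sol t by (simp add: nls_solution_def \<mu>_def)
      then have "w1 t = wcnj (schroedinger (v t) + nls_force \<mu> (v t) (u t))"
        by (intro curve_pointwise_unique[OF T t dw(2)[OF t]]) (simp add: w_def bounded_linear.has_vector_derivative[OF bounded_linear_wcnj])
      moreover have "wbound 2 Bw (v t)" using wbound_wcnj[of 2 Bw "w t"] dw(5)[OF t] by (simp add: w_def)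
      then have "coef (wcnj (schroedinger (v t))) a = - \<i> * \<Theta> a * coef (w t) a"
        unfolding coef_wcnj by (subst coef_schroedinger) (simp_all add: w_def \<Theta>_def half_square_def)
      moreover have "wcnj (nls_force \<mu> (v t) (u t)) = const (\<i> * of_real \<mu>) * (potential (v t) (u t) * w t)"
        by (simp add: nls_force_def wcnj_mult wcnj_const wcnj_potential w_def)
      ultimately show ?thesis by (simp add: wcnj_add)
    qed
    have freq: "of_real ((kg_freq c a)\<^sup>2) = C * C + 2 * C * \<Theta> a" for a
      unfolding kg_freq_square by (simp add: C_def \<Theta>_def half_square_def r_def algebra_simps)
    \<comment> \<open>What is left when the terms of order \<open>c^2\<close> have been matched. It
      is bounded independently of \<open>c\<close>, and the kernel bound \<open>1 / c^2\<close>
      turns it into the claimed order.\<close>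
    define \<rho> where "\<rho> = (\<lambda>a t. osc r t * coef (u2 t) a / 2 + osc (- r) t * coef (w2 t) a / 2
       + (osc (3 * r) t * (\<kappa> * (6 * \<i> * coef (q1 t) a + 2 * \<Theta> a * coef (q t) a) + k * coef (q2 t) a)
       + osc (- (3 * r)) t * (\<kappa> * (6 * (- \<i>) * coef (p1 t) a + 2 * \<Theta> a * coef (p t) a) + k * coef (p2 t) a)))"
    have force: "y2 a t + of_real ((kg_freq c a)\<^sup>2) * coef (Y t) a = C * of_real lam * coef (cubic (limit_profile c u v t)) a + \<rho> a t"
      if t: "t \<in> {0..T}" for a t
    proof -
      let ?U = "coef (u t) a" and ?W = "coef (w t) a" and ?Q = "coef (q t) a" and ?P = "coef (p t) a"
      let ?X = "coef (potential (u t) (v t) * u t) a" and ?X' = "coef (potential (v t) (u t) * w t) a"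
      let ?F = "C * C + 2 * C * \<Theta> a"
      have i2: "\<i> * \<i> = - 1" and mi2: "(- \<i>) * (- \<i>) = - 1" by simp_all
      have 1: "osc2 r t ?U (coef (u1 t) a) (coef (u2 t) a) + ?F * (osc r t * ?U) = osc r t * (2 * C * of_real \<mu> * ?X + coef (u2 t) a)"
        unfolding mode_identity[OF i2 U1[OF t], where C = C and ?U2.0 = "coef (u2 t) a", symmetric]
        by (simp add: osc2_def C_def algebra_simps)
      have 2: "osc2 (- r) t ?W (coef (w1 t) a) (coef (w2 t) a) + ?F * (osc (- r) t * ?W) = osc (- r) t * (2 * C * of_real \<mu> * ?X' + coef (w2 t) a)"
        unfolding mode_identity[OF mi2 W1[OF t], where C = C and ?U2.0 = "coef (w2 t) a", symmetric]
        by (simp add: osc2_def C_def algebra_simps)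
      have 3: "osc2 (3 * r) t ?Q (coef (q1 t) a) (coef (q2 t) a) + ?F * (osc (3 * r) t * ?Q)
          = osc (3 * r) t * (C * (- 8 * C * ?Q + (6 * \<i> * coef (q1 t) a + 2 * \<Theta> a * ?Q)) + coef (q2 t) a)"
        unfolding harmonic_identity[OF i2, symmetric] by (simp add: osc2_def C_def algebra_simps)
      have 4: "osc2 (- (3 * r)) t ?P (coef (p1 t) a) (coef (p2 t) a) + ?F * (osc (- (3 * r)) t * ?P)
          = osc (- (3 * r)) t * (C * (- 8 * C * ?P + (6 * (- \<i>) * coef (p1 t) a + 2 * \<Theta> a * ?P)) + coef (p2 t) a)"
        unfolding harmonic_identity[OF mi2, symmetric] by (simp add: osc2_def C_def algebra_simps)
      have kC: "k * C = \<kappa>" using C0 by (simp add: k_def)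
      \<comment> \<open>The choice of \<open>\<kappa>\<close> at work: \<open>- 8 \<kappa>\<close>
        is \<open>lam / 8\<close>, which reproduces the third harmonics of the cubic term with their
        coefficient 1/8.\<close>
      have k8: "k * (C * (- 8 * C * x + y) + z) = C * of_real lam * (x / 8) + (\<kappa> * y + k * z)" for x y z
      proof -
        have lam64: "of_real lam = - 64 * \<kappa>" by (simp add: \<kappa>_def)
        have "k * (C * (- 8 * C * x + y) + z) = (k * C) * (- 8 * C * x + y) + k * z" by (simp add: algebra_simps)
        also have "\<dots> = C * of_real lam * (x / 8) + (\<kappa> * y + k * z)" unfolding kC lam64 by (simp add: algebra_simps)
        finally show ?thesis .
      qed
      have cub: "coef (cubic (limit_profile c u v t)) a = osc r t / 8 * ?X + osc (- r) t / 8 * ?X' + (osc (3 * r) t / 8 * ?Q + osc (- (3 * r)) t / 8 * ?P)"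
        unfolding cubic_limit_profile by (simp add: r_def w_def q_def p_def)
      have "y2 a t + ?F * coef (Y t) a
          = (osc2 r t ?U (coef (u1 t) a) (coef (u2 t) a) + ?F * (osc r t * ?U)) / 2
          + (osc2 (- r) t ?W (coef (w1 t) a) (coef (w2 t) a) + ?F * (osc (- r) t * ?W)) / 2
          + k * (osc2 (3 * r) t ?Q (coef (q1 t) a) (coef (q2 t) a) + ?F * (osc (3 * r) t * ?Q))
          + k * (osc2 (- (3 * r)) t ?P (coef (p1 t) a) (coef (p2 t) a) + ?F * (osc (- (3 * r)) t * ?P))"
        unfolding y2_def coefY by (simp add: field_simps)
      also have "\<dots> = osc r t * (2 * C * of_real \<mu> * ?X + coef (u2 t) a) / 2 + osc (- r) t * (2 * C * of_real \<mu> * ?X' + coef (w2 t) a) / 2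
          + osc (3 * r) t * (k * (C * (- 8 * C * ?Q + (6 * \<i> * coef (q1 t) a + 2 * \<Theta> a * ?Q)) + coef (q2 t) a))
          + osc (- (3 * r)) t * (k * (C * (- 8 * C * ?P + (6 * (- \<i>) * coef (p1 t) a + 2 * \<Theta> a * ?P)) + coef (p2 t) a))"
        unfolding 1 2 3 4 by (simp only: mult.left_commute)
      also have "\<dots> = C * of_real lam * coef (cubic (limit_profile c u v t)) a + \<rho> a t"
        unfolding k8 cub \<rho>_def by (simp add: \<mu>_def field_simps)
      finally show ?thesis unfolding freq .
    qed
    have \<rho>_sum: "(\<Sum>a\<in>F. cmod (\<rho> a t)) \<le> (2 + 18 * K) * B" if t: "t \<in> {0..T}" and F: "finite F" for t F
    proof -
      have \<Theta>b: "cmod (\<Theta> a) \<le> weight a ^ 2" for a using half_square_bound[of a] by (simp add: \<Theta>_def)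
      let ?m = "\<lambda>h1 h h2 a. K * (6 * cmod (coef h1 a) + 2 * (weight a ^ 2 * cmod (coef h a))) + K * cmod (coef h2 a)"
      have har: "cmod (s * (\<kappa> * (6 * j * x1 + 2 * \<Theta> a * x) + k * x2)) \<le> K * (6 * cmod x1 + 2 * (weight a ^ 2 * cmod x)) + K * cmod x2"
        if "cmod s = 1" "cmod j = 1" for s j x1 x x2 a
      proof -
        have "cmod (6 * j * x1 + 2 * \<Theta> a * x) \<le> 6 * cmod x1 + 2 * (weight a ^ 2 * cmod x)"
          by (rule order.trans[OF norm_triangle_ineq]) (use that \<Theta>b[of a] in \<open>auto simp: norm_mult intro!: add_mono mult_right_mono\<close>)
        then have "cmod (\<kappa> * (6 * j * x1 + 2 * \<Theta> a * x)) \<le> K * (6 * cmod x1 + 2 * (weight a ^ 2 * cmod x))"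
          unfolding norm_mult nk by (rule mult_left_mono[OF _ K0])
        moreover have "cmod (k * x2) \<le> K * cmod x2" unfolding norm_mult by (rule mult_right_mono[OF nkk(1)]) simp
        ultimately have "cmod (\<kappa> * (6 * j * x1 + 2 * \<Theta> a * x) + k * x2) \<le> K * (6 * cmod x1 + 2 * (weight a ^ 2 * cmod x)) + K * cmod x2"
          by (rule norm_triangle_mono)
        then show ?thesis using that(1) by (simp add: norm_mult[of s])
      qed
      have "cmod (\<rho> a t) \<le> (cmod (coef (u2 t) a) + cmod (coef (w2 t) a)) + (?m (q1 t) (q t) (q2 t) a + ?m (p1 t) (p t) (p2 t) a)" for a
        unfolding \<rho>_def
      proof (intro norm_triangle_mono har)
        show "cmod (osc r t * coef (u2 t) a / 2) \<le> cmod (coef (u2 t) a)" "cmod (osc (- r) t * coef (w2 t) a / 2) \<le> cmod (coef (w2 t) a)"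
          by (simp_all add: norm_mult norm_divide)
      qed auto
      then have "(\<Sum>a\<in>F. cmod (\<rho> a t)) \<le> (\<Sum>a\<in>F. (cmod (coef (u2 t) a) + cmod (coef (w2 t) a)) + (?m (q1 t) (q t) (q2 t) a + ?m (p1 t) (p t) (p2 t) a))"
        by (intro sum_mono)
      also have "\<dots> = ((\<Sum>a\<in>F. cmod (coef (u2 t) a)) + (\<Sum>a\<in>F. cmod (coef (w2 t) a)))
          + ((K * (6 * (\<Sum>a\<in>F. cmod (coef (q1 t) a)) + 2 * (\<Sum>a\<in>F. weight a ^ 2 * cmod (coef (q t) a))) + K * (\<Sum>a\<in>F. cmod (coef (q2 t) a)))
          + (K * (6 * (\<Sum>a\<in>F. cmod (coef (p1 t) a)) + 2 * (\<Sum>a\<in>F. weight a ^ 2 * cmod (coef (p t) a))) + K * (\<Sum>a\<in>F. cmod (coef (p2 t) a))))"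
        by (simp only: sum.distrib sum_distrib_left[symmetric])
      also have "\<dots> \<le> (B + B) + ((K * (6 * B + 2 * B) + K * B) + (K * (6 * B + 2 * B) + K * B))"
      proof -
        have n: "(\<Sum>a\<in>F. cmod (coef h a)) \<le> B" if "norm h \<le> b" "b \<le> B" for h b
          using sum_coef_le_norm[OF F, of h] that by linarith
        show ?thesis
          using n[of "u2 t" Bu] n[of "w2 t" Bw] n[of "q1 t" Bq] n[of "q2 t" Bq] n[of "p1 t" Bp] n[of "p2 t" Bp]
            sw(1)[of Bq "q t" F] sw(1)[of Bp "p t" F] du(5)[OF t] dw(5)[OF t] dq(5)[OF t] dp(5)[OF t] le F
          by (intro add_mono mult_left_mono K0) auto
      qed
      finally show ?thesis by (simp add: algebra_simps)
    qed
    have np: "norm (limit_profile c u v t) \<le> B" if t: "t \<in> {0..T}" for t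
    proof -
      have "norm (const (osc s t / 2) * h) \<le> B / 2" if "norm h \<le> B" for s h
        using order.trans[OF norm_mult_ineq mult_left_mono[OF that norm_ge_zero], of "const (osc s t / 2)"]
        by (simp add: norm_divide)
      then have "norm (limit_profile c u v t) \<le> B / 2 + B / 2"
        unfolding limit_profile_def w_def[symmetric] using sw(3)[of Bu "u t" "{}"] sw(3)[of Bw "w t" "{}"] du(5)[OF t] dw(5)[OF t] le
        by (intro order.trans[OF norm_triangle_ineq] add_mono) (auto simp: w_def)
      then show ?thesis by simp
    qed
    define \<epsilon> where "\<epsilon> = A0 / r"
    have \<epsilon>: "0 \<le> \<epsilon>" "r * \<epsilon> = A0" using A00 r1 by (auto simp: \<epsilon>_def)
    have p0: "limit_profile c u v 0 = f"
      by (rule ev_inject, simp add: limit_profile_def u0 v0, simp add: field_simps)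
    have stab: "norm (Y t - Z t) \<le> ((2 + T) * \<epsilon>) * exp (L * t)"
    proof (rule kg_stability[where c = c and ?D1.0 = "\<lambda>a t. y1 a t - D1 a t" and ?D2.0 = "\<lambda>a t. y2 a t - D2 a t" and M = "B + 2 * K * B + RZ", OF _ L0 \<epsilon>(1) _ _ _ _ _ _ _ t])
      show "0 < c" using c by simp
      show "((\<lambda>t. coef (Y t - Z t) a) has_vector_derivative y1 a t - D1 a t) (at t within {0..T})" if "t \<in> {0..T}" for t a
        unfolding coef_diff by (rule has_vector_derivative_diff[OF dY[OF that] dZ[OF that]])
      show "((\<lambda>t. y1 a t - D1 a t) has_vector_derivative y2 a t - D2 a t) (at t within {0..T})" if "t \<in> {0..T}" for t a
        by (rule has_vector_derivative_diff[OF dy1[OF that] dD1[OF that]])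
      show "continuous_on {0..T} (\<lambda>t. y2 a t - D2 a t)" for a by (intro continuous_on_diff cy2 cD2)
      have "Y 0 - Z 0 = corr 0" by (simp add: Y_def p0 Z0)
      moreover have "2 * K * B / r \<le> \<epsilon>"
        unfolding \<epsilon>_def using r1 L0 K0 B0 by (intro divide_right_mono) (auto simp: A0_def)
      ultimately show "norm (Y 0 - Z 0) \<le> \<epsilon>" using corr[of 0] T by simp
      show "norm (Y t - Z t) \<le> B + 2 * K * B + RZ" if t: "t \<in> {0..T}" for t
      proof -
        have "2 * K * B / r \<le> 2 * K * B" using divide_left_mono[OF r1, of "2 * K * B"] r1 K0 B0 by simp
        then have "norm (Y t) \<le> B + 2 * K * B"
          unfolding Y_def using np[OF t] corr[OF t] norm_triangle_ineq[of "limit_profile c u v t" "corr t"] by linarith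
        then show ?thesis using Zb[OF t] norm_triangle_ineq4[of "Y t" "Z t"] by linarith
      qed
      show "(\<Sum>a\<in>F. cmod (y1 a 0 - D1 a 0)) \<le> c\<^sup>2 * \<epsilon>" if F: "finite F" for F
      proof -
        have t0: "0 \<in> {0..T}" using T by simp
        \<comment> \<open>The velocity of the profile is of order \<open>c^2\<close>, but the
          initial data give \<open>u - wcnj v = - 2 i g\<close> at time 0, so its leading part is
          exactly \<open>c^2 g\<close>. The corrector contributes only \<open>O(1)\<close>, since
          its factor \<open>1 / c^2\<close> meets the frequency \<open>3 c^2\<close>.\<close>
        have e: "y1 a 0 - D1 a 0 = (coef (u1 0) a / 2 + coef (w1 0) a / 2) + ((\<kappa> * (3 * \<i> * coef (q 0) a) + k * coef (q1 0) a) + (\<kappa> * (- 3 * \<i> * coef (p 0) a) + k * coef (p1 0) a))" for a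
        proof -
          have kC: "k * of_real (3 * r) = 3 * \<kappa>" using C0 by (simp add: k_def C_def)
          have uw: "coef (u 0) a - coef (w 0) a = - 2 * \<i> * coef g a" by (simp add: w_def u0 v0)
          have "y1 a 0 = \<i> * of_real r * (coef (u 0) a - coef (w 0) a) / 2 + (coef (u1 0) a / 2 + coef (w1 0) a / 2)
              + (((k * of_real (3 * r)) * (\<i> * coef (q 0) a) + k * coef (q1 0) a) + (- (k * of_real (3 * r)) * (\<i> * coef (p 0) a) + k * coef (p1 0) a))"
            unfolding y1_def by (simp add: field_simps)
          then show ?thesis unfolding kC uw D10 by (simp add: r_def field_simps)
        qed
        have b3: "cmod (\<kappa> * (s * \<i> * x) + k * x1) \<le> K * (3 * cmod x) + K * cmod x1" if "cmod s = 3" for s x x1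
        proof (rule norm_triangle_mono)
          show "cmod (\<kappa> * (s * \<i> * x)) \<le> K * (3 * cmod x)" by (simp add: norm_mult nk that)
          show "cmod (k * x1) \<le> K * cmod x1" unfolding norm_mult by (rule mult_right_mono[OF nkk(1)]) simp
        qed
        have "cmod (y1 a 0 - D1 a 0) \<le> (cmod (coef (u1 0) a) / 2 + cmod (coef (w1 0) a) / 2)
            + ((K * (3 * cmod (coef (q 0) a)) + K * cmod (coef (q1 0) a)) + (K * (3 * cmod (coef (p 0) a)) + K * cmod (coef (p1 0) a)))" for a
          unfolding e by (intro norm_triangle_mono b3) (auto simp: norm_divide)
        then have "(\<Sum>a\<in>F. cmod (y1 a 0 - D1 a 0)) \<le> (\<Sum>a\<in>F. (cmod (coef (u1 0) a) / 2 + cmod (coef (w1 0) a) / 2)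
            + ((K * (3 * cmod (coef (q 0) a)) + K * cmod (coef (q1 0) a)) + (K * (3 * cmod (coef (p 0) a)) + K * cmod (coef (p1 0) a))))"
          by (intro sum_mono)
        also have "\<dots> = ((\<Sum>a\<in>F. cmod (coef (u1 0) a)) / 2 + (\<Sum>a\<in>F. cmod (coef (w1 0) a)) / 2)
            + ((K * (3 * (\<Sum>a\<in>F. cmod (coef (q 0) a))) + K * (\<Sum>a\<in>F. cmod (coef (q1 0) a))) + (K * (3 * (\<Sum>a\<in>F. cmod (coef (p 0) a))) + K * (\<Sum>a\<in>F. cmod (coef (p1 0) a))))"
          by (simp only: sum.distrib sum_distrib_left[symmetric] sum_divide_distrib[symmetric])
        also have "\<dots> \<le> (B / 2 + B / 2) + ((K * (3 * B) + K * B) + (K * (3 * B) + K * B))"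
        proof -
          have n: "(\<Sum>a\<in>F. cmod (coef h a)) \<le> B" if "norm h \<le> b" "b \<le> B" for h b
            using sum_coef_le_norm[OF F, of h] that by linarith
          show ?thesis
            using n[of "u1 0" Bu] n[of "w1 0" Bw] n[of "q1 0" Bq] n[of "p1 0" Bp]
              sw(2)[of Bq "q 0" F] sw(2)[of Bp "p 0" F] du(5)[OF t0] dw(5)[OF t0] dq(5)[OF t0] dp(5)[OF t0] le F
            by (intro add_mono mult_left_mono divide_right_mono K0) auto
        qed
        also have "\<dots> = (1 + 8 * K) * B" by (simp add: algebra_simps)
        also have "\<dots> \<le> A0" using L0 K0 B0 by (simp add: A0_def)
        finally show ?thesis using \<epsilon>(2) by (simp add: r_def)
      qed
      show "(\<Sum>a\<in>F. cmod (y2 a t - D2 a t + of_real ((kg_freq c a)\<^sup>2) * coef (Y t - Z t) a)) \<le> c\<^sup>2 * (L * norm (Y t - Z t) + \<epsilon>)"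
        if t: "t \<in> {0..T}" and F: "finite F" for t F
      proof -
        define D where "D = cubic (limit_profile c u v t) - cubic (Z t)"
        have e: "y2 a t - D2 a t + of_real ((kg_freq c a)\<^sup>2) * coef (Y t - Z t) a = C * of_real lam * coef D a + \<rho> a t" for a
        proof -
          have "y2 a t - D2 a t + of_real ((kg_freq c a)\<^sup>2) * coef (Y t - Z t) a
              = (y2 a t + of_real ((kg_freq c a)\<^sup>2) * coef (Y t) a) - (D2 a t + of_real ((kg_freq c a)\<^sup>2) * coef (Z t) a)"
            by (simp add: algebra_simps)
          also have "D2 a t + of_real ((kg_freq c a)\<^sup>2) * coef (Z t) a = C * of_real lam * coef (cubic (Z t)) a"
            unfolding modal[OF t] by (simp add: C_def r_def)
          finally show ?thesis unfolding force[OF t] D_def by (simp add: algebra_simps)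
        qed
        \<comment> \<open>The cubic term was expanded at the profile, while Gronwall runs on
          \<open>Y\<close>; the corrector bridges the two.\<close>
        have nD: "norm D \<le> 3 * R\<^sup>2 * (norm (Y t - Z t) + 2 * K * B / r)"
        proof -
          have "limit_profile c u v t - Z t = (Y t - Z t) - corr t" by (simp add: Y_def)
          then have "norm (limit_profile c u v t - Z t) = norm ((Y t - Z t) - corr t)" by (simp only:)
          then have "norm (limit_profile c u v t - Z t) \<le> norm (Y t - Z t) + 2 * K * B / r"
            using norm_triangle_ineq4[of "Y t - Z t" "corr t"] corr[OF t] by linarith
          then show ?thesis
            unfolding D_def using np[OF t] Zb[OF t] B0 RZ by (intro cubic_lipschitz) (auto simp: R_def)
        qed
        have "(\<Sum>a\<in>F. cmod (y2 a t - D2 a t + of_real ((kg_freq c a)\<^sup>2) * coef (Y t - Z t) a)) \<le> r * \<bar>lam\<bar> * norm D + (2 + 18 * K) * B"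
          unfolding e
        proof (rule sum_cmod_le3[OF norm_triangle_ineq _ \<rho>_sum[OF t F]])
          have "(\<Sum>a\<in>F. cmod (C * of_real lam * coef D a)) = r * \<bar>lam\<bar> * (\<Sum>a\<in>F. cmod (coef D a))"
            using r1 by (simp add: norm_mult sum_distrib_left C_def)
          also have "\<dots> \<le> r * \<bar>lam\<bar> * norm D" using r1 by (intro mult_left_mono sum_coef_le_norm F) auto
          finally show "(\<Sum>a\<in>F. cmod (C * of_real lam * coef D a)) \<le> r * \<bar>lam\<bar> * norm D" .
        qed
        also have "\<dots> \<le> r * \<bar>lam\<bar> * (3 * R\<^sup>2 * (norm (Y t - Z t) + 2 * K * B / r)) + (2 + 18 * K) * B"
          using r1 by (intro add_right_mono mult_left_mono nD) auto
        also have "\<dots> = r * (L * norm (Y t - Z t)) + (L * (2 * K * B) + (2 + 18 * K) * B)"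
          using r1 by (simp add: L_def field_simps)
        also have "\<dots> \<le> r * (L * norm (Y t - Z t)) + A0" using K0 B0 by (simp add: A0_def)
        also have "\<dots> = c\<^sup>2 * (L * norm (Y t - Z t) + \<epsilon>)" using \<epsilon>(2) by (simp add: r_def algebra_simps)
        finally show ?thesis .
      qed
    qed
    have "exp (L * t) \<le> exp (L * T)" using t L0 by (simp add: mult_left_mono)
    then have "((2 + T) * \<epsilon>) * exp (L * t) \<le> ((2 + T) * \<epsilon>) * exp (L * T)" using T \<epsilon>(1) by (intro mult_left_mono) auto
    moreover have "Z t - limit_profile c u v t = corr t - (Y t - Z t)" by (simp add: Y_def)
    then have "norm (Z t - limit_profile c u v t) = norm (corr t - (Y t - Z t))" by (simp only:)
    ultimately have "norm (Z t - limit_profile c u v t) \<le> 2 * K * B / r + ((2 + T) * \<epsilon>) * exp (L * T)"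
      using norm_triangle_ineq4[of "corr t" "Y t - Z t"] corr[OF t] stab by linarith
    also have "\<dots> = A / c\<^sup>2" by (simp add: A_def \<epsilon>_def r_def add_divide_distrib)
    finally show ?thesis .
  qed
  show ?thesis
  proof (rule exI[of _ A], intro conjI A_0 allI impI ballI)
    fix c Z D1 D2 t
    assume h: "1 \<le> c \<and> (\<forall>t\<in>{0..T}. norm (Z t) \<le> RZ) \<and> kg_modes lam c T f g Z D1 D2" and t: "t \<in> {0..T}"
    show "norm (Z t - limit_profile c u v t) \<le> A / c\<^sup>2"
      by (rule main[of c Z D1 D2 t]) (use h[unfolded kg_modes_def] t in \<open>blast+\<close>)
  qed
qed

section \<open>Passage to the \<open>L2\<close> norm and assembly of the theorem\<close>

lemma torus_L2_norm_le:
  assumes "\<And>x. cmod (f x) \<le> B"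
  shows "torus_L2_norm f \<le> sqrt (2 * pi) * B"
proof -
  have B: "0 \<le> B" using assms[of 0] norm_ge_zero order.trans by blast
  have "integral {-pi..pi} (\<lambda>x. (cmod (f x))\<^sup>2) \<le> 2 * pi * B\<^sup>2"
  proof (cases "(\<lambda>x. (cmod (f x))\<^sup>2) integrable_on {-pi..pi}")
    case True
    have "integral {-pi..pi} (\<lambda>x. (cmod (f x))\<^sup>2) \<le> integral {-pi..pi} (\<lambda>x. B\<^sup>2)"
      by (rule integral_le[OF True]) (use assms in \<open>auto intro: power_mono\<close>)
    then show ?thesis by simp
  next
    \<comment> \<open>The integral of a non-integrable function is 0 by convention, so the pointwise
      bound alone is enough.\<close>
    case False
    then show ?thesis by (simp add: not_integrable_integral)
  qed
  then have "torus_L2_norm f \<le> sqrt (2 * pi * B\<^sup>2)"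
    unfolding torus_L2_norm_def by (rule real_sqrt_le_mono)
  then show ?thesis using B by (simp add: real_sqrt_mult)
qed

lemma nls_solution_restrict:
  assumes "nls_solution \<mu> T k u v" "T' \<le> T"
  shows "nls_solution \<mu> T' k u v"
proof -
  have sub: "{0..T'} \<subseteq> {0..T}" using assms(2) by auto
  show ?thesis
    using assms(1) sub unfolding nls_solution_def
    by (blast intro: curve_restrict[OF _ assms(2)] has_vector_derivative_within_subset[OF _ sub])
qed

lemma nls_solution_weight_mono: "nls_solution \<mu> T k u v \<Longrightarrow> k' \<le> k \<Longrightarrow> nls_solution \<mu> T k' u v"
  unfolding nls_solution_def using curve_weight_mono by blast

theorem theorem6p2:
  fixes s lam :: real and \<phi> \<gamma> :: "real \<Rightarrow> complex"
  assumes "s > 1 / 2" and "torus_smooth \<phi>" and "torus_smooth \<gamma>"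
  shows "\<exists>T c0 C h0 \<tau>0 :: real. T > 0 \<and> c0 > 0 \<and> C > 0 \<and> h0 > 0 \<and> \<tau>0 > 0 \<and>
    (\<forall>c > c0.
       (\<exists>z. klein_gordon_solution lam c \<phi> \<gamma> T z) \<and>
       (\<forall>z. klein_gordon_solution lam c \<phi> \<gamma> T z \<longrightarrow>
          (\<forall>(\<tau>::real) (K::nat) (h::real) (n::nat).
             0 < \<tau> \<and> \<tau> < \<tau>0 \<and> K \<ge> 1 \<and> h = 1 / real K \<and> h < h0 \<and> real n * \<tau> \<le> T \<longrightarrow>
             torus_L2_norm (\<lambda>x. z (real n * \<tau>) x - z0_approx K lam \<tau> c \<phi> \<gamma> n x)
               \<le> C * (\<tau>\<^sup>2 + h powr s + 1 / c\<^sup>2))))"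
proof -
  \<comment> \<open>The weights count integer orders. As \<open>h \<le> 1\<close> and
    \<open>s \<le> m\<close>, the power \<open>h^m\<close> is at most
    \<open>h powr s\<close>.\<close>
  define m where "m = nat \<lceil>s\<rceil>"
  have m: "1 \<le> m" "s \<le> real m" using assms(1) by (simp_all add: m_def) linarith+
  obtain f where f: "ev f = \<phi>" "\<And>k. \<exists>R. wbound k R f" using smooth_wiener[OF assms(2)] by metis
  obtain g where g: "ev g = \<gamma>" "\<And>k. \<exists>R. wbound k R g" using smooth_wiener[OF assms(3)] by metis
  \<comment> \<open>\<open>m\<close> weights for the spatial order, 10 for the splitting defect, and
    34 to be spent by \<open>nls_exists\<close>.\<close>
  obtain Rf Rg where R: "wbound (m + 10 + 34) Rf f" "wbound (m + 10 + 34) Rg g" using f(2) g(2) by metis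
  define R0 where "R0 = Rf + Rg"
  have R0: "wbound (m + 10 + 34) R0 f" "wbound (m + 10 + 34) R0 g"
    using R wbound_nonneg[OF R(1)] wbound_nonneg[OF R(2)] by (auto simp: R0_def elim!: wbound_mono)
  have ig: "wbound (m + 10 + 34) R0 (const \<i> * g)" using wbound_const_mult[OF R0(2), of \<i>] by simp
  define fu where "fu = f - const \<i> * g"
  define fv where "fv = wcnj (f + const \<i> * g)"
  have fuv: "wbound (m + 10 + 34) (R0 + R0) fu" "wbound (m + 10 + 34) (R0 + R0) fv"
    unfolding fu_def fv_def by (intro wbound_diff wbound_wcnj wbound_add R0 ig)+
  obtain T1 u v where nls: "0 < T1" "nls_solution (lam / 8) T1 (m + 10) u v" "u 0 = fu" "v 0 = fv"
    by (rule nls_exists[OF fuv]) (rule that)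
  \<comment> \<open>The 24 weights are spent by \<open>kg_exists\<close>, which with
    \<open>k = 2\<close> leaves the weight 6 asked for by \<open>kg_classical\<close>.\<close>
  have R2: "wbound (2 + 24) R0 f" "wbound (2 + 24) R0 g" by (rule wbound_mono[OF R0(1)]; simp) (rule wbound_mono[OF R0(2)]; simp)
  obtain T2 RZ where T2: "0 < T2" and kg: "\<And>T c. 0 < T \<Longrightarrow> T \<le> T2 \<Longrightarrow> 0 < c \<Longrightarrow>
     \<exists>Z Z1 Z2. curve 0 T (2 + 4) Z \<and> curve 0 T (2 + 4) Z1 \<and> curve 0 T (2 + 4) Z2 \<and>
       (\<forall>t\<in>{0..T}. norm (Z t) \<le> RZ \<and> (Z has_vector_derivative Z1 t) (at t within {0..T}) \<and> (Z1 has_vector_derivative Z2 t) (at t within {0..T})) \<and>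
       Z 0 = f \<and> (\<forall>a. coef (Z1 0) a = of_real (c\<^sup>2) * coef g a) \<and>
       (\<forall>t\<in>{0..T}. \<forall>a. coef (Z2 t) a = - of_real ((kg_freq c a)\<^sup>2) * coef (Z t) a + of_real (c\<^sup>2 * lam) * coef (cubic (Z t)) a)"
    by (rule kg_exists[OF R2, where lam = lam]) (rule that)
  define T where "T = min T1 T2"
  have T: "0 < T" "T \<le> T1" "T \<le> T2" using nls(1) T2 by (auto simp: T_def)
  have sol: "nls_solution (lam / 8) T (m + 10) u v" by (rule nls_solution_restrict[OF nls(2) T(2)])
  have sol10: "nls_solution (lam / 8) T 10 u v" by (rule nls_solution_weight_mono[OF sol]) simp
  obtain C1 \<tau>0 where C1: "0 < C1" "0 < \<tau>0"
    and strang: "\<And>\<tau> K n. 0 < \<tau> \<Longrightarrow> \<tau> < \<tau>0 \<Longrightarrow> 1 \<le> K \<Longrightarrow> 1 / real K < \<tau>0 \<Longrightarrow> real n * \<tau> \<le> T \<Longrightarrow>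
      pair_dist ((disc_step K (lam / 8) \<tau> ^^ n) (aliased K (u 0), aliased K (v 0))) (u (real n * \<tau>), v (real n * \<tau>))
        \<le> C1 * (\<tau>\<^sup>2 + 1 / real K ^ m)"
    by (rule strang_error[OF sol T(1) m(1)]) (rule that)
  have RZ0: "0 \<le> \<bar>RZ\<bar>" by simp
  obtain A where A: "0 \<le> A" and approx: "\<forall>c Z D1 D2. 1 \<le> c \<and> (\<forall>t\<in>{0..T}. norm (Z t) \<le> \<bar>RZ\<bar>) \<and> kg_modes lam c T f g Z D1 D2 \<longrightarrow>
     (\<forall>t\<in>{0..T}. norm (Z t - limit_profile c u v t) \<le> A / c\<^sup>2)"
    using kg_approximation[OF sol10 T(1) nls(3)[unfolded fu_def] nls(4)[unfolded fv_def] RZ0] by blast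
  define C where "C = sqrt (2 * pi) * (A + C1)"
  have C: "0 < C" using A C1(1) by (simp add: C_def)
  have main: "(\<exists>z. klein_gordon_solution lam c \<phi> \<gamma> T z) \<and>
       (\<forall>z. klein_gordon_solution lam c \<phi> \<gamma> T z \<longrightarrow>
          (\<forall>(\<tau>::real) (K::nat) (h::real) (n::nat).
             0 < \<tau> \<and> \<tau> < \<tau>0 \<and> K \<ge> 1 \<and> h = 1 / real K \<and> h < \<tau>0 \<and> real n * \<tau> \<le> T \<longrightarrow>
             torus_L2_norm (\<lambda>x. z (real n * \<tau>) x - z0_approx K lam \<tau> c \<phi> \<gamma> n x)
               \<le> C * (\<tau>\<^sup>2 + h powr s + 1 / c\<^sup>2)))" if c1: "1 < c" for c
  proof (intro conjI allI impI)
    have c: "0 < c" "1 \<le> c" using c1 by auto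
    obtain Y Y1 Y2 where Y: "curve 0 T (2 + 4) Y" "curve 0 T (2 + 4) Y1" "curve 0 T (2 + 4) Y2"
      and dY: "\<forall>t\<in>{0..T}. norm (Y t) \<le> RZ \<and> (Y has_vector_derivative Y1 t) (at t within {0..T}) \<and> (Y1 has_vector_derivative Y2 t) (at t within {0..T})"
      and Y0: "Y 0 = f" "\<forall>a. coef (Y1 0) a = of_real (c\<^sup>2) * coef g a"
      and Ym: "\<forall>t\<in>{0..T}. \<forall>a. coef (Y2 t) a = - of_real ((kg_freq c a)\<^sup>2) * coef (Y t) a + of_real (c\<^sup>2 * lam) * coef (cubic (Y t)) a"
      using kg[OF T(1) T(3) c(1)] by (elim exE conjE) (rule that)
    have Y6: "curve 0 T 6 Y" "curve 0 T 6 Y1" "curve 0 T 6 Y2" using Y by (simp_all add: numeral_eq_Suc)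
    note dY1 = dY[rule_format, THEN conjunct2, THEN conjunct1] and dY2 = dY[rule_format, THEN conjunct2, THEN conjunct2]
    have "klein_gordon_solution lam c (ev f) (ev g) T (\<lambda>t. ev (Y t))"
      by (rule kg_classical[OF T(1) c(1) Y6 dY1 dY2 Y0(1) Y0(2)[rule_format] Ym[rule_format]])
    then show "\<exists>z. klein_gordon_solution lam c \<phi> \<gamma> T z" unfolding f(1) g(1) by blast
    fix z \<tau> h and K n :: nat
    assume z: "klein_gordon_solution lam c \<phi> \<gamma> T z"
      and hyp: "0 < \<tau> \<and> \<tau> < \<tau>0 \<and> K \<ge> 1 \<and> h = 1 / real K \<and> h < \<tau>0 \<and> real n * \<tau> \<le> T"
    obtain Z D1 D2 M where evZ: "\<And>t. t \<in> {0..T} \<Longrightarrow> ev (Z t) = z t" and nZ: "\<And>t. t \<in> {0..T} \<Longrightarrow> norm (Z t) \<le> M"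
      and dZ: "\<And>t a. t \<in> {0..T} \<Longrightarrow> ((\<lambda>t. coef (Z t) a) has_vector_derivative D1 a t) (at t within {0..T})"
        "\<And>t a. t \<in> {0..T} \<Longrightarrow> (D1 a has_vector_derivative D2 a t) (at t within {0..T})"
        "\<And>a. continuous_on {0..T} (D2 a)"
        "\<And>t a. t \<in> {0..T} \<Longrightarrow> D2 a t = - of_real ((kg_freq c a)\<^sup>2) * coef (Z t) a + of_real (c\<^sup>2 * lam) * coef (cubic (Z t)) a"
        "Z 0 = f" "\<And>a. D1 a 0 = of_real (c\<^sup>2) * coef g a"
      by (rule kg_classical_modes[OF z T(1) c(1) f(1) g(1)]) (rule that)
    define R where "R = \<bar>M\<bar> + \<bar>RZ\<bar>"
    have nR: "norm (Y t) \<le> R" "norm (Z t) \<le> R" if "t \<in> {0..T}" for t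
      using dY[rule_format, OF that] nZ[OF that] unfolding R_def by linarith+
    \<comment> \<open>The bound \<open>M\<close> of the given solution may depend on
      \<open>c\<close>. Identifying it with the constructed solution \<open>Y\<close> replaces
      \<open>M\<close> by \<open>RZ\<close>, which does not, as required by the constant
      \<open>A\<close>.\<close>
    have uniq: "Y t = Z t" if t: "t \<in> {0..T}" for t
    proof -
      have "norm (Y t - Z t) \<le> ((2 + T) * 0) * exp ((3 * \<bar>lam\<bar> * R\<^sup>2) * t)"
      proof (rule kg_stability[where ?D1.0 = "\<lambda>a t. coef (Y1 t) a - D1 a t" and ?D2.0 = "\<lambda>a t. coef (Y2 t) a - D2 a t" and M = "2 * R", OF c(1) _ _ _ _ _ _ _ _ _ t])
        show "((\<lambda>t. coef (Y t - Z t) a) has_vector_derivative coef (Y1 t) a - D1 a t) (at t within {0..T})" if "t \<in> {0..T}" for t a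
          unfolding coef_diff by (rule has_vector_derivative_diff[OF coef_has_vector_derivative[OF dY1[OF that]] dZ(1)[OF that]])
        show "((\<lambda>t. coef (Y1 t) a - D1 a t) has_vector_derivative coef (Y2 t) a - D2 a t) (at t within {0..T})" if "t \<in> {0..T}" for t a
          by (rule has_vector_derivative_diff[OF coef_has_vector_derivative[OF dY2[OF that]] dZ(2)[OF that]])
        show "continuous_on {0..T} (\<lambda>t. coef (Y2 t) a - D2 a t)" for a
          by (intro continuous_on_diff dZ(3) continuous_on_coef curve_continuous[OF Y(3)])
        show "norm (Y t - Z t) \<le> 2 * R" if "t \<in> {0..T}" for t
          using norm_triangle_ineq4[of "Y t" "Z t"] nR[OF that] by linarith
        show "(\<Sum>a\<in>F. cmod (coef (Y2 t) a - D2 a t + of_real ((kg_freq c a)\<^sup>2) * coef (Y t - Z t) a)) \<le> c\<^sup>2 * (3 * \<bar>lam\<bar> * R\<^sup>2 * norm (Y t - Z t) + 0)"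
          if t: "t \<in> {0..T}" and F: "finite F" for t F
        proof -
          have "coef (Y2 t) a - D2 a t + of_real ((kg_freq c a)\<^sup>2) * coef (Y t - Z t) a = of_real (c\<^sup>2 * lam) * coef (cubic (Y t) - cubic (Z t)) a" for a
            unfolding Ym[rule_format, OF t] dZ(4)[OF t] coef_diff by (simp add: algebra_simps)
          then have "(\<Sum>a\<in>F. cmod (coef (Y2 t) a - D2 a t + of_real ((kg_freq c a)\<^sup>2) * coef (Y t - Z t) a))
              = c\<^sup>2 * \<bar>lam\<bar> * (\<Sum>a\<in>F. cmod (coef (cubic (Y t) - cubic (Z t)) a))"
            by (simp add: norm_mult norm_power sum_distrib_left del: coef_diff)
          also have "\<dots> \<le> c\<^sup>2 * \<bar>lam\<bar> * (3 * R\<^sup>2 * norm (Y t - Z t))"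
            by (intro mult_left_mono order.trans[OF sum_coef_le_norm[OF F]] cubic_lipschitz nR[OF t]) auto
          finally show ?thesis by (simp add: mult_ac)
        qed
      qed (use Y0 dZ(5,6) in auto)
      then show ?thesis by simp
    qed
    define t where "t = real n * \<tau>"
    have t: "t \<in> {0..T}" using hyp by (auto simp: t_def)
    have ZR: "norm (Z t) \<le> \<bar>RZ\<bar>" if "t \<in> {0..T}" for t
      using dY[rule_format, OF that] uniq[OF that] by auto
    have e1: "norm (Z t - limit_profile c u v t) \<le> A / c\<^sup>2"
    proof -
      have "kg_modes lam c T f g Z D1 D2" unfolding kg_modes_def by (intro conjI ballI allI dZ)
      then show ?thesis using approx c(2) ZR t by blast
    qed
    define p where "p = (disc_step K (lam / 8) \<tau> ^^ n) (aliased K (u 0), aliased K (v 0))"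
    have e2: "pair_dist p (u t, v t) \<le> C1 * (\<tau>\<^sup>2 + 1 / real K ^ m)"
      unfolding p_def t_def using hyp by (intro strang) auto
    have evu: "ev (u 0) x = \<phi> x - \<i> * \<gamma> x" and evv: "ev (v 0) x = cnj (\<phi> x + \<i> * \<gamma> x)" for x
      by (simp_all add: nls(3,4) fu_def fv_def f(1)[symmetric] g(1)[symmetric])
    have st: "strang_approx K lam \<tau> \<phi> \<gamma> n = (ev (fst p), ev (snd p))"
      using strang_approx_ev[OF _ evu evv, of K lam \<tau> n] hyp by (simp add: p_def map_prod_def case_prod_unfold)
    have pt: "cmod (z t x - z0_approx K lam \<tau> c \<phi> \<gamma> n x) \<le> A / c\<^sup>2 + C1 * (\<tau>\<^sup>2 + 1 / real K ^ m)" for x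
    proof -
      have half: "cmod (osc s t / 2 * y) \<le> cmod y" for s y by (simp add: norm_mult norm_divide)
      have ap: "z0_approx K lam \<tau> c \<phi> \<gamma> n x = osc (c\<^sup>2) t / 2 * ev (fst p) x + osc (- c\<^sup>2) t / 2 * cnj (ev (snd p) x)"
        by (simp add: z0_approx_def st osc_def t_def mult_ac)
      have "z t x - z0_approx K lam \<tau> c \<phi> \<gamma> n x = ev (Z t - limit_profile c u v t) x
          + (osc (c\<^sup>2) t / 2 * ev (u t - fst p) x + osc (- c\<^sup>2) t / 2 * cnj (ev (v t - snd p) x))"
        unfolding ap evZ[OF t, symmetric] by (simp add: limit_profile_def field_simps)
      moreover have "cmod (ev (Z t - limit_profile c u v t) x) \<le> A / c\<^sup>2"
        using norm_ev_le[of "Z t - limit_profile c u v t" x] e1 by linarith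
      moreover have "cmod (osc (c\<^sup>2) t / 2 * ev (u t - fst p) x) \<le> norm (fst p - u t)"
        unfolding norm_minus_commute[of "fst p"] by (rule order.trans[OF half norm_ev_le])
      moreover have "cmod (osc (- c\<^sup>2) t / 2 * cnj (ev (v t - snd p) x)) \<le> norm (snd p - v t)"
        unfolding norm_minus_commute[of "snd p"] by (rule order.trans[OF half]) (simp only: complex_mod_cnj norm_ev_le)
      ultimately have "cmod (z t x - z0_approx K lam \<tau> c \<phi> \<gamma> n x) \<le> A / c\<^sup>2 + (norm (fst p - u t) + norm (snd p - v t))"
        by (simp only:) (intro norm_triangle_mono)
      then show ?thesis using e2 by (simp add: pair_dist_def)
    qed
    have K1: "1 \<le> real K" and hK: "h = 1 / real K" using hyp by auto
    have hs: "1 / real K ^ m \<le> h powr s"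
    proof -
      have "1 / real K ^ m = h powr real m" using K1 by (simp add: hK powr_realpow power_one_over)
      also have "\<dots> \<le> h powr s" using K1 m(2) by (intro powr_mono') (auto simp: hK)
      finally show ?thesis .
    qed
    have "A / c\<^sup>2 + C1 * (\<tau>\<^sup>2 + 1 / real K ^ m) \<le> A * (1 / c\<^sup>2) + C1 * (\<tau>\<^sup>2 + h powr s)"
      using hs C1(1) by simp
    also have "\<dots> \<le> (A + C1) * (\<tau>\<^sup>2 + h powr s + 1 / c\<^sup>2)"
    proof -
      have "(x + y) * (e + d) = (x * d + y * e) + (x * e + y * d)" for x y e d :: real by (simp add: algebra_simps)
      moreover have "0 \<le> A * (\<tau>\<^sup>2 + h powr s) + C1 * (1 / c\<^sup>2)"
        using A C1(1) by (intro add_nonneg_nonneg mult_nonneg_nonneg) auto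
      ultimately show ?thesis by (simp only:)
    qed
    finally have le: "A / c\<^sup>2 + C1 * (\<tau>\<^sup>2 + 1 / real K ^ m) \<le> (A + C1) * (\<tau>\<^sup>2 + h powr s + 1 / c\<^sup>2)" .
    have "torus_L2_norm (\<lambda>x. z t x - z0_approx K lam \<tau> c \<phi> \<gamma> n x) \<le> sqrt (2 * pi) * ((A + C1) * (\<tau>\<^sup>2 + h powr s + 1 / c\<^sup>2))"
      by (rule torus_L2_norm_le) (rule order.trans[OF pt le])
    then show "torus_L2_norm (\<lambda>x. z (real n * \<tau>) x - z0_approx K lam \<tau> c \<phi> \<gamma> n x) \<le> C * (\<tau>\<^sup>2 + h powr s + 1 / c\<^sup>2)"
      by (simp add: C_def t_def mult.assoc)
  qed
  show ?thesis
    \<comment> \<open>The stability argument for the splitting treats \<open>\<tau>\<close> and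
      \<open>h\<close> symmetrically, so one threshold serves as both \<open>\<tau>0\<close> and
      \<open>h0\<close>; \<open>c0 = 1\<close> is where powers of \<open>1 / c\<close> are at most
      1.\<close>
    by (rule exI[of _ T], rule exI[of _ 1], rule exI[of _ C], rule exI[of _ \<tau>0], rule exI[of _ \<tau>0])
       (use T(1) C C1(2) main in simp)
qed

end
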